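(* Let $q\in\mathcal Z\setminus\{0\}$, $\mathcal H_{\mathbb R}$ a real Hilbert space, $\alpha\in S_0(n)$, $\beta\in S_0(k)$, $F\in\mathcal H_{\mathbb R}^{\odot n}$, $G\in\mathcal H_{\mathbb R}^{\odot k}$. Then $$\left\|W(\alpha\otimes_sF)\,W(\beta\otimes_sG)\right\|_\varphi\le(n+k)!\,\min\left[(k+1)^n,(n+1)^k\right]\|F\|\,\|G\|.$$ Consequently, the $*$-algebra structure of $\mathcal{TP}(\mathcal H_{\mathbb R})$ extends (by continuity in the tensor arguments) to $\overline{\mathcal{TP}}(\mathcal H_{\mathbb R})$ and $\overline{\mathcal{TP}}_q(\mathcal H_{\mathbb R})$.
   Context: Permutations. $[n]=\{1,\dots,n\}$, $[0,n]=\{0,\dots,n\}$; $S(n)$, $S_0(n)$ are the permutation groups of $[n]$, $[0,n]$, with $S(n)\subset S_0(n)$ the permutations fixing $0$; products are composed right to left; for $m>n$, $S_0(n)\subset S_0(m)$ by fixing $n+1,\dots,m$. $\mathrm{cyc}_0(\alpha)$ is the number of cycles of $\alpha\in S_0(n)$ (fixed points are cycles) not containing $0$; $|\alpha|=n-\mathrm{cyc}_0(\alpha)$. $\chi_q$ is the linear extension of $\chi_q(\alpha)=q^{|\alpha|}$. $\mathcal Z=\{0\}\cup\{\pm1/N:N\in\mathbb N\}$. For $\alpha\in S_0(n)$, $\beta\in S_0(k)$, $\alpha\cup\beta=\beta'\alpha\in S_0(n+k)$, where $\beta'$ fixes $[n]$ and is obtained from $\beta$ by replacing each $j\in[k]$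 by $n+j$ ($0$ unchanged). Contractions. $\mathcal P_{1,2}(n)$ is the set of partitions $\pi$ of $[n]$ into blocks of size 1 and 2, identified with the involution swapping the elements of each pair; $|\pi|$ is the number of pairs, $\mathrm{supp}(\pi)$ the union of the pairs. For $S\subset[n]$, $\alpha|_{S^c}$ is the permutation of $[0,n]\setminus S$, $x\mapsto\alpha^m(x)$, $m=\min\{j>0:\alpha^j(x)\notin S\}$. For $\ell=|\pi|$, $$C_\pi(\alpha)=q^{\mathrm{cyc}_0((\pi\alpha)|_{\mathrm{supp}(\pi)^c})-\mathrm{cyc}_0(\pi\alpha)+\ell}\;P\big((\pi\alpha)|_{\mathrm{supp}(\pi)^c}\big)\in\mathbb C[S_0(n-2\ell)],$$ where $P$ relabels $[0,n]\setminus\mathrm{supp}(\pi)$ by $[0,n-2\ell]$ in the order-preserving way. On tensors, $C_\pi(h_1\otimes\dots\otimes h_n)=\prod_{\{i,j\}\text{ pair of }\pi}\langle h_i,h_j\rangle\ h_{u_1}\otimes\dots\otimes h_{u_{n-2\ell}}$, with $u_1<\dots<u_{n-2\ell}$ the singletons of $\pi$. $C_\pi(\alpha\otimes F)=C_\pi(\alpha)\otimes C_\pi(F)$. Algebra. $\mathcal H_{\mathbb R}^{\odot n}$, $\mathcal H_{\mathbb R}^{\otimes n}$ are the algebraic and Hilbert space tensor powers. For $\sigma\in S(n)$, $U_\sigma(h_1\otimes\dots\otimes h_n)=h_{\sigma^{-1}(1)}\otimes\dots\otimes h_{\sigma^{-1}(n)}$, and $\alpha\otimes_sF=\frac1{n!}\sum_{\sigma\in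 S(n)}\sigma\alpha\sigma^{-1}\otimes U_\sigma F$. As complex vector spaces $\mathcal{TP}(\mathcal H_{\mathbb R})=\bigoplus_{n\ge0}\mathbb C[S_0(n)]\otimes_s\mathcal H_{\mathbb R}^{\odot n}$ and $\overline{\mathcal{TP}}(\mathcal H_{\mathbb R})=\bigoplus_{n\ge0}\mathbb C[S_0(n)]\otimes_s\mathcal H_{\mathbb R}^{\otimes n}$ (spans of $\alpha\otimes_sF$); the algebra element corresponding to $\xi$ is written $W(\xi)$. On $\mathcal{TP}(\mathcal H_{\mathbb R})$, $T(\eta\otimes F)=\sum_{\pi\in\mathcal P_{1,2}(n)}W(C_\pi(\eta\otimes F))$ (the $T$'s also span), and the $*$-algebra structure is $T(\alpha\otimes_sF)T(\beta\otimes_sG)=T((\alpha\cup\beta)\otimes_s(F\otimes G))$, with adjoint the antilinear extension of $T(\alpha\otimes_sF)^*=T(\alpha^{-1}\otimes_sF)$. State and norm. $\varphi$ is the linear functional with $\varphi[W((0))]=1$ and $\varphi[W(\alpha\otimes F)]=0$ for $n\ge1$; $\|A\|_\varphi=\varphi[A^*A]^{1/2}$, which on $W(\xi)$ equals $\langle\xi,\xi\rangle_q^{1/2}$ for the sesquilinear form $\langle\alpha\otimes F,\beta\otimes G\rangle_q=\delta_{n=k}\sum_{\sigma\in S(n)}\chi_q(\alpha\sigma\beta^{-1}\sigma^{-1})\langle F,U_\sigma G\rangle$, positive semi-definite for $q\in\mathcal Z$. $\overline{\mathcal{TP}}_q(\mathcal H_{\mathbb R})$ is the quotient of $\overline{\mathcal{TP}}(\mathcal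 H_{\mathbb R})$ by the kernel of this form. *)

theory Defs
  imports "HOL-Analysis.Analysis" "HOL-Combinatorics.Orbits" "HOL-Library.Poly_Mapping"
begin

section \<open>Hilbert space tensor powers\<close>

text \<open>
  The full Fock space over a real Hilbert space is realised as the reproducing kernel Hilbert
  space of the kernel \<open>K(xs, ys) = \<Prod>i. \<langle>xs\<^sub>i, ys\<^sub>i\<rangle>\<close> (zero for different lengths) on lists of
  vectors. A function \<open>f\<close> on lists belongs to it iff its squared norm, here called its energy,
  \<open>\<parallel>f\<parallel>\<^sup>2 = sup\<^sub>c (2 \<langle>f, c\<rangle> - \<parallel>c\<parallel>\<^sup>2)\<close> is finite, \<open>c\<close> running over the finite formal linear
  combinations of lists. All that matters is that the resulting type is a real Hilbert space
  and the lemma \<open>inner_tensor\<close> below.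
\<close>

definition tensor_kernel :: "'a::real_inner list \<Rightarrow> 'a list \<Rightarrow> real" where
  "tensor_kernel xs ys =
     (if length xs = length ys then \<Prod>i<length xs. inner (xs ! i) (ys ! i) else 0)"

lemma tensor_kernel_Nil [simp]: "tensor_kernel [] ys = (if ys = [] then 1 else 0)"
  by (auto simp: tensor_kernel_def)

lemma tensor_kernel_Nil2 [simp]: "tensor_kernel xs [] = (if xs = [] then 1 else 0)"
  by (auto simp: tensor_kernel_def)

lemma tensor_kernel_Cons [simp]:
  "tensor_kernel (x # xs) (y # ys) = inner x y * tensor_kernel xs ys"
  by (simp add: tensor_kernel_def prod.lessThan_Suc_shift del: prod.lessThan_Suc)

lemma tensor_kernel_commute: "tensor_kernel xs ys = tensor_kernel ys xs"
  by (auto simp: tensor_kernel_def inner_commute)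

lemma finite_parseval:
  fixes S :: "'a::real_inner set"
  assumes "finite S"
  obtains E where "finite E"
    and "\<And>x y. x \<in> S \<Longrightarrow> y \<in> S \<Longrightarrow> inner x y = (\<Sum>e\<in>E. inner x e * inner y e / inner e e)"
proof -
  obtain E where E: "finite E" "span E = span S" "pairwise orthogonal E"
    using basis_orthogonal[OF assms] by blast
  have "inner x y = (\<Sum>e\<in>E. inner x e * inner y e / inner e e)" if "x \<in> S" for x y
  proof -
    have "x \<in> span E"
      using that E(2) by (simp add: span_base)
    then obtain a where a: "x = (\<Sum>e\<in>E. a e *\<^sub>R e)"
      using E(1) by (auto simp: span_finite)
    have xe: "inner x e = a e * inner e e" if "e \<in> E" for e
    proof -
      have "inner x e = (\<Sum>f\<in>E. a f * inner f e)"
        by (simp add: a inner_sum_left)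
      also have "\<dots> = (\<Sum>f\<in>E. if f = e then a e * inner e e else 0)"
        using E(3) that by (intro sum.cong) (auto simp: pairwise_def orthogonal_def)
      finally show ?thesis
        using E(1) that by simp
    qed
    have "inner x y = (\<Sum>e\<in>E. a e * inner y e)"
      unfolding a inner_sum_left by (simp add: inner_commute)
    also have "\<dots> = (\<Sum>e\<in>E. inner x e * inner y e / inner e e)"
      by (intro sum.cong refl) (auto simp: xe)
    finally show ?thesis .
  qed
  with E(1) show ?thesis
    using that by blast
qed

lemma tensor_kernel_psd:
  fixes x :: "'i \<Rightarrow> 'a::real_inner list"
  assumes "finite I"
  shows "0 \<le> (\<Sum>i\<in>I. \<Sum>j\<in>I. c i * c j * tensor_kernel (x i) (x j))"
proof -
  obtain n where "\<forall>i\<in>I. length (x i) \<le> n"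
    using finite_nat_set_iff_bounded_le[of "(\<lambda>i. length (x i)) ` I"] assms by auto
  with assms show ?thesis
  proof (induction n arbitrary: I c x)
    case 0
    then have "(\<Sum>i\<in>I. \<Sum>j\<in>I. c i * c j * tensor_kernel (x i) (x j)) = (\<Sum>i\<in>I. c i)\<^sup>2"
      by (auto simp: power2_eq_square sum_product intro!: sum.cong)
    then show ?case by simp
  next
    case (Suc n)
    define A where "A = {i \<in> I. x i = []}"
    define B where "B = {i \<in> I. x i \<noteq> []}"
    have fin: "finite A" "finite B" and I: "I = A \<union> B" "A \<inter> B = {}"
      using Suc.prems by (auto simp: A_def B_def)
    obtain E where E: "finite E"
      and par: "\<And>u v. u \<in> (\<lambda>i. hd (x i)) ` B \<Longrightarrow> v \<in> (\<lambda>i. hd (x i)) ` B \<Longrightarrow>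
        inner u v = (\<Sum>e\<in>E. inner u e * inner v e / inner e e)"
      using finite_parseval[of "(\<lambda>i. hd (x i)) ` B"] fin by auto
    let ?d = "\<lambda>e i. c i * inner (hd (x i)) e"
    let ?K = "\<lambda>i j. c i * c j * tensor_kernel (x i) (x j)"
    have KAB: "?K i j = 0" "?K j i = 0" if "i \<in> A" "j \<in> B" for i j
      using that by (auto simp: A_def B_def)
    have KB: "?K i j = (\<Sum>e\<in>E. (?d e i * ?d e j * tensor_kernel (tl (x i)) (tl (x j))) / inner e e)"
      if "i \<in> B" "j \<in> B" for i j
    proof -
      have "x i = hd (x i) # tl (x i)" "x j = hd (x j) # tl (x j)"
        using that by (auto simp: B_def)
      then have "?K i j = c i * c j * (inner (hd (x i)) (hd (x j)) * tensor_kernel (tl (x i)) (tl (x j)))"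
        by (metis tensor_kernel_Cons)
      then show ?thesis
        using that by (simp add: par sum_distrib_left sum_distrib_right algebra_simps)
    qed
    have "(\<Sum>i\<in>I. \<Sum>j\<in>I. ?K i j) = (\<Sum>i\<in>A. \<Sum>j\<in>A. ?K i j) + (\<Sum>i\<in>B. \<Sum>j\<in>B. ?K i j)"
      using fin I by (simp add: sum.union_disjoint sum.distrib KAB)
    moreover have "(\<Sum>i\<in>A. \<Sum>j\<in>A. ?K i j) = (\<Sum>i\<in>A. c i)\<^sup>2"
      by (auto simp: A_def power2_eq_square sum_product intro!: sum.cong)
    moreover have "(\<Sum>i\<in>B. \<Sum>j\<in>B. ?K i j) =
        (\<Sum>i\<in>B. \<Sum>j\<in>B. \<Sum>e\<in>E. (?d e i * ?d e j * tensor_kernel (tl (x i)) (tl (x j))) / inner e e)"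
      by (intro sum.cong refl KB)
    moreover have "\<dots> = (\<Sum>i\<in>B. \<Sum>e\<in>E. \<Sum>j\<in>B. (?d e i * ?d e j * tensor_kernel (tl (x i)) (tl (x j))) / inner e e)"
      by (intro sum.cong refl sum.swap)
    moreover have "\<dots> = (\<Sum>e\<in>E. \<Sum>i\<in>B. \<Sum>j\<in>B. (?d e i * ?d e j * tensor_kernel (tl (x i)) (tl (x j))) / inner e e)"
      by (rule sum.swap)
    moreover have "\<dots> = (\<Sum>e\<in>E. (\<Sum>i\<in>B. \<Sum>j\<in>B. ?d e i * ?d e j * tensor_kernel (tl (x i)) (tl (x j))) / inner e e)"
      by (simp add: sum_divide_distrib)
    moreover have "\<dots> \<ge> 0"
    proof (rule sum_nonneg, rule divide_nonneg_nonneg)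
      fix e
      show "0 \<le> (\<Sum>i\<in>B. \<Sum>j\<in>B. ?d e i * ?d e j * tensor_kernel (tl (x i)) (tl (x j)))"
        using Suc.prems fin by (intro Suc.IH) (auto simp: B_def)
    qed simp
    ultimately show ?case by simp
  qed
qed

definition comb :: "('b \<Rightarrow> real) \<Rightarrow> (real \<times> 'b) list \<Rightarrow> real" where
  "comb f c = (\<Sum>(r, x)\<leftarrow>c. r * f x)"

definition gram :: "(real \<times> 'a::real_inner list) list \<Rightarrow> (real \<times> 'a list) list \<Rightarrow> real" where
  "gram c d = comb (\<lambda>xs. comb (tensor_kernel xs) d) c"

definition scale_comb :: "real \<Rightarrow> (real \<times> 'b) list \<Rightarrow> (real \<times> 'b) list" where
  "scale_comb t c = map (\<lambda>(r, x). (t * r, x)) c"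

lemma comb_simps [simp]:
  "comb f [] = 0" "comb f ((r, x) # c) = r * f x + comb f c"
  "comb f (c @ d) = comb f c + comb f d"
  "comb f (scale_comb t c) = t * comb f c"
  "comb (\<lambda>x. f x + g x) c = comb f c + comb g c"
  "comb (\<lambda>x. f x - g x) c = comb f c - comb g c"
  "comb (\<lambda>x. - f x) c = - comb f c"
  "comb (\<lambda>x. t * f x) c = t * comb f c"
  "comb (\<lambda>x. 0) c = 0"
  unfolding comb_def scale_comb_def
  by (induction c) (auto simp: algebra_simps)

lemma comb_index: "comb f c = (\<Sum>i<length c. fst (c ! i) * f (snd (c ! i)))"
  by (simp add: comb_def sum_list_sum_nth case_prod_unfold atLeast0LessThan)

lemma gram_commute: "gram c d = gram d c"
  unfolding gram_def comb_index sum_distrib_left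
  by (subst sum.swap) (simp add: tensor_kernel_commute algebra_simps)

lemma gram_simps [simp]:
  "gram (c @ c') d = gram c d + gram c' d" "gram d (c @ c') = gram d c + gram d c'"
  "gram (scale_comb t c) d = t * gram c d" "gram d (scale_comb t c) = t * gram d c"
  "gram [] d = 0" "gram d [] = 0"
  by (simp_all add: gram_def)

lemma gram_nonneg: "0 \<le> gram c c"
  using tensor_kernel_psd[of "{..<length c}" "\<lambda>i. fst (c ! i)" "\<lambda>i. snd (c ! i)"]
  by (simp add: gram_def comb_index sum_distrib_left algebra_simps)

definition energy_bounded :: "('a::real_inner list \<Rightarrow> real) \<Rightarrow> bool" where
  "energy_bounded f \<longleftrightarrow> bdd_above (range (\<lambda>c. 2 * comb f c - gram c c))"

definition energy :: "('a::real_inner list \<Rightarrow> real) \<Rightarrow> real" where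
  "energy f = (SUP c. 2 * comb f c - gram c c)"

lemma energy_upper: "energy_bounded f \<Longrightarrow> 2 * comb f c - gram c c \<le> energy f"
  unfolding energy_bounded_def energy_def by (intro cSUP_upper) auto

lemma energy_boundedI: "(\<And>c. 2 * comb f c - gram c c \<le> C) \<Longrightarrow> energy_bounded f"
  unfolding energy_bounded_def by (intro bdd_aboveI2[where M = C]) auto

lemma energy_least: "(\<And>c. 2 * comb f c - gram c c \<le> C) \<Longrightarrow> energy f \<le> C"
  unfolding energy_def by (intro cSUP_least) auto

lemma energy_nonneg: "energy_bounded f \<Longrightarrow> 0 \<le> energy f"
  using energy_upper[of f "[]"] by simp

lemma energy_zero:
  "energy_bounded (\<lambda>_ :: 'a::real_inner list. 0)" "energy (\<lambda>_ :: 'a list. 0) = 0"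
proof -
  have *: "2 * comb (\<lambda>_. 0) c - gram c c \<le> 0" for c :: "(real \<times> 'a list) list"
    using gram_nonneg[of c] by simp
  from energy_boundedI[OF *] show "energy_bounded (\<lambda>_::'a list. 0)" .
  then show "energy (\<lambda>_::'a list. 0) = 0"
    using energy_least[OF *] energy_nonneg by force
qed

lemma energy_scale_le:
  assumes "energy_bounded f"
  shows "2 * comb (\<lambda>x. t * f x) c - gram c c \<le> t\<^sup>2 * energy f"
proof (cases "t = 0")
  case True
  then show ?thesis using gram_nonneg[of c] by simp
next
  case False
  then have "2 * comb (\<lambda>x. t * f x) c - gram c c =
      t\<^sup>2 * (2 * comb f (scale_comb (1/t) c) - gram (scale_comb (1/t) c) (scale_comb (1/t) c))"
    by (simp add: field_simps power2_eq_square)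
  also have "\<dots> \<le> t\<^sup>2 * energy f"
    by (intro mult_left_mono energy_upper assms) simp
  finally show ?thesis .
qed

lemma energy_bounded_scale: "energy_bounded f \<Longrightarrow> energy_bounded (\<lambda>x. t * f x)"
  using energy_boundedI[OF energy_scale_le] .

lemma energy_scale:
  assumes "energy_bounded f"
  shows "energy (\<lambda>x. t * f x) = t\<^sup>2 * energy f"
proof (cases "t = 0")
  case True
  then show ?thesis by (simp add: energy_zero)
next
  case False
  have "energy f = energy (\<lambda>x. (1/t) * (t * f x))"
    using False by simp
  also have "\<dots> \<le> (1/t)\<^sup>2 * energy (\<lambda>x. t * f x)"
    by (intro energy_least energy_scale_le energy_bounded_scale assms)
  finally have "t\<^sup>2 * energy f \<le> energy (\<lambda>x. t * f x)"
    using False by (simp add: field_simps)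
  moreover have "energy (\<lambda>x. t * f x) \<le> t\<^sup>2 * energy f"
    by (intro energy_least energy_scale_le assms)
  ultimately show ?thesis by simp
qed

lemma energy_half:
  assumes "energy_bounded f"
  shows "2 * comb f c - gram c c / 2 \<le> 2 * energy f"
  using energy_upper[OF assms, of "scale_comb (1/2) c"] by simp

lemma energy_add_sub_le:
  assumes "energy_bounded f" "energy_bounded g"
  shows "(2 * comb (\<lambda>x. f x + g x) c - gram c c) + (2 * comb (\<lambda>x. f x - g x) d - gram d d)
    \<le> 2 * energy f + 2 * energy g"
proof -
  have "(2 * comb (\<lambda>x. f x + g x) c - gram c c) + (2 * comb (\<lambda>x. f x - g x) d - gram d d) =
     (2 * comb f (c @ d) - gram (c @ d) (c @ d) / 2) +
     (2 * comb g (c @ scale_comb (-1) d) - gram (c @ scale_comb (-1) d) (c @ scale_comb (-1) d) / 2)"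
    using gram_commute[of c d] by (simp add: field_simps)
  also have "\<dots> \<le> 2 * energy f + 2 * energy g"
    by (intro add_mono energy_half assms)
  finally show ?thesis .
qed

lemma energy_bounded_add:
  assumes "energy_bounded f" "energy_bounded g"
  shows "energy_bounded (\<lambda>x. f x + g x)"
  using energy_add_sub_le[OF assms, of _ "[]"] by (intro energy_boundedI) simp

lemma energy_bounded_sub:
  assumes "energy_bounded f" "energy_bounded g"
  shows "energy_bounded (\<lambda>x. f x - g x)"
  using energy_add_sub_le[OF assms, of "[]"] by (intro energy_boundedI) simp

lemma energy_parallelogram_le:
  assumes "energy_bounded f" "energy_bounded g"
  shows "energy (\<lambda>x. f x + g x) + energy (\<lambda>x. f x - g x) \<le> 2 * energy f + 2 * energy g"
proof -
  let ?b = "2 * energy f + 2 * energy g"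
  have "energy (\<lambda>x. f x + g x) \<le> ?b - (2 * comb (\<lambda>x. f x - g x) d - gram d d)" for d
    using energy_add_sub_le[OF assms, of _ d] by (intro energy_least) (simp add: algebra_simps)
  then have "energy (\<lambda>x. f x - g x) \<le> ?b - energy (\<lambda>x. f x + g x)"
    by (intro energy_least) (simp add: algebra_simps)
  then show ?thesis by simp
qed

lemma energy_parallelogram:
  assumes "energy_bounded f" "energy_bounded g"
  shows "energy (\<lambda>x. f x + g x) + energy (\<lambda>x. f x - g x) = 2 * energy f + 2 * energy g"
proof (rule antisym[OF energy_parallelogram_le[OF assms]])
  have "energy (\<lambda>x. (f x + g x) + (f x - g x)) + energy (\<lambda>x. (f x + g x) - (f x - g x))
      \<le> 2 * energy (\<lambda>x. f x + g x) + 2 * energy (\<lambda>x. f x - g x)"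
    by (intro energy_parallelogram_le energy_bounded_add energy_bounded_sub assms)
  moreover have "(\<lambda>x. (f x + g x) + (f x - g x)) = (\<lambda>x. 2 * f x)" "(\<lambda>x. (f x + g x) - (f x - g x)) = (\<lambda>x. 2 * g x)"
    by auto
  ultimately show "2 * energy f + 2 * energy g \<le> energy (\<lambda>x. f x + g x) + energy (\<lambda>x. f x - g x)"
    using assms by (simp add: energy_scale)
qed

lemma energy_point: 
  assumes "energy_bounded f"
  shows "(f x)\<^sup>2 \<le> energy f * tensor_kernel x x"
proof -
  have "2 * t * f x - t\<^sup>2 * tensor_kernel x x \<le> energy f" for t
    using energy_upper[OF assms, of "[(t, x)]"] by (simp add: gram_def power2_eq_square algebra_simps)
  then have *: "2 * t * f x - t\<^sup>2 * tensor_kernel x x \<le> energy f" for t .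
  have K: "0 \<le> tensor_kernel x x"
    by (auto simp: tensor_kernel_def intro: prod_nonneg)
  show ?thesis
  proof (cases "tensor_kernel x x = 0")
    case True
    have "f x = 0"
    proof (rule ccontr)
      assume "f x \<noteq> 0"
      then show False
        using *[of "(energy f + 1) / (2 * f x)"] True by simp
    qed
    with True show ?thesis by simp
  next
    case False
    then show ?thesis
      using *[of "f x / tensor_kernel x x"] K by (simp add: field_simps power2_eq_square)
  qed
qed

lemma energy_kernel:
  "energy_bounded (\<lambda>x. gram [(1, x)] c)" "energy (\<lambda>x. gram [(1, x)] c) = gram c c"
proof -
  have c: "comb (\<lambda>x. gram [(1, x)] c) d = gram d c" for d
    by (simp add: gram_def)
  have *: "2 * comb (\<lambda>x. gram [(1, x)] c) d - gram d d \<le> gram c c" for d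
    using gram_nonneg[of "d @ scale_comb (-1) c"] gram_commute[of c d] by (simp add: c)
  from energy_boundedI[OF *] show b: "energy_bounded (\<lambda>x. gram [(1, x)] c)" .
  show "energy (\<lambda>x. gram [(1, x)] c) = gram c c"
    using energy_least[OF *] energy_upper[OF b, of c] by (simp add: c)
qed

typedef (overloaded) ('a::real_inner) tensor_space = "{f :: 'a list \<Rightarrow> real. energy_bounded f}"
  using energy_zero(1) by blast

setup_lifting type_definition_tensor_space

instantiation tensor_space :: (real_inner) real_vector
begin

lift_definition zero_tensor_space :: "'a tensor_space" is "\<lambda>_. 0"
  by (rule energy_zero)

lift_definition plus_tensor_space :: "'a tensor_space \<Rightarrow> 'a tensor_space \<Rightarrow> 'a tensor_space"
  is "\<lambda>f g x. f x + g x"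
  by (rule energy_bounded_add)

lift_definition minus_tensor_space :: "'a tensor_space \<Rightarrow> 'a tensor_space \<Rightarrow> 'a tensor_space"
  is "\<lambda>f g x. f x - g x"
  by (rule energy_bounded_sub)

lift_definition scaleR_tensor_space :: "real \<Rightarrow> 'a tensor_space \<Rightarrow> 'a tensor_space"
  is "\<lambda>t f x. t * f x"
  by (rule energy_bounded_scale)

lift_definition uminus_tensor_space :: "'a tensor_space \<Rightarrow> 'a tensor_space"
  is "\<lambda>f x. - f x"
  using energy_bounded_scale[of _ "-1"] by simp

instance
  by standard (transfer; auto simp: algebra_simps)+

end

lift_definition tensor_energy :: "'a::real_inner tensor_space \<Rightarrow> real" is energy .

lemma tensor_energy_nonneg: "0 \<le> tensor_energy f"
  by transfer (rule energy_nonneg)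

lemma tensor_energy_scale: "tensor_energy (t *\<^sub>R f) = t\<^sup>2 * tensor_energy f"
  by transfer (rule energy_scale)

lemma tensor_energy_parallelogram:
  "tensor_energy (f + g) + tensor_energy (f - g) = 2 * tensor_energy f + 2 * tensor_energy g"
  by transfer (rule energy_parallelogram)

lemma tensor_energy_eq_0: "tensor_energy f = 0 \<longleftrightarrow> f = 0"
proof
  assume "tensor_energy f = 0"
  then show "f = 0"
  proof transfer
    fix f :: "'a list \<Rightarrow> real"
    assume "energy_bounded f" "energy f = 0"
    then show "f = (\<lambda>_. 0)"
      using energy_point[of f] by (auto simp: fun_eq_iff)
  qed
next
  assume "f = 0"
  then show "tensor_energy f = 0"
    using tensor_energy_scale[of 0 f] by simp
qed

lemma tensor_energy_minus: "tensor_energy (- f) = tensor_energy f"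
  using tensor_energy_scale[of "-1" f] by simp

instantiation tensor_space :: (real_inner) real_inner
begin

definition inner_tensor_space :: "'a tensor_space \<Rightarrow> 'a tensor_space \<Rightarrow> real" where
  "inner f g = (tensor_energy (f + g) - tensor_energy (f - g)) / 4"

definition norm_tensor_space_def:
  "norm (f :: 'a tensor_space) = sqrt (inner f f)"

definition sgn_tensor_space_def:
  "sgn (f :: 'a tensor_space) = f /\<^sub>R norm f"

definition dist_tensor_space_def:
  "dist (f :: 'a tensor_space) g = norm (f - g)"

definition uniformity_tensor_space_def:
  "(uniformity :: ('a tensor_space \<times> 'a tensor_space) filter) =
     (INF e\<in>{0<..}. principal {(f, g). dist f g < e})"

definition open_tensor_space_def:
  "open (U :: 'a tensor_space set) = (\<forall>f\<in>U. eventually (\<lambda>(f', g). f' = f \<longrightarrow> g \<in> U) uniformity)"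

lemma inner_tensor_add: "inner (f + g) h = inner f h + inner (g :: 'a tensor_space) h"
proof -
  have sum: "inner f h + inner g h = 2 * inner ((1/2) *\<^sub>R (f + g)) h" for f g :: "'a tensor_space"
  proof -
    have arith: "(a - a') / 4 + (b - b') / 4 = 2 * ((c - c') / 4)"
      if "a + b = 2 * c + 2 * e" "a' + b' = 2 * c' + 2 * e" for a b c a' b' c' e :: real
      using that by (simp add: field_simps)
    define m d where "m = (1/2) *\<^sub>R (f + g)" and "d = (1/2) *\<^sub>R (f - g)"
    have "m + d = (1/2) *\<^sub>R (f + f)" "m - d = (1/2) *\<^sub>R (g + g)"
      by (simp_all add: m_def d_def flip: scaleR_add_right scaleR_diff_right)
    then have f: "f = m + d" and g: "g = m - d"
      by (simp_all flip: scaleR_2)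
    have "f + h = (m + h) + d" "g + h = (m + h) - d" "f - h = (m - h) + d" "g - h = (m - h) - d"
      unfolding f g by (simp_all add: algebra_simps)
    then have "tensor_energy (f + h) + tensor_energy (g + h) = 2 * tensor_energy (m + h) + 2 * tensor_energy d"
      and "tensor_energy (f - h) + tensor_energy (g - h) = 2 * tensor_energy (m - h) + 2 * tensor_energy d"
      using tensor_energy_parallelogram[of "m + h" d] tensor_energy_parallelogram[of "m - h" d]
      by (simp_all only:)
    then show ?thesis
      unfolding inner_tensor_space_def m_def[symmetric] by (rule arith)
  qed
  have z: "inner 0 h = 0" for h :: "'a tensor_space"
    by (simp add: inner_tensor_space_def tensor_energy_minus)
  have "inner f h = 2 * inner ((1/2) *\<^sub>R f) h" for f :: "'a tensor_space"
    using sum[of f 0] z by simp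
  from this[of "f + g"] sum[of f g] show ?thesis by simp
qed

lemma inner_tensor_bound: "\<bar>inner f (g :: 'a tensor_space)\<bar> \<le> tensor_energy f + tensor_energy g"
  using tensor_energy_parallelogram[of f g] tensor_energy_nonneg[of "f + g"]
    tensor_energy_nonneg[of "f - g"] tensor_energy_nonneg[of f] tensor_energy_nonneg[of g]
  unfolding inner_tensor_space_def abs_le_iff by (simp add: field_simps)

lemma inner_tensor_scale: "inner (t *\<^sub>R f) h = t * inner f (h :: 'a tensor_space)"
proof -
  define p where "p = (\<lambda>t. inner (t *\<^sub>R f) h - t * inner f h)"
  have add: "p (s + t) = p s + p t" for s t
    by (simp add: p_def scaleR_add_left inner_tensor_add algebra_simps)
  have p1: "p 1 = 0" by (simp add: p_def)
  have p0: "p 0 = 0" using add[of 0 0] by simp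
  have mult: "p (real n * t) = real n * p t" for n t
    by (induction n) (simp_all add: p0 add algebra_simps)
  have neg: "p (- t) = - p t" for t
    using add[of t "- t"] p0 by simp
  have int: "p (of_int k) = 0" for k
  proof (cases k)
    case (nonneg n)
    then show ?thesis using mult[of n 1] p1 by simp
  next
    case (neg n)
    then show ?thesis using mult[of "Suc n" 1] p1 \<open>\<And>t. p (- t) = - p t\<close>[of "real (Suc n)"] by simp
  qed
  have frac: "p t = p (frac t)" for t :: real
    using add[of "of_int \<lfloor>t\<rfloor>" "frac t"] int by (simp add: frac_def)
  obtain M where M: "\<bar>p t\<bar> \<le> M" for t
  proof
    fix t :: real
    have "\<bar>frac t\<bar> \<le> 1" "(frac t)\<^sup>2 \<le> 1"
      using frac_ge_0[of t] frac_lt_1[of t] by (auto simp: power_le_one)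
    then have "\<bar>inner (frac t *\<^sub>R f) h\<bar> \<le> tensor_energy f + tensor_energy h"
      using inner_tensor_bound[of "frac t *\<^sub>R f" h] tensor_energy_nonneg[of f]
        mult_right_mono[of "(frac t)\<^sup>2" 1 "tensor_energy f"]
      by (simp add: tensor_energy_scale)
    moreover have "\<bar>frac t * inner f h\<bar> \<le> \<bar>inner f h\<bar>"
      using \<open>\<bar>frac t\<bar> \<le> 1\<close> mult_right_mono[of "\<bar>frac t\<bar>" 1 "\<bar>inner f h\<bar>"] by (simp add: abs_mult)
    ultimately show "\<bar>p t\<bar> \<le> tensor_energy f + tensor_energy h + \<bar>inner f h\<bar>"
      unfolding frac[of t] by (simp add: p_def)
  qed
  have "p t = 0"
  proof (rule ccontr)
    assume "p t \<noteq> 0"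
    then obtain n where "real n * \<bar>p t\<bar> > M"
      using reals_Archimedean3[of "\<bar>p t\<bar>"] by auto
    with M[of "real n * t"] show False
      by (simp add: mult abs_mult)
  qed
  then show ?thesis by (simp add: p_def)
qed

lemma inner_tensor_energy: "inner f f = tensor_energy (f :: 'a tensor_space)"
proof -
  have "tensor_energy (f + f) = 4 * tensor_energy f"
    using tensor_energy_scale[of 2 f] by (simp add: scaleR_2)
  moreover have "tensor_energy (f - f) = 0"
    by (simp add: tensor_energy_eq_0)
  ultimately show ?thesis
    unfolding inner_tensor_space_def by simp
qed

instance
proof
  fix f g h :: "'a tensor_space" and t :: real and U :: "'a tensor_space set"
  show "dist f g = norm (f - g)" by (rule dist_tensor_space_def)
  show "sgn f = f /\<^sub>R norm f" by (rule sgn_tensor_space_def)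
  show "uniformity = (INF e\<in>{0<..}. principal {(f, g :: 'a tensor_space). dist f g < e})"
    by (rule uniformity_tensor_space_def)
  show "open U = (\<forall>f\<in>U. eventually (\<lambda>(f', g). f' = f \<longrightarrow> g \<in> U) uniformity)"
    by (rule open_tensor_space_def)
  show "inner f g = inner g f"
    using tensor_energy_minus[of "f - g"] by (simp add: inner_tensor_space_def add.commute)
  show "inner (f + g) h = inner f h + inner g h" by (rule inner_tensor_add)
  show "inner (t *\<^sub>R f) g = t * inner f g" by (rule inner_tensor_scale)
  show "0 \<le> inner f f" by (simp only: inner_tensor_energy tensor_energy_nonneg)
  show "inner f f = 0 \<longleftrightarrow> f = 0" by (simp only: inner_tensor_energy tensor_energy_eq_0)
  show "norm f = sqrt (inner f f)" by (rule norm_tensor_space_def)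
qed

end

lemma norm_tensor_energy: "(norm f)\<^sup>2 = tensor_energy (f :: 'a::real_inner tensor_space)"
  by (simp only: power2_norm_eq_inner inner_tensor_energy)

instance tensor_space :: (real_inner) complete_space
proof
  fix X :: "nat \<Rightarrow> 'a tensor_space"
  assume X: "Cauchy X"
  have point: "\<bar>Rep_tensor_space f x\<bar> \<le> norm f * sqrt (tensor_kernel x x)" for f :: "'a tensor_space" and x
  proof -
    have "(Rep_tensor_space f x)\<^sup>2 \<le> (norm f)\<^sup>2 * tensor_kernel x x"
      using energy_point[of "Rep_tensor_space f" x] Rep_tensor_space[of f]
      by (simp only: norm_tensor_energy tensor_energy.rep_eq mem_Collect_eq)
    then have "sqrt ((Rep_tensor_space f x)\<^sup>2) \<le> sqrt ((norm f)\<^sup>2 * tensor_kernel x x)"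
      by (rule real_sqrt_le_mono)
    then show ?thesis by (simp add: real_sqrt_mult)
  qed
  have "Cauchy (\<lambda>n. Rep_tensor_space (X n) x)" for x
  proof (rule metric_CauchyI)
    fix e :: real assume e: "0 < e"
    define k where "k = sqrt (tensor_kernel x x) + 1"
    have K: "0 \<le> tensor_kernel x x"
      by (auto simp: tensor_kernel_def intro: prod_nonneg)
    then have k: "k > 0" "sqrt (tensor_kernel x x) \<le> k"
      using real_sqrt_ge_zero[OF K] unfolding k_def by linarith+
    have "\<exists>M. \<forall>m\<ge>M. \<forall>n\<ge>M. dist (X m) (X n) < e / k"
      by (intro metric_CauchyD[OF X] divide_pos_pos e k)
    then obtain M where M: "\<And>m n. m \<ge> M \<Longrightarrow> n \<ge> M \<Longrightarrow> dist (X m) (X n) < e / k"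
      by blast
    have "dist (Rep_tensor_space (X m) x) (Rep_tensor_space (X n) x) < e" if "m \<ge> M" "n \<ge> M" for m n
    proof -
      have "dist (Rep_tensor_space (X m) x) (Rep_tensor_space (X n) x) \<le> norm (X m - X n) * sqrt (tensor_kernel x x)"
        using point[of "X m - X n" x] unfolding dist_real_def minus_tensor_space.rep_eq .
      also have "\<dots> \<le> norm (X m - X n) * k"
        by (intro mult_left_mono k norm_ge_zero)
      also have "\<dots> < e"
        using M[OF that] k(1) by (simp only: dist_norm pos_less_divide_eq)
      finally show ?thesis .
    qed
    then show "\<exists>M. \<forall>m\<ge>M. \<forall>n\<ge>M. dist (Rep_tensor_space (X m) x) (Rep_tensor_space (X n) x) < e"
      by blast
  qed
  then have "convergent (\<lambda>n. Rep_tensor_space (X n) x)" for x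
    by (rule Cauchy_convergent)
  then have lim: "(\<lambda>n. Rep_tensor_space (X n) x) \<longlonglongrightarrow> lim (\<lambda>n. Rep_tensor_space (X n) x)" for x
    by (simp only: convergent_LIMSEQ_iff)
  define g where "g = (\<lambda>x. lim (\<lambda>n. Rep_tensor_space (X n) x))"
  have g: "(\<lambda>n. Rep_tensor_space (X n) x) \<longlonglongrightarrow> g x" for x
    unfolding g_def by (rule lim)
  have comb_lim: "(\<lambda>n. comb (Rep_tensor_space (X n)) c) \<longlonglongrightarrow> comb g c" for c
    unfolding comb_index by (intro tendsto_sum tendsto_mult tendsto_const g)
  have key: "\<exists>M. \<forall>n\<ge>M. \<forall>c. 2 * comb (\<lambda>x. Rep_tensor_space (X n) x - g x) c - gram c c \<le> e\<^sup>2"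
    if "e > 0" for e
  proof -
    obtain M where M: "\<And>m n. m \<ge> M \<Longrightarrow> n \<ge> M \<Longrightarrow> dist (X m) (X n) < e"
      using metric_CauchyD[OF X \<open>e > 0\<close>] by blast
    have "2 * comb (\<lambda>x. Rep_tensor_space (X n) x - g x) c - gram c c \<le> e\<^sup>2" if "n \<ge> M" for n c
    proof (rule tendsto_upperbound)
      show "(\<lambda>m. 2 * comb (\<lambda>x. Rep_tensor_space (X n) x - Rep_tensor_space (X m) x) c - gram c c)
          \<longlonglongrightarrow> 2 * comb (\<lambda>x. Rep_tensor_space (X n) x - g x) c - gram c c"
        unfolding comb_simps by (intro tendsto_diff tendsto_mult tendsto_const comb_lim)
      have "2 * comb (\<lambda>x. Rep_tensor_space (X n) x - Rep_tensor_space (X m) x) c - gram c c \<le> e\<^sup>2"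
        if "m \<ge> M" for m
      proof -
        have "2 * comb (Rep_tensor_space (X n - X m)) c - gram c c \<le> tensor_energy (X n - X m)"
          using energy_upper[of "Rep_tensor_space (X n - X m)"] Rep_tensor_space[of "X n - X m"]
          by (simp only: tensor_energy.rep_eq mem_Collect_eq)
        also have "\<dots> = (dist (X n) (X m))\<^sup>2"
          by (simp only: dist_norm norm_tensor_energy)
        also have "\<dots> \<le> e\<^sup>2"
          using M[OF \<open>n \<ge> M\<close> that] by (intro power_mono) auto
        finally show ?thesis by (simp add: minus_tensor_space.rep_eq)
      qed
      then show "\<forall>\<^sub>F m in sequentially.
          2 * comb (\<lambda>x. Rep_tensor_space (X n) x - Rep_tensor_space (X m) x) c - gram c c \<le> e\<^sup>2"
        unfolding eventually_sequentially by blast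
    qed simp
    then show ?thesis by blast
  qed
  have diff: "energy_bounded (\<lambda>x. Rep_tensor_space (X n) x - g x)"
    if "\<forall>c. 2 * comb (\<lambda>x. Rep_tensor_space (X n) x - g x) c - gram c c \<le> e\<^sup>2" for n e
    using that by (intro energy_boundedI) auto
  obtain M0 where M0: "\<And>n c. n \<ge> M0 \<Longrightarrow> 2 * comb (\<lambda>x. Rep_tensor_space (X n) x - g x) c - gram c c \<le> 1\<^sup>2"
    using key[of 1] by auto
  have "energy_bounded (\<lambda>x. Rep_tensor_space (X M0) x - (Rep_tensor_space (X M0) x - g x))"
  proof (rule energy_bounded_sub)
    show "energy_bounded (Rep_tensor_space (X M0))"
      using Rep_tensor_space[of "X M0"] by simp
    show "energy_bounded (\<lambda>x. Rep_tensor_space (X M0) x - g x)"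
      by (intro diff[of M0 1] allI M0 order_refl)
  qed
  then have gb: "energy_bounded g" by simp
  define G where "G = Abs_tensor_space g"
  have G: "Rep_tensor_space G = g"
    using gb by (simp add: G_def Abs_tensor_space_inverse)
  have "X \<longlonglongrightarrow> G"
  proof (rule metric_LIMSEQ_I)
    fix e :: real assume e: "0 < e"
    obtain M where M: "\<And>n c. n \<ge> M \<Longrightarrow> 2 * comb (\<lambda>x. Rep_tensor_space (X n) x - g x) c - gram c c \<le> (e/2)\<^sup>2"
      using key[of "e/2"] e half_gt_zero by blast
    have "dist (X n) G < e" if "n \<ge> M" for n
    proof -
      have "(norm (X n - G))\<^sup>2 \<le> (e/2)\<^sup>2"
        unfolding norm_tensor_energy tensor_energy.rep_eq minus_tensor_space.rep_eq G
        using energy_least[OF M[OF that]] .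
      then have "norm (X n - G) \<le> e/2"
        by (rule power2_le_imp_le) (use e in linarith)
      then show ?thesis using e unfolding dist_norm by linarith
    qed
    then show "\<exists>M. \<forall>n\<ge>M. dist (X n) G < e" by blast
  qed
  then show "convergent X" by (auto simp: convergent_def)
qed

lift_definition tensor :: "'a::real_inner list \<Rightarrow> 'a tensor_space" is "\<lambda>xs ys. tensor_kernel ys xs"
  subgoal for xs using energy_kernel(1)[of "[(1, xs)]"] by (simp add: gram_def) done

lemma inner_tensor:
  "inner (tensor xs) (tensor ys) =
     (if length xs = length ys then \<Prod>i<length xs. inner (xs ! i) (ys ! i) else 0)"
proof -
  have *: "tensor_energy (s *\<^sub>R tensor xs + t *\<^sub>R tensor ys) = gram [(s, xs), (t, ys)] [(s, xs), (t, ys)]" for s t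
  proof -
    have "Rep_tensor_space (s *\<^sub>R tensor xs + t *\<^sub>R tensor ys) = (\<lambda>x. gram [(1, x)] [(s, xs), (t, ys)])"
      by (simp add: plus_tensor_space.rep_eq scaleR_tensor_space.rep_eq tensor.rep_eq gram_def fun_eq_iff)
    then show ?thesis
      by (simp add: tensor_energy.rep_eq energy_kernel)
  qed
  have g: "gram [(s, xs), (t, ys)] [(s, xs), (t, ys)] =
      s * s * tensor_kernel xs xs + 2 * s * t * tensor_kernel xs ys + t * t * tensor_kernel ys ys" for s t
    unfolding gram_def comb_simps tensor_kernel_commute[of ys xs] by (simp add: algebra_simps)
  have "tensor_energy (tensor xs + tensor ys) =
      tensor_kernel xs xs + 2 * tensor_kernel xs ys + tensor_kernel ys ys"
    using *[of 1 1] unfolding g by simp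
  moreover have "tensor_energy (tensor xs - tensor ys) =
      tensor_kernel xs xs - 2 * tensor_kernel xs ys + tensor_kernel ys ys"
    using *[of 1 "-1"] unfolding g by simp
  ultimately have "inner (tensor xs) (tensor ys) = tensor_kernel xs ys"
    unfolding inner_tensor_space_def by simp
  then show ?thesis
    unfolding tensor_kernel_def .
qed


text \<open>
  \<open>tensor [h\<^sub>1, \<dots>, h\<^sub>n]\<close> is the elementary tensor of the \<open>h\<^sub>i\<close>, so the entry with index \<open>i - 1\<close> of
  the list is the factor in position \<open>i\<close>. All degrees live in the one type \<open>'a tensor_space\<close>.
\<close>

definition alg_power :: "nat \<Rightarrow> 'a::real_inner tensor_space set" where
  "alg_power n = span {tensor hs |hs. length hs = n}"

definition hilbert_power :: "nat \<Rightarrow> 'a::real_inner tensor_space set" where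
  "hilbert_power n = closure (alg_power n)"

text \<open>
  Linear maps prescribed on elementary tensors of fixed degree. Each condition determines the map
  on the relevant tensor power (algebraic, respectively Hilbert); the values elsewhere are never
  used. The map of \<open>tensor_mult\<close> is restricted to degrees \<open>n\<close> and \<open>k\<close> since the tensor product is
  not bounded on the full Fock space.
\<close>

definition tensor_perm :: "nat \<Rightarrow> (nat \<Rightarrow> nat) \<Rightarrow> 'a::real_inner tensor_space \<Rightarrow> 'a tensor_space" where
  "tensor_perm n \<sigma> = (SOME U. bounded_linear U \<and>
     (\<forall>hs. length hs = n \<longrightarrow>
        U (tensor hs) = tensor (map (\<lambda>i. hs ! (inv \<sigma> i - 1)) [1..<Suc n])))"

definition tensor_mult ::
  "nat \<Rightarrow> nat \<Rightarrow> 'a::real_inner tensor_space \<Rightarrow> 'a tensor_space \<Rightarrow> 'a tensor_space" where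
  "tensor_mult n k = (SOME B. bounded_bilinear B \<and>
     (\<forall>hs gs. length hs = n \<longrightarrow> length gs = k \<longrightarrow> B (tensor hs) (tensor gs) = tensor (hs @ gs)))"


section \<open>Permutations and contractions\<close>

definition Zset :: "real set" where
  "Zset = {0} \<union> {x. \<exists>N::nat. N \<ge> 1 \<and> (x = 1 / real N \<or> x = - 1 / real N)}"

definition perms :: "nat \<Rightarrow> (nat \<Rightarrow> nat) set" where
  "perms n = {\<sigma>. \<sigma> permutes {1..n}}"

definition perms0 :: "nat \<Rightarrow> (nat \<Rightarrow> nat) set" where
  "perms0 n = {\<alpha>. \<alpha> permutes {0..n}}"

definition cyc0 :: "nat set \<Rightarrow> (nat \<Rightarrow> nat) \<Rightarrow> nat" where
  "cyc0 X \<alpha> = card {C \<in> orbit \<alpha> ` X. 0 \<notin> C}"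

definition chi :: "real \<Rightarrow> nat \<Rightarrow> (nat \<Rightarrow> nat) \<Rightarrow> real" where
  "chi q n \<alpha> = q ^ (n - cyc0 {0..n} \<alpha>)"

definition perm_cup :: "nat \<Rightarrow> nat \<Rightarrow> (nat \<Rightarrow> nat) \<Rightarrow> (nat \<Rightarrow> nat) \<Rightarrow> nat \<Rightarrow> nat" where
  "perm_cup n k \<alpha> \<beta> = map_permutation {0..k} (\<lambda>j. if j = 0 then 0 else n + j) \<beta> \<circ> \<alpha>"

text \<open>Partitions of \<open>{1..n}\<close> into blocks of size 1 and 2 are identified with involutions.\<close>

definition pairings :: "nat \<Rightarrow> (nat \<Rightarrow> nat) set" where
  "pairings n = {\<pi>. \<pi> permutes {1..n} \<and> \<pi> \<circ> \<pi> = id}"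

definition supp :: "(nat \<Rightarrow> nat) \<Rightarrow> nat set" where
  "supp \<pi> = {i. \<pi> i \<noteq> i}"

definition num_pairs :: "(nat \<Rightarrow> nat) \<Rightarrow> nat" where
  "num_pairs \<pi> = card {{i, \<pi> i} |i. i \<in> supp \<pi>}"

text \<open>The restriction of \<open>\<alpha>\<close> to the complement of \<open>S\<close>, extended by the identity on \<open>S\<close>.\<close>

definition perm_avoid :: "(nat \<Rightarrow> nat) \<Rightarrow> nat set \<Rightarrow> nat \<Rightarrow> nat" where
  "perm_avoid \<alpha> S x =
     (if x \<in> S then x else (\<alpha> ^^ (LEAST j. 0 < j \<and> (\<alpha> ^^ j) x \<notin> S)) x)"

definition relabel :: "nat set \<Rightarrow> (nat \<Rightarrow> nat) \<Rightarrow> nat \<Rightarrow> nat" where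
  "relabel X = map_permutation X (\<lambda>x. card {y \<in> X. y < x})"

text \<open>
  The exponent can be negative: contracting a transposition with itself removes two cycles but
  only one pair.
\<close>

definition contract_exp :: "nat \<Rightarrow> (nat \<Rightarrow> nat) \<Rightarrow> (nat \<Rightarrow> nat) \<Rightarrow> int" where
  "contract_exp n \<pi> \<alpha> =
     int (cyc0 ({0..n} - supp \<pi>) (perm_avoid (\<pi> \<circ> \<alpha>) (supp \<pi>)))
     - int (cyc0 {0..n} (\<pi> \<circ> \<alpha>)) + int (num_pairs \<pi>)"

definition contract_perm :: "nat \<Rightarrow> (nat \<Rightarrow> nat) \<Rightarrow> (nat \<Rightarrow> nat) \<Rightarrow> nat \<Rightarrow> nat" where
  "contract_perm n \<pi> \<alpha> = relabel ({0..n} - supp \<pi>) (perm_avoid (\<pi> \<circ> \<alpha>) (supp \<pi>))"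

definition contract_tensor ::
  "nat \<Rightarrow> (nat \<Rightarrow> nat) \<Rightarrow> 'a::real_inner tensor_space \<Rightarrow> 'a tensor_space" where
  "contract_tensor n \<pi> = (SOME L. linear L \<and>
     (\<forall>hs. length hs = n \<longrightarrow>
        L (tensor hs) =
          (\<Prod>i\<in>{i. i < \<pi> i}. inner (hs ! (i - 1)) (hs ! (\<pi> i - 1))) *\<^sub>R
          tensor (map (\<lambda>i. hs ! (i - 1)) (filter (\<lambda>i. \<pi> i = i) [1..<Suc n]))))"


section \<open>The vector space\<close>

text \<open>
  A pair \<open>(F, G)\<close> stands for \<open>F + \<i> G\<close> in the complexified Fock space, and an element of the
  algebraic direct sum of the \<open>\<complex>[S\<^sub>0(n)] \<otimes> \<H>\<^bsup>\<otimes>n\<^esup>\<close> is the family of its coefficients at the pairs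
  \<open>(n, \<alpha>)\<close> with \<open>\<alpha>\<close> in \<open>S\<^sub>0(n)\<close>.
\<close>

type_synonym 'a tp = "(nat \<times> (nat \<Rightarrow> nat)) \<Rightarrow>\<^sub>0 ('a tensor_space \<times> 'a tensor_space)"

definition cmul ::
  "complex \<Rightarrow> 'a::real_inner tensor_space \<times> 'a tensor_space \<Rightarrow> 'a tensor_space \<times> 'a tensor_space" where
  "cmul z = (\<lambda>(F, G). (Re z *\<^sub>R F - Im z *\<^sub>R G, Re z *\<^sub>R G + Im z *\<^sub>R F))"

definition tp_scale :: "complex \<Rightarrow> 'a::real_inner tp \<Rightarrow> 'a tp" where
  "tp_scale z = Poly_Mapping.map (cmul z)"

lemma lookup_tp_scale:
  "Poly_Mapping.lookup (tp_scale z \<xi>) i = cmul z (Poly_Mapping.lookup \<xi> i)"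
  by (simp add: tp_scale_def map.rep_eq when_def cmul_def zero_prod_def)

global_interpretation tp: vector_space "tp_scale :: complex \<Rightarrow> 'a::real_inner tp \<Rightarrow> 'a tp"
  by unfold_locales
    (auto intro!: poly_mapping_eqI
      simp: lookup_tp_scale lookup_add cmul_def case_prod_unfold prod_eq_iff algebra_simps)

definition elem_tensor :: "nat \<Rightarrow> (nat \<Rightarrow> nat) \<Rightarrow> 'a::real_inner tensor_space \<Rightarrow> 'a tp" where
  "elem_tensor n \<alpha> F = Poly_Mapping.single (n, \<alpha>) (F, 0)"

definition sym_tensor :: "nat \<Rightarrow> (nat \<Rightarrow> nat) \<Rightarrow> 'a::real_inner tensor_space \<Rightarrow> 'a tp" where
  "sym_tensor n \<alpha> F = tp_scale (1 / fact n)
     (\<Sum>\<sigma>\<in>perms n. elem_tensor n (\<sigma> \<circ> \<alpha> \<circ> inv \<sigma>) (tensor_perm n \<sigma> F))"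

definition TP :: "'a::real_inner tp set" where
  "TP = tp.span {sym_tensor n \<alpha> F |n \<alpha> F. \<alpha> \<in> perms0 n \<and> F \<in> alg_power n}"

definition TPbar :: "'a::real_inner tp set" where
  "TPbar = tp.span {sym_tensor n \<alpha> F |n \<alpha> F. \<alpha> \<in> perms0 n \<and> F \<in> hilbert_power n}"

text \<open>Complex-linear and antilinear extension of a map given on the tensors \<open>\<alpha> \<otimes> F\<close>.\<close>

definition lin_ext ::
  "(nat \<Rightarrow> (nat \<Rightarrow> nat) \<Rightarrow> 'a::real_inner tensor_space \<Rightarrow> 'a tp) \<Rightarrow> 'a tp \<Rightarrow> 'a tp" where
  "lin_ext g \<xi> = (\<Sum>(n, \<alpha>)\<in>Poly_Mapping.keys \<xi>. case Poly_Mapping.lookup \<xi> (n, \<alpha>) of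
     (F, G) \<Rightarrow> g n \<alpha> F + tp_scale \<i> (g n \<alpha> G))"

definition antilin_ext ::
  "(nat \<Rightarrow> (nat \<Rightarrow> nat) \<Rightarrow> 'a::real_inner tensor_space \<Rightarrow> 'a tp) \<Rightarrow> 'a tp \<Rightarrow> 'a tp" where
  "antilin_ext g \<xi> = (\<Sum>(n, \<alpha>)\<in>Poly_Mapping.keys \<xi>. case Poly_Mapping.lookup \<xi> (n, \<alpha>) of
     (F, G) \<Rightarrow> g n \<alpha> F - tp_scale \<i> (g n \<alpha> G))"


section \<open>The algebra\<close>

text \<open>
  The underlying vector space of the algebra is \<open>TP\<close> itself. On non-symmetric tensors
  \<open>W(\<alpha> \<otimes> F) = W(\<alpha> \<otimes>\<^sub>s F)\<close>, so \<open>W\<close> is the symmetrisation, and the identity on \<open>TPbar\<close>.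
\<close>

definition W :: "'a::real_inner tp \<Rightarrow> 'a tp" where
  "W = lin_ext sym_tensor"

definition contract ::
  "real \<Rightarrow> nat \<Rightarrow> (nat \<Rightarrow> nat) \<Rightarrow> (nat \<Rightarrow> nat) \<Rightarrow> 'a::real_inner tensor_space \<Rightarrow> 'a tp" where
  "contract q n \<pi> \<alpha> F =
     elem_tensor (n - 2 * num_pairs \<pi>) (contract_perm n \<pi> \<alpha>)
       (q powi contract_exp n \<pi> \<alpha> *\<^sub>R contract_tensor n \<pi> F)"

definition T :: "real \<Rightarrow> 'a::real_inner tp \<Rightarrow> 'a tp" where
  "T q = lin_ext (\<lambda>n \<alpha> F. \<Sum>\<pi>\<in>pairings n. W (contract q n \<pi> \<alpha> F))"

text \<open>
  The bilinear extension of \<open>(\<alpha> \<otimes>\<^sub>s F, \<beta> \<otimes>\<^sub>s G) \<mapsto> (\<alpha> \<union> \<beta>) \<otimes>\<^sub>s (F \<otimes> G)\<close> and the antilinear extension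
  of \<open>\<alpha> \<otimes>\<^sub>s F \<mapsto> \<alpha>\<^sup>-\<^sup>1 \<otimes>\<^sub>s F\<close>. The map \<open>T\<close> is a bijection of \<open>TP\<close>, being the identity up to terms of
  lower degree, and transports them to the algebra.
\<close>

definition cup :: "'a::real_inner tp \<Rightarrow> 'a tp \<Rightarrow> 'a tp" where
  "cup \<xi> \<eta> = lin_ext (\<lambda>n \<alpha> F. lin_ext (\<lambda>k \<beta> G.
     sym_tensor (n + k) (perm_cup n k \<alpha> \<beta>) (tensor_mult n k F G)) \<eta>) \<xi>"

definition flip :: "'a::real_inner tp \<Rightarrow> 'a tp" where
  "flip = antilin_ext (\<lambda>n \<alpha> F. sym_tensor n (inv \<alpha>) F)"

definition tp_mult :: "real \<Rightarrow> 'a::real_inner tp \<Rightarrow> 'a tp \<Rightarrow> 'a tp" where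
  "tp_mult q A B = T q (cup (inv_into TP (T q) A) (inv_into TP (T q) B))"

definition tp_adj :: "real \<Rightarrow> 'a::real_inner tp \<Rightarrow> 'a tp" where
  "tp_adj q A = T q (flip (inv_into TP (T q) A))"

definition tp_one :: "'a::real_inner tp" where
  "tp_one = W (elem_tensor 0 id (tensor []))"

text \<open>The state is the (complex) coefficient of \<open>W((0)) = tp_one\<close>.\<close>

definition phi :: "'a::real_inner tp \<Rightarrow> complex" where
  "phi A = (case Poly_Mapping.lookup A (0, id) of
     (F, G) \<Rightarrow> Complex (inner F (tensor [])) (inner G (tensor [])))"

definition phi_norm :: "real \<Rightarrow> 'a::real_inner tp \<Rightarrow> real" where
  "phi_norm q A = sqrt (Re (phi (tp_mult q (tp_adj q A) A)))"


section \<open>The deformed inner product and the quotient\<close>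

definition cinner_pair ::
  "'a::real_inner tensor_space \<times> 'a tensor_space \<Rightarrow> 'a tensor_space \<times> 'a tensor_space \<Rightarrow> complex" where
  "cinner_pair = (\<lambda>(F1, F2) (G1, G2).
     Complex (inner F1 G1 + inner F2 G2) (inner F2 G1 - inner F1 G2))"

definition qform :: "real \<Rightarrow> 'a::real_inner tp \<Rightarrow> 'a tp \<Rightarrow> complex" where
  "qform q \<xi> \<eta> = (\<Sum>(n, \<alpha>)\<in>Poly_Mapping.keys \<xi>. \<Sum>(k, \<beta>)\<in>Poly_Mapping.keys \<eta>.
     if n = k then \<Sum>\<sigma>\<in>perms n. of_real (chi q n (\<alpha> \<circ> \<sigma> \<circ> inv \<beta> \<circ> inv \<sigma>)) *
       cinner_pair (Poly_Mapping.lookup \<xi> (n, \<alpha>))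
         (map_prod (tensor_perm n \<sigma>) (tensor_perm n \<sigma>) (Poly_Mapping.lookup \<eta> (k, \<beta>)))
     else 0)"

definition qkernel :: "real \<Rightarrow> 'a::real_inner tp set" where
  "qkernel q = {\<xi> \<in> TPbar. \<forall>\<eta>\<in>TPbar. qform q \<xi> \<eta> = 0}"

definition qrel :: "real \<Rightarrow> ('a::real_inner tp \<times> 'a tp) set" where
  "qrel q = {(\<xi>, \<eta>). \<xi> \<in> TPbar \<and> \<eta> \<in> TPbar \<and> \<xi> - \<eta> \<in> qkernel q}"

definition qclass :: "real \<Rightarrow> 'a::real_inner tp \<Rightarrow> 'a tp set" where
  "qclass q \<xi> = qrel q `` {\<xi>}"

definition TPq :: "real \<Rightarrow> 'a::real_inner tp set set" where
  "TPq q = TPbar // qrel q"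

definition qrep :: "'v set \<Rightarrow> 'v" where
  "qrep X = (SOME \<xi>. \<xi> \<in> X)"

definition qadd :: "real \<Rightarrow> 'a::real_inner tp set \<Rightarrow> 'a tp set \<Rightarrow> 'a tp set" where
  "qadd q X Y = qclass q (qrep X + qrep Y)"

definition qscale :: "real \<Rightarrow> complex \<Rightarrow> 'a::real_inner tp set \<Rightarrow> 'a tp set" where
  "qscale q z X = qclass q (tp_scale z (qrep X))"

definition qdist :: "real \<Rightarrow> 'a::real_inner tp set \<Rightarrow> 'a tp set \<Rightarrow> real" where
  "qdist q X Y = sqrt (Re (qform q (qrep X - qrep Y) (qrep X - qrep Y)))"

text \<open>The Hilbert norm on \<open>\<complex>[S\<^sub>0(n)] \<otimes> \<H>\<^bsup>\<otimes>n\<^esup>\<close> for which the permutations are orthonormal.\<close>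

definition tp_dist :: "'a::real_inner tp \<Rightarrow> 'a tp \<Rightarrow> real" where
  "tp_dist \<xi> \<eta> =
     sqrt (\<Sum>i\<in>Poly_Mapping.keys (\<xi> - \<eta>). (norm (Poly_Mapping.lookup (\<xi> - \<eta>) i))\<^sup>2)"


section \<open>Star-algebras and extension by continuity\<close>

locale star_algebra =
  fixes V :: "'v set" and add :: "'v \<Rightarrow> 'v \<Rightarrow> 'v" and zero :: 'v
    and scale :: "complex \<Rightarrow> 'v \<Rightarrow> 'v"
    and mult :: "'v \<Rightarrow> 'v \<Rightarrow> 'v" and one :: 'v and star :: "'v \<Rightarrow> 'v"
  assumes add_closed: "x \<in> V \<Longrightarrow> y \<in> V \<Longrightarrow> add x y \<in> V"
    and zero_closed: "zero \<in> V"
    and add_assoc: "x \<in> V \<Longrightarrow> y \<in> V \<Longrightarrow> z \<in> V \<Longrightarrow> add (add x y) z = add x (add y z)"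
    and add_commute: "x \<in> V \<Longrightarrow> y \<in> V \<Longrightarrow> add x y = add y x"
    and zero_add: "x \<in> V \<Longrightarrow> add zero x = x"
    and add_inverse: "x \<in> V \<Longrightarrow> \<exists>y\<in>V. add x y = zero"
    and scale_closed: "x \<in> V \<Longrightarrow> scale a x \<in> V"
    and scale_add_right: "x \<in> V \<Longrightarrow> y \<in> V \<Longrightarrow> scale a (add x y) = add (scale a x) (scale a y)"
    and scale_add_left: "x \<in> V \<Longrightarrow> scale (a + b) x = add (scale a x) (scale b x)"
    and scale_scale: "x \<in> V \<Longrightarrow> scale a (scale b x) = scale (a * b) x"
    and scale_one: "x \<in> V \<Longrightarrow> scale 1 x = x"
    and mult_closed: "x \<in> V \<Longrightarrow> y \<in> V \<Longrightarrow> mult x y \<in> V"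
    and one_closed: "one \<in> V"
    and mult_assoc: "x \<in> V \<Longrightarrow> y \<in> V \<Longrightarrow> z \<in> V \<Longrightarrow> mult (mult x y) z = mult x (mult y z)"
    and one_mult: "x \<in> V \<Longrightarrow> mult one x = x"
    and mult_one: "x \<in> V \<Longrightarrow> mult x one = x"
    and mult_add: "x \<in> V \<Longrightarrow> y \<in> V \<Longrightarrow> z \<in> V \<Longrightarrow> mult x (add y z) = add (mult x y) (mult x z)"
    and add_mult: "x \<in> V \<Longrightarrow> y \<in> V \<Longrightarrow> z \<in> V \<Longrightarrow> mult (add x y) z = add (mult x z) (mult y z)"
    and mult_scale: "x \<in> V \<Longrightarrow> y \<in> V \<Longrightarrow> mult x (scale a y) = scale a (mult x y)"
    and scale_mult: "x \<in> V \<Longrightarrow> y \<in> V \<Longrightarrow> mult (scale a x) y = scale a (mult x y)"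
    and star_closed: "x \<in> V \<Longrightarrow> star x \<in> V"
    and star_star: "x \<in> V \<Longrightarrow> star (star x) = x"
    and star_add: "x \<in> V \<Longrightarrow> y \<in> V \<Longrightarrow> star (add x y) = add (star x) (star y)"
    and star_scale: "x \<in> V \<Longrightarrow> star (scale a x) = scale (cnj a) (star x)"
    and star_mult: "x \<in> V \<Longrightarrow> y \<in> V \<Longrightarrow> star (mult x y) = mult (star y) (star x)"

text \<open>
  \<open>mul\<close> and \<open>adj\<close>, on a space that receives \<open>TPbar\<close> through \<open>\<iota>\<close> and carries the
  (pseudo)metric \<open>d\<close>, restrict to the given operations on \<open>TP\<close>, and for fixed permutations they
  depend continuously, with respect to \<open>d\<close>, on the tensor arguments.
\<close>

definition extends_by_continuity ::
  "real \<Rightarrow> ('a::real_inner tp \<Rightarrow> 'v) \<Rightarrow> ('v \<Rightarrow> 'v \<Rightarrow> real) \<Rightarrow> ('v \<Rightarrow> 'v \<Rightarrow> 'v) \<Rightarrow> ('v \<Rightarrow> 'v) \<Rightarrow> bool" where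
  "extends_by_continuity q \<iota> d mul adj \<longleftrightarrow>
     (\<forall>A\<in>TP. \<forall>B\<in>TP. mul (\<iota> A) (\<iota> B) = \<iota> (tp_mult q A B)) \<and>
     (\<forall>A\<in>TP. adj (\<iota> A) = \<iota> (tp_adj q A)) \<and>
     (\<forall>n k. \<forall>\<alpha>\<in>perms0 n. \<forall>\<beta>\<in>perms0 k. \<forall>F\<in>hilbert_power n. \<forall>G\<in>hilbert_power k.
        ((\<lambda>(F', G'). d (mul (\<iota> (W (sym_tensor n \<alpha> F'))) (\<iota> (W (sym_tensor k \<beta> G'))))
                       (mul (\<iota> (W (sym_tensor n \<alpha> F))) (\<iota> (W (sym_tensor k \<beta> G)))))
          \<longlongrightarrow> 0) (at (F, G) within hilbert_power n \<times> hilbert_power k)) \<and>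
     (\<forall>n. \<forall>\<alpha>\<in>perms0 n. \<forall>F\<in>hilbert_power n.
        ((\<lambda>F'. d (adj (\<iota> (W (sym_tensor n \<alpha> F')))) (adj (\<iota> (W (sym_tensor n \<alpha> F)))))
          \<longlongrightarrow> 0) (at F within hilbert_power n))"

end

theory Submission
  imports Defs
begin

text \<open>
  In terms of \<open>T\<close> multiplication is mere juxtaposition of tensors, but \<open>T\<close> contracts slots within one
  tensor, and such contractions are unbounded. The idea is to express the product in terms of \<open>W\<close>: the
  product of \<open>W(\<alpha> \<otimes> F)\<close> and \<open>W(\<beta> \<otimes> G)\<close> is the sum of the contractions of \<open>(\<alpha> \<union> \<beta>) \<otimes> (F \<otimes> G)\<close> along
  all pairings that join slots of \<open>F\<close> to slots of \<open>G\<close> (\<open>mul\<close>, \<open>mul_diagram\<close>, \<open>tp_mult_eq_mul\<close>). Indeed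
  a pairing of all \<open>n + k\<close> slots consists of a pairing inside each factor and one between the slots
  that these leave over (\<open>pairings_decompose\<close>), and the exponents of \<open>q\<close>, which count lost cycles, add
  up accordingly (\<open>expo_compose\<close>, \<open>expo_product\<close>, \<open>contraction_contraction\<close>). The sum over the inner
  pairings is what \<open>T\<close> does to the factors. Since \<open>T\<close> is the identity up to terms of lower degree, it
  is onto (\<open>T_surj\<close>), and so the formula describes the product of all elements.

  Contractions between two tensors are bounded: by the Cauchy-Schwarz inequality their norm is at most
  \<open>\<parallel>F\<parallel> \<parallel>G\<parallel>\<close> (\<open>contraction_estimate\<close>). Each pair costs at most one cycle, so the exponents of \<open>q\<close> are
  nonnegative (\<open>expo_bipairing_nonneg\<close>) and, as \<open>\<bar>q\<bar> \<le> 1\<close>, the coefficients are at most one. The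
  deformed inner product of two symmetrised tensors of degree \<open>m\<close> is at most \<open>m!\<close> times the product of
  their norms. As a pairing between the slots is determined by the partners of the slots on one side,
  there are at most \<open>min ((k + 1)^n) ((n + 1)^k)\<close> of them, which gives the estimate
  (\<open>card_bipairings_le\<close>, \<open>mul_norm_le\<close>).

  Being given by bounded maps on each component, the product and the adjoint are sequentially
  continuous on elements supported in a fixed finite set of components (\<open>tpconv\<close>). Every element of
  the completed space is such a limit of algebraic elements (\<open>TPbar_approx\<close>, \<open>TPbar_limit\<close>), so the
  laws of a star-algebra extend. For the quotient, complete contractions of two tensors of degree
  \<open>n\<close> correspond to permutations, which identifies the deformed inner product of \<open>\<xi>\<close> and \<open>\<eta>\<close> with
  \<open>\<phi>[\<eta>\<^sup>* \<xi>]\<close> (\<open>qform_phi\<close>). The state is a trace (\<open>phi_mul_commute\<close>), because the permutations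
  whose cycles are counted are conjugate. Hence the kernel is a two-sided ideal that is invariant
  under the adjoint, and the algebra passes to the quotient.

  Symmetrisation makes the numbering of the slots irrelevant. All computations are therefore done
  with diagrams, whose slots are labelled by an arbitrary finite set; contracting, juxtaposing and
  multiplying them then needs no renumbering.
\<close>

section \<open>Bounded multilinear maps on tensors\<close>

instance tensor_space :: (real_inner) banach ..

lemma inner_tensor_kernel: "inner (tensor xs) (tensor ys) = tensor_kernel xs ys"
  by (simp add: inner_tensor tensor_kernel_def)

lemma inner_tensor_comb:
  "inner (\<Sum>i\<in>I. r i *\<^sub>R tensor (x i)) (\<Sum>j\<in>J. s j *\<^sub>R tensor (y j)) =
     (\<Sum>i\<in>I. \<Sum>j\<in>J. r i * s j * tensor_kernel (x i) (y j))"
  unfolding inner_sum_left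
  by (simp add: inner_sum_right inner_tensor_kernel sum_distrib_left algebra_simps)

lemma norm_tensor_comb:
  "(norm (\<Sum>i\<in>I. r i *\<^sub>R tensor (x i)))\<^sup>2 =
     (\<Sum>i\<in>I. \<Sum>j\<in>I. r i * r j * tensor_kernel (x i) (x j))"
  by (simp add: power2_norm_eq_inner inner_tensor_comb)

lemma tensor_dense: "closure (span (range tensor)) = (UNIV :: 'a::real_inner tensor_space set)"
proof -
  have "\<exists>G\<in>span (range tensor). dist G F < e" if e: "e > 0" for F :: "'a tensor_space" and e
  proof -
    define f where "f = Rep_tensor_space F"
    have f: "energy_bounded f"
      using Rep_tensor_space[of F] by (simp add: f_def)
    obtain c where c: "energy f - e\<^sup>2 < 2 * comb f c - gram c c"
    proof (rule ccontr)
      assume "\<not> thesis"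
      then have "energy f \<le> energy f - e\<^sup>2"
        using that by (intro energy_least) (meson linorder_not_less)
      then show False using e by simp
    qed
    define G where "G = (\<Sum>(r, x)\<leftarrow>c. r *\<^sub>R tensor x)"
    have G: "G \<in> span (range tensor)"
      unfolding G_def by (induction c) (simp_all add: span_zero span_add span_scale span_base case_prod_beta)
    have RG: "Rep_tensor_space G = (\<lambda>x. gram [(1, x)] c)"
      unfolding G_def
      by (induction c) (auto simp: zero_tensor_space.rep_eq plus_tensor_space.rep_eq
          scaleR_tensor_space.rep_eq tensor.rep_eq gram_def fun_eq_iff)
    have cG: "comb (Rep_tensor_space G) d = gram d c" for d
      by (simp add: RG gram_def)
    have "tensor_energy (F - G) \<le> energy f - (2 * comb f c - gram c c)"
      unfolding tensor_energy.rep_eq minus_tensor_space.rep_eq f_def[symmetric]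
    proof (rule energy_least)
      fix d
      have "2 * comb (\<lambda>x. f x - Rep_tensor_space G x) d - gram d d =
          2 * comb f (d @ c) - gram (d @ c) (d @ c) - (2 * comb f c - gram c c)"
        using gram_commute[of c d] by (simp add: cG)
      also have "\<dots> \<le> energy f - (2 * comb f c - gram c c)"
        using energy_upper[OF f, of "d @ c"] by simp
      finally show "2 * comb (\<lambda>x. f x - Rep_tensor_space G x) d - gram d d
          \<le> energy f - (2 * comb f c - gram c c)" .
    qed
    then have "(norm (F - G))\<^sup>2 < e\<^sup>2"
      using c by (simp add: norm_tensor_energy)
    then have "norm (F - G) < e"
      using e by (meson less_imp_le power2_less_imp_less)
    with G show ?thesis
      by (auto simp: dist_norm norm_minus_commute)
  qed
  then show ?thesis
    by (auto simp: closure_approachable)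
qed

lemma span_explicitE:
  assumes "v \<in> span S"
  obtains T r where "finite T" "T \<subseteq> S" "v = (\<Sum>a\<in>T. r a *\<^sub>R a)"
  using assms unfolding span_explicit mem_Collect_eq by (elim exE conjE) (rule that)

lemma linear_extension_from_generators:
  fixes t :: "'i \<Rightarrow> 'v::real_vector" and b :: "'i \<Rightarrow> 'w::real_vector"
  assumes wd: "\<And>I r. finite I \<Longrightarrow> I \<subseteq> P \<Longrightarrow> (\<Sum>i\<in>I. r i *\<^sub>R t i) = 0 \<Longrightarrow> (\<Sum>i\<in>I. r i *\<^sub>R b i) = 0"
  obtains L where "linear L" "\<And>i. i \<in> P \<Longrightarrow> L (t i) = b i"
proof -
  \<comment> \<open>The hypothesis says that the span of the graph is single-valued.\<close>
  define p where "p i = (t i, b i)" for i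
  define S where "S = p ` P"
  have single: "w = 0" if w: "(0, w) \<in> span S" for w
  proof -
    obtain T r where T: "finite T" "T \<subseteq> S" and sum: "(0, w) = (\<Sum>a\<in>T. r a *\<^sub>R a)"
      using w by (rule span_explicitE)
    obtain I where I: "I \<subseteq> P" "inj_on p I" "T = p ` I"
      using T(2)[unfolded S_def subset_image_inj] by blast
    then have "finite I"
      using T(1) finite_image_iff by blast
    have "(0, w) = (\<Sum>i\<in>I. r (p i) *\<^sub>R p i)"
      by (simp add: sum I(3) sum.reindex[OF I(2)])
    then have "(\<Sum>i\<in>I. r (p i) *\<^sub>R t i) = 0" "w = (\<Sum>i\<in>I. r (p i) *\<^sub>R b i)"
      by (simp_all add: prod_eq_iff fst_sum snd_sum p_def)
    with wd[OF \<open>finite I\<close> I(1)] show "w = 0" by simp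
  qed
  obtain B where B: "B \<subseteq> t ` P" "independent B" "t ` P \<subseteq> span B"
    using maximal_independent_subset by blast
  define s where "s v = inv_into P t v" for v
  have s: "s v \<in> P" "t (s v) = v" if "v \<in> t ` P" for v
    using that by (auto simp: s_def inv_into_into f_inv_into_f)
  obtain L where L: "linear L" "\<And>v. v \<in> B \<Longrightarrow> L v = b (s v)"
    using linear_independent_extend[OF B(2), of "\<lambda>v. b (s v)"] by blast
  have "L (t i) = b i" if i: "i \<in> P" for i
  proof -
    obtain T u where T: "finite T" "T \<subseteq> B" and ti: "t i = (\<Sum>v\<in>T. u v *\<^sub>R v)"
      using subsetD[OF B(3) imageI[OF i]] by (rule span_explicitE)
    have "L (t i) = (\<Sum>v\<in>T. u v *\<^sub>R b (s v))"
      using T(2) L by (simp add: ti linear_sum linear_scale subset_iff)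
    moreover have "(\<Sum>v\<in>T. u v *\<^sub>R (t (s v), b (s v))) \<in> span S"
      using T(2) B(1) s(1) by (intro span_sum span_scale span_base) (auto simp: S_def p_def)
    moreover have "(\<Sum>v\<in>T. u v *\<^sub>R t (s v)) = t i"
      unfolding ti using T(2) B(1) s(2) by (intro sum.cong) auto
    ultimately have "(t i, L (t i)) \<in> span S"
      by (simp add: sum_prod)
    moreover have "(t i, b i) \<in> span S"
      using i by (intro span_base) (auto simp: S_def p_def)
    ultimately have "(t i, L (t i)) - (t i, b i) \<in> span S"
      by (rule span_diff)
    then have "(0, L (t i) - b i) \<in> span S" by simp
    from single[OF this] show ?thesis by simp
  qed
  with L(1) show ?thesis using that by blast
qed

lemma tensor_span_explicit:
  assumes "F \<in> span (tensor ` P)"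
  obtains I r where "finite I" "I \<subseteq> P" "F = (\<Sum>x\<in>I. r x *\<^sub>R tensor x)"
proof -
  obtain T r where T: "finite T" "T \<subseteq> tensor ` P" "F = (\<Sum>a\<in>T. r a *\<^sub>R a)"
    using assms by (rule span_explicitE)
  obtain I where I: "I \<subseteq> P" "inj_on tensor I" "T = tensor ` I"
    using T(2)[unfolded subset_image_inj] by blast
  have "finite I"
    using T(1) I finite_image_iff by blast
  moreover have "F = (\<Sum>x\<in>I. r (tensor x) *\<^sub>R tensor x)"
    by (simp add: T(3) I(3) sum.reindex[OF I(2)])
  ultimately show ?thesis
    using that[of I "\<lambda>x. r (tensor x)"] I(1) by blast
qed

lemma norm_degree_part_le:
  assumes "finite I"
  shows "norm (\<Sum>x\<in>{x\<in>I. length x = n}. r x *\<^sub>R tensor x) \<le> norm (\<Sum>x\<in>I. r x *\<^sub>R tensor x)"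
    (is "norm ?A \<le> norm ?F")
proof -
  let ?B = "\<Sum>x\<in>{x\<in>I. length x \<noteq> n}. r x *\<^sub>R tensor x"
  have F: "?F = ?A + ?B"
    using assms by (subst sum.union_disjoint[symmetric]) (auto intro!: sum.cong)
  have "inner ?A ?B = 0"
    unfolding inner_tensor_comb by (auto intro!: sum.neutral simp: tensor_kernel_def)
  then have "(norm ?F)\<^sup>2 = (norm ?A)\<^sup>2 + (norm ?B)\<^sup>2"
    by (simp add: F power2_norm_eq_inner inner_add inner_commute)
  then have "(norm ?A)\<^sup>2 \<le> (norm ?F)\<^sup>2"
    by simp
  then show ?thesis
    by (rule power2_le_imp_le) simp
qed

text \<open>
  Elementary tensors span a dense subspace, and different degrees are orthogonal. So a map on
  elementary tensors of one degree that is bounded on their finite combinations extends, by zero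
  in the other degrees, to the whole Fock space.
\<close>

lemma extend_linear_tensor:
  fixes b :: "'a::real_inner list \<Rightarrow> 'w::banach"
  assumes C: "C \<ge> 0"
    and bound: "\<And>I r. finite I \<Longrightarrow> (\<forall>x\<in>I. length x = n) \<Longrightarrow>
      norm (\<Sum>x\<in>I. r x *\<^sub>R b x) \<le> C * norm (\<Sum>x\<in>I. r x *\<^sub>R tensor x)"
  obtains L where "bounded_linear L" "\<And>x. length x = n \<Longrightarrow> L (tensor x) = b x"
    "\<And>x. length x \<noteq> n \<Longrightarrow> L (tensor x) = 0" "\<And>F. norm (L F) \<le> C * norm F"
proof -
  define b' where "b' x = (if length x = n then b x else 0)" for x
  have b': "norm (\<Sum>x\<in>I. r x *\<^sub>R b' x) \<le> C * norm (\<Sum>x\<in>I. r x *\<^sub>R tensor x)"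
    if "finite I" for I r
  proof -
    have "(\<Sum>x\<in>I. r x *\<^sub>R b' x) = (\<Sum>x\<in>{x\<in>I. length x = n}. r x *\<^sub>R b x)"
      using that by (intro sum.mono_neutral_cong_right) (auto simp: b'_def)
    also have "norm \<dots> \<le> C * norm (\<Sum>x\<in>{x\<in>I. length x = n}. r x *\<^sub>R tensor x)"
      using that by (intro bound) auto
    also have "\<dots> \<le> C * norm (\<Sum>x\<in>I. r x *\<^sub>R tensor x)"
      using C that by (intro mult_left_mono norm_degree_part_le)
    finally show ?thesis .
  qed
  obtain M where M: "linear M" "\<And>x. x \<in> UNIV \<Longrightarrow> M (tensor x) = b' x"
  proof (rule linear_extension_from_generators[where P = UNIV and t = tensor and b = b'])
    fix I :: "'a list set" and r
    assume "finite I" and "(\<Sum>x\<in>I. r x *\<^sub>R tensor x) = 0"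
    with b'[of I r] show "(\<Sum>x\<in>I. r x *\<^sub>R b' x) = 0" by simp
  qed blast
  let ?D = "span (range tensor) :: 'a tensor_space set"
  have MD: "norm (M F) \<le> C * norm F" if F: "F \<in> ?D" for F
  proof -
    obtain I r where I: "finite I" "F = (\<Sum>x\<in>I. r x *\<^sub>R tensor x)"
      using tensor_span_explicit[OF F] by metis
    then have "M F = (\<Sum>x\<in>I. r x *\<^sub>R b' x)"
      using M by (simp add: linear_sum linear_scale)
    with I b'[of I r] show ?thesis by simp
  qed
  have "C-lipschitz_on ?D M"
  proof (rule lipschitz_onI)
    fix F G assume "F \<in> ?D" "G \<in> ?D"
    then show "dist (M F) (M G) \<le> C * dist F G"
      using MD[of "F - G"] M(1) by (simp add: dist_norm linear_diff span_diff)
  qed (rule C)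
  then obtain L where "C-lipschitz_on (closure ?D) L" and LM: "\<And>F. F \<in> ?D \<Longrightarrow> L F = M F"
    using lipschitz_extend_closure by metis
  then have lip: "C-lipschitz_on UNIV L"
    by (simp add: tensor_dense)
  then have cont: "continuous_on UNIV L"
    by (rule lipschitz_on_continuous_on)
  have conv: "(\<lambda>j. L (X j)) \<longlonglongrightarrow> L F" if "X \<longlonglongrightarrow> F" for X F
    using cont that by (auto simp: continuous_on_sequentially o_def)
  have approx: "\<exists>X. (\<forall>j. X j \<in> ?D) \<and> X \<longlonglongrightarrow> F" for F
    using tensor_dense by (metis UNIV_I closure_sequential)
  have "linear L"
  proof (rule linearI)
    fix F G :: "'a tensor_space"
    obtain X Y where X: "\<And>j. X j \<in> ?D" "X \<longlonglongrightarrow> F" and Y: "\<And>j. Y j \<in> ?D" "Y \<longlonglongrightarrow> G"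
      using approx by metis
    have "(\<lambda>j. L (X j + Y j)) \<longlonglongrightarrow> L (F + G)"
      by (intro conv tendsto_add X Y)
    moreover have "(\<lambda>j. L (X j + Y j)) = (\<lambda>j. L (X j) + L (Y j))"
      using X Y M(1) by (simp add: LM span_add linear_add)
    ultimately show "L (F + G) = L F + L G"
      using tendsto_add[OF conv[OF X(2)] conv[OF Y(2)]] LIMSEQ_unique by auto
  next
    fix t :: real and F :: "'a tensor_space"
    obtain X where X: "\<And>j. X j \<in> ?D" "X \<longlonglongrightarrow> F"
      using approx by metis
    have "(\<lambda>j. L (t *\<^sub>R X j)) \<longlonglongrightarrow> L (t *\<^sub>R F)"
      by (intro conv tendsto_scaleR tendsto_const X)
    moreover have "(\<lambda>j. L (t *\<^sub>R X j)) = (\<lambda>j. t *\<^sub>R L (X j))"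
      using X M(1) by (simp add: LM span_scale linear_scale)
    ultimately show "L (t *\<^sub>R F) = t *\<^sub>R L F"
      using tendsto_scaleR[OF tendsto_const conv[OF X(2)]] LIMSEQ_unique by auto
  qed
  have bd: "norm (L F) \<le> C * norm F" for F
    using lipschitz_onD[OF lip, of F 0] \<open>linear L\<close> by (simp add: dist_norm linear_0)
  show ?thesis
  proof (rule that[of L])
    show "bounded_linear L"
      using \<open>linear L\<close> bd
      by (intro bounded_linear_intro[of _ C]) (auto simp: linear_add linear_scale mult.commute)
  qed (auto simp: LM span_base M(2) b'_def bd)
qed

lemma extend_bilinear_tensor:
  fixes b :: "'a::real_inner list \<Rightarrow> 'a list \<Rightarrow> 'a tensor_space"
  assumes bound: "\<And>I J r s. finite I \<Longrightarrow> finite J \<Longrightarrow> (\<forall>x\<in>I. length x = n) \<Longrightarrow> (\<forall>y\<in>J. length y = k) \<Longrightarrow>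
      norm (\<Sum>x\<in>I. \<Sum>y\<in>J. (r x * s y) *\<^sub>R b x y)
        \<le> norm (\<Sum>x\<in>I. r x *\<^sub>R tensor x) * norm (\<Sum>y\<in>J. s y *\<^sub>R tensor y)"
  obtains B where "bounded_bilinear B" "\<And>x y. length x = n \<Longrightarrow> length y = k \<Longrightarrow> B (tensor x) (tensor y) = b x y"
proof -
  have "\<exists>L. bounded_linear L \<and> (\<forall>y. length y = k \<longrightarrow> L (tensor y) = b x y) \<and>
      (\<forall>y. length y \<noteq> k \<longrightarrow> L (tensor y) = 0)" if "length x = n" for x
  proof -
    have *: "norm (\<Sum>y\<in>J. s y *\<^sub>R b x y) \<le> norm (tensor x) * norm (\<Sum>y\<in>J. s y *\<^sub>R tensor y)"
      if "finite J" "\<forall>y\<in>J. length y = k" for J s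
      using bound[of "{x}" J "\<lambda>_. 1" s] that \<open>length x = n\<close> by simp
    show ?thesis
      by (rule extend_linear_tensor[of "norm (tensor x)" k "b x", OF norm_ge_zero *]) blast+
  qed
  then obtain L where L: "\<And>x. length x = n \<Longrightarrow> bounded_linear (L x)"
    "\<And>x y. length x = n \<Longrightarrow> length y = k \<Longrightarrow> L x (tensor y) = b x y"
    "\<And>x y. length x = n \<Longrightarrow> length y \<noteq> k \<Longrightarrow> L x (tensor y) = 0"
    by metis
  define l where "l x = Blinfun (L x)" for x
  have l: "blinfun_apply (l x) = L x" if "length x = n" for x
    using L(1)[OF that] by (simp add: l_def bounded_linear_Blinfun_apply)
  have lb: "norm (\<Sum>x\<in>I. r x *\<^sub>R l x) \<le> 1 * norm (\<Sum>x\<in>I. r x *\<^sub>R tensor x)"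
    if I: "finite I" "\<forall>x\<in>I. length x = n" for I r
  proof (unfold mult_1, rule norm_blinfun_bound)
    let ?l = "\<Sum>x\<in>I. r x *\<^sub>R l x" and ?F = "\<Sum>x\<in>I. r x *\<^sub>R tensor x"
    have app: "blinfun_apply ?l G = (\<Sum>x\<in>I. r x *\<^sub>R L x G)" for G
      using I by (simp add: blinfun.sum_left blinfun.scaleR_left l)
    have dense: "norm (blinfun_apply ?l G) \<le> norm ?F * norm G" if G: "G \<in> span (range tensor)" for G
    proof -
      obtain J s where J: "finite J" "G = (\<Sum>y\<in>J. s y *\<^sub>R tensor y)"
        using tensor_span_explicit[OF G] by metis
      have "blinfun_apply ?l G = (\<Sum>x\<in>I. \<Sum>y\<in>J. (r x * s y) *\<^sub>R L x (tensor y))"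
        unfolding app J(2) using I L(1)
        by (intro sum.cong refl) (simp add: bounded_linear.linear linear_sum linear_scale scaleR_sum_right)
      also have "\<dots> = (\<Sum>x\<in>I. \<Sum>y\<in>{y\<in>J. length y = k}. (r x * s y) *\<^sub>R b x y)"
        using I J(1) L(2,3) by (intro sum.cong refl sum.mono_neutral_cong_right) auto
      also have "norm \<dots> \<le> norm ?F * norm (\<Sum>y\<in>{y\<in>J. length y = k}. s y *\<^sub>R tensor y)"
        using I J(1) by (intro bound) auto
      also have "\<dots> \<le> norm ?F * norm G"
        unfolding J(2) using J(1) by (intro mult_left_mono norm_degree_part_le) auto
      finally show ?thesis .
    qed
    have "closed {G. norm (blinfun_apply ?l G) \<le> norm ?F * norm G}"
      by (intro closed_Collect_le continuous_intros)
    then have "closure (span (range tensor)) \<subseteq> {G. norm (blinfun_apply ?l G) \<le> norm ?F * norm G}"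
      using dense by (intro closure_minimal) auto
    then show "norm (blinfun_apply ?l G) \<le> norm ?F * norm G" for G
      by (auto simp: tensor_dense)
  qed simp
  obtain M where M: "bounded_linear M" "\<And>x. length x = n \<Longrightarrow> M (tensor x) = l x"
    by (rule extend_linear_tensor[of 1 n l, OF zero_le_one lb]) blast+
  show ?thesis
  proof (rule that[of "\<lambda>F G. blinfun_apply (M F) G"])
    show "bounded_bilinear (\<lambda>F. blinfun_apply (M F))"
      using bounded_bilinear.comp1[OF bounded_bilinear_blinfun_apply M(1)] .
  qed (auto simp: M(2) l L(2))
qed

lemma tensor_kernel_append:
  "length xs = length xs' \<Longrightarrow>
    tensor_kernel (xs @ ys) (xs' @ ys') = tensor_kernel xs xs' * tensor_kernel ys ys'"
  by (induction xs xs' rule: list_induct2) auto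

lemma tensor_kernel_map:
  "tensor_kernel (map f A) (map g A) = (\<Prod>p\<leftarrow>A. inner (f p) (g p))"
  by (induction A) auto

text \<open>
  Contracting slots of one tensor with slots of another, one pair of slots at a time: in an
  orthogonal basis of the finitely many vectors involved each contraction is a matrix product,
  and the Cauchy-Schwarz inequality bounds it by the product of the Hilbert-Schmidt norms.
\<close>

lemma contraction_estimate:
  fixes h :: "'i \<Rightarrow> 'p \<Rightarrow> 'a::real_inner" and g :: "'j \<Rightarrow> 'p \<Rightarrow> 'a"
  assumes I: "finite I" and J: "finite J"
  shows "norm (\<Sum>i\<in>I. \<Sum>j\<in>J. (r i * s j * (\<Prod>(p, p')\<leftarrow>M. inner (h i p) (g j p'))) *\<^sub>R
        tensor (map (h i) A @ map (g j) B))
    \<le> norm (\<Sum>i\<in>I. r i *\<^sub>R tensor (map (h i) (map fst M @ A)))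
      * norm (\<Sum>j\<in>J. s j *\<^sub>R tensor (map (g j) (map snd M @ B)))"
proof (induction M arbitrary: r s)
  case Nil
  have "(norm (\<Sum>i\<in>I. \<Sum>j\<in>J. (r i * s j) *\<^sub>R tensor (map (h i) A @ map (g j) B)))\<^sup>2
      = (norm (\<Sum>(i, j)\<in>I \<times> J. (r i * s j) *\<^sub>R tensor (map (h i) A @ map (g j) B)))\<^sup>2"
    by (simp add: sum.cartesian_product)
  also have "\<dots> = (\<Sum>(i, j)\<in>I \<times> J. \<Sum>(i', j')\<in>I \<times> J. (r i * s j) * (r i' * s j') *
       (tensor_kernel (map (h i) A) (map (h i') A) * tensor_kernel (map (g j) B) (map (g j') B)))"
    using norm_tensor_comb[of "\<lambda>(i, j). r i * s j" "\<lambda>(i, j). map (h i) A @ map (g j) B" "I \<times> J"]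
    by (simp add: case_prod_unfold tensor_kernel_append)
  also have "\<dots> = (\<Sum>i\<in>I. \<Sum>j\<in>J. \<Sum>i'\<in>I. \<Sum>j'\<in>J. (r i * s j) * (r i' * s j') *
       (tensor_kernel (map (h i) A) (map (h i') A) * tensor_kernel (map (g j) B) (map (g j') B)))"
    by (simp add: sum.cartesian_product[symmetric])
  also have "\<dots> = (\<Sum>i\<in>I. \<Sum>i'\<in>I. \<Sum>j\<in>J. \<Sum>j'\<in>J. (r i * s j) * (r i' * s j') *
       (tensor_kernel (map (h i) A) (map (h i') A) * tensor_kernel (map (g j) B) (map (g j') B)))"
    by (intro sum.cong refl sum.swap)
  also have "\<dots> = (norm (\<Sum>i\<in>I. r i *\<^sub>R tensor (map (h i) A)))\<^sup>2 * (norm (\<Sum>j\<in>J. s j *\<^sub>R tensor (map (g j) B)))\<^sup>2"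
    unfolding norm_tensor_comb sum_distrib_right
    unfolding sum_distrib_left
    by (intro sum.cong refl) (simp add: algebra_simps)
  also have "\<dots> = (norm (\<Sum>i\<in>I. r i *\<^sub>R tensor (map (h i) A)) * norm (\<Sum>j\<in>J. s j *\<^sub>R tensor (map (g j) B)))\<^sup>2"
    by (simp add: power_mult_distrib)
  finally have "norm (\<Sum>i\<in>I. \<Sum>j\<in>J. (r i * s j) *\<^sub>R tensor (map (h i) A @ map (g j) B))
      = norm (\<Sum>i\<in>I. r i *\<^sub>R tensor (map (h i) A)) * norm (\<Sum>j\<in>J. s j *\<^sub>R tensor (map (g j) B))"
    by (rule power2_eq_imp_eq) auto
  then show ?case by simp
next
  case (Cons pq M)
  obtain p p' where pq: "pq = (p, p')" by force
  obtain E where E: "finite E" and par: "\<And>u v. u \<in> (\<lambda>i. h i p) ` I \<union> (\<lambda>j. g j p') ` J \<Longrightarrow>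
      v \<in> (\<lambda>i. h i p) ` I \<union> (\<lambda>j. g j p') ` J \<Longrightarrow> inner u v = (\<Sum>e\<in>E. inner u e * inner v e / inner e e)"
    using finite_parseval[of "(\<lambda>i. h i p) ` I \<union> (\<lambda>j. g j p') ` J"] I J by auto
  define r' where "r' e i = r i * (inner (h i p) e / norm e)" for e i
  define s' where "s' e j = s j * (inner (g j p') e / norm e)" for e j
  define f1 where "f1 e = norm (\<Sum>i\<in>I. r' e i *\<^sub>R tensor (map (h i) (map fst M @ A)))" for e
  define g1 where "g1 e = norm (\<Sum>j\<in>J. s' e j *\<^sub>R tensor (map (g j) (map snd M @ B)))" for e
  have nn: "inner e e = norm e * norm e" for e :: 'a
    by (simp add: power2_norm_eq_inner[symmetric] power2_eq_square)
  have slice: "(\<Sum>e\<in>E. (norm (\<Sum>i\<in>K. (t i * (inner (w i a) e / norm e)) *\<^sub>R tensor (map (w i) R)))\<^sup>2)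
      = (norm (\<Sum>i\<in>K. t i *\<^sub>R tensor (map (w i) (a # R))))\<^sup>2"
    if "\<And>i i'. i \<in> K \<Longrightarrow> i' \<in> K \<Longrightarrow>
      inner (w i a) (w i' a) = (\<Sum>e\<in>E. inner (w i a) e * inner (w i' a) e / inner e e)"
    for K :: "'k set" and t and w :: "'k \<Rightarrow> 'p \<Rightarrow> 'a" and a R
  proof -
    have "(\<Sum>e\<in>E. (norm (\<Sum>i\<in>K. (t i * (inner (w i a) e / norm e)) *\<^sub>R tensor (map (w i) R)))\<^sup>2)
      = (\<Sum>e\<in>E. \<Sum>i\<in>K. \<Sum>i'\<in>K. t i * t i' * tensor_kernel (map (w i) R) (map (w i') R) *
           (inner (w i a) e * inner (w i' a) e / inner e e))"
      unfolding norm_tensor_comb by (intro sum.cong refl) (simp add: nn)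
    also have "\<dots> = (\<Sum>i\<in>K. \<Sum>e\<in>E. \<Sum>i'\<in>K. t i * t i' * tensor_kernel (map (w i) R) (map (w i') R) *
           (inner (w i a) e * inner (w i' a) e / inner e e))"
      by (rule sum.swap)
    also have "\<dots> = (\<Sum>i\<in>K. \<Sum>i'\<in>K. \<Sum>e\<in>E. t i * t i' * tensor_kernel (map (w i) R) (map (w i') R) *
           (inner (w i a) e * inner (w i' a) e / inner e e))"
      by (intro sum.cong refl sum.swap)
    also have "\<dots> = (\<Sum>i\<in>K. \<Sum>i'\<in>K. t i * t i' * tensor_kernel (map (w i) R) (map (w i') R) *
           inner (w i a) (w i' a))"
      by (intro sum.cong refl) (simp only: sum_distrib_left that)
    also have "\<dots> = (norm (\<Sum>i\<in>K. t i *\<^sub>R tensor (map (w i) (a # R))))\<^sup>2"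
      unfolding norm_tensor_comb by (intro sum.cong refl) simp
    finally show ?thesis .
  qed
  have split: "(r i * s j * (\<Prod>(p, p')\<leftarrow>pq # M. inner (h i p) (g j p'))) *\<^sub>R v =
      (\<Sum>e\<in>E. (r' e i * s' e j * (\<Prod>(p, p')\<leftarrow>M. inner (h i p) (g j p'))) *\<^sub>R v)"
    if "i \<in> I" "j \<in> J" for i j and v :: "'a tensor_space"
  proof -
    have "inner (h i p) (g j p') = (\<Sum>e\<in>E. inner (h i p) e * inner (g j p') e / inner e e)"
      using that by (intro par) auto
    then have "r i * s j * (\<Prod>(p, p')\<leftarrow>pq # M. inner (h i p) (g j p')) =
        (\<Sum>e\<in>E. inner (h i p) e * inner (g j p') e / inner e e) *
        (r i * s j * (\<Prod>(p, p')\<leftarrow>M. inner (h i p) (g j p')))"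
      by (simp add: pq)
    also have "\<dots> = (\<Sum>e\<in>E. r' e i * s' e j * (\<Prod>(p, p')\<leftarrow>M. inner (h i p) (g j p')))"
      unfolding sum_distrib_right by (intro sum.cong refl) (simp add: r'_def s'_def nn)
    finally show ?thesis
      by (simp only: scaleR_sum_left)
  qed
  have "(\<Sum>i\<in>I. \<Sum>j\<in>J. (r i * s j * (\<Prod>(p, p')\<leftarrow>pq # M. inner (h i p) (g j p'))) *\<^sub>R
        tensor (map (h i) A @ map (g j) B))
     = (\<Sum>i\<in>I. \<Sum>j\<in>J. \<Sum>e\<in>E. (r' e i * s' e j * (\<Prod>(p, p')\<leftarrow>M. inner (h i p) (g j p'))) *\<^sub>R
        tensor (map (h i) A @ map (g j) B))"
    by (intro sum.cong refl split)
  also have "\<dots> = (\<Sum>i\<in>I. \<Sum>e\<in>E. \<Sum>j\<in>J. (r' e i * s' e j * (\<Prod>(p, p')\<leftarrow>M. inner (h i p) (g j p'))) *\<^sub>R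
        tensor (map (h i) A @ map (g j) B))"
    by (intro sum.cong refl sum.swap)
  also have "\<dots> = (\<Sum>e\<in>E. \<Sum>i\<in>I. \<Sum>j\<in>J. (r' e i * s' e j * (\<Prod>(p, p')\<leftarrow>M. inner (h i p) (g j p'))) *\<^sub>R
        tensor (map (h i) A @ map (g j) B))"
    by (rule sum.swap)
  also have "norm \<dots> \<le> (\<Sum>e\<in>E. f1 e * g1 e)"
    unfolding f1_def g1_def by (intro sum_norm_le Cons.IH)
  also have "\<dots> \<le> L2_set f1 E * L2_set g1 E"
    using L2_set_mult_ineq[of f1 g1 E] by (simp add: f1_def g1_def)
  also have "L2_set f1 E = norm (\<Sum>i\<in>I. r i *\<^sub>R tensor (map (h i) (map fst (pq # M) @ A)))"
  proof -
    have "(\<Sum>e\<in>E. (f1 e)\<^sup>2) = (norm (\<Sum>i\<in>I. r i *\<^sub>R tensor (map (h i) (p # (map fst M @ A)))))\<^sup>2"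
      unfolding f1_def r'_def by (intro slice par) auto
    then show ?thesis
      by (simp add: L2_set_def pq)
  qed
  also have "L2_set g1 E = norm (\<Sum>j\<in>J. s j *\<^sub>R tensor (map (g j) (map snd (pq # M) @ B)))"
  proof -
    have "(\<Sum>e\<in>E. (g1 e)\<^sup>2) = (norm (\<Sum>j\<in>J. s j *\<^sub>R tensor (map (g j) (p' # (map snd M @ B)))))\<^sup>2"
      unfolding g1_def s'_def by (intro slice par) auto
    then show ?thesis
      by (simp add: L2_set_def pq)
  qed
  finally show ?case .
qed

section \<open>The tensor operations on elementary tensors\<close>

text \<open>
  Degree \<open>n\<close> elementary tensors are written as functions on the labels \<open>1, \<dots>, n\<close>; a permutation
  or a contraction then acts on labels only.
\<close>

definition word :: "nat \<Rightarrow> (nat \<Rightarrow> 'a::real_inner) \<Rightarrow> 'a tensor_space" where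
  "word n h = tensor (map h [1..<Suc n])"

definition glue :: "nat \<Rightarrow> (nat \<Rightarrow> 'a) \<Rightarrow> (nat \<Rightarrow> 'a) \<Rightarrow> nat \<Rightarrow> 'a" where
  "glue n h g i = (if i \<le> n then h i else g (i - n))"

definition weight :: "(nat \<Rightarrow> nat) \<Rightarrow> (nat \<Rightarrow> 'a::real_inner) \<Rightarrow> real" where
  "weight \<pi> h = (\<Prod>i\<in>{i. i < \<pi> i}. inner (h i) (h (\<pi> i)))"

definition pairings_on :: "nat set \<Rightarrow> (nat \<Rightarrow> nat) set" where
  "pairings_on X = {\<pi>. \<pi> permutes X \<and> \<pi> \<circ> \<pi> = id}"

definition bipairings :: "nat set \<Rightarrow> nat set \<Rightarrow> (nat \<Rightarrow> nat) set" where
  "bipairings X Y = {\<pi> \<in> pairings_on (X \<union> Y).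
     (\<forall>x\<in>X. \<pi> x \<in> X \<longrightarrow> \<pi> x = x) \<and> (\<forall>y\<in>Y. \<pi> y \<in> Y \<longrightarrow> \<pi> y = y)}"

lemma pairings_onD:
  assumes "\<pi> \<in> pairings_on X"
  shows "\<pi> permutes X" "\<pi> (\<pi> x) = x" "bij \<pi>" "inv \<pi> = \<pi>"
proof -
  show p: "\<pi> permutes X" and i: "\<pi> (\<pi> x) = x" for x
    using assms by (auto simp: pairings_on_def o_def fun_eq_iff)
  show "bij \<pi>" using p by (rule permutes_bij)
  show "inv \<pi> = \<pi>" using i by (intro ext inv_equality)
qed

lemma bipairings_id: "id \<in> bipairings X Y"
  by (auto simp: bipairings_def pairings_on_def permutes_id)

lemma list_eq_word: "length hs = n \<Longrightarrow> map (\<lambda>i. hs ! (i - 1)) [1..<Suc n] = hs"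
  by (rule nth_equalityI) (auto simp del: upt_Suc One_nat_def)

lemma nth_map_upt_1: "i \<in> {1..n} \<Longrightarrow> map h [1..<Suc n] ! (i - 1) = h i"
  using nth_map[of "i - 1" "[1..<Suc n]" h] nth_upt[of 1 "i - 1" "Suc n"] by (auto simp del: upt_Suc One_nat_def)

lemma alg_power_word: "alg_power n = span (range (word n))"
proof -
  have "{tensor hs |hs. length hs = n} = range (word n :: (nat \<Rightarrow> 'a) \<Rightarrow> _)"
  proof (intro equalityI subsetI; clarsimp)
    show "tensor hs \<in> range (word (length hs))" for hs :: "'a list"
      using list_eq_word[OF refl, of hs] by (metis rangeI word_def)
    show "\<exists>hs. word n h = tensor hs \<and> length hs = n" for h :: "nat \<Rightarrow> 'a"
      by (auto simp: word_def simp del: upt_Suc One_nat_def intro!: exI[of _ "map h [1..<Suc n]"])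
  qed
  then show ?thesis by (simp add: alg_power_def)
qed

lemma alg_power_induct [consumes 1, case_names add scale word]:
  assumes F: "F \<in> alg_power n"
    and add: "\<And>F G. P F \<Longrightarrow> P G \<Longrightarrow> P (F + G)" and scale: "\<And>r F. P F \<Longrightarrow> P (r *\<^sub>R F)"
    and word: "\<And>h. P (word n h)"
  shows "P F"
  using F unfolding alg_power_word
proof (induction rule: span_induct_alt)
  case base
  show ?case using scale[OF word, of 0] by simp
next
  case (step c x y)
  then show ?case using add scale word by auto
qed

lemma tensor_kernel_map_set:
  "distinct A \<Longrightarrow> tensor_kernel (map f A) (map g A) = (\<Prod>p\<in>set A. inner (f p) (g p))"
  by (simp add: tensor_kernel_map prod.distinct_set_conv_list)

lemma norm_tensor_comb_reorder:
  assumes "distinct A" "distinct B" "set A = set B"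
  shows "norm (\<Sum>i\<in>I. r i *\<^sub>R tensor (map (h i) A)) = norm (\<Sum>i\<in>I. r i *\<^sub>R tensor (map (h i) B))"
  by (rule power2_eq_imp_eq) (use assms in \<open>simp_all add: norm_tensor_comb tensor_kernel_map_set\<close>)

lemma tensor_perm_exists:
  assumes \<sigma>: "\<sigma> permutes {1..n}"
  shows "\<exists>U :: 'a::real_inner tensor_space \<Rightarrow> _. bounded_linear U \<and> (\<forall>hs. length hs = n \<longrightarrow>
        U (tensor hs) = tensor (map (\<lambda>i. hs ! (inv \<sigma> i - 1)) [1..<Suc n]))"
proof -
  let ?b = "\<lambda>hs. tensor (map (\<lambda>i. hs ! (inv \<sigma> i - 1)) [1..<Suc n])"
  have inv: "inv \<sigma> permutes {1..n}" using \<sigma> by (rule permutes_inv)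
  have *: "norm (\<Sum>x\<in>I. r x *\<^sub>R ?b x) \<le> 1 * norm (\<Sum>x\<in>I. r x *\<^sub>R tensor x)"
    if "finite I" "\<forall>x\<in>I. length x = n" for I :: "'a list set" and r
  proof -
    have set: "set (map (inv \<sigma>) [1..<Suc n]) = set [1..<Suc n]"
      using permutes_image[OF inv] by (simp add: atLeastLessThanSuc_atLeastAtMost del: upt_Suc One_nat_def)
    have "distinct (map (inv \<sigma>) [1..<Suc n])"
      using inj_on_subset[OF permutes_inj[OF inv]] by (simp add: distinct_map del: upt_Suc One_nat_def)
    then have "norm (\<Sum>x\<in>I. r x *\<^sub>R tensor (map (\<lambda>i. x ! (i - 1)) (map (inv \<sigma>) [1..<Suc n]))) =
       norm (\<Sum>x\<in>I. r x *\<^sub>R tensor (map (\<lambda>i. x ! (i - 1)) [1..<Suc n]))"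
      using set by (intro norm_tensor_comb_reorder) (auto simp del: upt_Suc One_nat_def)
    also have "\<dots> = norm (\<Sum>x\<in>I. r x *\<^sub>R tensor x)"
      using that by (intro arg_cong[of _ _ norm] sum.cong refl) (simp add: list_eq_word del: upt_Suc One_nat_def)
    finally show ?thesis by (simp add: o_def del: upt_Suc One_nat_def)
  qed
  show ?thesis
    by (rule extend_linear_tensor[of 1 n ?b, OF zero_le_one *]) blast+
qed

lemma tensor_perm_word:
  fixes h :: "nat \<Rightarrow> 'a::real_inner"
  assumes "\<sigma> permutes {1..n}"
  shows "bounded_linear (tensor_perm n \<sigma> :: 'a tensor_space \<Rightarrow> _)" "tensor_perm n \<sigma> (word n h) = word n (h \<circ> inv \<sigma>)"
proof -
  have *: "bounded_linear (tensor_perm n \<sigma> :: 'a tensor_space \<Rightarrow> _) \<and> (\<forall>hs::'a list. length hs = n \<longrightarrow>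
        tensor_perm n \<sigma> (tensor hs) = tensor (map (\<lambda>i. hs ! (inv \<sigma> i - 1)) [1..<Suc n]))"
    unfolding tensor_perm_def by (rule someI_ex[OF tensor_perm_exists[OF assms]])
  then show "bounded_linear (tensor_perm n \<sigma> :: 'a tensor_space \<Rightarrow> _)" by blast
  have inv: "inv \<sigma> i \<in> {1..n}" if "i \<in> {1..n}" for i
    using that permutes_in_image[OF permutes_inv[OF assms]] by simp
  show "tensor_perm n \<sigma> (word n h) = word n (h \<circ> inv \<sigma>)"
  proof -
    have "map (\<lambda>i. map h [1..<Suc n] ! (inv \<sigma> i - 1)) [1..<Suc n] = map (h \<circ> inv \<sigma>) [1..<Suc n]"
    proof (rule map_cong[OF refl])
      fix i assume "i \<in> set [1..<Suc n]"
      then have "inv \<sigma> i \<in> {1..n}" by (intro inv) auto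
      then show "map h [1..<Suc n] ! (inv \<sigma> i - 1) = (h \<circ> inv \<sigma>) i"
        unfolding o_apply by (rule nth_map_upt_1)
    qed
    moreover have "tensor_perm n \<sigma> (tensor (map h [1..<Suc n])) =
        tensor (map (\<lambda>i. map h [1..<Suc n] ! (inv \<sigma> i - 1)) [1..<Suc n])"
      by (rule conjunct2[OF *, rule_format]) simp
    ultimately show ?thesis
      by (simp only: word_def)
  qed
qed

text \<open>
  The contraction of an element of degree \<open>n\<close> with one of degree \<open>k\<close> along a pairing between their
  slots. Unlike a contraction within one tensor it is bounded, so it is available on the Hilbert
  space tensor powers.
\<close>

definition cross_contract ::
  "nat \<Rightarrow> nat \<Rightarrow> (nat \<Rightarrow> nat) \<Rightarrow> 'a::real_inner tensor_space \<Rightarrow> 'a tensor_space \<Rightarrow> 'a tensor_space" where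
  "cross_contract n k \<pi> = (SOME B. bounded_bilinear B \<and>
     (\<forall>hs gs. length hs = n \<longrightarrow> length gs = k \<longrightarrow> B (tensor hs) (tensor gs) =
        weight \<pi> (\<lambda>i. (hs @ gs) ! (i - 1)) *\<^sub>R
        tensor (map (\<lambda>i. (hs @ gs) ! (i - 1)) (filter (\<lambda>i. \<pi> i = i) [1..<Suc (n + k)]))))"

lemma bipairings_less:
  assumes \<pi>: "\<pi> \<in> bipairings {1..n} {n+1..n+k}"
  shows "{i. i < \<pi> i} = {i\<in>{1..n}. \<pi> i \<noteq> i}" "\<And>i. i \<in> {1..n} \<Longrightarrow> \<pi> i \<noteq> i \<Longrightarrow> \<pi> i \<in> {n+1..n+k}"
    "\<pi> ` {i\<in>{1..n}. \<pi> i \<noteq> i} = {i\<in>{n+1..n+k}. \<pi> i \<noteq> i}"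
proof -
  have p: "\<pi> permutes ({1..n} \<union> {n+1..n+k})" and inv: "\<pi> (\<pi> i) = i" for i
    using \<pi> pairings_onD unfolding bipairings_def by blast+
  have out: "\<pi> i = i" if "i \<notin> {1..n} \<union> {n+1..n+k}" for i
    using p that by (rule permutes_not_in)
  have im: "\<pi> i \<in> {1..n} \<union> {n+1..n+k}" if "i \<in> {1..n} \<union> {n+1..n+k}" for i
    using permutes_in_image[OF p, of i] that by simp
  have X: "\<pi> i \<in> {n+1..n+k}" if "i \<in> {1..n}" "\<pi> i \<noteq> i" for i
    using that im[of i] \<pi> unfolding bipairings_def by blast
  have Y: "\<pi> i \<in> {1..n}" if "i \<in> {n+1..n+k}" "\<pi> i \<noteq> i" for i
    using that im[of i] \<pi> unfolding bipairings_def by blast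
  show "{i. i < \<pi> i} = {i\<in>{1..n}. \<pi> i \<noteq> i}"
  proof (intro equalityI subsetI)
    fix i assume "i \<in> {i. i < \<pi> i}"
    then show "i \<in> {i\<in>{1..n}. \<pi> i \<noteq> i}"
      using out[of i] Y[of i] by (cases "i \<in> {n+1..n+k}") auto
  next
    fix i assume "i \<in> {i\<in>{1..n}. \<pi> i \<noteq> i}"
    then show "i \<in> {i. i < \<pi> i}"
      using X[of i] by auto
  qed
  show "\<And>i. i \<in> {1..n} \<Longrightarrow> \<pi> i \<noteq> i \<Longrightarrow> \<pi> i \<in> {n+1..n+k}" by (rule X)
  show "\<pi> ` {i\<in>{1..n}. \<pi> i \<noteq> i} = {i\<in>{n+1..n+k}. \<pi> i \<noteq> i}"
  proof (intro equalityI subsetI)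
    fix j assume "j \<in> \<pi> ` {i\<in>{1..n}. \<pi> i \<noteq> i}"
    then obtain i where i: "i \<in> {1..n}" "\<pi> i \<noteq> i" "j = \<pi> i" by auto
    from i(2) have "\<pi> (\<pi> i) \<noteq> \<pi> i" unfolding inv by (rule not_sym)
    with X[OF i(1,2)] show "j \<in> {i\<in>{n+1..n+k}. \<pi> i \<noteq> i}" unfolding i(3) by blast
  next
    fix j assume j: "j \<in> {i\<in>{n+1..n+k}. \<pi> i \<noteq> i}"
    then have "\<pi> j \<in> {i\<in>{1..n}. \<pi> i \<noteq> i}" using Y[of j] inv[of j] by auto
    then have "\<pi> (\<pi> j) \<in> \<pi> ` {i\<in>{1..n}. \<pi> i \<noteq> i}" by (rule imageI)
    then show "j \<in> \<pi> ` {i\<in>{1..n}. \<pi> i \<noteq> i}" unfolding inv .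
  qed
qed

lemma cross_contract_bound:
  fixes x :: "'i \<Rightarrow> 'a::real_inner list" and y :: "'j \<Rightarrow> 'a list"
  assumes \<pi>: "\<pi> \<in> bipairings {1..n} {n+1..n+k}" and I: "finite I" "\<forall>i\<in>I. length (x i) = n"
    and J: "finite J" "\<forall>j\<in>J. length (y j) = k"
  shows "norm (\<Sum>i\<in>I. \<Sum>j\<in>J. (r i * s j) *\<^sub>R (weight \<pi> (\<lambda>p. (x i @ y j) ! (p - 1)) *\<^sub>R
        tensor (map (\<lambda>p. (x i @ y j) ! (p - 1)) (filter (\<lambda>p. \<pi> p = p) [1..<Suc (n + k)]))))
    \<le> norm (\<Sum>i\<in>I. r i *\<^sub>R tensor (x i)) * norm (\<Sum>j\<in>J. s j *\<^sub>R tensor (y j))"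
proof -
  note b = bipairings_less[OF \<pi>]
  have inj: "inj \<pi>"
    using \<pi> pairings_onD(3) unfolding bipairings_def by (blast intro: bij_is_inj)
  define h where "h i p = x i ! (p - 1)" for i p
  define g where "g j p = y j ! (p - 1 - n)" for j p
  define M where "M = map (\<lambda>p. (p, \<pi> p)) (filter (\<lambda>p. \<pi> p \<noteq> p) [1..<Suc n])"
  define A where "A = filter (\<lambda>p. \<pi> p = p) [1..<Suc n]"
  define B where "B = filter (\<lambda>p. \<pi> p = p) [Suc n..<Suc (n + k)]"
  have upt: "[1..<Suc (n + k)] = [1..<Suc n] @ [Suc n..<Suc (n + k)]"
    using upt_add_eq_append[of 1 "Suc n" k] by simp
  have hA: "map (\<lambda>p. (x i @ y j) ! (p - 1)) (filter (\<lambda>p. \<pi> p = p) [1..<Suc (n + k)])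
      = map (h i) A @ map (g j) B" if "i \<in> I" for i j
    using that I unfolding upt A_def B_def h_def g_def
    by (auto simp: nth_append simp del: upt_Suc One_nat_def)
  have w: "weight \<pi> (\<lambda>p. (x i @ y j) ! (p - 1)) = (\<Prod>(p, p')\<leftarrow>M. inner (h i p) (g j p'))"
    if "i \<in> I" for i j
  proof -
    have "(\<Prod>(p, p')\<leftarrow>M. inner (h i p) (g j p')) =
        (\<Prod>p\<in>set (filter (\<lambda>p. \<pi> p \<noteq> p) [1..<Suc n]). inner (h i p) (g j (\<pi> p)))"
      unfolding M_def by (subst prod.distinct_set_conv_list) (auto simp: o_def simp del: upt_Suc One_nat_def)
    also have "set (filter (\<lambda>p. \<pi> p \<noteq> p) [1..<Suc n]) = {p. p < \<pi> p}"
      unfolding b(1) by (auto simp del: upt_Suc One_nat_def)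
    also have "(\<Prod>p\<in>{p. p < \<pi> p}. inner (h i p) (g j (\<pi> p))) = weight \<pi> (\<lambda>p. (x i @ y j) ! (p - 1))"
      unfolding weight_def
    proof (intro prod.cong refl)
      fix p assume "p \<in> {p. p < \<pi> p}"
      then have "p \<in> {1..n}" "\<pi> p \<in> {n+1..n+k}" using b(1,2) by auto
      with I that show "inner (h i p) (g j (\<pi> p)) = inner ((x i @ y j) ! (p - 1)) ((x i @ y j) ! (\<pi> p - 1))"
        by (auto simp: h_def g_def nth_append)
    qed
    finally show ?thesis ..
  qed
  have "norm (\<Sum>i\<in>I. \<Sum>j\<in>J. (r i * s j * (\<Prod>(p, p')\<leftarrow>M. inner (h i p) (g j p'))) *\<^sub>R
        tensor (map (h i) A @ map (g j) B))
    \<le> norm (\<Sum>i\<in>I. r i *\<^sub>R tensor (map (h i) (map fst M @ A)))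
      * norm (\<Sum>j\<in>J. s j *\<^sub>R tensor (map (g j) (map snd M @ B)))"
    by (rule contraction_estimate[OF I(1) J(1)])
  also have "norm (\<Sum>i\<in>I. r i *\<^sub>R tensor (map (h i) (map fst M @ A))) =
      norm (\<Sum>i\<in>I. r i *\<^sub>R tensor (map (h i) [1..<Suc n]))"
    by (rule norm_tensor_comb_reorder) (auto simp: M_def A_def o_def simp del: upt_Suc One_nat_def)
  also have "\<dots> = norm (\<Sum>i\<in>I. r i *\<^sub>R tensor (x i))"
    unfolding h_def using I
    by (intro arg_cong[of _ _ norm] sum.cong refl) (simp add: list_eq_word del: upt_Suc One_nat_def)
  also have "norm (\<Sum>j\<in>J. s j *\<^sub>R tensor (map (g j) (map snd M @ B))) =
      norm (\<Sum>j\<in>J. s j *\<^sub>R tensor (map (g j) [Suc n..<Suc (n + k)]))"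
  proof (rule norm_tensor_comb_reorder)
    have sM: "set (map snd M) = {i\<in>{n+1..n+k}. \<pi> i \<noteq> i}"
      unfolding M_def b(3)[symmetric] by (auto simp del: upt_Suc One_nat_def)
    have "distinct (map snd M)"
      unfolding M_def using inj by (auto simp: o_def distinct_map inj_on_def simp del: upt_Suc One_nat_def)
    then show "distinct (map snd M @ B)"
      unfolding distinct_append sM by (auto simp: B_def simp del: upt_Suc One_nat_def)
    show "set (map snd M @ B) = set [Suc n..<Suc (n + k)]"
      unfolding set_append sM by (auto simp: B_def simp del: upt_Suc One_nat_def)
  qed simp
  also have "map (g j) [Suc n..<Suc (n + k)] = y j" if "j \<in> J" for j
    using J that by (intro nth_equalityI) (auto simp: g_def simp del: upt_Suc One_nat_def)
  then have "norm (\<Sum>j\<in>J. s j *\<^sub>R tensor (map (g j) [Suc n..<Suc (n + k)])) = norm (\<Sum>j\<in>J. s j *\<^sub>R tensor (y j))"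
    by (intro arg_cong[of _ _ norm] sum.cong refl) simp
  finally show ?thesis
    using w hA by simp
qed

lemma cross_contract_exists:
  assumes \<pi>: "\<pi> \<in> bipairings {1..n} {n+1..n+k}"
  shows "\<exists>B :: 'a::real_inner tensor_space \<Rightarrow> _. bounded_bilinear B \<and>
     (\<forall>hs gs. length hs = n \<longrightarrow> length gs = k \<longrightarrow> B (tensor hs) (tensor gs) =
        weight \<pi> (\<lambda>i. (hs @ gs) ! (i - 1)) *\<^sub>R
        tensor (map (\<lambda>i. (hs @ gs) ! (i - 1)) (filter (\<lambda>i. \<pi> i = i) [1..<Suc (n + k)])))"
proof -
  obtain B :: "'a::real_inner tensor_space \<Rightarrow> 'a tensor_space \<Rightarrow> 'a tensor_space" where
    "bounded_bilinear B" "\<And>hs gs. length hs = n \<Longrightarrow> length gs = k \<Longrightarrow> B (tensor hs) (tensor gs) =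
        weight \<pi> (\<lambda>i. (hs @ gs) ! (i - 1)) *\<^sub>R
        tensor (map (\<lambda>i. (hs @ gs) ! (i - 1)) (filter (\<lambda>i. \<pi> i = i) [1..<Suc (n + k)]))"
    by (rule extend_bilinear_tensor[of n k, OF cross_contract_bound[OF \<pi>]]) blast+
  then show ?thesis by blast
qed

lemma map_glue:
  assumes "set A \<subseteq> {1..n+k}"
  shows "map (\<lambda>i. (map h [1..<Suc n] @ map g [1..<Suc k]) ! (i - 1)) A = map (glue n h g) A"
proof (rule map_cong[OF refl])
  fix i assume "i \<in> set A"
  then have i: "1 \<le> i" "i \<le> n + k" using assms by auto
  show "(map h [1..<Suc n] @ map g [1..<Suc k]) ! (i - 1) = glue n h g i"
  proof (cases "i \<le> n")
    case True
    then have "i - 1 < n" using i by simp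
    then have "(map h [1..<Suc n] @ map g [1..<Suc k]) ! (i - 1) = map h [1..<Suc n] ! (i - 1)"
      by (simp add: nth_append del: upt_Suc One_nat_def)
    also have "\<dots> = h i" using True i by (intro nth_map_upt_1) auto
    finally show ?thesis using True by (simp add: glue_def)
  next
    case False
    then have "\<not> i - 1 < length (map h [1..<Suc n])" "i - 1 - length (map h [1..<Suc n]) = i - n - 1"
      using i by auto
    then have "(map h [1..<Suc n] @ map g [1..<Suc k]) ! (i - 1) = map g [1..<Suc k] ! (i - n - 1)"
      by (simp only: nth_append if_False)
    also have "\<dots> = g (i - n)" using False i by (intro nth_map_upt_1) auto
    finally show ?thesis using False by (simp add: glue_def)
  qed
qed

lemma cross_contract_word:
  fixes h :: "nat \<Rightarrow> 'a::real_inner"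
  assumes \<pi>: "\<pi> \<in> bipairings {1..n} {n+1..n+k}"
  shows "bounded_bilinear (cross_contract n k \<pi> :: 'a tensor_space \<Rightarrow> _)"
    and "cross_contract n k \<pi> (word n h) (word k g) =
      weight \<pi> (glue n h g) *\<^sub>R tensor (map (glue n h g) (filter (\<lambda>i. \<pi> i = i) [1..<Suc (n + k)]))"
proof -
  have *: "bounded_bilinear (cross_contract n k \<pi> :: 'a tensor_space \<Rightarrow> _) \<and>
     (\<forall>(hs::'a list) gs. length hs = n \<longrightarrow> length gs = k \<longrightarrow> cross_contract n k \<pi> (tensor hs) (tensor gs) =
        weight \<pi> (\<lambda>i. (hs @ gs) ! (i - 1)) *\<^sub>R
        tensor (map (\<lambda>i. (hs @ gs) ! (i - 1)) (filter (\<lambda>i. \<pi> i = i) [1..<Suc (n + k)])))"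
    unfolding cross_contract_def by (rule someI_ex[OF cross_contract_exists[OF \<pi>]])
  then show "bounded_bilinear (cross_contract n k \<pi> :: 'a tensor_space \<Rightarrow> _)"
    by blast
  have w: "weight \<pi> (\<lambda>i. (map h [1..<Suc n] @ map g [1..<Suc k]) ! (i - 1)) = weight \<pi> (glue n h g)"
    unfolding weight_def bipairings_less(1)[OF \<pi>]
  proof (intro prod.cong refl)
    fix i assume "i \<in> {i\<in>{1..n}. \<pi> i \<noteq> i}"
    then have "i \<in> {1..n}" "\<pi> i \<in> {n+1..n+k}"
      using bipairings_less(2)[OF \<pi>] by auto
    then show "inner ((map h [1..<Suc n] @ map g [1..<Suc k]) ! (i - 1)) ((map h [1..<Suc n] @ map g [1..<Suc k]) ! (\<pi> i - 1))
       = inner (glue n h g i) (glue n h g (\<pi> i))"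
      using map_glue[of "[i, \<pi> i]" n k h g] by (simp del: upt_Suc One_nat_def)
  qed
  show "cross_contract n k \<pi> (word n h) (word k g) =
      weight \<pi> (glue n h g) *\<^sub>R tensor (map (glue n h g) (filter (\<lambda>i. \<pi> i = i) [1..<Suc (n + k)]))"
  proof -
    have "cross_contract n k \<pi> (tensor (map h [1..<Suc n])) (tensor (map g [1..<Suc k])) =
        weight \<pi> (\<lambda>i. (map h [1..<Suc n] @ map g [1..<Suc k]) ! (i - 1)) *\<^sub>R
        tensor (map (\<lambda>i. (map h [1..<Suc n] @ map g [1..<Suc k]) ! (i - 1)) (filter (\<lambda>i. \<pi> i = i) [1..<Suc (n + k)]))"
      by (rule conjunct2[OF *, rule_format]) simp_all
    moreover have "map (\<lambda>i. (map h [1..<Suc n] @ map g [1..<Suc k]) ! (i - 1)) (filter (\<lambda>i. \<pi> i = i) [1..<Suc (n + k)])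
        = map (glue n h g) (filter (\<lambda>i. \<pi> i = i) [1..<Suc (n + k)])"
      by (rule map_glue) auto
    ultimately show ?thesis
      by (simp only: word_def w)
  qed
qed

lemma tensor_mult_word:
  fixes h :: "nat \<Rightarrow> 'a::real_inner"
  shows "bounded_bilinear (tensor_mult n k :: 'a tensor_space \<Rightarrow> _)"
    and "tensor_mult n k (word n h) (word k g) = word (n + k) (glue n h g)"
proof -
  have "\<exists>B :: 'a tensor_space \<Rightarrow> _. bounded_bilinear B \<and>
     (\<forall>hs gs. length hs = n \<longrightarrow> length gs = k \<longrightarrow> B (tensor hs) (tensor gs) = tensor (hs @ gs))"
  proof -
    have f: "filter (\<lambda>i. id i = i) [1..<Suc (n + k)] = [1..<Suc (n + k)]"
      by (simp del: upt_Suc One_nat_def)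
    have "map (\<lambda>i. (hs @ gs) ! (i - 1)) [1..<Suc (n + k)] = hs @ gs"
      if "length hs = n" "length gs = k" for hs gs :: "'a list"
      using that by (intro list_eq_word) simp
    moreover obtain B where "bounded_bilinear B" "\<And>(hs::'a list) gs. length hs = n \<Longrightarrow> length gs = k \<Longrightarrow>
        B (tensor hs) (tensor gs) = weight id (\<lambda>i. (hs @ gs) ! (i - 1)) *\<^sub>R
        tensor (map (\<lambda>i. (hs @ gs) ! (i - 1)) (filter (\<lambda>i. id i = i) [1..<Suc (n + k)]))"
      using cross_contract_exists[of id n k, where ?'a = 'a, OF bipairings_id] by blast
    ultimately have "bounded_bilinear B \<and>
        (\<forall>(hs::'a list) gs. length hs = n \<longrightarrow> length gs = k \<longrightarrow> B (tensor hs) (tensor gs) = tensor (hs @ gs))"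
      by (simp only: f) (simp add: weight_def)
    then show ?thesis by blast
  qed
  then have *: "bounded_bilinear (tensor_mult n k :: 'a tensor_space \<Rightarrow> _) \<and>
     (\<forall>(hs::'a list) gs. length hs = n \<longrightarrow> length gs = k \<longrightarrow> tensor_mult n k (tensor hs) (tensor gs) = tensor (hs @ gs))"
    unfolding tensor_mult_def by (rule someI_ex)
  then show "bounded_bilinear (tensor_mult n k :: 'a tensor_space \<Rightarrow> _)"
    by blast
  have "map h [1..<Suc n] @ map g [1..<Suc k] = map (glue n h g) [1..<Suc (n + k)]"
    using map_glue[of "[1..<Suc (n + k)]" n k h g, OF eq_refl]
      list_eq_word[of "map h [1..<Suc n] @ map g [1..<Suc k]" "n + k"] by (simp add: atLeastLessThanSuc_atLeastAtMost del: upt_Suc One_nat_def)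
  then show "tensor_mult n k (word n h) (word k g) = word (n + k) (glue n h g)"
    using * by (simp add: word_def del: upt_Suc One_nat_def)
qed

text \<open>
  Contractions within one tensor are unbounded, but they are well defined on the algebraic power:
  for finitely many vectors the pairing \<open>\<langle>u, v\<rangle>\<close> is a finite sum of products \<open>\<langle>u, e\<rangle> \<langle>v, e\<rangle>\<close>, so a
  vanishing combination of elementary tensors stays zero when two slots are paired.
\<close>

lemma contraction_well_defined:
  fixes h :: "'i \<Rightarrow> 'p \<Rightarrow> 'a::real_inner"
  assumes I: "finite I"
    and "(\<Sum>i\<in>I. r i *\<^sub>R tensor (map (h i) (concat (map (\<lambda>(p, p'). [p, p']) M) @ A))) = 0"
  shows "(\<Sum>i\<in>I. (r i * (\<Prod>(p, p')\<leftarrow>M. inner (h i p) (h i p'))) *\<^sub>R tensor (map (h i) A)) = 0"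
  using assms(2)
proof (induction M arbitrary: r)
  case (Cons pq M)
  obtain p p' where pq: "pq = (p, p')" by force
  define L where "L = concat (map (\<lambda>(p, p'). [p, p']) M) @ A"
  obtain E where E: "finite E" and par: "\<And>u v. u \<in> (\<lambda>i. h i p) ` I \<union> (\<lambda>i. h i p') ` I \<Longrightarrow>
      v \<in> (\<lambda>i. h i p) ` I \<union> (\<lambda>i. h i p') ` I \<Longrightarrow> inner u v = (\<Sum>e\<in>E. inner u e * inner v e / inner e e)"
    using finite_parseval[of "(\<lambda>i. h i p) ` I \<union> (\<lambda>i. h i p') ` I"] I by auto
  define a where "a e i = inner (h i p) e * inner (h i p') e / inner e e" for e i
  have zero: "(\<Sum>i\<in>I. (r i * a e i) *\<^sub>R tensor (map (h i) L)) = 0" for e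
  proof -
    have "(norm (\<Sum>i\<in>I. (r i * a e i) *\<^sub>R tensor (map (h i) L)))\<^sup>2 =
        inner (\<Sum>i\<in>I. r i *\<^sub>R tensor (map (h i) (p # p' # L)))
          (\<Sum>j\<in>I. (r j * a e j / inner e e) *\<^sub>R tensor (e # e # map (h j) L))"
      unfolding norm_tensor_comb inner_tensor_comb
      by (intro sum.cong refl) (simp add: a_def)
    also have "\<dots> = 0"
      using Cons.prems by (simp add: pq L_def)
    finally show ?thesis by simp
  qed
  have "(\<Sum>i\<in>I. (r i * (\<Prod>(p, p')\<leftarrow>pq # M. inner (h i p) (h i p'))) *\<^sub>R tensor (map (h i) A)) =
     (\<Sum>i\<in>I. \<Sum>e\<in>E. (r i * a e i * (\<Prod>(p, p')\<leftarrow>M. inner (h i p) (h i p'))) *\<^sub>R tensor (map (h i) A))"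
  proof (intro sum.cong refl)
    fix i assume i: "i \<in> I"
    have "r i * (\<Prod>(p, p')\<leftarrow>pq # M. inner (h i p) (h i p')) =
       (\<Sum>e\<in>E. a e i) * (r i * (\<Prod>(p, p')\<leftarrow>M. inner (h i p) (h i p')))"
      unfolding a_def using i by (subst par[symmetric]) (auto simp: pq)
    also have "\<dots> = (\<Sum>e\<in>E. r i * a e i * (\<Prod>(p, p')\<leftarrow>M. inner (h i p) (h i p')))"
      unfolding sum_distrib_right by (intro sum.cong refl) simp
    finally show "(r i * (\<Prod>(p, p')\<leftarrow>pq # M. inner (h i p) (h i p'))) *\<^sub>R tensor (map (h i) A) =
      (\<Sum>e\<in>E. (r i * a e i * (\<Prod>(p, p')\<leftarrow>M. inner (h i p) (h i p'))) *\<^sub>R tensor (map (h i) A))"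
      by (simp only: scaleR_sum_left)
  qed
  also have "\<dots> = (\<Sum>e\<in>E. \<Sum>i\<in>I. (r i * a e i * (\<Prod>(p, p')\<leftarrow>M. inner (h i p) (h i p'))) *\<^sub>R tensor (map (h i) A))"
    by (rule sum.swap)
  also have "\<dots> = 0"
    using Cons.IH zero unfolding L_def by simp
  finally show ?case .
qed simp

lemma pairing_list:
  assumes \<pi>: "\<pi> \<in> pairings_on {1..n}"
  defines "P \<equiv> filter (\<lambda>p. p < \<pi> p) [1..<Suc n]"
  shows "set P = {i. i < \<pi> i}"
    and "distinct (concat (map (\<lambda>(p, p'). [p, p']) (map (\<lambda>p. (p, \<pi> p)) P)) @ filter (\<lambda>p. \<pi> p = p) [1..<Suc n])"
    and "set (concat (map (\<lambda>(p, p'). [p, p']) (map (\<lambda>p. (p, \<pi> p)) P)) @ filter (\<lambda>p. \<pi> p = p) [1..<Suc n]) = {1..n}"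
proof -
  note D = pairings_onD[OF \<pi>]
  have out: "\<pi> i = i" if "i \<notin> {1..n}" for i
    using D(1) that by (rule permutes_not_in)
  have im: "\<pi> i \<in> {1..n} \<longleftrightarrow> i \<in> {1..n}" for i
    using permutes_in_image[OF D(1)] .
  have cset: "set (concat (map (\<lambda>(p, p'). [p, p']) (map (\<lambda>p. (p, \<pi> p)) Q))) = set Q \<union> \<pi> ` set Q" for Q
    by (induction Q) auto
  show P: "set P = {i. i < \<pi> i}"
  proof -
    have "i \<in> {1..n}" if "i < \<pi> i" for i
      using out[of i] that by fastforce
    then show ?thesis
      by (auto simp: P_def less_Suc_eq_le simp del: upt_Suc One_nat_def)
  qed
  have cd: "distinct (concat (map (\<lambda>(p, p'). [p, p']) (map (\<lambda>p. (p, \<pi> p)) Q)))"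
    if "distinct Q" "\<forall>i\<in>set Q. i < \<pi> i" for Q
    using that
  proof (induction Q)
    case (Cons a Q)
    have "a \<notin> \<pi> ` set Q"
    proof
      assume "a \<in> \<pi> ` set Q"
      then obtain i where "i \<in> set Q" "a = \<pi> i" by auto
      with Cons.prems D(2)[of i] show False by auto
    qed
    moreover have "\<pi> a \<notin> set Q"
      using Cons.prems D(2)[of a] by auto
    moreover have "\<pi> a \<notin> \<pi> ` set Q"
      using Cons.prems D(2) by (metis distinct.simps(2) image_iff)
    moreover have "distinct (concat (map (\<lambda>(p, p'). [p, p']) (map (\<lambda>p. (p, \<pi> p)) Q)))"
      using Cons.prems by (intro Cons.IH) auto
    ultimately show ?case
      using Cons.prems cset[of Q] by auto
  qed simp
  have "\<pi> i \<noteq> i" if "i \<in> set P \<union> \<pi> ` set P" for i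
    using that D(2) unfolding P by auto
  moreover have "distinct (concat (map (\<lambda>(p, p'). [p, p']) (map (\<lambda>p. (p, \<pi> p)) P)))"
    using P by (intro cd) (auto simp: P_def simp del: upt_Suc One_nat_def)
  ultimately show "distinct (concat (map (\<lambda>(p, p'). [p, p']) (map (\<lambda>p. (p, \<pi> p)) P)) @ filter (\<lambda>p. \<pi> p = p) [1..<Suc n])"
    unfolding distinct_append cset by (auto simp del: upt_Suc One_nat_def)
  have *: "i \<in> set P \<union> \<pi> ` set P \<longleftrightarrow> \<pi> i \<noteq> i" for i
  proof
    assume "\<pi> i \<noteq> i"
    then consider "i < \<pi> i" | "\<pi> i < \<pi> (\<pi> i)" using D(2)[of i] by fastforce
    then show "i \<in> set P \<union> \<pi> ` set P"
    proof cases
      case 2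
      then have "\<pi> (\<pi> i) \<in> \<pi> ` set P" unfolding P by blast
      then show ?thesis by (simp add: D(2))
    qed (auto simp: P)
  qed fact
  show "set (concat (map (\<lambda>(p, p'). [p, p']) (map (\<lambda>p. (p, \<pi> p)) P)) @ filter (\<lambda>p. \<pi> p = p) [1..<Suc n]) = {1..n}"
  proof (intro equalityI subsetI)
    fix i assume "i \<in> set (concat (map (\<lambda>(p, p'). [p, p']) (map (\<lambda>p. (p, \<pi> p)) P)) @ filter (\<lambda>p. \<pi> p = p) [1..<Suc n])"
    then have "\<pi> i \<noteq> i \<or> i \<in> {1..n}"
      unfolding set_append cset Un_iff[of i "set P \<union> \<pi> ` set P"] * by (auto simp del: upt_Suc One_nat_def)
    then show "i \<in> {1..n}" using out by blast
  next
    fix i assume "i \<in> {1..n}"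
    then show "i \<in> set (concat (map (\<lambda>(p, p'). [p, p']) (map (\<lambda>p. (p, \<pi> p)) P)) @ filter (\<lambda>p. \<pi> p = p) [1..<Suc n])"
      unfolding set_append cset Un_iff[of i "set P \<union> \<pi> ` set P"] * by (auto simp del: upt_Suc One_nat_def)
  qed
qed

lemma contract_tensor_word:
  fixes h :: "nat \<Rightarrow> 'a::real_inner"
  assumes \<pi>: "\<pi> \<in> pairings_on {1..n}"
  shows "linear (contract_tensor n \<pi> :: 'a tensor_space \<Rightarrow> _)"
    and "contract_tensor n \<pi> (word n h) = weight \<pi> h *\<^sub>R tensor (map h (filter (\<lambda>i. \<pi> i = i) [1..<Suc n]))"
proof -
  let ?A = "filter (\<lambda>i. \<pi> i = i) [1..<Suc n]"
  define b :: "'a list \<Rightarrow> _" where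
    "b hs = weight \<pi> (\<lambda>i. hs ! (i - 1)) *\<^sub>R tensor (map (\<lambda>i. hs ! (i - 1)) ?A)" for hs
  define P where "P = filter (\<lambda>p. p < \<pi> p) [1..<Suc n]"
  note P = pairing_list[OF \<pi>, folded P_def]
  have w: "weight \<pi> f = (\<Prod>(p, p')\<leftarrow>map (\<lambda>p. (p, \<pi> p)) P. inner (f p) (f p'))"
    for f :: "nat \<Rightarrow> 'c::real_inner"
  proof -
    have "distinct P" by (simp add: P_def del: upt_Suc One_nat_def)
    then show ?thesis
      unfolding weight_def P(1)[symmetric] by (simp add: prod.distinct_set_conv_list o_def)
  qed
  obtain L where L: "linear L" "\<And>hs. hs \<in> {hs::'a list. length hs = n} \<Longrightarrow> L (tensor hs) = b hs"
  proof (rule linear_extension_from_generators[where P = "{hs::'a list. length hs = n}" and t = tensor and b = b])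
    fix I :: "'a list set" and r
    assume I: "finite I" "I \<subseteq> {hs. length hs = n}" and 0: "(\<Sum>hs\<in>I. r hs *\<^sub>R tensor hs) = 0"
    let ?h = "\<lambda>hs i. hs ! (i - 1)"
    let ?L = "concat (map (\<lambda>(p, p'). [p, p']) (map (\<lambda>p. (p, \<pi> p)) P)) @ ?A"
    have "norm (\<Sum>hs\<in>I. r hs *\<^sub>R tensor (map (?h hs) ?L)) = norm (\<Sum>hs\<in>I. r hs *\<^sub>R tensor (map (?h hs) [1..<Suc n]))"
      using P(2,3) by (intro norm_tensor_comb_reorder) (auto simp del: upt_Suc One_nat_def)
    also have "\<dots> = norm (\<Sum>hs\<in>I. r hs *\<^sub>R tensor hs)"
      using I by (intro arg_cong[of _ _ norm] sum.cong refl) (auto simp: list_eq_word simp del: upt_Suc One_nat_def)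
    finally have "(\<Sum>hs\<in>I. r hs *\<^sub>R tensor (map (?h hs) ?L)) = 0"
      using 0 by simp
    from contraction_well_defined[OF I(1) this] show "(\<Sum>hs\<in>I. r hs *\<^sub>R b hs) = 0"
      by (simp add: b_def w)
  qed blast
  then have "\<exists>L. linear L \<and> (\<forall>hs::'a list. length hs = n \<longrightarrow>
        L (tensor hs) =
          (\<Prod>i\<in>{i. i < \<pi> i}. inner (hs ! (i - 1)) (hs ! (\<pi> i - 1))) *\<^sub>R
          tensor (map (\<lambda>i. hs ! (i - 1)) (filter (\<lambda>i. \<pi> i = i) [1..<Suc n])))"
    by (intro exI[of _ L]) (simp add: b_def weight_def)
  then have *: "linear (contract_tensor n \<pi> :: 'a tensor_space \<Rightarrow> _) \<and> (\<forall>hs::'a list. length hs = n \<longrightarrow>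
        contract_tensor n \<pi> (tensor hs) = b hs)"
    unfolding contract_tensor_def b_def weight_def by (rule someI_ex)
  then show "linear (contract_tensor n \<pi> :: 'a tensor_space \<Rightarrow> _)" by blast
  have "map (\<lambda>i. map h [1..<Suc n] ! (i - 1)) ?A = map h ?A"
    using nth_map_upt_1[of _ n h] by (intro map_cong refl) (auto simp del: upt_Suc One_nat_def)
  moreover have "weight \<pi> (\<lambda>i. map h [1..<Suc n] ! (i - 1)) = weight \<pi> h"
    unfolding weight_def
  proof (intro prod.cong refl)
    fix i assume i: "i \<in> {i. i < \<pi> i}"
    then have "i \<in> {1..n}"
      using permutes_not_in[OF pairings_onD(1)[OF \<pi>], of i] by fastforce
    then have "\<pi> i \<in> {1..n}"
      using permutes_in_image[OF pairings_onD(1)[OF \<pi>]] by simp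
    with \<open>i \<in> {1..n}\<close> show "inner (map h [1..<Suc n] ! (i - 1)) (map h [1..<Suc n] ! (\<pi> i - 1)) = inner (h i) (h (\<pi> i))"
      by (simp only: nth_map_upt_1)
  qed
  ultimately have calculation: "map (\<lambda>i. map h [1..<Suc n] ! (i - 1)) ?A = map h ?A"
    "weight \<pi> (\<lambda>i. map h [1..<Suc n] ! (i - 1)) = weight \<pi> h" by blast+
  show "contract_tensor n \<pi> (word n h) = weight \<pi> h *\<^sub>R tensor (map h ?A)"
  proof -
    have "contract_tensor n \<pi> (word n h) = b (map h [1..<Suc n])"
      unfolding word_def by (rule conjunct2[OF *, rule_format]) simp
    then show ?thesis
      using calculation by (simp only: b_def)
  qed
qed

text \<open>
  In the algebraic powers both tensors are finite combinations of elementary ones. Reordering the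
  slots of these is isometric, so the paired slots can be assumed to be aligned, which is the
  situation of \<open>contraction_estimate\<close>.
\<close>

lemma norm_cross_contract_le:
  assumes \<pi>: "\<pi> \<in> bipairings {1..n} {n+1..n+k}" and F: "F \<in> alg_power n" and G: "G \<in> alg_power k"
  shows "norm (cross_contract n k \<pi> F G) \<le> norm F * norm G"
proof -
  have *: "\<exists>I r. finite I \<and> (\<forall>x\<in>I. length x = m) \<and> H = (\<Sum>x\<in>I. r x *\<^sub>R tensor x)"
    if H: "H \<in> alg_power m" for H :: "'a tensor_space" and m
  proof -
    have "H \<in> span (tensor ` {x. length x = m})"
      using H by (simp add: alg_power_def setcompr_eq_image)
    then obtain I r where "finite I" "I \<subseteq> {x. length x = m}" "H = (\<Sum>x\<in>I. r x *\<^sub>R tensor x)"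
      by (rule tensor_span_explicit)
    then show ?thesis by blast
  qed
  obtain I r where I: "finite I" "\<forall>x\<in>I. length x = n" "F = (\<Sum>x\<in>I. r x *\<^sub>R tensor x)"
    using *[OF F] by blast
  obtain J s where J: "finite J" "\<forall>y\<in>J. length y = k" "G = (\<Sum>y\<in>J. s y *\<^sub>R tensor y)"
    using *[OF G] by blast
  interpret B: bounded_bilinear "cross_contract n k \<pi> :: 'a tensor_space \<Rightarrow> _"
    by (rule cross_contract_word(1)[OF \<pi>])
  have spec: "cross_contract n k \<pi> (tensor x) (tensor y) = weight \<pi> (\<lambda>i. (x @ y) ! (i - 1)) *\<^sub>R
        tensor (map (\<lambda>i. (x @ y) ! (i - 1)) (filter (\<lambda>i. \<pi> i = i) [1..<Suc (n + k)]))"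
    if "length x = n" "length y = k" for x y :: "'a list"
    using someI_ex[OF cross_contract_exists[OF \<pi>, where ?'a = 'a]] that unfolding cross_contract_def by blast
  have "cross_contract n k \<pi> F G = (\<Sum>x\<in>I. \<Sum>y\<in>J. (r x * s y) *\<^sub>R cross_contract n k \<pi> (tensor x) (tensor y))"
    unfolding I(3) J(3) B.sum_left
    by (simp add: B.sum_right B.scaleR_left B.scaleR_right scaleR_sum_right mult.commute)
  also have "\<dots> = (\<Sum>x\<in>I. \<Sum>y\<in>J. (r x * s y) *\<^sub>R (weight \<pi> (\<lambda>i. (x @ y) ! (i - 1)) *\<^sub>R
        tensor (map (\<lambda>i. (x @ y) ! (i - 1)) (filter (\<lambda>i. \<pi> i = i) [1..<Suc (n + k)]))))"
    using I(2) J(2) by (intro sum.cong refl) (simp add: spec del: upt_Suc One_nat_def)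
  also have "norm \<dots> \<le> norm F * norm G"
    unfolding I(3) J(3) by (rule cross_contract_bound[OF \<pi> I(1,2) J(1,2)])
  finally show ?thesis .
qed

section \<open>Deleting points from permutations\<close>

text \<open>
  Deleting a set of points from a permutation is done one point at a time; every fact about
  restrictions and their cycles then reduces to composing with a transposition.
\<close>

definition skip :: "nat \<Rightarrow> (nat \<Rightarrow> nat) \<Rightarrow> nat \<Rightarrow> nat" where
  "skip a \<gamma> = Transposition.transpose a (\<gamma> a) \<circ> \<gamma>"

lemma permutesD_permutation: "\<gamma> permutes Z \<Longrightarrow> finite Z \<Longrightarrow> permutation \<gamma>"
  unfolding permutation_permutes by blast

lemma permutation_inj: "permutation \<gamma> \<Longrightarrow> inj \<gamma>"
  by (simp add: permutation_bijective bij_is_inj)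

lemma skip_apply:
  assumes "inj \<gamma>"
  shows "skip a \<gamma> x = (if x = a then a else if \<gamma> x = a then \<gamma> a else \<gamma> x)"
  using injD[OF assms, of x a] by (auto simp: skip_def Transposition.transpose_def)

lemma permutation_skip: "permutation \<gamma> \<Longrightarrow> permutation (skip a \<gamma>)"
  unfolding skip_def by (intro permutation_compose permutation_swap_id)

lemma perm_avoid_first:
  assumes "x \<notin> S" "0 < j" "(\<gamma> ^^ j) x \<notin> S" "\<And>i. 0 < i \<Longrightarrow> i < j \<Longrightarrow> (\<gamma> ^^ i) x \<in> S"
  shows "perm_avoid \<gamma> S x = (\<gamma> ^^ j) x"
proof -
  have "(LEAST j. 0 < j \<and> (\<gamma> ^^ j) x \<notin> S) = j"
    by (rule Least_equality) (use assms in \<open>auto simp: not_less[symmetric]\<close>)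
  with assms(1) show ?thesis by (simp add: perm_avoid_def)
qed

lemma perm_avoid_first_obtain:
  assumes "permutation \<gamma>" "x \<notin> S"
  obtains j where "0 < j" "(\<gamma> ^^ j) x \<notin> S" "\<And>i. 0 < i \<Longrightarrow> i < j \<Longrightarrow> (\<gamma> ^^ i) x \<in> S"
    "perm_avoid \<gamma> S x = (\<gamma> ^^ j) x"
proof -
  obtain m where m: "0 < m" "(\<gamma> ^^ m) x = x"
    using permutation_self_in_orbit[OF assms(1), of x] by (auto simp: orbit_altdef)
  define j where "j = (LEAST j. 0 < j \<and> (\<gamma> ^^ j) x \<notin> S)"
  have "0 < j \<and> (\<gamma> ^^ j) x \<notin> S"
    unfolding j_def by (rule LeastI[of _ m]) (use m assms(2) in auto)
  moreover have "(\<gamma> ^^ i) x \<in> S" if "0 < i" "i < j" for i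
    using not_less_Least[of i "\<lambda>j. 0 < j \<and> (\<gamma> ^^ j) x \<notin> S"] that by (auto simp: j_def)
  ultimately show ?thesis
    using that[of j] perm_avoid_first[OF assms(2), of j \<gamma>] by blast
qed

lemma perm_avoid_empty [simp]: "perm_avoid \<gamma> {} = \<gamma>"
  by (rule ext) (use perm_avoid_first[of _ "{}" 1 \<gamma>] in auto)

lemma perm_avoid_in: "x \<in> S \<Longrightarrow> perm_avoid \<gamma> S x = x"
  by (simp add: perm_avoid_def)

lemma perm_avoid_notin: "permutation \<gamma> \<Longrightarrow> x \<notin> S \<Longrightarrow> perm_avoid \<gamma> S x \<notin> S"
  using perm_avoid_first_obtain by metis

lemma perm_avoid_insert:
  assumes \<gamma>: "permutation \<gamma>" and a: "a \<notin> S"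
  shows "perm_avoid \<gamma> (insert a S) = skip a (perm_avoid \<gamma> S)"
proof
  fix x
  let ?\<delta> = "perm_avoid \<gamma> S"
  obtain l where l: "0 < l" "(\<gamma> ^^ l) a \<notin> S" "\<And>i. 0 < i \<Longrightarrow> i < l \<Longrightarrow> (\<gamma> ^^ i) a \<in> S"
    "?\<delta> a = (\<gamma> ^^ l) a"
    by (rule perm_avoid_first_obtain[OF \<gamma> a]) blast
  consider "x = a" | "x \<in> S" "x \<noteq> a" | "x \<notin> S" "x \<noteq> a" by blast
  then show "perm_avoid \<gamma> (insert a S) x = skip a ?\<delta> x"
  proof cases
    case 1
    then show ?thesis by (simp add: perm_avoid_in skip_def)
  next
    case 2
    then have "?\<delta> a \<noteq> x" using perm_avoid_notin[OF \<gamma> a] by metis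
    with 2 show ?thesis by (simp add: perm_avoid_in skip_def Transposition.transpose_def)
  next
    case 3
    obtain j where j: "0 < j" "(\<gamma> ^^ j) x \<notin> S" "\<And>i. 0 < i \<Longrightarrow> i < j \<Longrightarrow> (\<gamma> ^^ i) x \<in> S"
      "?\<delta> x = (\<gamma> ^^ j) x"
      by (rule perm_avoid_first_obtain[OF \<gamma> 3(1)]) blast
    have inj: "inj (\<gamma> ^^ i)" for i
      by (rule inj_fn[OF permutation_inj[OF \<gamma>]])
    \<comment> \<open>If both \<open>x\<close> and \<open>a\<close> have the same first exit, the orbit segments end alike, so one
      contains the start of the other.\<close>
    have eq: "x = a" if e: "?\<delta> x = ?\<delta> a"
    proof (rule ccontr)
      assume "x \<noteq> a"
      have e': "(\<gamma> ^^ j) x = (\<gamma> ^^ l) a" using e j(4) l(4) by simp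
      consider "j < l" | "j = l" | "l < j" by linarith
      then show False
      proof cases
        case 1
        then have "(\<gamma> ^^ l) a = (\<gamma> ^^ j) ((\<gamma> ^^ (l - j)) a)"
          by (simp flip: funpow_add o_apply[of "\<gamma> ^^ j"])
        with e' have "x = (\<gamma> ^^ (l - j)) a" using injD[OF inj[of j]] by metis
        then show False using l(3)[of "l - j"] 1 j(1) 3 by simp
      next
        case 2
        with e' \<open>x \<noteq> a\<close> show False using injD[OF inj[of j]] by metis
      next
        case 3
        then have "(\<gamma> ^^ j) x = (\<gamma> ^^ l) ((\<gamma> ^^ (j - l)) x)"
          by (simp flip: funpow_add o_apply[of "\<gamma> ^^ l"])
        with e' have "a = (\<gamma> ^^ (j - l)) x" using injD[OF inj[of l]] by metis
        then show False using j(3)[of "j - l"] 3 l(1) a by simp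
      qed
    qed
    show ?thesis
    proof (cases "?\<delta> x = a")
      case False
      then have "perm_avoid \<gamma> (insert a S) x = (\<gamma> ^^ j) x"
        using j 3 by (intro perm_avoid_first) auto
      moreover have "?\<delta> x \<noteq> ?\<delta> a" using eq 3 by blast
      ultimately show ?thesis using False j(4) by (simp add: skip_def Transposition.transpose_def)
    next
      case True
      have "?\<delta> a \<noteq> a" using eq 3 True by metis
      have add: "(\<gamma> ^^ (i + j)) x = (\<gamma> ^^ i) a" for i
        using True j(4) by (simp add: funpow_add)
      have "perm_avoid \<gamma> (insert a S) x = (\<gamma> ^^ (l + j)) x"
      proof (rule perm_avoid_first)
        show "(\<gamma> ^^ (l + j)) x \<notin> insert a S"
          using add l(2,4) \<open>?\<delta> a \<noteq> a\<close> by simp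
        show "(\<gamma> ^^ i) x \<in> insert a S" if "0 < i" "i < l + j" for i
        proof -
          consider "i < j" | "i = j" | "j < i" by linarith
          then show ?thesis
          proof cases
            case 3
            then have "(\<gamma> ^^ i) x = (\<gamma> ^^ (i - j)) a" using add[of "i - j"] by simp
            moreover have "0 < i - j" "i - j < l" using 3 that by auto
            ultimately show ?thesis using l(3) by simp
          qed (use j True that in auto)
        qed
      qed (use 3 j l in auto)
      then show ?thesis using add[of l] l(4) True by (simp add: skip_def)
    qed
  qed
qed

lemma permutation_perm_avoid:
  assumes "permutation \<gamma>" "finite S"
  shows "permutation (perm_avoid \<gamma> S)"
  using assms(2) by induction (use assms(1) in \<open>auto simp: perm_avoid_insert permutation_skip\<close>)

lemma skip_permutes:
  assumes "\<gamma> permutes Z" "a \<in> Z"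
  shows "skip a \<gamma> permutes (Z - {a})"
proof (rule permutes_superset)
  show "skip a \<gamma> permutes Z"
    unfolding skip_def using assms permutes_in_image[OF assms(1)]
    by (intro permutes_compose permutes_swap_id) auto
qed (use skip_apply[OF permutes_inj[OF assms(1)]] in auto)

lemma perm_avoid_permutes:
  assumes "\<gamma> permutes Z" "finite Z" "S \<subseteq> Z"
  shows "perm_avoid \<gamma> S permutes (Z - S)"
proof -
  have "finite S" using assms finite_subset by blast
  then show ?thesis using assms(3)
  proof induction
    case (insert a S)
    then have "skip a (perm_avoid \<gamma> S) permutes (Z - S - {a})"
      by (intro skip_permutes) auto
    moreover have "Z - S - {a} = Z - insert a S" by auto
    ultimately show ?case
      using insert perm_avoid_insert[OF permutesD_permutation[OF assms(1,2)]] by simp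
  qed (use assms in simp)
qed

lemma comp_transpose_inj: "inj \<rho> \<Longrightarrow> \<rho> \<circ> Transposition.transpose a b = Transposition.transpose (\<rho> a) (\<rho> b) \<circ> \<rho>"
  by (auto simp: Transposition.transpose_def fun_eq_iff inj_eq)

lemma perm_avoid_comp_left:
  assumes "permutation \<gamma>" "permutation \<rho>" "finite S" "\<And>s. s \<in> S \<Longrightarrow> \<rho> s = s"
  shows "perm_avoid (\<rho> \<circ> \<gamma>) S = \<rho> \<circ> perm_avoid \<gamma> S"
  using assms(3,4)
proof induction
  case (insert a S)
  have "skip a (\<rho> \<circ> \<delta>) = \<rho> \<circ> skip a \<delta>" for \<delta>
    using insert.prems comp_transpose_inj[OF permutation_inj[OF assms(2)], of a "\<delta> a"]
    by (simp add: skip_def fun_eq_iff)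
  moreover have "perm_avoid (\<rho> \<circ> \<gamma>) (insert a S) = skip a (perm_avoid (\<rho> \<circ> \<gamma>) S)"
    using insert.hyps assms by (intro perm_avoid_insert permutation_compose)
  ultimately show ?case
    using insert.IH insert.prems perm_avoid_insert[OF assms(1) insert.hyps(2)]
    by (simp only: insert_iff simp_thms)
qed simp

lemma perm_avoid_comp_right:
  assumes "permutation \<gamma>" "permutation \<rho>" "finite S" "\<And>s. s \<in> S \<Longrightarrow> \<rho> s = s"
  shows "perm_avoid (\<gamma> \<circ> \<rho>) S = perm_avoid \<gamma> S \<circ> \<rho>"
  using assms(3,4)
proof induction
  case (insert a S)
  have "perm_avoid (\<gamma> \<circ> \<rho>) (insert a S) = skip a (perm_avoid (\<gamma> \<circ> \<rho>) S)"
    using insert.hyps assms by (intro perm_avoid_insert permutation_compose)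
  also have "\<dots> = skip a (perm_avoid \<gamma> S) \<circ> \<rho>"
  proof -
    have "perm_avoid (\<gamma> \<circ> \<rho>) S = perm_avoid \<gamma> S \<circ> \<rho>"
      using insert.IH insert.prems by blast
    then show ?thesis
      using insert.prems[of a] by (simp only: skip_def o_assoc) (simp add: o_def)
  qed
  finally show ?case
    by (simp only: perm_avoid_insert[OF assms(1) insert.hyps(2)])
qed simp

lemma perm_avoid_perm_avoid:
  assumes "permutation \<gamma>" "finite S" "finite S'" "S \<inter> S' = {}"
  shows "perm_avoid (perm_avoid \<gamma> S) S' = perm_avoid \<gamma> (S \<union> S')"
  using assms(3,4)
proof induction
  case (insert a S')
  then have "a \<notin> S \<union> S'" by auto
  with insert show ?case
    using assms by (simp add: perm_avoid_insert permutation_perm_avoid)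
qed simp

lemma perm_avoid_inv:
  assumes "permutation \<gamma>" "finite S"
  shows "perm_avoid (inv \<gamma>) S = inv (perm_avoid \<gamma> S)"
  using assms(2)
proof induction
  case (insert a S)
  have "skip a (inv \<delta>) = inv (skip a \<delta>)" if "permutation \<delta>" for \<delta>
  proof -
    have b: "bij \<delta>" using that by (rule permutation_bijective)
    then have "inv (skip a \<delta>) = inv \<delta> \<circ> Transposition.transpose a (\<delta> a)"
      by (simp add: skip_def o_inv_distrib bij_is_inj)
    also have "\<dots> = Transposition.transpose (inv \<delta> a) a \<circ> inv \<delta>"
      using b by (subst comp_transpose_inj) (auto simp: bij_is_inj bij_imp_bij_inv inv_f_f)
    finally show ?thesis by (simp add: skip_def transpose_commute)
  qed
  with insert show ?case
    using assms by (simp add: perm_avoid_insert permutation_inverse permutation_perm_avoid)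
qed simp

lemma conj_funpow:
  assumes "bij \<sigma>"
  shows "(\<sigma> \<circ> \<gamma> \<circ> inv \<sigma>) ^^ j = \<sigma> \<circ> \<gamma> ^^ j \<circ> inv \<sigma>"
  using assms by (induction j) (simp_all add: fun_eq_iff bij_is_inj bij_is_surj surj_f_inv_f)

lemma perm_avoid_conj:
  assumes \<sigma>: "bij \<sigma>"
  shows "perm_avoid (\<sigma> \<circ> \<gamma> \<circ> inv \<sigma>) (\<sigma> ` S) = \<sigma> \<circ> perm_avoid \<gamma> S \<circ> inv \<sigma>"
proof
  fix y
  obtain x where y: "y = \<sigma> x" using bij_is_surj[OF \<sigma>] by (metis surjD)
  have "\<sigma> x \<in> \<sigma> ` S \<longleftrightarrow> x \<in> S" for x
    using bij_is_inj[OF \<sigma>] by (simp add: inj_image_mem_iff)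
  then show "perm_avoid (\<sigma> \<circ> \<gamma> \<circ> inv \<sigma>) (\<sigma> ` S) y = (\<sigma> \<circ> perm_avoid \<gamma> S \<circ> inv \<sigma>) y"
    by (simp add: y perm_avoid_def conj_funpow[OF \<sigma>] bij_is_inj[OF \<sigma>])
qed


subsection \<open>Counting cycles\<close>

lemma orbit_eq_orbit:
  assumes "permutation \<gamma>" "y \<in> orbit \<gamma> x"
  shows "orbit \<gamma> y = orbit \<gamma> x"
proof -
  obtain Z where "finite Z" "\<gamma> permutes Z" using assms(1) unfolding permutation_permutes by blast
  then have "cyclic_on \<gamma> (orbit \<gamma> x)" by (intro cyclic_on_orbit)
  then show ?thesis using assms(2) by (rule orbit_cyclic_eq3)
qed

lemma orbit_skip:
  assumes \<gamma>: "permutation \<gamma>" and x: "x \<noteq> a"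
  shows "orbit (skip a \<gamma>) x = orbit \<gamma> x - {a}"
proof (intro equalityI subsetI)
  note inj = permutation_inj[OF \<gamma>]
  fix y assume "y \<in> orbit (skip a \<gamma>) x"
  then show "y \<in> orbit \<gamma> x - {a}"
  proof induction
    case base
    then show ?case
      using x injD[OF inj, of x a] by (auto simp: skip_apply[OF inj] intro: orbit.intros)
  next
    case (step y)
    then show ?case
      using injD[OF inj, of y a] by (auto simp: skip_apply[OF inj] intro: orbit.intros)
  qed
next
  note inj = permutation_inj[OF \<gamma>]
  fix y assume y: "y \<in> orbit \<gamma> x - {a}"
  have "if y = a then \<gamma> a \<in> orbit (skip a \<gamma>) x else y \<in> orbit (skip a \<gamma>) x" if "y \<in> orbit \<gamma> x" for y
    using that
  proof induction
    case base
    have s: "skip a \<gamma> x = (if \<gamma> x = a then \<gamma> a else \<gamma> x)"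
      using x by (simp add: skip_apply[OF inj])
    show ?case
      using orbit.base[of "skip a \<gamma>" x] unfolding s by (auto split: if_splits)
  next
    case (step y)
    show ?case
    proof (cases "y = a")
      case False
      then have s: "skip a \<gamma> y = (if \<gamma> y = a then \<gamma> a else \<gamma> y)"
        by (simp add: skip_apply[OF inj])
      have "skip a \<gamma> y \<in> orbit (skip a \<gamma>) x" using False step.IH by (intro orbit.step) simp
      then show ?thesis unfolding s by (auto split: if_splits)
    qed (use step.IH in auto)
  qed
  with y show "y \<in> orbit (skip a \<gamma>) x" by (metis DiffD1 DiffD2 singletonI)
qed

lemma cyc0_skip:
  assumes "\<gamma> permutes Z" "finite Z" "a \<in> Z" "a \<noteq> 0"
  shows "cyc0 Z \<gamma> = cyc0 (Z - {a}) (skip a \<gamma>) + (if \<gamma> a = a then 1 else 0)"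
proof -
  have \<gamma>: "permutation \<gamma>" using assms permutesD_permutation by blast
  note self = permutation_self_in_orbit[OF \<gamma>]
  define A where "A = {C \<in> orbit \<gamma> ` (Z - {a}). 0 \<notin> C}"
  have fin: "finite A" using assms(2) by (simp add: A_def)
  have "{C \<in> orbit (skip a \<gamma>) ` (Z - {a}). 0 \<notin> C} = (\<lambda>C. C - {a}) ` A"
  proof -
    have "orbit (skip a \<gamma>) ` (Z - {a}) = (\<lambda>C. C - {a}) ` orbit \<gamma> ` (Z - {a})"
      unfolding image_image by (rule image_cong) (auto simp: orbit_skip[OF \<gamma>])
    then show ?thesis using assms(4) unfolding A_def by auto
  qed
  moreover have "inj_on (\<lambda>C. C - {a}) A"
  proof (rule inj_onI)
    fix C D assume CD: "C \<in> A" "D \<in> A" "C - {a} = D - {a}"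
    then obtain x y where x: "x \<in> Z - {a}" "C = orbit \<gamma> x" and y: "D = orbit \<gamma> y"
      unfolding A_def by auto
    then have "x \<in> D" using self[of x] CD(3) by blast
    then show "C = D" using orbit_eq_orbit[OF \<gamma>, of x y] x y by simp
  qed
  ultimately have B: "cyc0 (Z - {a}) (skip a \<gamma>) = card A"
    by (simp add: cyc0_def card_image)
  show ?thesis
  proof (cases "\<gamma> a = a")
    case True
    then have oa: "orbit \<gamma> a = {a}" by (simp add: orbit_eq_singleton_iff)
    have "{a} \<notin> A"
    proof
      assume "{a} \<in> A"
      then obtain x where "x \<in> Z - {a}" "{a} = orbit \<gamma> x" unfolding A_def by auto
      then show False using self[of x] by auto
    qed
    moreover have "orbit \<gamma> ` Z = insert {a} (orbit \<gamma> ` (Z - {a}))"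
      using assms(3) oa by blast
    then have "{C \<in> orbit \<gamma> ` Z. 0 \<notin> C} = insert {a} A"
      unfolding A_def using assms(4) by auto
    ultimately show ?thesis using fin B True by (simp add: cyc0_def)
  next
    case False
    have "\<gamma> a \<in> orbit \<gamma> a" by (rule orbit.base)
    then have "orbit \<gamma> (\<gamma> a) = orbit \<gamma> a" by (rule orbit_eq_orbit[OF \<gamma>])
    moreover have "\<gamma> a \<in> Z - {a}" using False permutes_in_image[OF assms(1)] assms(3) by auto
    ultimately have "orbit \<gamma> a \<in> orbit \<gamma> ` (Z - {a})" by (metis imageI)
    then have "orbit \<gamma> ` Z = orbit \<gamma> ` (Z - {a})" using assms(3) by blast
    then show ?thesis using B False by (simp add: cyc0_def A_def)
  qed
qed

lemma orbit_conj:
  assumes "bij \<sigma>"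
  shows "orbit (\<sigma> \<circ> \<gamma> \<circ> inv \<sigma>) (\<sigma> x) = \<sigma> ` orbit \<gamma> x"
  using assms by (auto simp: orbit_altdef conj_funpow bij_is_inj image_iff)

lemma orbits_conj:
  assumes "bij \<sigma>"
  shows "orbit (\<sigma> \<circ> \<gamma> \<circ> inv \<sigma>) ` (\<sigma> ` Z) = (`) \<sigma> ` orbit \<gamma> ` Z"
  by (simp add: image_image orbit_conj[OF assms])

lemma inj_on_image_bij: "bij \<sigma> \<Longrightarrow> inj_on ((`) \<sigma>) A"
  by (rule inj_onI) (simp add: bij_is_inj inj_image_eq_iff)

lemma cyc0_conj:
  assumes \<sigma>: "bij \<sigma>" "\<sigma> 0 = 0"
  shows "cyc0 (\<sigma> ` Z) (\<sigma> \<circ> \<gamma> \<circ> inv \<sigma>) = cyc0 Z \<gamma>"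
proof -
  have "0 \<in> \<sigma> ` C \<longleftrightarrow> 0 \<in> C" for C
    using inj_image_mem_iff[OF bij_is_inj[OF \<sigma>(1)], of 0 C] \<sigma>(2) by simp
  then have "{C \<in> orbit (\<sigma> \<circ> \<gamma> \<circ> inv \<sigma>) ` (\<sigma> ` Z). 0 \<notin> C} = (`) \<sigma> ` {C \<in> orbit \<gamma> ` Z. 0 \<notin> C}"
    unfolding orbits_conj[OF \<sigma>(1)] by auto
  then show ?thesis
    by (simp add: cyc0_def card_image inj_on_image_bij[OF \<sigma>(1)])
qed

text \<open>
  On a set containing \<open>0\<close> exactly one cycle is left out of the count, so the count is invariant
  under conjugations that move \<open>0\<close>.
\<close>

lemma cyc0_eq_card_orbits:
  assumes "\<gamma> permutes Z" "finite Z" "0 \<in> Z"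
  shows "Suc (cyc0 Z \<gamma>) = card (orbit \<gamma> ` Z)"
proof -
  have \<gamma>: "permutation \<gamma>" using assms permutesD_permutation by blast
  have "{C \<in> orbit \<gamma> ` Z. 0 \<notin> C} = orbit \<gamma> ` Z - {orbit \<gamma> 0}"
    using orbit_eq_orbit[OF \<gamma>] permutation_self_in_orbit[OF \<gamma>] by auto
  then have "card (orbit \<gamma> ` Z) = Suc (card {C \<in> orbit \<gamma> ` Z. 0 \<notin> C})"
    using assms card_Suc_Diff1[of "orbit \<gamma> ` Z" "orbit \<gamma> 0"] by simp
  then show ?thesis by (simp add: cyc0_def)
qed

lemma cyc0_conj_permutes:
  assumes "\<gamma> permutes Z" "finite Z" "0 \<in> Z" "\<sigma> permutes Z"
  shows "cyc0 Z (\<sigma> \<circ> \<gamma> \<circ> inv \<sigma>) = cyc0 Z \<gamma>"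
proof -
  have "card (orbit (\<sigma> \<circ> \<gamma> \<circ> inv \<sigma>) ` Z) = card (orbit \<gamma> ` Z)"
    using orbits_conj[OF permutes_bij[OF assms(4)], of \<gamma> Z] permutes_image[OF assms(4)]
    by (simp add: card_image inj_on_image_bij[OF permutes_bij[OF assms(4)]])
  moreover have "\<sigma> \<circ> \<gamma> \<circ> inv \<sigma> permutes Z"
    using assms by (intro permutes_compose permutes_inv)
  ultimately show ?thesis
    using cyc0_eq_card_orbits[of _ Z] assms by (metis Suc_inject)
qed

lemma cyc0_inv:
  assumes "\<gamma> permutes Z" "finite Z"
  shows "cyc0 Z (inv \<gamma>) = cyc0 Z \<gamma>"
  using orbit_inv_eq[OF permutesD_permutation[OF assms]] by (simp add: cyc0_def)

text \<open>The part of the exponent of a contraction that depends on cycles; it adds up under successive deletions.\<close>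

definition lost :: "nat set \<Rightarrow> (nat \<Rightarrow> nat) \<Rightarrow> nat set \<Rightarrow> int" where
  "lost Z \<delta> S = int (cyc0 Z \<delta>) - int (cyc0 (Z - S) (perm_avoid \<delta> S))"

lemma lost_empty [simp]: "lost Z \<delta> {} = 0"
  by (simp add: lost_def)

lemma lost_insert:
  assumes "\<delta> permutes Z" "finite Z" "insert a S \<subseteq> Z" "a \<notin> S" "0 \<notin> insert a S"
  shows "lost Z \<delta> (insert a S) = lost Z \<delta> S + (if perm_avoid \<delta> S a = a then 1 else 0)"
proof -
  have "cyc0 (Z - S) (perm_avoid \<delta> S) = cyc0 (Z - S - {a}) (skip a (perm_avoid \<delta> S))
      + (if perm_avoid \<delta> S a = a then 1 else 0)"
    using assms by (intro cyc0_skip perm_avoid_permutes) auto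
  moreover have "Z - S - {a} = Z - insert a S" by auto
  ultimately show ?thesis
    using assms by (simp add: lost_def perm_avoid_insert[OF permutesD_permutation])
qed

lemma lost_singleton:
  assumes "\<delta> permutes Z" "finite Z" "a \<in> Z" "a \<noteq> 0"
  shows "lost Z \<delta> {a} = (if \<delta> a = a then 1 else 0)"
  using lost_insert[OF assms(1,2), of a "{}"] assms by simp

lemma lost_union:
  assumes "permutation \<delta>" "finite S" "finite S'" "S \<inter> S' = {}"
  shows "lost Z \<delta> (S \<union> S') = lost Z \<delta> S + lost (Z - S) (perm_avoid \<delta> S) S'"
proof -
  have "Z - S - S' = Z - (S \<union> S')" by auto
  then show ?thesis
    using perm_avoid_perm_avoid[OF assms] by (simp add: lost_def)
qed

lemma lost_le_card:
  assumes "\<delta> permutes Z" "finite Z" "S \<subseteq> Z" "0 \<notin> S"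
  shows "lost Z \<delta> S \<le> int (card S)"
proof -
  have "finite S" using assms finite_subset by blast
  then show ?thesis using assms(3,4)
    by induction (use assms in \<open>auto simp: lost_insert\<close>)
qed

lemma lost_cong:
  assumes "\<delta> permutes Z" "\<delta>' permutes Z'" "finite Z" "finite Z'" "S \<subseteq> Z" "S \<subseteq> Z'" "0 \<notin> S"
    and "\<And>a R. R \<subseteq> S \<Longrightarrow> a \<in> S \<Longrightarrow> perm_avoid \<delta> R a = a \<longleftrightarrow> perm_avoid \<delta>' R a = a"
  shows "lost Z \<delta> S = lost Z' \<delta>' S"
proof -
  have "finite S" using assms finite_subset by blast
  then show ?thesis using assms(5-8)
  proof induction
    case (insert a S)
    have "lost Z \<delta> S = lost Z' \<delta>' S" using insert.prems by (intro insert.IH) blast+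
    moreover have "perm_avoid \<delta> S a = a \<longleftrightarrow> perm_avoid \<delta>' S a = a"
      using insert.prems by blast
    ultimately show ?case using insert assms(1-4) by (simp add: lost_insert)
  qed simp
qed

lemma lost_comp_left:
  assumes "\<delta> permutes Z'" "\<rho> \<circ> \<delta> permutes Z" "permutation \<rho>" "finite Z" "finite Z'" "S \<subseteq> Z" "S \<subseteq> Z'" "0 \<notin> S"
    and id: "\<And>s. s \<in> S \<Longrightarrow> \<rho> s = s"
  shows "lost Z (\<rho> \<circ> \<delta>) S = lost Z' \<delta> S"
proof (rule lost_cong)
  fix a R assume R: "R \<subseteq> S" and a: "a \<in> S"
  have "finite R" using R assms finite_subset by metis
  then have "perm_avoid (\<rho> \<circ> \<delta>) R = \<rho> \<circ> perm_avoid \<delta> R"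
    using assms R permutesD_permutation by (intro perm_avoid_comp_left) auto
  then show "perm_avoid (\<rho> \<circ> \<delta>) R a = a \<longleftrightarrow> perm_avoid \<delta> R a = a"
    using id[OF a] permutation_inj[OF assms(3)] by (metis comp_apply injD)
qed (use assms in auto)

lemma lost_comp_right:
  assumes "\<delta> permutes Z'" "\<delta> \<circ> \<rho> permutes Z" "permutation \<rho>" "finite Z" "finite Z'" "S \<subseteq> Z" "S \<subseteq> Z'" "0 \<notin> S"
    and id: "\<And>s. s \<in> S \<Longrightarrow> \<rho> s = s"
  shows "lost Z (\<delta> \<circ> \<rho>) S = lost Z' \<delta> S"
proof (rule lost_cong)
  fix a R assume R: "R \<subseteq> S" and a: "a \<in> S"
  have "finite R" using R assms finite_subset by metis
  then have "perm_avoid (\<delta> \<circ> \<rho>) R = perm_avoid \<delta> R \<circ> \<rho>"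
    using assms R permutesD_permutation by (intro perm_avoid_comp_right) auto
  then show "perm_avoid (\<delta> \<circ> \<rho>) R a = a \<longleftrightarrow> perm_avoid \<delta> R a = a"
    using id[OF a] by simp
qed (use assms in auto)

lemma lost_inv:
  assumes "\<delta> permutes Z" "finite Z" "S \<subseteq> Z"
  shows "lost Z (inv \<delta>) S = lost Z \<delta> S"
  using assms perm_avoid_permutes[OF assms] finite_subset[OF assms(3,2)]
  by (simp add: lost_def perm_avoid_inv permutesD_permutation cyc0_inv)

lemma lost_conj:
  assumes \<sigma>: "bij \<sigma>" "\<sigma> 0 = 0"
  shows "lost (\<sigma> ` Z) (\<sigma> \<circ> \<delta> \<circ> inv \<sigma>) (\<sigma> ` S) = lost Z \<delta> S"
proof -
  have "\<sigma> ` Z - \<sigma> ` S = \<sigma> ` (Z - S)"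
    using bij_is_inj[OF \<sigma>(1)] by (simp add: image_set_diff)
  then show ?thesis
    by (simp add: lost_def perm_avoid_conj[OF \<sigma>(1)] cyc0_conj[OF \<sigma>])
qed

text \<open>
  If the involution \<open>\<pi>\<close> matches \<open>X\<close> with points fixed by \<open>\<gamma>\<close>, then deleting \<open>X\<close> from \<open>\<gamma> \<pi>\<close>
  transports \<open>\<gamma>\<close> along \<open>\<pi>\<close> and loses no cycle: deleting one point \<open>x\<close> composes with the
  transposition of \<open>x\<close> and \<open>\<pi> x\<close>, which conjugates \<open>\<gamma>\<close> and removes this pair from \<open>\<pi>\<close>.
\<close>

lemma perm_avoid_matching:
  assumes "finite X" "\<gamma> \<circ> \<pi> permutes Z" "finite Z" "permutation \<gamma>" "permutation \<pi>"
    and "\<And>i. \<pi> (\<pi> i) = i" "X \<inter> \<pi> ` X = {}" "supp \<pi> = X \<union> \<pi> ` X" "X \<subseteq> Z" "0 \<notin> X"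
    and "\<And>y. y \<in> \<pi> ` X \<Longrightarrow> \<gamma> y = y"
  shows "perm_avoid (\<gamma> \<circ> \<pi>) X = \<pi> \<circ> \<gamma> \<circ> \<pi> \<and> lost Z (\<gamma> \<circ> \<pi>) X = 0"
  using assms
proof (induction X arbitrary: \<gamma> \<pi> Z rule: finite_induct)
  case empty
  then have "\<pi> = id" by (auto simp: supp_def)
  then show ?case by simp
next
  case (insert x X)
  have perm: "\<gamma> \<circ> \<pi> permutes Z" by (rule insert.prems(1))
  define y where "y = \<pi> x"
  define t where "t = Transposition.transpose x y"
  define \<pi>1 where "\<pi>1 = t \<circ> \<pi>"
  define \<gamma>1 where "\<gamma>1 = t \<circ> \<gamma> \<circ> t"
  have y: "y \<notin> insert x X" "\<gamma> y = y" "\<pi> y = x" "y \<notin> \<pi> ` X"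
    using insert.prems insert.hyps unfolding y_def by (auto simp: image_iff) (metis insert.prems(5))
  have tt: "t (t z) = z" for z by (simp add: t_def)
  have x: "x \<noteq> y" "x \<notin> \<pi> ` X"
    using y insert.hyps insert.prems(5) by (auto simp: y_def)
  have \<pi>t: "\<pi> (t z) = t (\<pi> z)" for z
    using comp_transpose_inj[OF permutation_inj[OF insert.prems(4)], of x y] y(3)
    by (simp add: t_def fun_eq_iff y_def[symmetric] transpose_commute)
  have eq: "skip x (\<gamma> \<circ> \<pi>) = \<gamma>1 \<circ> \<pi>1"
    using y tt by (simp add: skip_def \<gamma>1_def \<pi>1_def t_def[symmetric] y_def[symmetric] fun_eq_iff)
  have \<pi>1: "\<pi>1 z = (if z = x \<or> z = y then z else \<pi> z)" for z
  proof -
    show ?thesis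
    proof (cases "z = x \<or> z = y")
      case True
      then show ?thesis
        by (auto simp: \<pi>1_def t_def y(3) y_def[symmetric])
    next
      case False
      then have "\<pi> z \<noteq> \<pi> x" "\<pi> z \<noteq> \<pi> y"
        using injD[OF permutation_inj[OF insert.prems(4)]] by blast+
      with False show ?thesis
        by (simp add: \<pi>1_def t_def y(3) y_def[symmetric] Transposition.transpose_def)
    qed
  qed
  have im: "\<pi>1 ` X = \<pi> ` X"
    using insert.hyps y by (intro image_cong) (auto simp: \<pi>1)
  have px: "perm_avoid (\<gamma> \<circ> \<pi>) {x} = \<gamma>1 \<circ> \<pi>1"
    using perm_avoid_insert[of "\<gamma> \<circ> \<pi>" x "{}"] eq permutesD_permutation[OF perm insert.prems(2)] by simp
  have IH: "perm_avoid (\<gamma>1 \<circ> \<pi>1) X = \<pi>1 \<circ> \<gamma>1 \<circ> \<pi>1 \<and> lost (Z - {x}) (\<gamma>1 \<circ> \<pi>1) X = 0"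
  proof (rule insert.IH)
    show "\<gamma>1 \<circ> \<pi>1 permutes (Z - {x})"
      unfolding eq[symmetric] using insert.prems(8) by (intro skip_permutes perm) simp
    show "permutation \<gamma>1" "permutation \<pi>1"
      unfolding \<gamma>1_def \<pi>1_def t_def using insert.prems
      by (intro permutation_compose permutation_swap_id; simp)+
    show "\<pi>1 (\<pi>1 i) = i" for i
      unfolding \<pi>1_def using \<pi>t tt insert.prems(5) by simp
    show "X \<inter> \<pi>1 ` X = {}" unfolding im using insert.prems by auto
    show "supp \<pi>1 = X \<union> \<pi>1 ` X"
    proof -
      have "supp \<pi>1 = supp \<pi> - {x, y}"
        using x y y_def by (auto simp: supp_def \<pi>1)
      then show ?thesis
        unfolding im using insert.prems(7) x y insert.hyps by (auto simp: y_def)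
    qed
    show "\<gamma>1 z = z" if "z \<in> \<pi>1 ` X" for z
    proof -
      have "z \<noteq> x" "z \<noteq> y" "\<gamma> z = z"
        using that insert.prems(10) x(2) y(4) unfolding im by blast+
      then show ?thesis by (simp add: \<gamma>1_def t_def)
    qed
  qed (use insert in auto)
  have "perm_avoid (\<gamma> \<circ> \<pi>) (insert x X) = perm_avoid (\<gamma>1 \<circ> \<pi>1) X"
    using perm_avoid_perm_avoid[of "\<gamma> \<circ> \<pi>" "{x}" X] px insert permutesD_permutation[OF perm insert.prems(2)] by simp
  also have "\<dots> = \<pi> \<circ> \<gamma> \<circ> \<pi>"
    using IH \<pi>t tt by (auto simp: \<pi>1_def \<gamma>1_def fun_eq_iff)
  finally have "perm_avoid (\<gamma> \<circ> \<pi>) (insert x X) = \<pi> \<circ> \<gamma> \<circ> \<pi>" .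
  moreover have "lost Z (\<gamma> \<circ> \<pi>) (insert x X) = lost Z (\<gamma> \<circ> \<pi>) {x} + lost (Z - {x}) (\<gamma>1 \<circ> \<pi>1) X"
    using lost_union[of "\<gamma> \<circ> \<pi>" "{x}" X Z] px insert permutesD_permutation[OF perm insert.prems(2)] by simp
  moreover have "lost Z (\<gamma> \<circ> \<pi>) {x} = 0"
  proof -
    have "(\<gamma> \<circ> \<pi>) x \<noteq> x" using x y y_def by simp
    moreover have "x \<in> Z" "x \<noteq> 0" using insert.prems(8,9) by auto
    ultimately show ?thesis
      using lost_singleton[OF perm insert.prems(2), of x] by (simp only: if_False simp_thms)
  qed
  ultimately have "perm_avoid (\<gamma> \<circ> \<pi>) (insert x X) = \<pi> \<circ> \<gamma> \<circ> \<pi> \<and> lost Z (\<gamma> \<circ> \<pi>) (insert x X) = 0"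
    using IH by simp
  then show ?case .
qed

section \<open>Pairings\<close>

lemma pairings_on_supp:
  assumes "\<pi> \<in> pairings_on X"
  shows "supp \<pi> \<subseteq> X" "\<pi> ` supp \<pi> = supp \<pi>"
proof -
  show "supp \<pi> \<subseteq> X"
    using permutes_not_in[OF pairings_onD(1)[OF assms]] by (auto simp: supp_def)
  have "\<pi> i \<in> supp \<pi> \<longleftrightarrow> i \<in> supp \<pi>" for i
    using pairings_onD(2)[OF assms] by (auto simp: supp_def)
  then show "\<pi> ` supp \<pi> = supp \<pi>"
    using pairings_onD(2)[OF assms] by (metis (no_types, lifting) image_iff subsetI subset_antisym)
qed

lemma finite_pairings_on: "finite X \<Longrightarrow> finite (pairings_on X)"
  by (rule finite_subset[OF _ finite_permutations[of X]]) (auto simp: pairings_on_def)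

lemma pairings_eq: "pairings n = pairings_on {1..n}"
  by (simp add: pairings_def pairings_on_def)

lemma bipairings_subset: "bipairings X Y \<subseteq> pairings_on (X \<union> Y)"
  by (auto simp: bipairings_def)

text \<open>A product over the pairs may be computed from any choice of one point in each pair.\<close>

lemma transversal_bij:
  assumes inv: "\<And>i. \<pi> (\<pi> i) = i"
    and A: "A \<inter> \<pi> ` A = {}" and B: "B \<inter> \<pi> ` B = {}" and AB: "A \<union> \<pi> ` A = B \<union> \<pi> ` B"
  shows "bij_betw (\<lambda>a. if a \<in> B then a else \<pi> a) A B"
proof (rule bij_betw_byWitness[where f' = "\<lambda>b. if b \<in> A then b else \<pi> b"])
  have *: "\<pi> i \<in> \<pi> ` C \<longleftrightarrow> i \<in> C" for i C
    using inv by (metis image_iff)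
  have mem: "i \<in> B \<or> \<pi> i \<in> B" if "i \<in> A" for i
    using that AB * inv by (metis UnCI UnE imageI)
  have mem': "i \<in> A \<or> \<pi> i \<in> A" if "i \<in> B" for i
    using that AB * inv by (metis UnCI UnE imageI)
  have nA: "\<pi> i \<notin> A" if "i \<in> A" for i using that A by auto
  have nB: "\<pi> i \<notin> B" if "i \<in> B" for i using that B by auto
  show "\<forall>a\<in>A. (if (if a \<in> B then a else \<pi> a) \<in> A then if a \<in> B then a else \<pi> a
        else \<pi> (if a \<in> B then a else \<pi> a)) = a"
    using nA inv by auto
  show "\<forall>b\<in>B. (if (if b \<in> A then b else \<pi> b) \<in> B then if b \<in> A then b else \<pi> b
        else \<pi> (if b \<in> A then b else \<pi> b)) = b"
    using nB inv by auto
  show "(\<lambda>a. if a \<in> B then a else \<pi> a) ` A \<subseteq> B" using mem by auto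
  show "(\<lambda>b. if b \<in> A then b else \<pi> b) ` B \<subseteq> A" using mem' by auto
qed

lemma less_transversal:
  assumes inv: "\<And>i. \<pi> (\<pi> i) = (i::nat)"
  shows "{i. i < \<pi> i} \<inter> \<pi> ` {i. i < \<pi> i} = {}" "{i. i < \<pi> i} \<union> \<pi> ` {i. i < \<pi> i} = supp \<pi>"
proof -
  show "{i. i < \<pi> i} \<inter> \<pi> ` {i. i < \<pi> i} = {}" using inv by auto
  have "i \<in> {i. i < \<pi> i} \<union> \<pi> ` {i. i < \<pi> i}" if "\<pi> i \<noteq> i" for i
  proof (cases "i < \<pi> i")
    case False
    then have "\<pi> i \<in> {i. i < \<pi> i}" using that inv by simp
    then have "\<pi> (\<pi> i) \<in> \<pi> ` {i. i < \<pi> i}" by (rule imageI)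
    then show ?thesis by (simp add: inv)
  qed simp
  moreover have "\<pi> (\<pi> i) \<noteq> \<pi> i" if "i < \<pi> i" for i using that inv by simp
  ultimately show "{i. i < \<pi> i} \<union> \<pi> ` {i. i < \<pi> i} = supp \<pi>"
    by (auto simp: supp_def)
qed

lemma num_pairs_eq:
  assumes inv: "\<And>i. \<pi> (\<pi> i) = (i::nat)"
  shows "num_pairs \<pi> = card {i. i < \<pi> i}"
proof -
  have "{{i, \<pi> i} |i. i \<in> supp \<pi>} = (\<lambda>i. {i, \<pi> i}) ` {i. i < \<pi> i}"
    unfolding less_transversal(2)[of \<pi>, OF inv, symmetric] using inv
    by (auto simp: insert_commute)
  moreover have "inj_on (\<lambda>i. {i, \<pi> i}) {i. i < \<pi> i}"
    by (rule inj_onI) (use inv in \<open>auto simp: doubleton_eq_iff\<close>)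
  ultimately show ?thesis by (simp add: num_pairs_def card_image)
qed

lemma num_pairs_transversal:
  assumes inv: "\<And>i. \<pi> (\<pi> i) = (i::nat)" and A: "A \<inter> \<pi> ` A = {}" "A \<union> \<pi> ` A = supp \<pi>"
  shows "num_pairs \<pi> = card A"
  using bij_betw_same_card[OF transversal_bij[of \<pi>, OF inv less_transversal(1)[of \<pi>, OF inv] A(1)]]
    less_transversal(2)[of \<pi>, OF inv] A(2) num_pairs_eq[of \<pi>, OF inv] by simp

lemma weight_transversal:
  assumes inv: "\<And>i. \<pi> (\<pi> i) = (i::nat)" and A: "A \<inter> \<pi> ` A = {}" "A \<union> \<pi> ` A = supp \<pi>"
  shows "weight \<pi> h = (\<Prod>i\<in>A. inner (h i) (h (\<pi> i)))"
proof -
  let ?f = "\<lambda>a. if a \<in> A then a else \<pi> a"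
  have "bij_betw ?f {i. i < \<pi> i} A"
    using less_transversal[of \<pi>, OF inv] A by (intro transversal_bij inv) auto
  then have "(\<Prod>i\<in>A. inner (h i) (h (\<pi> i))) = (\<Prod>i\<in>{i. i < \<pi> i}. inner (h (?f i)) (h (\<pi> (?f i))))"
    by (rule prod.reindex_bij_betw[symmetric])
  also have "\<dots> = weight \<pi> h"
    unfolding weight_def by (intro prod.cong refl) (auto simp: inv inner_commute)
  finally show ?thesis ..
qed

lemma supp_conj:
  assumes "bij \<sigma>"
  shows "supp (\<sigma> \<circ> \<pi> \<circ> inv \<sigma>) = \<sigma> ` supp \<pi>"
proof -
  have "\<sigma> x \<in> supp (\<sigma> \<circ> \<pi> \<circ> inv \<sigma>) \<longleftrightarrow> x \<in> supp \<pi>" for x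
    using bij_is_inj[OF assms] by (simp add: supp_def inj_eq)
  then show ?thesis
    using bij_is_surj[OF assms] by (auto simp: image_iff) (metis surjD)
qed

lemma weight_num_pairs_conj:
  assumes \<sigma>: "bij \<sigma>" and inv: "\<And>i. \<pi> (\<pi> i) = (i::nat)"
  shows "weight (\<sigma> \<circ> \<pi> \<circ> inv \<sigma>) (h \<circ> inv \<sigma>) = weight \<pi> h"
    and "num_pairs (\<sigma> \<circ> \<pi> \<circ> inv \<sigma>) = num_pairs \<pi>"
proof -
  let ?\<pi> = "\<sigma> \<circ> \<pi> \<circ> inv \<sigma>" and ?A = "{i. i < \<pi> i}"
  have i: "inj \<sigma>" using \<sigma> by (rule bij_is_inj)
  have inv': "?\<pi> (?\<pi> i) = i" for i
    using i bij_is_surj[OF \<sigma>] by (simp add: inv surj_f_inv_f)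
  have im: "?\<pi> ` \<sigma> ` ?A = \<sigma> ` \<pi> ` ?A"
    using i by (simp add: image_image)
  have t: "\<sigma> ` ?A \<inter> ?\<pi> ` \<sigma> ` ?A = {}" "\<sigma> ` ?A \<union> ?\<pi> ` \<sigma> ` ?A = supp ?\<pi>"
    unfolding im supp_conj[OF \<sigma>] less_transversal(2)[of \<pi>, OF inv, symmetric]
    using less_transversal(1)[of \<pi>, OF inv] by (simp_all add: image_Un image_Int[OF i, symmetric])
  have "inj_on \<sigma> ?A" using i inj_on_subset by blast
  then show "weight ?\<pi> (h \<circ> inv \<sigma>) = weight \<pi> h"
    using i unfolding weight_transversal[of ?\<pi>, OF inv' t]
    by (simp add: prod.reindex weight_def)
  show "num_pairs ?\<pi> = num_pairs \<pi>"
    using num_pairs_transversal[of ?\<pi>, OF inv' t] num_pairs_eq[of \<pi>, OF inv] \<open>inj_on \<sigma> ?A\<close>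
    by (simp add: card_image)
qed

lemma weight_cong:
  assumes inv: "\<And>i. \<pi> (\<pi> i) = (i::nat)" and "\<And>i. i \<in> supp \<pi> \<Longrightarrow> h i = h' i"
  shows "weight \<pi> h = weight \<pi> h'"
  unfolding weight_def using less_transversal(2)[of \<pi>, OF inv] assms(2)
  by (intro prod.cong refl arg_cong2[of _ _ _ _ inner]) (blast+)

lemma card_supp:
  assumes inv: "\<And>i. \<pi> (\<pi> i) = (i::nat)" and "finite (supp \<pi>)"
  shows "card (supp \<pi>) = 2 * num_pairs \<pi>"
proof -
  note l = less_transversal[of \<pi>, OF inv]
  have "inj_on \<pi> {i. i < \<pi> i}" by (rule inj_onI) (use inv in metis)
  moreover have "finite {i. i < \<pi> i}" using l(2) assms(2) by (metis finite_Un)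
  ultimately show ?thesis
    unfolding l(2)[symmetric] num_pairs_eq[of \<pi>, OF inv]
    by (subst card_Un_disjoint) (auto simp: l(1) card_image)
qed

lemma disjoint_supp:
  assumes inv: "\<And>i. \<pi> (\<pi> i) = (i::nat)" "\<And>i. \<rho> (\<rho> i) = i" and d: "supp \<pi> \<inter> supp \<rho> = {}"
  shows "\<pi> (\<rho> i) = \<rho> (\<pi> i)" "\<pi> (\<rho> (\<pi> (\<rho> i))) = i" "supp (\<pi> \<circ> \<rho>) = supp \<pi> \<union> supp \<rho>"
    "(\<pi> \<circ> \<rho>) i = (if i \<in> supp \<pi> then \<pi> i else \<rho> i)"
proof -
  have im: "\<pi> i \<in> supp \<pi> \<longleftrightarrow> i \<in> supp \<pi>" "\<rho> i \<in> supp \<rho> \<longleftrightarrow> i \<in> supp \<rho>" for i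
    using inv[of i] unfolding supp_def mem_Collect_eq by metis+
  have fix\<pi>: "\<pi> i = i" if "i \<notin> supp \<pi>" for i using that by (simp add: supp_def)
  have fix\<rho>: "\<rho> i = i" if "i \<notin> supp \<rho>" for i using that by (simp add: supp_def)
  show c: "\<pi> (\<rho> i) = \<rho> (\<pi> i)" for i
  proof (cases "i \<in> supp \<pi>")
    case True
    then have "i \<notin> supp \<rho>" "\<pi> i \<notin> supp \<rho>" using d im(1)[of i] by auto
    then show ?thesis by (simp add: fix\<rho>)
  next
    case False
    then have "\<rho> i \<notin> supp \<pi>" using d im(2)[of i] fix\<rho>[of i] by (cases "i \<in> supp \<rho>") auto
    with False show ?thesis by (simp add: fix\<pi>)
  qed
  show "\<pi> (\<rho> (\<pi> (\<rho> i))) = i" by (simp add: c inv)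
  show v: "(\<pi> \<circ> \<rho>) i = (if i \<in> supp \<pi> then \<pi> i else \<rho> i)" for i
  proof (cases "i \<in> supp \<pi>")
    case True
    then have "\<rho> i = i" using d by (intro fix\<rho>) auto
    with True show ?thesis by simp
  next
    case False
    then show ?thesis using c[of i] fix\<pi>[of i] by simp
  qed
  show "supp (\<pi> \<circ> \<rho>) = supp \<pi> \<union> supp \<rho>"
    using v unfolding supp_def by auto
qed

lemma disjoint_weight_num_pairs:
  assumes inv: "\<And>i. \<pi> (\<pi> i) = (i::nat)" "\<And>i. \<rho> (\<rho> i) = i" and d: "supp \<pi> \<inter> supp \<rho> = {}"
    and fin: "finite (supp \<pi>)" "finite (supp \<rho>)"
  shows "weight (\<pi> \<circ> \<rho>) h = weight \<pi> h * weight \<rho> h" "num_pairs (\<pi> \<circ> \<rho>) = num_pairs \<pi> + num_pairs \<rho>"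
proof -
  note D = disjoint_supp[of \<pi> \<rho>, OF inv d]
  note L = less_transversal(2)[of \<pi>, OF inv(1)] less_transversal(2)[of \<rho>, OF inv(2)]
  have set: "{i. i < (\<pi> \<circ> \<rho>) i} = {i. i < \<pi> i} \<union> {i. i < \<rho> i}"
    unfolding D(4) using d by (auto simp: supp_def)
  have disj: "{i. i < \<pi> i} \<inter> {i. i < \<rho> i} = {}" using d L by auto
  have f: "finite {i. i < \<pi> i}" "finite {i. i < \<rho> i}" using fin L by (metis finite_Un)+
  have "\<pi> i = (\<pi> \<circ> \<rho>) i" if "i < \<pi> i" for i using that unfolding D(4) by (simp add: supp_def)
  moreover have "\<rho> i = (\<pi> \<circ> \<rho>) i" if "i < \<rho> i" for i using that d L unfolding D(4) by auto
  ultimately show "weight (\<pi> \<circ> \<rho>) h = weight \<pi> h * weight \<rho> h"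
    unfolding weight_def set prod.union_disjoint[OF f disj]
    by (intro arg_cong2[of _ _ _ _ "(*)"] prod.cong) auto
  have "(\<pi> \<circ> \<rho>) ((\<pi> \<circ> \<rho>) i) = i" for i using D(2) by simp
  then show "num_pairs (\<pi> \<circ> \<rho>) = num_pairs \<pi> + num_pairs \<rho>"
    by (simp only: num_pairs_eq[of "\<pi> \<circ> \<rho>"] num_pairs_eq[of \<pi>, OF inv(1)] num_pairs_eq[of \<rho>, OF inv(2)]
        set card_Un_disjoint[OF f disj])
qed


subsection \<open>The exponent of a contraction\<close>

definition expo :: "nat set \<Rightarrow> (nat \<Rightarrow> nat) \<Rightarrow> (nat \<Rightarrow> nat) \<Rightarrow> int" where
  "expo X \<pi> \<gamma> = int (num_pairs \<pi>) - lost (insert 0 X) (\<pi> \<circ> \<gamma>) (supp \<pi>)"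

lemma contract_exp_eq: "contract_exp n \<pi> \<alpha> = expo {1..n} \<pi> \<alpha>"
proof -
  have "insert 0 {1..n} = {0..n}" by auto
  then show ?thesis by (simp add: contract_exp_def expo_def lost_def)
qed

lemma expo_conj:
  assumes \<sigma>: "bij \<sigma>" "\<sigma> 0 = 0" and inv: "\<And>i. \<pi> (\<pi> i) = i"
  shows "expo (\<sigma> ` X) (\<sigma> \<circ> \<pi> \<circ> inv \<sigma>) (\<sigma> \<circ> \<gamma> \<circ> inv \<sigma>) = expo X \<pi> \<gamma>"
proof -
  have "\<sigma> \<circ> \<pi> \<circ> inv \<sigma> \<circ> (\<sigma> \<circ> \<gamma> \<circ> inv \<sigma>) = \<sigma> \<circ> (\<pi> \<circ> \<gamma>) \<circ> inv \<sigma>"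
    using bij_is_inj[OF \<sigma>(1)] by (simp add: fun_eq_iff)
  moreover have "insert 0 (\<sigma> ` X) = \<sigma> ` insert 0 X" using \<sigma>(2) by auto
  ultimately show ?thesis
    unfolding expo_def supp_conj[OF \<sigma>(1)] weight_num_pairs_conj(2)[OF \<sigma>(1) inv]
    by (simp only: lost_conj[OF \<sigma>])
qed

text \<open>Contracting in two steps: the cycles lost in the two steps add up.\<close>

lemma expo_compose:
  assumes X: "finite X" "0 \<notin> X" and \<pi>: "\<pi> \<in> pairings_on X" and \<gamma>: "\<gamma> permutes insert 0 X"
    and \<rho>: "\<rho> \<in> pairings_on (X - supp \<pi>)"
  shows "perm_avoid (\<rho> \<circ> perm_avoid (\<pi> \<circ> \<gamma>) (supp \<pi>)) (supp \<rho>) =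
      perm_avoid (\<rho> \<circ> \<pi> \<circ> \<gamma>) (supp (\<rho> \<circ> \<pi>))"
    and "expo X \<pi> \<gamma> + expo (X - supp \<pi>) \<rho> (perm_avoid (\<pi> \<circ> \<gamma>) (supp \<pi>)) = expo X (\<rho> \<circ> \<pi>) \<gamma>"
proof -
  let ?Z = "insert 0 X" and ?s = "supp \<pi>" and ?r = "supp \<rho>"
  have sX: "?s \<subseteq> X" "?r \<subseteq> X - ?s" using pairings_on_supp[OF \<pi>] pairings_on_supp[OF \<rho>] by auto
  have fin: "finite ?s" "finite ?r" using sX X by (meson finite_Diff finite_subset)+
  have \<pi>p: "\<pi> permutes ?Z" and \<rho>p: "\<rho> permutes ?Z"
    using pairings_onD(1)[OF \<pi>] pairings_onD(1)[OF \<rho>] by (auto intro: permutes_subset)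
  have pg: "\<pi> \<circ> \<gamma> permutes ?Z" using \<pi>p \<gamma> by (simp add: permutes_compose)
  have rpg: "\<rho> \<circ> (\<pi> \<circ> \<gamma>) permutes ?Z" using pg \<rho>p by (simp add: permutes_compose)
  have fZ: "finite ?Z" using X by simp
  have pm: "permutation (\<pi> \<circ> \<gamma>)" "permutation \<rho>" "permutation (\<rho> \<circ> (\<pi> \<circ> \<gamma>))"
    using pg \<rho>p rpg fZ permutesD_permutation by blast+
  have id: "\<rho> s = s" if "s \<in> ?s" for s using that sX(2) by (auto simp: supp_def)
  have 1: "perm_avoid (\<rho> \<circ> (\<pi> \<circ> \<gamma>)) ?s = \<rho> \<circ> perm_avoid (\<pi> \<circ> \<gamma>) ?s"
    using pm fin id by (intro perm_avoid_comp_left) auto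
  have dis: "?s \<inter> ?r = {}" using sX by auto
  have s: "supp (\<rho> \<circ> \<pi>) = ?s \<union> ?r"
    using disjoint_supp(3)[of \<rho> \<pi>, OF pairings_onD(2)[OF \<rho>] pairings_onD(2)[OF \<pi>]] dis by blast
  have "?r \<inter> ?s = {}" using dis by blast
  then have np: "num_pairs (\<rho> \<circ> \<pi>) = num_pairs \<rho> + num_pairs \<pi>"
    by (rule disjoint_weight_num_pairs(2)[of \<rho> \<pi>, OF pairings_onD(2)[OF \<rho>] pairings_onD(2)[OF \<pi>] _ fin(2,1)])
  show "perm_avoid (\<rho> \<circ> perm_avoid (\<pi> \<circ> \<gamma>) (supp \<pi>)) (supp \<rho>) =
      perm_avoid (\<rho> \<circ> \<pi> \<circ> \<gamma>) (supp (\<rho> \<circ> \<pi>))"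
    unfolding s using perm_avoid_perm_avoid[OF pm(3) fin dis] 1 by (simp only: o_assoc)
  have "lost ?Z (\<rho> \<circ> (\<pi> \<circ> \<gamma>)) (?s \<union> ?r) = lost ?Z (\<rho> \<circ> (\<pi> \<circ> \<gamma>)) ?s
      + lost (?Z - ?s) (\<rho> \<circ> perm_avoid (\<pi> \<circ> \<gamma>) ?s) ?r"
    using lost_union[OF pm(3) fin dis, of ?Z] unfolding 1 .
  also have "lost ?Z (\<rho> \<circ> (\<pi> \<circ> \<gamma>)) ?s = lost ?Z (\<pi> \<circ> \<gamma>) ?s"
    using pg rpg pm fZ sX X id by (intro lost_comp_left) auto
  also have "?Z - ?s = insert 0 (X - ?s)" using sX X by auto
  finally show "expo X \<pi> \<gamma> + expo (X - supp \<pi>) \<rho> (perm_avoid (\<pi> \<circ> \<gamma>) (supp \<pi>)) = expo X (\<rho> \<circ> \<pi>) \<gamma>"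
    using np unfolding expo_def s o_assoc by linarith
qed

text \<open>Contractions inside the two factors of a product do not interact.\<close>

lemma expo_product:
  assumes X: "finite X" "0 \<notin> X" and Y: "finite Y" "0 \<notin> Y" and XY: "X \<inter> Y = {}"
    and \<pi>: "\<pi> \<in> pairings_on X" and \<rho>: "\<rho> \<in> pairings_on Y"
    and \<alpha>: "\<alpha> permutes insert 0 X" and \<beta>: "\<beta> permutes insert 0 Y"
  shows "perm_avoid (\<rho> \<circ> \<beta>) (supp \<rho>) \<circ> perm_avoid (\<pi> \<circ> \<alpha>) (supp \<pi>) =
      perm_avoid (\<rho> \<circ> \<pi> \<circ> (\<beta> \<circ> \<alpha>)) (supp (\<rho> \<circ> \<pi>))"
    and "expo X \<pi> \<alpha> + expo Y \<rho> \<beta> = expo (X \<union> Y) (\<rho> \<circ> \<pi>) (\<beta> \<circ> \<alpha>)"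
proof -
  let ?Z = "insert 0 (X \<union> Y)" and ?s = "supp \<pi>" and ?r = "supp \<rho>"
  have sX: "?s \<subseteq> X" "?r \<subseteq> Y" using pairings_on_supp[OF \<pi>] pairings_on_supp[OF \<rho>] by auto
  have fin: "finite ?s" "finite ?r" using sX X Y by (meson finite_subset)+
  have fZ: "finite ?Z" "finite (insert 0 X)" "finite (insert 0 Y)" using X Y by auto
  have p: "\<pi> permutes insert 0 X" "\<rho> permutes insert 0 Y"
    using pairings_onD(1)[OF \<pi>] pairings_onD(1)[OF \<rho>] by (auto intro: permutes_subset)
  have pa: "\<pi> \<circ> \<alpha> permutes insert 0 X" and rb: "\<rho> \<circ> \<beta> permutes insert 0 Y"
    using p \<alpha> \<beta> by (simp_all add: permutes_compose)
  then have Z: "\<pi> \<circ> \<alpha> permutes ?Z" "\<rho> \<circ> \<beta> permutes ?Z" by (auto intro: permutes_subset)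
  have prod: "(\<rho> \<circ> \<beta>) \<circ> (\<pi> \<circ> \<alpha>) permutes ?Z" using permutes_compose[OF Z] .
  have pm: "permutation (\<pi> \<circ> \<alpha>)" "permutation (\<rho> \<circ> \<beta>)" "permutation ((\<rho> \<circ> \<beta>) \<circ> (\<pi> \<circ> \<alpha>))"
    using Z prod fZ permutesD_permutation by blast+
  have com: "\<beta> (\<pi> z) = \<pi> (\<beta> z)" for z
  proof (cases "z \<in> X")
    case True
    then have "z \<notin> insert 0 Y" "\<pi> z \<notin> insert 0 Y"
      using X XY permutes_in_image[OF pairings_onD(1)[OF \<pi>], of z] by auto
    then show ?thesis using permutes_not_in[OF \<beta>] by simp
  next
    case False
    have "\<beta> z \<notin> X"
    proof (cases "z \<in> insert 0 Y")
      case True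
      then have "\<beta> z \<in> insert 0 Y" by (simp only: permutes_in_image[OF \<beta>])
      then show ?thesis using X XY by auto
    qed (use False permutes_not_in[OF \<beta>] in simp)
    with False show ?thesis using permutes_not_in[OF pairings_onD(1)[OF \<pi>]] by simp
  qed
  have eq: "\<rho> \<circ> \<pi> \<circ> (\<beta> \<circ> \<alpha>) = (\<rho> \<circ> \<beta>) \<circ> (\<pi> \<circ> \<alpha>)" by (simp add: fun_eq_iff com)
  have ids: "(\<rho> \<circ> \<beta>) s = s" if "s \<in> ?s" for s
  proof -
    have "s \<notin> insert 0 Y" using that sX X XY by auto
    then show ?thesis using permutes_not_in[OF rb] by blast
  qed
  have 1: "perm_avoid ((\<rho> \<circ> \<beta>) \<circ> (\<pi> \<circ> \<alpha>)) ?s = (\<rho> \<circ> \<beta>) \<circ> perm_avoid (\<pi> \<circ> \<alpha>) ?s"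
    using pm fin ids by (intro perm_avoid_comp_left) auto
  have pap: "perm_avoid (\<pi> \<circ> \<alpha>) ?s permutes (insert 0 X - ?s)"
    using pa fZ sX by (intro perm_avoid_permutes) auto
  have idr: "perm_avoid (\<pi> \<circ> \<alpha>) ?s s = s" if "s \<in> ?r" for s
  proof -
    have "s \<notin> insert 0 X - ?s" using that sX Y XY by auto
    then show ?thesis using permutes_not_in[OF pap] by blast
  qed
  have dis: "?s \<inter> ?r = {}" using sX XY by auto
  have s: "supp (\<rho> \<circ> \<pi>) = ?s \<union> ?r"
    using disjoint_supp(3)[of \<rho> \<pi>, OF pairings_onD(2)[OF \<rho>] pairings_onD(2)[OF \<pi>]] dis by blast
  have "?r \<inter> ?s = {}" using dis by blast
  then have np: "num_pairs (\<rho> \<circ> \<pi>) = num_pairs \<rho> + num_pairs \<pi>"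
    by (rule disjoint_weight_num_pairs(2)[of \<rho> \<pi>, OF pairings_onD(2)[OF \<rho>] pairings_onD(2)[OF \<pi>] _ fin(2,1)])
  have 2: "perm_avoid ((\<rho> \<circ> \<beta>) \<circ> perm_avoid (\<pi> \<circ> \<alpha>) ?s) ?r = perm_avoid (\<rho> \<circ> \<beta>) ?r \<circ> perm_avoid (\<pi> \<circ> \<alpha>) ?s"
    using pm fin idr by (intro perm_avoid_comp_right permutation_perm_avoid) auto
  show "perm_avoid (\<rho> \<circ> \<beta>) (supp \<rho>) \<circ> perm_avoid (\<pi> \<circ> \<alpha>) (supp \<pi>) =
      perm_avoid (\<rho> \<circ> \<pi> \<circ> (\<beta> \<circ> \<alpha>)) (supp (\<rho> \<circ> \<pi>))"
    unfolding s eq perm_avoid_perm_avoid[OF pm(3) fin dis, symmetric] 1 2 ..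
  have "lost ?Z ((\<rho> \<circ> \<beta>) \<circ> (\<pi> \<circ> \<alpha>)) (?s \<union> ?r) = lost ?Z ((\<rho> \<circ> \<beta>) \<circ> (\<pi> \<circ> \<alpha>)) ?s
      + lost (?Z - ?s) ((\<rho> \<circ> \<beta>) \<circ> perm_avoid (\<pi> \<circ> \<alpha>) ?s) ?r"
    using lost_union[OF pm(3) fin dis, of ?Z] unfolding 1 .
  also have "lost ?Z ((\<rho> \<circ> \<beta>) \<circ> (\<pi> \<circ> \<alpha>)) ?s = lost (insert 0 X) (\<pi> \<circ> \<alpha>) ?s"
    using pa prod pm fZ sX X ids by (intro lost_comp_left) auto
  also have "lost (?Z - ?s) ((\<rho> \<circ> \<beta>) \<circ> perm_avoid (\<pi> \<circ> \<alpha>) ?s) ?r = lost (insert 0 Y) (\<rho> \<circ> \<beta>) ?r"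
  proof (rule lost_comp_right[OF rb])
    have "perm_avoid ((\<rho> \<circ> \<beta>) \<circ> (\<pi> \<circ> \<alpha>)) ?s permutes (?Z - ?s)"
      using prod fZ sX by (intro perm_avoid_permutes) auto
    then show "(\<rho> \<circ> \<beta>) \<circ> perm_avoid (\<pi> \<circ> \<alpha>) ?s permutes (?Z - ?s)" unfolding 1 .
    show "permutation (perm_avoid (\<pi> \<circ> \<alpha>) ?s)" using pm fin by (intro permutation_perm_avoid)
  qed (use fZ sX XY X Y idr in auto)
  finally show "expo X \<pi> \<alpha> + expo Y \<rho> \<beta> = expo (X \<union> Y) (\<rho> \<circ> \<pi>) (\<beta> \<circ> \<alpha>)"
    unfolding expo_def s eq
    using np by linarith
qed

lemma expo_inv:
  assumes X: "finite X" "0 \<notin> X" and \<pi>: "\<pi> \<in> pairings_on X" and \<gamma>: "\<gamma> permutes insert 0 X"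
  shows "perm_avoid (\<pi> \<circ> inv \<gamma>) (supp \<pi>) = inv (perm_avoid (\<pi> \<circ> \<gamma>) (supp \<pi>))"
    and "expo X \<pi> (inv \<gamma>) = expo X \<pi> \<gamma>"
proof -
  let ?Z = "insert 0 X" and ?s = "supp \<pi>"
  note D = pairings_onD[OF \<pi>]
  have sX: "?s \<subseteq> X" and im: "\<pi> ` ?s = ?s" using pairings_on_supp[OF \<pi>] by auto
  have fin: "finite ?s" "finite ?Z" using sX X by (auto intro: finite_subset)
  have \<pi>p: "\<pi> permutes ?Z" using D(1) by (auto intro: permutes_subset)
  have pg: "\<pi> \<circ> \<gamma> permutes ?Z" using \<pi>p \<gamma> by (simp add: permutes_compose)
  have pm: "permutation (\<pi> \<circ> \<gamma>)" "permutation (inv (\<pi> \<circ> \<gamma>))"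
    using pg fin permutesD_permutation permutes_inv by blast+
  \<comment> \<open>\<open>\<pi> \<gamma>\<^sup>-\<^sup>1\<close> is the conjugate by \<open>\<pi>\<close> of the inverse of \<open>\<pi> \<gamma>\<close>, and \<open>\<pi>\<close> is the identity off its support.\<close>
  have eq: "\<pi> \<circ> inv \<gamma> = \<pi> \<circ> inv (\<pi> \<circ> \<gamma>) \<circ> inv \<pi>"
    using o_inv_distrib[OF D(3) permutes_bij[OF \<gamma>]] D(2) by (simp add: D(4) fun_eq_iff)
  have \<pi>0: "\<pi> 0 = 0" using permutes_not_in[OF D(1)] X by simp
  have \<pi>Z: "\<pi> ` ?Z = ?Z" using permutes_image[OF \<pi>p] .
  have conj: "perm_avoid (\<pi> \<circ> inv (\<pi> \<circ> \<gamma>) \<circ> inv \<pi>) ?s = \<pi> \<circ> perm_avoid (inv (\<pi> \<circ> \<gamma>)) ?s \<circ> inv \<pi>"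
    using perm_avoid_conj[OF D(3), of "inv (\<pi> \<circ> \<gamma>)" ?s] unfolding im .
  have "(\<pi> \<circ> perm_avoid (inv (\<pi> \<circ> \<gamma>)) ?s \<circ> inv \<pi>) z = perm_avoid (inv (\<pi> \<circ> \<gamma>)) ?s z" for z
  proof (cases "z \<in> ?s")
    case True
    then have "\<pi> z \<in> ?s" using im by blast
    with True show ?thesis by (simp add: D(2,4) perm_avoid_in)
  next
    case False
    have "\<pi> i = i" if "i \<notin> ?s" for i using that by (simp add: supp_def)
    then have "\<pi> z = z" "\<pi> (perm_avoid (inv (\<pi> \<circ> \<gamma>)) ?s z) = perm_avoid (inv (\<pi> \<circ> \<gamma>)) ?s z"
      using False perm_avoid_notin[OF pm(2)] by blast+
    then show ?thesis by (simp only: D(4) o_apply)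
  qed
  then show "perm_avoid (\<pi> \<circ> inv \<gamma>) ?s = inv (perm_avoid (\<pi> \<circ> \<gamma>) ?s)"
    unfolding eq conj perm_avoid_inv[OF pm(1) fin(1), symmetric] by (rule ext)
  have "lost ?Z (\<pi> \<circ> inv \<gamma>) ?s = lost ?Z (inv (\<pi> \<circ> \<gamma>)) ?s"
    using lost_conj[OF D(3) \<pi>0, of ?Z "inv (\<pi> \<circ> \<gamma>)" ?s] unfolding eq im \<pi>Z .
  also have "\<dots> = lost ?Z (\<pi> \<circ> \<gamma>) ?s"
    using pg fin sX by (intro lost_inv) auto
  finally show "expo X \<pi> (inv \<gamma>) = expo X \<pi> \<gamma>" by (simp add: expo_def)
qed

lemma bipairing_supp:
  assumes \<pi>: "\<pi> \<in> bipairings X Y" and XY: "X \<inter> Y = {}"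
  shows "\<pi> ` (X \<inter> supp \<pi>) = Y \<inter> supp \<pi>" "supp \<pi> = (X \<inter> supp \<pi>) \<union> \<pi> ` (X \<inter> supp \<pi>)"
    "(X \<inter> supp \<pi>) \<inter> \<pi> ` (X \<inter> supp \<pi>) = {}" "num_pairs \<pi> = card (X \<inter> supp \<pi>)"
proof -
  have p: "\<pi> \<in> pairings_on (X \<union> Y)" using \<pi> bipairings_subset by blast
  note D = pairings_onD[OF p]
  have im: "\<pi> i \<in> supp \<pi>" if "i \<in> supp \<pi>" for i using pairings_on_supp[OF p] that by blast
  have sub: "supp \<pi> \<subseteq> X \<union> Y" using pairings_on_supp[OF p] by blast
  have X: "\<pi> i \<in> Y" if "i \<in> X" "i \<in> supp \<pi>" for i
    using that im[of i] sub \<pi> unfolding bipairings_def supp_def by blast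
  have Y: "\<pi> i \<in> X" if "i \<in> Y" "i \<in> supp \<pi>" for i
    using that im[of i] sub \<pi> unfolding bipairings_def supp_def by blast
  show 1: "\<pi> ` (X \<inter> supp \<pi>) = Y \<inter> supp \<pi>"
  proof (intro equalityI subsetI)
    fix j assume "j \<in> Y \<inter> supp \<pi>"
    then have "\<pi> j \<in> X \<inter> supp \<pi>" using Y im by blast
    then have "\<pi> (\<pi> j) \<in> \<pi> ` (X \<inter> supp \<pi>)" by (rule imageI)
    then show "j \<in> \<pi> ` (X \<inter> supp \<pi>)" by (simp add: D(2))
  qed (use X im in blast)
  show 2: "supp \<pi> = (X \<inter> supp \<pi>) \<union> \<pi> ` (X \<inter> supp \<pi>)" unfolding 1 using sub by blast
  show 3: "(X \<inter> supp \<pi>) \<inter> \<pi> ` (X \<inter> supp \<pi>) = {}" unfolding 1 using XY by blast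
  show "num_pairs \<pi> = card (X \<inter> supp \<pi>)"
    by (rule num_pairs_transversal[of \<pi>, OF D(2) 3 2[symmetric]])
qed

lemma bipairing_transport:
  assumes X: "finite X" "0 \<notin> X" and Y: "finite Y" "0 \<notin> Y" and XY: "X \<inter> Y = {}"
    and \<pi>: "\<pi> \<in> bipairings X Y"
    and \<alpha>: "\<alpha> permutes insert 0 X" and \<beta>: "\<beta> permutes insert 0 Y"
  shows "perm_avoid (\<beta> \<circ> (\<alpha> \<circ> \<pi>)) (X \<inter> supp \<pi>) = \<beta> \<circ> (\<pi> \<circ> \<alpha> \<circ> \<pi>)"
    and "lost (insert 0 (X \<union> Y)) (\<beta> \<circ> (\<alpha> \<circ> \<pi>)) (X \<inter> supp \<pi>) = 0"
    and "expo (X \<union> Y) \<pi> (\<beta> \<circ> \<alpha>) = int (num_pairs \<pi>)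
      - lost (insert 0 (X \<union> Y) - (X \<inter> supp \<pi>)) (\<beta> \<circ> (\<pi> \<circ> \<alpha> \<circ> \<pi>)) (Y \<inter> supp \<pi>)"
    and "\<beta> \<circ> (\<pi> \<circ> \<alpha> \<circ> \<pi>) permutes (insert 0 (X \<union> Y) - (X \<inter> supp \<pi>))"
proof -
  let ?Z = "insert 0 (X \<union> Y)" and ?X = "X \<inter> supp \<pi>" and ?Y = "Y \<inter> supp \<pi>"
  have p: "\<pi> \<in> pairings_on (X \<union> Y)" using \<pi> bipairings_subset by blast
  note D = pairings_onD[OF p] and S = bipairing_supp[OF \<pi> XY]
  have fZ: "finite ?Z" "finite ?X" using X Y by auto
  have \<pi>p: "\<pi> permutes ?Z" using D(1) by (rule permutes_subset) auto
  have \<alpha>p: "\<alpha> permutes ?Z" using \<alpha> by (rule permutes_subset) auto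
  have \<beta>p: "\<beta> permutes ?Z" using \<beta> by (rule permutes_subset) auto
  have ap: "\<alpha> \<circ> \<pi> permutes ?Z" using permutes_compose[OF \<pi>p \<alpha>p] .
  have bap: "\<beta> \<circ> (\<alpha> \<circ> \<pi>) permutes ?Z" using permutes_compose[OF ap \<beta>p] .
  have pm: "permutation \<alpha>" "permutation \<beta>" "permutation \<pi>" "permutation (\<alpha> \<circ> \<pi>)" "permutation (\<beta> \<circ> (\<alpha> \<circ> \<pi>))"
    using \<alpha>p \<beta>p \<pi>p ap bap fZ permutesD_permutation by blast+
  have id\<alpha>: "\<alpha> y = y" if "y \<in> \<pi> ` ?X" for y
  proof -
    have "y \<notin> insert 0 X" using that Y XY unfolding S(1) by auto
    then show ?thesis using permutes_not_in[OF \<alpha>] by blast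
  qed
  have id\<beta>: "\<beta> x = x" if "x \<in> ?X" for x
  proof -
    have "x \<notin> insert 0 Y" using that X XY by auto
    then show ?thesis using permutes_not_in[OF \<beta>] by blast
  qed
  have m: "perm_avoid (\<alpha> \<circ> \<pi>) ?X = \<pi> \<circ> \<alpha> \<circ> \<pi> \<and> lost ?Z (\<alpha> \<circ> \<pi>) ?X = 0"
    by (rule perm_avoid_matching[OF fZ(2) ap fZ(1) pm(1,3) D(2) S(3,2)]) (use X id\<alpha> in auto)
  show pa: "perm_avoid (\<beta> \<circ> (\<alpha> \<circ> \<pi>)) ?X = \<beta> \<circ> (\<pi> \<circ> \<alpha> \<circ> \<pi>)"
    using perm_avoid_comp_left[OF pm(4,2) fZ(2) id\<beta>] m by metis
  show l: "lost ?Z (\<beta> \<circ> (\<alpha> \<circ> \<pi>)) ?X = 0"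
  proof -
    have "lost ?Z (\<beta> \<circ> (\<alpha> \<circ> \<pi>)) ?X = lost ?Z (\<alpha> \<circ> \<pi>) ?X"
      by (rule lost_comp_left[OF ap bap pm(2) fZ(1) fZ(1)]) (use X id\<beta> in auto)
    with m show ?thesis by metis
  qed
  show "\<beta> \<circ> (\<pi> \<circ> \<alpha> \<circ> \<pi>) permutes (?Z - ?X)"
    unfolding pa[symmetric] using bap fZ by (intro perm_avoid_permutes) auto
  have \<pi>0: "\<pi> 0 = 0" using permutes_not_in[OF D(1)] X Y by simp
  have "\<pi> \<circ> (\<beta> \<circ> \<alpha>) = \<pi> \<circ> (\<beta> \<circ> (\<alpha> \<circ> \<pi>)) \<circ> inv \<pi>"
    by (simp add: D(2,4) fun_eq_iff)
  then have "lost ?Z (\<pi> \<circ> (\<beta> \<circ> \<alpha>)) (supp \<pi>) = lost ?Z (\<beta> \<circ> (\<alpha> \<circ> \<pi>)) (supp \<pi>)"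
    using lost_conj[OF D(3) \<pi>0, of ?Z "\<beta> \<circ> (\<alpha> \<circ> \<pi>)" "supp \<pi>"] permutes_image[OF \<pi>p] pairings_on_supp(2)[OF p]
    by simp
  also have "\<dots> = lost ?Z (\<beta> \<circ> (\<alpha> \<circ> \<pi>)) (?X \<union> ?Y)"
    using S(1,2) by simp
  also have "\<dots> = lost (?Z - ?X) (\<beta> \<circ> (\<pi> \<circ> \<alpha> \<circ> \<pi>)) ?Y"
  proof -
    have fY: "finite ?Y" and dis: "?X \<inter> ?Y = {}" using XY Y by auto
    show ?thesis using lost_union[OF pm(5) fZ(2) fY dis, of ?Z] unfolding l pa add_0 .
  qed
  finally show "expo (X \<union> Y) \<pi> (\<beta> \<circ> \<alpha>) = int (num_pairs \<pi>) - lost (?Z - ?X) (\<beta> \<circ> (\<pi> \<circ> \<alpha> \<circ> \<pi>)) ?Y"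
    by (simp only: expo_def)
qed

text \<open>
  Since deleting the points of \<open>X\<close> loses no cycle, at most one cycle is lost per pair. So the powers
  of \<open>q\<close> in a product are nonnegative.
\<close>

lemma expo_bipairing_nonneg:
  assumes "finite X" "0 \<notin> X" "finite Y" "0 \<notin> Y" "X \<inter> Y = {}" "\<pi> \<in> bipairings X Y"
    "\<alpha> permutes insert 0 X" "\<beta> permutes insert 0 Y"
  shows "0 \<le> expo (X \<union> Y) \<pi> (\<beta> \<circ> \<alpha>)"
proof -
  note T = bipairing_transport[OF assms] and S = bipairing_supp[OF assms(6,5)]
  have "inj_on \<pi> (X \<inter> supp \<pi>)"
    using inj_on_subset[OF bij_is_inj[OF pairings_onD(3)[OF subsetD[OF bipairings_subset assms(6)]]]] by simp
  then have "card (Y \<inter> supp \<pi>) = num_pairs \<pi>"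
    unfolding S(1)[symmetric] S(4) by (rule card_image)
  moreover have "lost (insert 0 (X \<union> Y) - (X \<inter> supp \<pi>)) (\<beta> \<circ> (\<pi> \<circ> \<alpha> \<circ> \<pi>)) (Y \<inter> supp \<pi>)
      \<le> int (card (Y \<inter> supp \<pi>))"
    using assms by (intro lost_le_card T(4)) auto
  ultimately show ?thesis unfolding T(3) by simp
qed

text \<open>
  After a complete contraction only the point \<open>0\<close> is left, so every counted cycle is lost.
\<close>

lemma expo_full_bipairing:
  assumes "finite X" "0 \<notin> X" "finite Y" "0 \<notin> Y" "X \<inter> Y = {}" "\<pi> \<in> bipairings X Y"
    "\<alpha> permutes insert 0 X" "\<beta> permutes insert 0 Y" and full: "supp \<pi> = X \<union> Y"
  shows "expo (X \<union> Y) \<pi> (\<beta> \<circ> \<alpha>) = int (card X) - int (cyc0 (insert 0 Y) (\<beta> \<circ> (\<pi> \<circ> \<alpha> \<circ> \<pi>)))"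
proof -
  note T = bipairing_transport[OF assms(1-8)] and S = bipairing_supp[OF assms(6,5)]
  have XY: "X \<inter> supp \<pi> = X" "Y \<inter> supp \<pi> = Y" "insert 0 (X \<union> Y) - X = insert 0 Y"
    using full assms by auto
  have "perm_avoid (\<beta> \<circ> (\<pi> \<circ> \<alpha> \<circ> \<pi>)) Y permutes (insert 0 Y - Y)"
    using T(4) assms unfolding XY by (intro perm_avoid_permutes) auto
  moreover have "insert 0 Y - Y = {0}" using assms by auto
  ultimately have "perm_avoid (\<beta> \<circ> (\<pi> \<circ> \<alpha> \<circ> \<pi>)) Y 0 = 0"
    using permutes_in_image[of _ "{0}" 0] by auto
  then have "orbit (perm_avoid (\<beta> \<circ> (\<pi> \<circ> \<alpha> \<circ> \<pi>)) Y) 0 = {0}"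
    by (simp add: orbit_eq_singleton_iff)
  then have "cyc0 {0} (perm_avoid (\<beta> \<circ> (\<pi> \<circ> \<alpha> \<circ> \<pi>)) Y) = 0"
    by (simp add: cyc0_def)
  then show ?thesis
    using T(3) S(4) \<open>insert 0 Y - Y = {0}\<close> unfolding XY by (simp add: lost_def)
qed

section \<open>Linear extension from permutations and tensors\<close>

definition real_linear :: "('a::real_inner tensor_space \<Rightarrow> 'a tp) \<Rightarrow> bool" where
  "real_linear f \<longleftrightarrow> (\<forall>F G. f (F + G) = f F + f G) \<and> (\<forall>r F. f (r *\<^sub>R F) = tp_scale (of_real r) (f F))"

text \<open>The common form of the linear (\<open>c = \<i>\<close>) and the antilinear (\<open>c = -\<i>\<close>) extension.\<close>

definition tp_ext ::
  "complex \<Rightarrow> (nat \<Rightarrow> (nat \<Rightarrow> nat) \<Rightarrow> 'a::real_inner tensor_space \<Rightarrow> 'a tp) \<Rightarrow> 'a tp \<Rightarrow> 'a tp" where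
  "tp_ext c g \<xi> = (\<Sum>i\<in>Poly_Mapping.keys \<xi>.
     g (fst i) (snd i) (fst (Poly_Mapping.lookup \<xi> i)) + tp_scale c (g (fst i) (snd i) (snd (Poly_Mapping.lookup \<xi> i))))"

lemma lin_ext_eq: "lin_ext g = tp_ext \<i> g"
  by (simp add: lin_ext_def tp_ext_def fun_eq_iff case_prod_unfold)

lemma antilin_ext_eq: "antilin_ext g = tp_ext (- \<i>) g"
  by (simp add: antilin_ext_def tp_ext_def fun_eq_iff case_prod_unfold tp.scale_minus_left)

lemma real_linearD:
  assumes "real_linear f"
  shows "f (F + G) = f F + f G" "f (r *\<^sub>R F) = tp_scale (of_real r) (f F)" "f 0 = 0"
    "f (- F) = - f F" "f (F - G) = f F - f G" "f (\<Sum>i\<in>I. H i) = (\<Sum>i\<in>I. f (H i))"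
proof -
  show a: "f (F + G) = f F + f G" and s: "f (r *\<^sub>R F) = tp_scale (of_real r) (f F)" for F G r
    using assms by (auto simp: real_linear_def)
  show z: "f 0 = 0" using s[of 0 0] by simp
  show m: "f (- F) = - f F" for F using s[of "-1" F] by simp
  show "f (F - G) = f F - f G" using a[of F "- G"] m[of G] by simp
  show "f (\<Sum>i\<in>I. H i) = (\<Sum>i\<in>I. f (H i))"
    by (induction I rule: infinite_finite_induct) (simp_all add: z a)
qed

lemma real_linear_sum: "(\<And>i. i \<in> I \<Longrightarrow> real_linear (f i)) \<Longrightarrow> real_linear (\<lambda>F. \<Sum>i\<in>I. f i F)"
  by (simp add: real_linear_def sum.distrib tp.scale_sum_right)

lemma real_linear_scale: "real_linear f \<Longrightarrow> real_linear (\<lambda>F. tp_scale z (f F))"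
  by (simp add: real_linear_def tp.scale_right_distrib mult.commute)

lemma real_linear_comp: "real_linear f \<Longrightarrow> linear L \<Longrightarrow> real_linear (\<lambda>F. f (L F))"
  by (simp add: real_linear_def linear_add linear_scale)

lemma real_linear_elem_tensor: "real_linear (elem_tensor n \<alpha>)"
  unfolding real_linear_def elem_tensor_def
  by (auto intro!: poly_mapping_eqI simp: lookup_add lookup_single lookup_tp_scale cmul_def when_def zero_prod_def)

lemma real_linear_sym_tensor: "real_linear (sym_tensor n \<alpha>)"
proof -
  have "linear (tensor_perm n \<sigma> :: 'a tensor_space \<Rightarrow> _)" if "\<sigma> \<in> perms n" for \<sigma>
    by (rule bounded_linear.linear[OF tensor_perm_word(1)]) (use that in \<open>simp add: perms_def\<close>)
  then have "real_linear (\<lambda>F. elem_tensor n \<beta> (tensor_perm n \<sigma> F) :: 'a tp)" if "\<sigma> \<in> perms n" for \<sigma> \<beta>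
    using that by (intro real_linear_comp[OF real_linear_elem_tensor])
  then show ?thesis
    unfolding sym_tensor_def
    by (intro real_linear_scale real_linear_sum)
qed

lemma tp_ext_superset:
  assumes "finite K" "Poly_Mapping.keys \<xi> \<subseteq> K" "\<And>n \<alpha>. g n \<alpha> 0 = 0"
  shows "tp_ext c g \<xi> = (\<Sum>i\<in>K.
     g (fst i) (snd i) (fst (Poly_Mapping.lookup \<xi> i)) + tp_scale c (g (fst i) (snd i) (snd (Poly_Mapping.lookup \<xi> i))))"
  unfolding tp_ext_def using assms
  by (intro sum.mono_neutral_left) (auto simp: in_keys_iff)

lemma tp_ext_add:
  assumes g: "\<And>n \<alpha>. real_linear (g n \<alpha>)"
  shows "tp_ext c g (\<xi> + \<eta>) = tp_ext c g \<xi> + tp_ext c g \<eta>"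
proof -
  note L = real_linearD[OF g]
  let ?K = "Poly_Mapping.keys \<xi> \<union> Poly_Mapping.keys \<eta>"
  have *: "tp_ext c g \<zeta> = (\<Sum>i\<in>?K. g (fst i) (snd i) (fst (Poly_Mapping.lookup \<zeta> i))
      + tp_scale c (g (fst i) (snd i) (snd (Poly_Mapping.lookup \<zeta> i))))"
    if "Poly_Mapping.keys \<zeta> \<subseteq> ?K" for \<zeta>
    using that by (intro tp_ext_superset) (auto simp: L(3))
  show ?thesis
    unfolding *[of \<xi>, OF Un_upper1] *[of \<eta>, OF Un_upper2] *[of "\<xi> + \<eta>", OF Poly_Mapping.keys_add]
    by (simp add: sum.distrib[symmetric] lookup_add L(1) tp.scale_right_distrib algebra_simps)
qed

lemma tp_ext_scale:
  assumes g: "\<And>n \<alpha>. real_linear (g n \<alpha>)" and c: "c * c = -1"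
  shows "tp_ext c g (tp_scale z \<xi>) = tp_scale (of_real (Re z) + c * of_real (Im z)) (tp_ext c g \<xi>)"
proof -
  note L = real_linearD[OF g]
  let ?K = "Poly_Mapping.keys \<xi>"
  have k: "Poly_Mapping.keys (tp_scale z \<xi>) \<subseteq> ?K"
    by (auto simp: in_keys_iff lookup_tp_scale cmul_def zero_prod_def)
  define a b where "a = complex_of_real (Re z)" and "b = complex_of_real (Im z)"
  have "c * b * c = (c * c) * b" by (simp only: mult_ac)
  then have cc: "a * c = c * a" "c * b * c = - b"
    unfolding c by (simp_all only: mult.commute[of a] mult_minus1)
  have e: "g n \<alpha> (Re z *\<^sub>R F - Im z *\<^sub>R G) + tp_scale c (g n \<alpha> (Re z *\<^sub>R G + Im z *\<^sub>R F))
     = tp_scale (of_real (Re z) + c * of_real (Im z)) (g n \<alpha> F + tp_scale c (g n \<alpha> G))" for n \<alpha> F G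
    unfolding L(1,2,5) a_def[symmetric] b_def[symmetric] tp.scale_right_distrib distrib_right cc
      tp.scale_left_distrib tp.scale_scale cc tp.scale_minus_left by (simp add: add_ac)
  show ?thesis
    unfolding tp_ext_superset[where K = ?K and g = g, OF finite_keys k L(3)]
      tp_ext_superset[where K = ?K and g = g, OF finite_keys order_refl L(3)]
    by (simp add: lookup_tp_scale cmul_def case_prod_unfold e tp.scale_sum_right)
qed

lemma tp_ext_elem:
  assumes g: "\<And>n \<alpha>. real_linear (g n \<alpha>)"
  shows "tp_ext c g (elem_tensor n \<alpha> F) = g n \<alpha> F"
proof -
  have k: "Poly_Mapping.keys (elem_tensor n \<alpha> F) \<subseteq> {(n, \<alpha>)}"
    by (simp add: elem_tensor_def)
  show ?thesis
    using tp_ext_superset[where K = "{(n, \<alpha>)}" and g = g and c = c, OF _ k real_linearD(3)[OF g]]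
    by (simp add: elem_tensor_def real_linearD(3)[OF g])
qed

lemma tp_ext_zero [simp]: "tp_ext c g 0 = 0"
  by (simp add: tp_ext_def)

lemma tp_ext_sum:
  assumes g: "\<And>n \<alpha>. real_linear (g n \<alpha>)"
  shows "tp_ext c g (\<Sum>i\<in>I. \<xi> i) = (\<Sum>i\<in>I. tp_ext c g (\<xi> i))"
  by (induction I rule: infinite_finite_induct) (simp_all add: tp_ext_add[OF g])

lemma tp_ext_scale_real:
  assumes g: "\<And>n \<alpha>. real_linear (g n \<alpha>)" and c: "c * c = -1"
  shows "tp_ext c g (tp_scale (of_real r) \<xi>) = tp_scale (of_real r) (tp_ext c g \<xi>)"
  using tp_ext_scale[of g c "of_real r" \<xi>, OF g c] by simp

lemma tp_ext_fun:
  shows tp_ext_fun_add: "tp_ext c (\<lambda>n \<alpha> F. f n \<alpha> F + g n \<alpha> F) \<xi> = tp_ext c f \<xi> + tp_ext c g \<xi>"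
    and tp_ext_fun_scale: "tp_ext c (\<lambda>n \<alpha> F. tp_scale z (g n \<alpha> F)) \<xi> = tp_scale z (tp_ext c g \<xi>)"
  unfolding tp_ext_def
  by (simp_all add: sum.distrib[symmetric] tp.scale_sum_right tp.scale_right_distrib algebra_simps)


section \<open>Diagrams with arbitrary labels\<close>

text \<open>
  A label-free symbol: for a finite set \<open>X\<close> of positive labels, a permutation \<open>\<gamma>\<close> of
  \<open>{0} \<union> X\<close> and a vector \<open>h x\<close> for each label, the symmetrised tensor obtained by numbering the
  labels. Symmetrisation makes it invariant under every relabelling, so that contractions and
  products can be described without renumbering.
\<close>

definition diagram :: "nat set \<Rightarrow> (nat \<Rightarrow> nat) \<Rightarrow> (nat \<Rightarrow> 'a::real_inner) \<Rightarrow> 'a tp" where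
  "diagram X \<gamma> h = sym_tensor (card X) (relabel (insert 0 X) \<gamma>) (tensor (map h (sorted_list_of_set X)))"

lemma extend_to_bij:
  fixes f :: "'b \<Rightarrow> 'b"
  assumes A: "finite A" and f: "inj_on f A"
  obtains \<sigma> where "bij \<sigma>" "\<And>x. x \<in> A \<Longrightarrow> \<sigma> x = f x"
proof -
  let ?U = "A \<union> f ` A"
  have "card (?U - A) = card (?U - f ` A)"
    using A f by (simp add: card_Diff_subset card_image)
  then obtain g where g: "bij_betw g (?U - A) (?U - f ` A)"
    using A finite_same_card_bij[of "?U - A" "?U - f ` A"] by auto
  define \<sigma> where "\<sigma> x = (if x \<in> A then f x else if x \<in> ?U then g x else x)" for x
  have "bij_betw \<sigma> A (f ` A)"
    using f by (subst bij_betw_cong[of A _ f]) (auto simp: \<sigma>_def bij_betw_def)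
  moreover have "bij_betw \<sigma> (?U - A) (?U - f ` A)"
    using g by (subst bij_betw_cong[of _ _ g]) (auto simp: \<sigma>_def)
  ultimately have "bij_betw \<sigma> (A \<union> (?U - A)) (f ` A \<union> (?U - f ` A))"
    by (rule bij_betw_combine) auto
  moreover have "bij_betw \<sigma> (- ?U) (- ?U)"
    by (subst bij_betw_cong[of _ _ id]) (auto simp: \<sigma>_def)
  ultimately have "bij_betw \<sigma> (A \<union> (?U - A) \<union> - ?U) (f ` A \<union> (?U - f ` A) \<union> - ?U)"
    by (rule bij_betw_combine) auto
  moreover have "A \<union> (?U - A) \<union> - ?U = UNIV" "f ` A \<union> (?U - f ` A) \<union> - ?U = UNIV" by auto
  ultimately have "bij \<sigma>" by simp
  then show ?thesis using that by (simp add: \<sigma>_def)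
qed

lemma conj_eqI:
  assumes "bij \<rho>" "bij \<rho>'" "\<gamma> permutes Z" "\<And>z. z \<in> Z \<Longrightarrow> \<rho> z = \<rho>' z"
  shows "\<rho> \<circ> \<gamma> \<circ> inv \<rho> = \<rho>' \<circ> \<gamma> \<circ> inv \<rho>'"
proof
  fix y
  note inv = inv_f_f[OF bij_is_inj[OF assms(1)]] inv_f_f[OF bij_is_inj[OF assms(2)]]
    surj_f_inv_f[OF bij_is_surj[OF assms(1)]] surj_f_inv_f[OF bij_is_surj[OF assms(2)]]
  show "(\<rho> \<circ> \<gamma> \<circ> inv \<rho>) y = (\<rho>' \<circ> \<gamma> \<circ> inv \<rho>') y"
  proof (cases "inv \<rho> y \<in> Z")
    case True
    then have "\<rho>' (inv \<rho> y) = y" using assms(4) inv by metis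
    then have "inv \<rho>' y = inv \<rho> y" using inv by metis
    then show ?thesis using True assms(4) permutes_in_image[OF assms(3)] by simp
  next
    case False
    have "inv \<rho>' y \<notin> Z"
    proof
      assume "inv \<rho>' y \<in> Z"
      then have "\<rho> (inv \<rho>' y) = y" using assms(4) inv by metis
      then have "inv \<rho> y = inv \<rho>' y" using inv by metis
      with \<open>inv \<rho>' y \<in> Z\<close> False show False by simp
    qed
    then show ?thesis using False permutes_not_in[OF assms(3)] by (simp add: inv)
  qed
qed

lemma map_permutation_conj:
  assumes "bij \<rho>" "\<gamma> permutes Z" "\<And>z. z \<in> Z \<Longrightarrow> \<rho> z = f z"
  shows "map_permutation Z f \<gamma> = \<rho> \<circ> \<gamma> \<circ> inv \<rho>"
proof
  fix y
  have inj: "inj_on f Z"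
    using assms(3) inj_on_cong[of Z \<rho> f] inj_on_subset[OF bij_is_inj[OF assms(1)], of Z] by simp
  show "map_permutation Z f \<gamma> y = (\<rho> \<circ> \<gamma> \<circ> inv \<rho>) y"
  proof (cases "y \<in> f ` Z")
    case True
    then obtain z where z: "z \<in> Z" "y = f z" by auto
    then have "y = \<rho> z" "\<gamma> z \<in> Z" using assms(3) permutes_in_image[OF assms(2)] by auto
    moreover have "inv \<rho> y = z" using \<open>y = \<rho> z\<close> inv_f_f[OF bij_is_inj[OF assms(1)]] by simp
    ultimately show ?thesis
      using True z(1) assms(3)[of "\<gamma> z"] inv_into_f_f[OF inj z(1)] z(2)
      by (simp add: map_permutation_def restrict_id_def)
  next
    case False
    then have "inv \<rho> y \<notin> Z"
      using assms(3) surj_f_inv_f[OF bij_is_surj[OF assms(1)], of y] by (metis image_eqI)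
    then show ?thesis
      using False permutes_not_in[OF assms(2)] surj_f_inv_f[OF bij_is_surj[OF assms(1)], of y]
      by (simp add: map_permutation_def restrict_id_def)
  qed
qed

lemma conj_permutes:
  assumes "bij \<sigma>" "\<gamma> permutes Z"
  shows "\<sigma> \<circ> \<gamma> \<circ> inv \<sigma> permutes (\<sigma> ` Z)"
  using map_permutation_permutes[OF inj_on_imp_bij_betw[OF inj_on_subset[OF bij_is_inj[OF assms(1)] subset_UNIV]] assms(2)]
    map_permutation_conj[OF assms(1,2), of \<sigma>] by simp

lemma bij_inv_comp:
  assumes "bij \<sigma>" "bij \<tau>"
  shows "bij (\<sigma> \<circ> \<tau>)" "inv (\<sigma> \<circ> \<tau>) = inv \<tau> \<circ> inv \<sigma>"
    "\<sigma> \<circ> (\<tau> \<circ> \<gamma> \<circ> inv \<tau>) \<circ> inv \<sigma> = (\<sigma> \<circ> \<tau>) \<circ> \<gamma> \<circ> inv (\<sigma> \<circ> \<tau>)"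
  using assms by (simp_all add: bij_comp o_inv_distrib fun_eq_iff)

lemma sym_tensor_word_conj:
  fixes h :: "nat \<Rightarrow> 'a::real_inner"
  assumes \<sigma>: "\<sigma> permutes {1..n}"
  shows "sym_tensor n (\<sigma> \<circ> \<alpha> \<circ> inv \<sigma>) (word n (h \<circ> inv \<sigma>)) = sym_tensor n \<alpha> (word n h)"
proof -
  have b: "bij \<sigma>" using \<sigma> by (rule permutes_bij)
  have "(\<Sum>\<tau>\<in>perms n. elem_tensor n (\<tau> \<circ> \<alpha> \<circ> inv \<tau>) (tensor_perm n \<tau> (word n h)))
      = (\<Sum>\<tau> | \<tau> permutes {1..n}. elem_tensor n (\<tau> \<circ> \<alpha> \<circ> inv \<tau>) (word n (h \<circ> inv \<tau>)))"
    unfolding perms_def by (intro sum.cong refl) (simp add: tensor_perm_word)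
  also have "\<dots> = (\<Sum>\<tau> | \<tau> permutes {1..n}. elem_tensor n ((\<tau> \<circ> \<sigma>) \<circ> \<alpha> \<circ> inv (\<tau> \<circ> \<sigma>)) (word n (h \<circ> inv (\<tau> \<circ> \<sigma>))))"
    by (rule sum_permutations_compose_right[OF \<sigma>])
  also have "\<dots> = (\<Sum>\<tau>\<in>perms n. elem_tensor n (\<tau> \<circ> (\<sigma> \<circ> \<alpha> \<circ> inv \<sigma>) \<circ> inv \<tau>) (tensor_perm n \<tau> (word n (h \<circ> inv \<sigma>))))"
    unfolding perms_def
  proof (intro sum.cong refl)
    fix \<tau> assume "\<tau> \<in> {\<tau>. \<tau> permutes {1..n}}"
    then have \<tau>: "\<tau> permutes {1..n}" by simp
    have "tensor_perm n \<tau> (word n (h \<circ> inv \<sigma>)) = word n (h \<circ> inv (\<tau> \<circ> \<sigma>))"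
      unfolding tensor_perm_word(2)[OF \<tau>] bij_inv_comp(2)[OF permutes_bij[OF \<tau>] b] by (simp only: o_assoc)
    then show "elem_tensor n ((\<tau> \<circ> \<sigma>) \<circ> \<alpha> \<circ> inv (\<tau> \<circ> \<sigma>)) (word n (h \<circ> inv (\<tau> \<circ> \<sigma>))) =
        elem_tensor n (\<tau> \<circ> (\<sigma> \<circ> \<alpha> \<circ> inv \<sigma>) \<circ> inv \<tau>) (tensor_perm n \<tau> (word n (h \<circ> inv \<sigma>)))"
      by (simp only: bij_inv_comp(3)[OF permutes_bij[OF \<tau>] b])
  qed
  finally show ?thesis by (simp only: sym_tensor_def)
qed

lemma label_order:
  fixes X :: "nat set"
  assumes X: "finite X" "0 \<notin> X"
  obtains e where "bij e" "e 0 = 0" "e ` X = {1..card X}"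
    "\<And>x. x \<in> insert 0 X \<Longrightarrow> e x = card {y \<in> insert 0 X. y < x}"
    "sorted_list_of_set X = map (inv e) [1..<Suc (card X)]"
proof -
  let ?Z = "insert 0 X"
  define c where "c x = card {y \<in> ?Z. y < x}" for x
  have mono: "c x < c y" if "x \<in> ?Z" "x < y" for x y
    unfolding c_def
  proof (rule psubset_card_mono)
    have "{z \<in> ?Z. z < x} \<subseteq> {z \<in> ?Z. z < y}" using that(2) by auto
    moreover have "x \<in> {z \<in> ?Z. z < y}" "x \<notin> {z \<in> ?Z. z < x}" using that by simp_all
    ultimately show "{z \<in> ?Z. z < x} \<subset> {z \<in> ?Z. z < y}" by blast
  qed (use X in simp)
  have inj: "inj_on c ?Z"
  proof (rule inj_onI)
    fix x y assume "x \<in> ?Z" "y \<in> ?Z" "c x = c y"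
    then show "x = y"
      using mono[of x y] mono[of y x] by (cases x y rule: linorder_cases) simp_all
  qed
  have fZ: "finite ?Z" using X by simp
  obtain e where e: "bij e" "\<And>x. x \<in> ?Z \<Longrightarrow> e x = c x"
    using extend_to_bij[OF fZ inj] by blast
  have e0: "e 0 = 0" using e(2)[of 0] by (simp add: c_def)
  have sub: "e ` X \<subseteq> {1..card X}"
  proof
    fix z assume "z \<in> e ` X"
    then obtain x where x: "x \<in> X" "z = c x" using e(2) by auto
    have "c 0 < c x" using x X by (intro mono) (auto intro: Nat.gr0I)
    moreover have "c x \<le> card X"
    proof -
      have "c x \<le> card (?Z - {x})" unfolding c_def using X by (intro card_mono) auto
      also have "\<dots> = card X" using x X by simp
      finally show ?thesis .
    qed
    ultimately show "z \<in> {1..card X}" using x by simp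
  qed
  have ie: "inj e" using e(1) by (rule bij_is_inj)
  have cX: "card (e ` X) = card X" using ie by (simp add: card_image inj_on_subset)
  have im: "e ` X = {1..card X}"
    using sub cX by (intro card_subset_eq) auto
  have "map e (sorted_list_of_set X) = [1..<Suc (card X)]"
  proof (rule sorted_distinct_set_unique)
    have "sorted_wrt (\<lambda>x y. e x \<le> e y) (sorted_list_of_set X)"
    proof (rule sorted_wrt_mono_rel[of _ "(\<le>)"])
      fix x y assume "x \<in> set (sorted_list_of_set X)" "y \<in> set (sorted_list_of_set X)" "x \<le> y"
      then show "e x \<le> e y"
        using mono[of x y] e(2) X by (cases "x = y") (auto intro: less_imp_le)
    qed simp
    then show "sorted (map e (sorted_list_of_set X))" by (simp add: sorted_map)
    show "distinct (map e (sorted_list_of_set X))"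
      using ie by (simp add: distinct_map inj_on_subset[OF _ subset_UNIV])
    show "set (map e (sorted_list_of_set X)) = set [1..<Suc (card X)]"
      using X im by auto
  qed (simp_all del: upt_Suc)
  then have "map (inv e) (map e (sorted_list_of_set X)) = map (inv e) [1..<Suc (card X)]"
    by simp
  then have "sorted_list_of_set X = map (inv e) [1..<Suc (card X)]"
    using ie by (simp add: o_def del: upt_Suc)
  moreover have "e x = card {y \<in> ?Z. y < x}" if "x \<in> ?Z" for x
    using e(2)[OF that] by (simp only: c_def)
  ultimately show ?thesis by (intro that[OF e(1) e0 im])
qed

text \<open>Any numbering of the labels gives the same symbol.\<close>

lemma diagram_numbering:
  fixes h :: "nat \<Rightarrow> 'a::real_inner"
  assumes X: "finite X" "0 \<notin> X" and \<gamma>: "\<gamma> permutes insert 0 X"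
    and e: "bij e" "e 0 = 0" "e ` X = {1..n}"
  shows "diagram X \<gamma> h = sym_tensor n (e \<circ> \<gamma> \<circ> inv e) (word n (h \<circ> inv e))"
proof -
  obtain d where d: "bij d" "d 0 = 0" "d ` X = {1..card X}"
    and dc: "\<And>x. x \<in> insert 0 X \<Longrightarrow> d x = card {y \<in> insert 0 X. y < x}"
    and sl: "sorted_list_of_set X = map (inv d) [1..<Suc (card X)]"
    using label_order[OF X] by blast
  have n: "card X = n"
    using e(3) card_image[OF inj_on_subset[OF bij_is_inj[OF e(1)] subset_UNIV], of X] by simp
  have rel: "relabel (insert 0 X) \<gamma> = d \<circ> \<gamma> \<circ> inv d"
    unfolding relabel_def by (rule map_permutation_conj[OF d(1) \<gamma> dc])
  have dia: "diagram X \<gamma> h = sym_tensor n (d \<circ> \<gamma> \<circ> inv d) (word n (h \<circ> inv d))"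
    unfolding diagram_def rel sl n word_def by (simp del: upt_Suc)
  define \<tau> where "\<tau> i = (if i \<in> {1..n} then e (inv d i) else i)" for i
  have di: "inv d i \<in> X" if "i \<in> {1..n}" for i
    using that d n inv_f_f[OF bij_is_inj[OF d(1)]] by (metis imageE)
  have \<tau>: "\<tau> permutes {1..n}"
  proof (rule bij_imp_permutes)
    have "bij_betw (inv d) {1..n} X"
      using d(3) n inj_on_imp_bij_betw[OF inj_on_subset[OF bij_is_inj[OF d(1)] subset_UNIV], of X]
        bij_betw_inv_into_subset[OF d(1)[unfolded bij_def[symmetric]], of X "{1..n}"] by simp
    moreover have "bij_betw e X {1..n}"
      using e(3) inj_on_imp_bij_betw[OF inj_on_subset[OF bij_is_inj[OF e(1)] subset_UNIV], of X] by simp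
    ultimately have "bij_betw (e \<circ> inv d) {1..n} {1..n}" by (rule bij_betw_trans)
    then show "bij_betw \<tau> {1..n} {1..n}"
      by (subst bij_betw_cong[of _ _ "e \<circ> inv d"]) (auto simp: \<tau>_def)
  qed (auto simp: \<tau>_def)
  have b: "bij (\<tau> \<circ> d)" using permutes_bij[OF \<tau>] d(1) by (rule bij_comp[rotated])
  have agree: "(\<tau> \<circ> d) x = e x" if "x \<in> insert 0 X" for x
  proof (cases "x = 0")
    case False
    then have "d x \<in> {1..n}" using that d(3) n by blast
    then show ?thesis using inv_f_f[OF bij_is_inj[OF d(1)]] by (simp add: \<tau>_def)
  qed (simp add: \<tau>_def d(2) e(2))
  have "sym_tensor n (d \<circ> \<gamma> \<circ> inv d) (word n (h \<circ> inv d))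
      = sym_tensor n (\<tau> \<circ> (d \<circ> \<gamma> \<circ> inv d) \<circ> inv \<tau>) (word n (h \<circ> inv d \<circ> inv \<tau>))"
    by (rule sym_tensor_word_conj[OF \<tau>, symmetric])
  also have "\<tau> \<circ> (d \<circ> \<gamma> \<circ> inv d) \<circ> inv \<tau> = e \<circ> \<gamma> \<circ> inv e"
    unfolding bij_inv_comp(3)[OF permutes_bij[OF \<tau>] d(1)]
    by (rule conj_eqI[OF b e(1) \<gamma> agree])
  also have "word n (h \<circ> inv d \<circ> inv \<tau>) = word n (h \<circ> inv e)"
    unfolding word_def
  proof (intro arg_cong[of _ _ tensor] map_cong refl)
    fix i assume "i \<in> set [1..<Suc n]"
    then have "i \<in> e ` X" using e(3) by auto
    then obtain x where x: "x \<in> X" "i = e x" by auto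
    then have "i = (\<tau> \<circ> d) x" using agree by simp
    then have "inv (\<tau> \<circ> d) i = x" using inv_f_f[OF bij_is_inj[OF b]] by simp
    moreover have "inv e i = x" using x inv_f_f[OF bij_is_inj[OF e(1)]] by simp
    ultimately show "(h \<circ> inv d \<circ> inv \<tau>) i = (h \<circ> inv e) i"
      unfolding bij_inv_comp(2)[OF permutes_bij[OF \<tau>] d(1)] by simp
  qed
  finally show ?thesis unfolding dia .
qed

lemma ex_numbering:
  fixes X :: "nat set"
  assumes X: "finite X" "0 \<notin> X"
  obtains e where "bij e" "e 0 = 0" "e ` X = {1..card X}"
  by (rule label_order[OF X]) (rule that)

lemma diagram_conj:
  assumes X: "finite X" "0 \<notin> X" and \<gamma>: "\<gamma> permutes insert 0 X" and \<sigma>: "bij \<sigma>" "\<sigma> 0 = 0"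
  shows "diagram (\<sigma> ` X) (\<sigma> \<circ> \<gamma> \<circ> inv \<sigma>) (h \<circ> inv \<sigma>) = diagram X \<gamma> h"
proof -
  obtain e where e: "bij e" "e 0 = 0" "e ` X = {1..card X}" using ex_numbering[OF X] by blast
  define e' where "e' = e \<circ> inv \<sigma>"
  have isg: "inv \<sigma> (\<sigma> x) = x" for x using inv_f_f[OF bij_is_inj[OF \<sigma>(1)]] .
  have b: "bij (inv \<sigma>)" using \<sigma>(1) by (rule bij_imp_bij_inv)
  have e': "bij e'" "e' 0 = 0" "e' ` \<sigma> ` X = {1..card X}"
    using e b isg isg[of 0] \<sigma>(2) by (auto simp: e'_def bij_comp image_image)
  have e'\<sigma>: "e' \<circ> \<sigma> = e" by (simp add: e'_def fun_eq_iff isg)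
  have Z: "insert 0 (\<sigma> ` X) = \<sigma> ` insert 0 X" using \<sigma>(2) by auto
  have "0 \<notin> \<sigma> ` X" using X isg isg[of 0] \<sigma>(2) by (metis imageE)
  then have "diagram (\<sigma> ` X) (\<sigma> \<circ> \<gamma> \<circ> inv \<sigma>) (h \<circ> inv \<sigma>) =
      sym_tensor (card X) (e' \<circ> (\<sigma> \<circ> \<gamma> \<circ> inv \<sigma>) \<circ> inv e') (word (card X) (h \<circ> inv \<sigma> \<circ> inv e'))"
    using X e' conj_permutes[OF \<sigma>(1) \<gamma>] unfolding Z[symmetric] by (intro diagram_numbering) auto
  also have "\<dots> = sym_tensor (card X) (e \<circ> \<gamma> \<circ> inv e) (word (card X) (h \<circ> inv e))"
    unfolding bij_inv_comp(3)[OF e'(1) \<sigma>(1)] e'\<sigma>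
    using bij_inv_comp(2)[OF e'(1) \<sigma>(1)] unfolding e'\<sigma> by (simp only: o_assoc)
  also have "\<dots> = diagram X \<gamma> h"
    by (rule diagram_numbering[OF X \<gamma> e, symmetric])
  finally show ?thesis .
qed

lemma diagram_cong:
  assumes "finite X" "\<And>x. x \<in> X \<Longrightarrow> h x = h' x"
  shows "diagram X \<gamma> h = diagram X \<gamma> h'"
proof -
  have "map h (sorted_list_of_set X) = map h' (sorted_list_of_set X)"
    by (rule map_cong[OF refl]) (use assms in simp)
  then show ?thesis by (simp only: diagram_def)
qed

lemma tp_sum_const: "(\<Sum>i\<in>A. \<xi>) = tp_scale (of_nat (card A)) \<xi>"
  by (induction A rule: infinite_finite_induct) (simp_all add: tp.scale_left_distrib)

lemma card_perms: "finite (perms n)" "card (perms n) = fact n"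
  unfolding perms_def by (simp_all add: finite_permutations card_permutations)

lemma diagram_word:
  assumes "\<gamma> permutes insert 0 {1..n}"
  shows "diagram {1..n} \<gamma> h = sym_tensor n \<gamma> (word n h)"
proof -
  have "diagram {1..n} \<gamma> h = sym_tensor n (id \<circ> \<gamma> \<circ> inv id) (word n (h \<circ> inv id))"
    by (rule diagram_numbering) (use assms in simp_all)
  then show ?thesis by (simp only: inv_id id_comp comp_id)
qed

text \<open>
  An operation given on elementary tensors by a formula that does not depend on the labelling is
  given by the same formula on all diagrams, since it commutes with symmetrisation.
\<close>

lemma tp_ext_diagram:
  assumes g: "\<And>n \<alpha>. real_linear (g n \<alpha>)" and c: "c * c = -1"
    and word: "\<And>n \<alpha> h. \<alpha> permutes insert 0 {1..n} \<Longrightarrow> g n \<alpha> (word n h) = \<Phi> {1..n} \<alpha> h"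
    and conj: "\<And>\<sigma> X \<alpha> h. bij \<sigma> \<Longrightarrow> \<sigma> 0 = 0 \<Longrightarrow> finite X \<Longrightarrow> 0 \<notin> X \<Longrightarrow> \<alpha> permutes insert 0 X \<Longrightarrow>
      \<Phi> (\<sigma> ` X) (\<sigma> \<circ> \<alpha> \<circ> inv \<sigma>) (h \<circ> inv \<sigma>) = \<Phi> X \<alpha> h"
    and X: "finite X" "0 \<notin> X" and \<gamma>: "\<gamma> permutes insert 0 X"
  shows "tp_ext c g (diagram X \<gamma> h) = \<Phi> X \<gamma> h"
proof -
  obtain e where e: "bij e" "e 0 = 0" "e ` X = {1..card X}" using ex_numbering[OF X] by blast
  define n where "n = card X"
  define \<alpha> where "\<alpha> = e \<circ> \<gamma> \<circ> inv e"
  have "e ` insert 0 X = insert 0 {1..n}" using e by (simp add: n_def)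
  then have \<alpha>: "\<alpha> permutes insert 0 {1..n}"
    using conj_permutes[OF e(1) \<gamma>] by (simp add: \<alpha>_def)
  have "g n (\<sigma> \<circ> \<alpha> \<circ> inv \<sigma>) (tensor_perm n \<sigma> (word n (h \<circ> inv e))) = \<Phi> X \<gamma> h"
    if "\<sigma> \<in> perms n" for \<sigma>
  proof -
    have \<sigma>: "\<sigma> permutes {1..n}" using that by (simp add: perms_def)
    have s: "bij \<sigma>" "\<sigma> 0 = 0" "\<sigma> ` {1..n} = {1..n}"
      using permutes_bij[OF \<sigma>] permutes_not_in[OF \<sigma>, of 0] permutes_image[OF \<sigma>] by auto
    have "\<sigma> ` insert 0 {1..n} = insert 0 {1..n}" using s by simp
    then have "\<sigma> \<circ> \<alpha> \<circ> inv \<sigma> permutes insert 0 {1..n}"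
      using conj_permutes[OF s(1) \<alpha>] by simp
    then have "g n (\<sigma> \<circ> \<alpha> \<circ> inv \<sigma>) (tensor_perm n \<sigma> (word n (h \<circ> inv e))) =
        \<Phi> (\<sigma> ` {1..n}) (\<sigma> \<circ> \<alpha> \<circ> inv \<sigma>) (h \<circ> inv e \<circ> inv \<sigma>)"
      unfolding s(3) tensor_perm_word(2)[OF \<sigma>] by (rule word)
    also have "\<dots> = \<Phi> {1..n} \<alpha> (h \<circ> inv e)"
      using s \<alpha> by (intro conj) auto
    also have "\<dots> = \<Phi> X \<gamma> h"
      unfolding \<alpha>_def n_def e(3)[symmetric] by (rule conj[OF e(1,2) X \<gamma>])
    finally show ?thesis .
  qed
  then have "(\<Sum>\<sigma>\<in>perms n. g n (\<sigma> \<circ> \<alpha> \<circ> inv \<sigma>) (tensor_perm n \<sigma> (word n (h \<circ> inv e)))) =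
      (\<Sum>\<sigma>\<in>perms n. \<Phi> X \<gamma> h)"
    by (rule sum.cong[OF refl])
  also have "\<dots> = tp_scale (of_real (fact n)) (\<Phi> X \<gamma> h)"
    by (simp add: tp_sum_const card_perms)
  finally have sum: "(\<Sum>\<sigma>\<in>perms n. g n (\<sigma> \<circ> \<alpha> \<circ> inv \<sigma>) (tensor_perm n \<sigma> (word n (h \<circ> inv e)))) =
      tp_scale (of_real (fact n)) (\<Phi> X \<gamma> h)" .
  have "diagram X \<gamma> h = tp_scale (of_real (1 / fact n))
      (\<Sum>\<sigma>\<in>perms n. elem_tensor n (\<sigma> \<circ> \<alpha> \<circ> inv \<sigma>) (tensor_perm n \<sigma> (word n (h \<circ> inv e))))"
    using diagram_numbering[OF X \<gamma> e, of h] by (simp add: sym_tensor_def \<alpha>_def n_def)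
  then have "tp_ext c g (diagram X \<gamma> h) = tp_scale (of_real (1 / fact n)) (tp_scale (of_real (fact n)) (\<Phi> X \<gamma> h))"
    by (simp only: tp_ext_scale_real[OF g c] tp_ext_sum[OF g] tp_ext_elem[OF g] sum)
  also have "\<dots> = \<Phi> X \<gamma> h" by simp
  finally show ?thesis .
qed

section \<open>Contractions, products and adjoints of diagrams\<close>

definition tp_bilinear_ext ::
  "(nat \<Rightarrow> nat \<Rightarrow> (nat \<Rightarrow> nat) \<Rightarrow> (nat \<Rightarrow> nat) \<Rightarrow> 'a::real_inner tensor_space \<Rightarrow> 'a tensor_space \<Rightarrow> 'a tp)
    \<Rightarrow> 'a tp \<Rightarrow> 'a tp \<Rightarrow> 'a tp" where
  "tp_bilinear_ext b \<xi> \<eta> = tp_ext \<i> (\<lambda>n \<alpha> F. tp_ext \<i> (\<lambda>k \<beta> G. b n k \<alpha> \<beta> F G) \<eta>) \<xi>"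

locale bilinear_op =
  fixes b :: "nat \<Rightarrow> nat \<Rightarrow> (nat \<Rightarrow> nat) \<Rightarrow> (nat \<Rightarrow> nat) \<Rightarrow> 'a::real_inner tensor_space \<Rightarrow> 'a tensor_space \<Rightarrow> 'a tp"
  assumes left: "\<And>n k \<alpha> \<beta> G. real_linear (\<lambda>F. b n k \<alpha> \<beta> F G)"
    and right: "\<And>n k \<alpha> \<beta> F. real_linear (\<lambda>G. b n k \<alpha> \<beta> F G)"
begin

lemma ii: "\<i> * \<i> = -1" by simp

lemma inner_real_linear: "real_linear (\<lambda>F. tp_ext \<i> (\<lambda>k \<beta> G. b n k \<alpha> \<beta> F G) \<eta>)"
  unfolding real_linear_def
proof (intro conjI allI)
  fix F F' and r :: real
  have "(\<lambda>k \<beta>. b n k \<alpha> \<beta> (F + F')) = (\<lambda>k \<beta> G. b n k \<alpha> \<beta> F G + b n k \<alpha> \<beta> F' G)"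
    by (intro ext) (rule real_linearD(1)[OF left])
  then show "tp_ext \<i> (\<lambda>k \<beta>. b n k \<alpha> \<beta> (F + F')) \<eta> =
      tp_ext \<i> (\<lambda>k \<beta>. b n k \<alpha> \<beta> F) \<eta> + tp_ext \<i> (\<lambda>k \<beta>. b n k \<alpha> \<beta> F') \<eta>"
    by (simp only: tp_ext_fun_add)
  have "(\<lambda>k \<beta>. b n k \<alpha> \<beta> (r *\<^sub>R F)) = (\<lambda>k \<beta> G. tp_scale (of_real r) (b n k \<alpha> \<beta> F G))"
    by (intro ext) (rule real_linearD(2)[OF left])
  then show "tp_ext \<i> (\<lambda>k \<beta>. b n k \<alpha> \<beta> (r *\<^sub>R F)) \<eta> =
      tp_scale (of_real r) (tp_ext \<i> (\<lambda>k \<beta>. b n k \<alpha> \<beta> F) \<eta>)"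
    by (simp only: tp_ext_fun_scale)
qed

lemma ext_add_left: "tp_bilinear_ext b (\<xi> + \<xi>') \<eta> = tp_bilinear_ext b \<xi> \<eta> + tp_bilinear_ext b \<xi>' \<eta>"
  unfolding tp_bilinear_ext_def by (rule tp_ext_add[OF inner_real_linear])

lemma ext_scale_left: "tp_bilinear_ext b (tp_scale z \<xi>) \<eta> = tp_scale z (tp_bilinear_ext b \<xi> \<eta>)"
  unfolding tp_bilinear_ext_def
  by (subst tp_ext_scale[OF inner_real_linear ii]) (simp add: complex_eq[symmetric])

lemma ext_add_right: "tp_bilinear_ext b \<xi> (\<eta> + \<eta>') = tp_bilinear_ext b \<xi> \<eta> + tp_bilinear_ext b \<xi> \<eta>'"
  unfolding tp_bilinear_ext_def by (simp add: tp_ext_add[OF right] tp_ext_fun_add)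

lemma ext_scale_right: "tp_bilinear_ext b \<xi> (tp_scale z \<eta>) = tp_scale z (tp_bilinear_ext b \<xi> \<eta>)"
  unfolding tp_bilinear_ext_def
  by (simp add: tp_ext_scale[OF right ii] tp_ext_fun_scale complex_eq[symmetric])

lemma ext_elem: "tp_bilinear_ext b (elem_tensor n \<alpha> F) (elem_tensor k \<beta> G) = b n k \<alpha> \<beta> F G"
  unfolding tp_bilinear_ext_def
  by (subst tp_ext_elem[OF inner_real_linear]) (rule tp_ext_elem[OF right])

lemma ext_sum_left: "tp_bilinear_ext b (\<Sum>i\<in>I. \<xi> i) \<eta> = (\<Sum>i\<in>I. tp_bilinear_ext b (\<xi> i) \<eta>)"
  unfolding tp_bilinear_ext_def by (rule tp_ext_sum[OF inner_real_linear])

lemma ext_zero_right: "tp_bilinear_ext b \<xi> 0 = 0"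
  using ext_scale_right[of \<xi> 0 0] by simp

lemma ext_sum_right: "tp_bilinear_ext b \<xi> (\<Sum>i\<in>I. \<eta> i) = (\<Sum>i\<in>I. tp_bilinear_ext b \<xi> (\<eta> i))"
  by (induction I rule: infinite_finite_induct) (simp_all add: ext_add_right ext_zero_right)

end

lemma word_cong: "(\<And>i. i \<in> {1..n} \<Longrightarrow> h i = h' i) \<Longrightarrow> word n h = word n h'"
  unfolding word_def by (rule arg_cong[of _ _ tensor], rule map_cong) auto

lemma ex_shift:
  obtains s :: "nat \<Rightarrow> nat" where "bij s" "s 0 = 0" "\<And>j. j \<in> {1..k} \<Longrightarrow> s j = n + j"
proof -
  have "inj_on (\<lambda>j. if j = 0 then 0 else n + j) {0..k}" by (auto simp: inj_on_def)
  then obtain s where s: "bij s" "\<And>j. j \<in> {0..k} \<Longrightarrow> s j = (if j = 0 then 0 else n + j)"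
    using extend_to_bij[OF finite_atLeastAtMost] by blast
  have "s 0 = 0" using s(2)[of 0] by simp
  moreover have "s j = n + j" if "j \<in> {1..k}" for j using s(2)[of j] that by simp
  ultimately show ?thesis using that[OF s(1)] by blast
qed

lemma (in bilinear_op) tp_bilinear_ext_diagram:
  assumes word: "\<And>n k \<alpha> \<beta> s h. \<alpha> permutes insert 0 {1..n} \<Longrightarrow> \<beta> permutes insert 0 {1..k} \<Longrightarrow>
      bij s \<Longrightarrow> s 0 = 0 \<Longrightarrow> (\<And>j. j \<in> {1..k} \<Longrightarrow> s j = n + j) \<Longrightarrow>
      b n k \<alpha> \<beta> (word n h) (word k (h \<circ> s)) = \<Phi> {1..n} {n+1..n+k} \<alpha> (s \<circ> \<beta> \<circ> inv s) h"
    and conj: "\<And>\<sigma> X Y \<alpha> \<beta> h. bij \<sigma> \<Longrightarrow> \<sigma> 0 = 0 \<Longrightarrow> finite X \<Longrightarrow> 0 \<notin> X \<Longrightarrow> finite Y \<Longrightarrow> 0 \<notin> Y \<Longrightarrow>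
      \<alpha> permutes insert 0 X \<Longrightarrow> \<beta> permutes insert 0 Y \<Longrightarrow>
      \<Phi> (\<sigma> ` X) (\<sigma> ` Y) (\<sigma> \<circ> \<alpha> \<circ> inv \<sigma>) (\<sigma> \<circ> \<beta> \<circ> inv \<sigma>) (h \<circ> inv \<sigma>) = \<Phi> X Y \<alpha> \<beta> h"
    and X: "finite X" "0 \<notin> X" and Y: "finite Y" "0 \<notin> Y" and XY: "X \<inter> Y = {}"
    and \<alpha>: "\<alpha> permutes insert 0 X" and \<beta>: "\<beta> permutes insert 0 Y"
  shows "tp_bilinear_ext b (diagram X \<alpha> h) (diagram Y \<beta> h) = \<Phi> X Y \<alpha> \<beta> h"
proof -
  define n where "n = card X"
  define k where "k = card Y"
  obtain eX where eX: "bij eX" "eX 0 = 0" "eX ` X = {1..n}" using ex_numbering[OF X] n_def by metis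
  obtain eY where eY: "bij eY" "eY 0 = 0" "eY ` Y = {1..k}" using ex_numbering[OF Y] k_def by metis
  obtain s where s: "bij s" "s 0 = 0" "\<And>j. j \<in> {1..k} \<Longrightarrow> s j = n + j" using ex_shift[of k n] by blast
  have sk: "s ` {1..k} = {n+1..n+k}"
  proof -
    have "s ` {1..k} = (+) n ` {1..k}" using s(3) by (rule image_cong[OF refl])
    then show ?thesis by simp
  qed
  define \<alpha>' where "\<alpha>' = eX \<circ> \<alpha> \<circ> inv eX"
  define \<beta>' where "\<beta>' = eY \<circ> \<beta> \<circ> inv eY"
  have "eX ` insert 0 X = insert 0 {1..n}" "eY ` insert 0 Y = insert 0 {1..k}" using eX eY by auto
  then have \<alpha>': "\<alpha>' permutes insert 0 {1..n}" and \<beta>': "\<beta>' permutes insert 0 {1..k}"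
    using conj_permutes[OF eX(1) \<alpha>] conj_permutes[OF eY(1) \<beta>] by (simp_all only: \<alpha>'_def \<beta>'_def)
  let ?F = "\<lambda>\<sigma>. tensor_perm n \<sigma> (word n (h \<circ> inv eX))"
  let ?G = "\<lambda>\<tau>. tensor_perm k \<tau> (word k (h \<circ> inv eY))"
  have main: "b n k (\<sigma> \<circ> \<alpha>' \<circ> inv \<sigma>) (\<tau> \<circ> \<beta>' \<circ> inv \<tau>) (?F \<sigma>) (?G \<tau>) = \<Phi> X Y \<alpha> \<beta> h"
    if "\<sigma> \<in> perms n" "\<tau> \<in> perms k" for \<sigma> \<tau>
  proof -
    have \<sigma>: "\<sigma> permutes {1..n}" and \<tau>: "\<tau> permutes {1..k}" using that by (simp_all only: perms_def mem_Collect_eq)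
    note b\<sigma> = permutes_bij[OF \<sigma>] and b\<tau> = permutes_bij[OF \<tau>]
    have \<sigma>0: "\<sigma> 0 = 0" and \<tau>0: "\<tau> 0 = 0" using permutes_not_in[OF \<sigma>] permutes_not_in[OF \<tau>] by simp_all
    \<comment> \<open>One bijection that numbers \<open>X\<close> by \<open>\<sigma> eX\<close> and \<open>Y\<close> by \<open>s \<tau> eY\<close>.\<close>
    define f where "f z = (if z \<in> Y then s (\<tau> (eY z)) else \<sigma> (eX z))" for z
    have fX: "\<sigma> (eX z) \<in> {1..n}" if "z \<in> X" for z
      using that eX(3) permutes_in_image[OF \<sigma>] by blast
    have \<tau>eY: "\<tau> (eY z) \<in> {1..k}" if "z \<in> Y" for z
      using that eY(3) permutes_in_image[OF \<tau>] by blast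
    have fY: "s (\<tau> (eY z)) \<in> {n+1..n+k}" if "z \<in> Y" for z
      using \<tau>eY[OF that] sk by blast
    have f0: "f 0 = 0" using Y eX(2) \<sigma>0 by (simp add: f_def)
    have injX: "inj (\<sigma> \<circ> eX)" using bij_comp[OF eX(1) b\<sigma>] by (rule bij_is_inj)
    have injY: "inj (s \<circ> \<tau> \<circ> eY)" using bij_comp[OF eY(1) bij_comp[OF b\<tau> s(1)]] by (simp add: o_assoc bij_is_inj)
    have "inj_on f (insert 0 (X \<union> Y))"
    proof (rule inj_onI)
      fix x y assume x: "x \<in> insert 0 (X \<union> Y)" and y: "y \<in> insert 0 (X \<union> Y)" and eq: "f x = f y"
      have low: "f z \<le> n" if "z \<in> insert 0 (X \<union> Y)" "z \<notin> Y" for z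
      proof (cases "z = 0")
        case False
        then have "z \<in> X" using that by simp
        then show ?thesis using fX[of z] that by (simp add: f_def)
      qed (simp add: f0)
      have high: "f z > n" if "z \<in> Y" for z using fY[OF that] that by (simp add: f_def)
      show "x = y"
      proof (cases "x \<in> Y")
        case True
        then have "y \<in> Y" using low[OF y] high eq by force
        then show ?thesis using injD[OF injY, of x y] True eq by (simp add: f_def)
      next
        case False
        then have "y \<notin> Y" using low[OF x] high eq by force
        then show ?thesis using injD[OF injX, of x y] False eq by (simp add: f_def)
      qed
    qed
    moreover have "finite (insert 0 (X \<union> Y))" using X Y by simp
    ultimately obtain \<rho> where \<rho>: "bij \<rho>" and \<rho>f: "\<And>z. z \<in> insert 0 (X \<union> Y) \<Longrightarrow> \<rho> z = f z"
      by (metis extend_to_bij)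
    have \<rho>0: "\<rho> 0 = 0" using \<rho>f[of 0] f0 by simp
    have \<rho>X: "\<rho> z = (\<sigma> \<circ> eX) z" if "z \<in> insert 0 X" for z
      using that \<rho>f[of z] XY Y by (auto simp: f_def)
    have \<rho>Y: "\<rho> z = (s \<circ> \<tau> \<circ> eY) z" if "z \<in> insert 0 Y" for z
      using that \<rho>f[of z] \<rho>0 s(2) \<tau>0 eY(2) by (auto simp: f_def)
    have imX: "\<rho> ` X = {1..n}"
    proof -
      have "\<rho> ` X = \<sigma> ` eX ` X" unfolding image_image using \<rho>X by (intro image_cong) auto
      then show ?thesis unfolding eX(3) permutes_image[OF \<sigma>] .
    qed
    have imY: "\<rho> ` Y = {n+1..n+k}"
    proof -
      have "\<rho> ` Y = s ` \<tau> ` eY ` Y" unfolding image_image using \<rho>Y by (intro image_cong) auto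
      then show ?thesis unfolding eY(3) permutes_image[OF \<tau>] sk .
    qed
    have cX: "\<rho> \<circ> \<alpha> \<circ> inv \<rho> = \<sigma> \<circ> \<alpha>' \<circ> inv \<sigma>"
      unfolding \<alpha>'_def bij_inv_comp(3)[OF b\<sigma> eX(1)]
      by (rule conj_eqI[OF \<rho> bij_comp[OF eX(1) b\<sigma>] \<alpha> \<rho>X])
    have cY: "\<rho> \<circ> \<beta> \<circ> inv \<rho> = s \<circ> (\<tau> \<circ> \<beta>' \<circ> inv \<tau>) \<circ> inv s"
      unfolding \<beta>'_def bij_inv_comp(3)[OF b\<tau> eY(1)] bij_inv_comp(3)[OF s(1) bij_comp[OF eY(1) b\<tau>]]
      unfolding o_assoc
      by (rule conj_eqI[OF \<rho> bij_comp[OF eY(1) bij_comp[OF b\<tau> s(1)]] \<beta> \<rho>Y])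
    have wX: "?F \<sigma> = word n (h \<circ> inv \<rho>)"
      unfolding tensor_perm_word(2)[OF \<sigma>]
    proof (rule word_cong)
      fix i assume "i \<in> {1..n}"
      then obtain x where x: "x \<in> X" "i = \<rho> x" using imX by blast
      then have "i = \<sigma> (eX x)" using \<rho>X by simp
      then show "(h \<circ> inv eX \<circ> inv \<sigma>) i = (h \<circ> inv \<rho>) i"
        using x(2) inv_f_f[OF bij_is_inj[OF \<rho>]] inv_f_f[OF bij_is_inj[OF b\<sigma>]] inv_f_f[OF bij_is_inj[OF eX(1)]]
        by (metis comp_apply)
    qed
    have wY: "?G \<tau> = word k (h \<circ> inv \<rho> \<circ> s)"
      unfolding tensor_perm_word(2)[OF \<tau>]
    proof (rule word_cong)
      fix i assume "i \<in> {1..k}"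
      then have "s i \<in> \<rho> ` Y" using sk imY by blast
      then obtain x where x: "x \<in> Y" "s i = \<rho> x" by blast
      then have "s i = s (\<tau> (eY x))" using \<rho>Y by simp
      then have "i = \<tau> (eY x)" using injD[OF bij_is_inj[OF s(1)]] by blast
      then show "(h \<circ> inv eY \<circ> inv \<tau>) i = (h \<circ> inv \<rho> \<circ> s) i"
        using x(2) inv_f_f[OF bij_is_inj[OF \<rho>]] inv_f_f[OF bij_is_inj[OF b\<tau>]] inv_f_f[OF bij_is_inj[OF eY(1)]]
        by (metis comp_apply)
    qed
    have i1: "\<sigma> ` insert 0 {1..n} = insert 0 {1..n}" "\<tau> ` insert 0 {1..k} = insert 0 {1..k}"
      using permutes_image[OF \<sigma>] permutes_image[OF \<tau>] \<sigma>0 \<tau>0 by (simp_all only: image_insert)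
    have "b n k (\<sigma> \<circ> \<alpha>' \<circ> inv \<sigma>) (\<tau> \<circ> \<beta>' \<circ> inv \<tau>) (?F \<sigma>) (?G \<tau>) =
        \<Phi> {1..n} {n+1..n+k} (\<sigma> \<circ> \<alpha>' \<circ> inv \<sigma>) (s \<circ> (\<tau> \<circ> \<beta>' \<circ> inv \<tau>) \<circ> inv s) (h \<circ> inv \<rho>)"
      unfolding wX wY
      using conj_permutes[OF b\<sigma> \<alpha>'] conj_permutes[OF b\<tau> \<beta>'] s unfolding i1 by (intro word)
    also have "\<dots> = \<Phi> X Y \<alpha> \<beta> h"
      unfolding cX[symmetric] cY[symmetric] imX[symmetric] imY[symmetric]
      by (rule conj[OF \<rho> \<rho>0 X Y \<alpha> \<beta>])
    finally show ?thesis .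
  qed
  have dX: "diagram X \<alpha> h = tp_scale (1 / fact n) (\<Sum>\<sigma>\<in>perms n. elem_tensor n (\<sigma> \<circ> \<alpha>' \<circ> inv \<sigma>) (?F \<sigma>))"
    using diagram_numbering[OF X \<alpha> eX, of h] by (simp only: sym_tensor_def \<alpha>'_def)
  have dY: "diagram Y \<beta> h = tp_scale (1 / fact k) (\<Sum>\<tau>\<in>perms k. elem_tensor k (\<tau> \<circ> \<beta>' \<circ> inv \<tau>) (?G \<tau>))"
    using diagram_numbering[OF Y \<beta> eY, of h] by (simp only: sym_tensor_def \<beta>'_def)
  have "tp_bilinear_ext b (diagram X \<alpha> h) (diagram Y \<beta> h) = tp_scale (1 / fact k) (tp_scale (1 / fact n)
      (\<Sum>\<tau>\<in>perms k. \<Sum>\<sigma>\<in>perms n. \<Phi> X Y \<alpha> \<beta> h))"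
    unfolding dX dY ext_scale_left ext_scale_right ext_sum_left ext_sum_right ext_elem tp.scale_sum_right[symmetric]
    by (simp only: main cong: sum.cong)
  also have "\<dots> = \<Phi> X Y \<alpha> \<beta> h"
    by (simp add: tp_sum_const card_perms)
  finally show ?thesis .
qed


subsection \<open>Single contractions\<close>

definition contraction :: "real \<Rightarrow> nat set \<Rightarrow> (nat \<Rightarrow> nat) \<Rightarrow> (nat \<Rightarrow> nat) \<Rightarrow> (nat \<Rightarrow> 'a::real_inner) \<Rightarrow> 'a tp" where
  "contraction q X \<pi> \<gamma> h = tp_scale (of_real (q powi expo X \<pi> \<gamma> * weight \<pi> h))
     (diagram (X - supp \<pi>) (perm_avoid (\<pi> \<circ> \<gamma>) (supp \<pi>)) h)"

lemma pairing_avoid_permutes: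
  assumes X: "finite X" "0 \<notin> X" and \<pi>: "\<pi> \<in> pairings_on X" and \<gamma>: "\<gamma> permutes insert 0 X"
  shows "perm_avoid (\<pi> \<circ> \<gamma>) (supp \<pi>) permutes insert 0 (X - supp \<pi>)"
proof -
  have "\<pi> permutes insert 0 X" using pairings_onD(1)[OF \<pi>] by (rule permutes_subset) auto
  then have "\<pi> \<circ> \<gamma> permutes insert 0 X" using \<gamma> by (simp only: permutes_compose)
  moreover have "supp \<pi> \<subseteq> X" using pairings_on_supp[OF \<pi>] by simp
  ultimately have "perm_avoid (\<pi> \<circ> \<gamma>) (supp \<pi>) permutes (insert 0 X - supp \<pi>)"
    using X by (intro perm_avoid_permutes) auto
  moreover have "insert 0 X - supp \<pi> = insert 0 (X - supp \<pi>)" using \<open>supp \<pi> \<subseteq> X\<close> X by auto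
  ultimately show ?thesis by simp
qed

lemma contraction_conj:
  assumes X: "finite X" "0 \<notin> X" and \<pi>: "\<pi> \<in> pairings_on X" and \<gamma>: "\<gamma> permutes insert 0 X"
    and \<sigma>: "bij \<sigma>" "\<sigma> 0 = 0"
  shows "contraction q (\<sigma> ` X) (\<sigma> \<circ> \<pi> \<circ> inv \<sigma>) (\<sigma> \<circ> \<gamma> \<circ> inv \<sigma>) (h \<circ> inv \<sigma>) = contraction q X \<pi> \<gamma> h"
proof -
  note inv = pairings_onD(2)[OF \<pi>]
  have c: "\<sigma> \<circ> \<pi> \<circ> inv \<sigma> \<circ> (\<sigma> \<circ> \<gamma> \<circ> inv \<sigma>) = \<sigma> \<circ> (\<pi> \<circ> \<gamma>) \<circ> inv \<sigma>"
    using bij_is_inj[OF \<sigma>(1)] by (simp add: fun_eq_iff)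
  have d: "\<sigma> ` X - \<sigma> ` supp \<pi> = \<sigma> ` (X - supp \<pi>)"
    using bij_is_inj[OF \<sigma>(1)] by (simp add: image_set_diff)
  have "diagram (\<sigma> ` (X - supp \<pi>)) (\<sigma> \<circ> perm_avoid (\<pi> \<circ> \<gamma>) (supp \<pi>) \<circ> inv \<sigma>) (h \<circ> inv \<sigma>) =
      diagram (X - supp \<pi>) (perm_avoid (\<pi> \<circ> \<gamma>) (supp \<pi>)) h"
    using X pairing_avoid_permutes[OF X \<pi> \<gamma>] \<sigma> by (intro diagram_conj) auto
  then show ?thesis
    unfolding contraction_def supp_conj[OF \<sigma>(1)] c d perm_avoid_conj[OF \<sigma>(1)]
      expo_conj[OF \<sigma> inv] weight_num_pairs_conj(1)[OF \<sigma>(1) inv] by (rule arg_cong)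
qed

lemma contraction_cong:
  assumes X: "finite X" and \<pi>: "\<pi> \<in> pairings_on X" and h: "\<And>x. x \<in> X \<Longrightarrow> h x = h' x"
  shows "contraction q X \<pi> \<gamma> h = contraction q X \<pi> \<gamma> h'"
proof -
  have "weight \<pi> h = weight \<pi> h'"
    using pairings_on_supp[OF \<pi>] h by (intro weight_cong pairings_onD(2)[OF \<pi>]) auto
  moreover have "diagram (X - supp \<pi>) (perm_avoid (\<pi> \<circ> \<gamma>) (supp \<pi>)) h = diagram (X - supp \<pi>) (perm_avoid (\<pi> \<circ> \<gamma>) (supp \<pi>)) h'"
    using X h by (intro diagram_cong) auto
  ultimately show ?thesis by (simp only: contraction_def)
qed

lemma sym_tensor_contraction:
  assumes \<pi>: "\<pi> \<in> pairings_on {1..m}"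
  shows "sym_tensor (m - 2 * num_pairs \<pi>) (contract_perm m \<pi> \<gamma>) (q powi contract_exp m \<pi> \<gamma> *\<^sub>R
      (weight \<pi> h *\<^sub>R tensor (map h (filter (\<lambda>i. \<pi> i = i) [1..<Suc m])))) = contraction q {1..m} \<pi> \<gamma> h"
proof -
  note s = pairings_on_supp[OF \<pi>]
  have fin: "finite (supp \<pi>)" using s(1) finite_subset by blast
  have c: "card ({1..m} - supp \<pi>) = m - 2 * num_pairs \<pi>"
    using s(1) fin card_supp[of \<pi>, OF pairings_onD(2)[OF \<pi>] fin] by (simp add: card_Diff_subset)
  have z: "{0..m} - supp \<pi> = insert 0 ({1..m} - supp \<pi>)"
    using s(1) by (auto simp: Suc_le_eq)
  have "filter (\<lambda>i. \<pi> i = i) [1..<Suc m] = sorted_list_of_set ({1..m} - supp \<pi>)"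
  proof (rule sorted_distinct_set_unique)
    show "sorted (filter (\<lambda>i. \<pi> i = i) [1..<Suc m])" by (rule sorted_wrt_filter) (simp del: upt_Suc)
    show "set (filter (\<lambda>i. \<pi> i = i) [1..<Suc m]) = set (sorted_list_of_set ({1..m} - supp \<pi>))"
      by (auto simp: supp_def simp del: upt_Suc)
  qed (simp_all del: upt_Suc)
  then show ?thesis
    unfolding contraction_def diagram_def c contract_perm_def z real_linearD(2)[OF real_linear_sym_tensor] contract_exp_eq
    by (simp only: tp.scale_scale of_real_mult)
qed

lemma conj_pairings:
  assumes \<sigma>: "bij \<sigma>"
  shows "bij_betw (\<lambda>\<pi>. \<sigma> \<circ> \<pi> \<circ> inv \<sigma>) (pairings_on X) (pairings_on (\<sigma> ` X))"
    and "bij_betw (\<lambda>\<pi>. \<sigma> \<circ> \<pi> \<circ> inv \<sigma>) (bipairings X Y) (bipairings (\<sigma> ` X) (\<sigma> ` Y))"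
proof -
  have i: "inv \<sigma> (\<sigma> x) = x" "\<sigma> (inv \<sigma> x) = x" for x
    using inv_f_f[OF bij_is_inj[OF \<sigma>]] surj_f_inv_f[OF bij_is_surj[OF \<sigma>]] by simp_all
  have ii: "inv (inv \<sigma>) = \<sigma>" using \<sigma> by (rule inv_inv_eq)
  have b': "bij (inv \<sigma>)" using \<sigma> by (rule bij_imp_bij_inv)
  have p: "\<tau> \<circ> \<pi> \<circ> inv \<tau> \<in> pairings_on (\<tau> ` Z)" if "bij \<tau>" "\<pi> \<in> pairings_on Z" for \<tau> \<pi> Z
    using conj_permutes[OF that(1) pairings_onD(1)[OF that(2)]] pairings_onD(2)[OF that(2)]
      inv_f_f[OF bij_is_inj[OF that(1)]] surj_f_inv_f[OF bij_is_surj[OF that(1)]]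
    by (simp add: pairings_on_def fun_eq_iff)
  have q: "\<tau> \<circ> \<pi> \<circ> inv \<tau> \<in> bipairings (\<tau> ` Z) (\<tau> ` Z')" if "bij \<tau>" "\<pi> \<in> bipairings Z Z'" for \<tau> \<pi> Z Z'
    using p[OF that(1), of \<pi> "Z \<union> Z'"] that(2) inv_f_f[OF bij_is_inj[OF that(1)]] inj_image_mem_iff[OF bij_is_inj[OF that(1)]]
    by (auto simp add: bipairings_def image_Un)
  have u1: "inv \<sigma> \<circ> (\<sigma> \<circ> \<pi> \<circ> inv \<sigma>) \<circ> inv (inv \<sigma>) = \<pi>" for \<pi> by (simp add: fun_eq_iff i ii)
  have u2: "\<sigma> \<circ> (inv \<sigma> \<circ> \<pi> \<circ> inv (inv \<sigma>)) \<circ> inv \<sigma> = \<pi>" for \<pi> by (simp add: fun_eq_iff i ii)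
  have im: "inv \<sigma> ` \<sigma> ` Z = Z" for Z by (simp add: image_image i)
  show "bij_betw (\<lambda>\<pi>. \<sigma> \<circ> \<pi> \<circ> inv \<sigma>) (pairings_on X) (pairings_on (\<sigma> ` X))"
  proof (rule bij_betw_byWitness[where f' = "\<lambda>\<pi>. inv \<sigma> \<circ> \<pi> \<circ> inv (inv \<sigma>)"])
    show "(\<lambda>\<pi>. \<sigma> \<circ> \<pi> \<circ> inv \<sigma>) ` (pairings_on X) \<subseteq> pairings_on (\<sigma> ` X)"
      using p[OF \<sigma>] by blast
    show "(\<lambda>\<pi>. inv \<sigma> \<circ> \<pi> \<circ> inv (inv \<sigma>)) ` (pairings_on (\<sigma> ` X)) \<subseteq> pairings_on X"
      using p[OF b', of _ "\<sigma> ` X"] unfolding im by blast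
  qed (simp_all only: u1 u2 refl ball_triv simp_thms)
  show "bij_betw (\<lambda>\<pi>. \<sigma> \<circ> \<pi> \<circ> inv \<sigma>) (bipairings X Y) (bipairings (\<sigma> ` X) (\<sigma> ` Y))"
  proof (rule bij_betw_byWitness[where f' = "\<lambda>\<pi>. inv \<sigma> \<circ> \<pi> \<circ> inv (inv \<sigma>)"])
    show "(\<lambda>\<pi>. \<sigma> \<circ> \<pi> \<circ> inv \<sigma>) ` (bipairings X Y) \<subseteq> bipairings (\<sigma> ` X) (\<sigma> ` Y)"
      using q[OF \<sigma>] by blast
    show "(\<lambda>\<pi>. inv \<sigma> \<circ> \<pi> \<circ> inv (inv \<sigma>)) ` (bipairings (\<sigma> ` X) (\<sigma> ` Y)) \<subseteq> bipairings X Y"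
      using q[OF b', of _ "\<sigma> ` X" "\<sigma> ` Y"] unfolding im by blast
  qed (simp_all only: u1 u2 refl ball_triv simp_thms)
qed


subsection \<open>The operations\<close>

lemma i_squared: "\<i> * \<i> = -1" "(- \<i>) * (- \<i>) = -1" by simp_all

lemma W_elem_tensor: "W (elem_tensor n \<alpha> F) = sym_tensor n \<alpha> F"
  unfolding W_def lin_ext_eq by (rule tp_ext_elem[OF real_linear_sym_tensor])

lemma W_diagram:
  assumes "finite X" "0 \<notin> X" "\<gamma> permutes insert 0 X"
  shows "W (diagram X \<gamma> h) = diagram X \<gamma> h"
  unfolding W_def lin_ext_eq
  by (rule tp_ext_diagram[where \<Phi> = diagram, OF real_linear_sym_tensor i_squared(1) diagram_word[symmetric] diagram_conj assms])

lemma T_elem_real_linear: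
  "real_linear (\<lambda>F. \<Sum>\<pi>\<in>pairings n. W (contract q n \<pi> \<alpha> F))"
proof -
  have "linear (\<lambda>F. q powi e *\<^sub>R contract_tensor n \<pi> F :: 'a tensor_space)" if "\<pi> \<in> pairings n" for \<pi> e
    using contract_tensor_word(1)[of \<pi> n] that unfolding pairings_eq by (intro linear_compose_scale_right)
  then show ?thesis
    unfolding contract_def W_elem_tensor by (intro real_linear_sum real_linear_comp[OF real_linear_sym_tensor])
qed

lemma T_diagram:
  assumes X: "finite X" "0 \<notin> X" "\<gamma> permutes insert 0 X"
  shows "T q (diagram X \<gamma> h) = (\<Sum>\<pi>\<in>pairings_on X. contraction q X \<pi> \<gamma> h)"
proof -
  have "T q (diagram X \<gamma> h) = tp_ext \<i> (\<lambda>n \<alpha> F. \<Sum>\<pi>\<in>pairings n. W (contract q n \<pi> \<alpha> F)) (diagram X \<gamma> h)"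
    by (simp only: T_def lin_ext_eq)
  also have "\<dots> = (\<Sum>\<pi>\<in>pairings_on X. contraction q X \<pi> \<gamma> h)"
  proof (rule tp_ext_diagram[OF _ i_squared(1) _ _ X])
    show "real_linear (\<lambda>F :: 'a tensor_space. \<Sum>\<pi>\<in>pairings n. W (contract q n \<pi> \<alpha> F))" for n \<alpha>
      by (rule T_elem_real_linear)
    show "(\<Sum>\<pi>\<in>pairings n. W (contract q n \<pi> \<alpha> (word n h))) =
      (\<Sum>\<pi>\<in>pairings_on {1..n}. contraction q {1..n} \<pi> \<alpha> h)" for n \<alpha> and h :: "nat \<Rightarrow> 'a"
      unfolding pairings_eq contract_def W_elem_tensor
      by (rule sum.cong[OF refl], subst contract_tensor_word(2), assumption, rule sym_tensor_contraction)
    show "(\<Sum>\<pi>\<in>pairings_on (\<sigma> ` X). contraction q (\<sigma> ` X) \<pi> (\<sigma> \<circ> \<alpha> \<circ> inv \<sigma>) (h \<circ> inv \<sigma>)) =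
        (\<Sum>\<pi>\<in>pairings_on X. contraction q X \<pi> \<alpha> h)"
      if "bij \<sigma>" "\<sigma> 0 = 0" "finite X" "0 \<notin> X" "\<alpha> permutes insert 0 X" for \<sigma> X \<alpha> and h :: "nat \<Rightarrow> 'a"
      unfolding sum.reindex_bij_betw[OF conj_pairings(1)[OF that(1), of X], symmetric]
      using that by (intro sum.cong refl contraction_conj)
  qed
  finally show ?thesis .
qed

lemma flip_diagram:
  assumes X: "finite X" "0 \<notin> X" "\<gamma> permutes insert 0 X"
  shows "flip (diagram X \<gamma> h) = diagram X (inv \<gamma>) h"
  unfolding flip_def antilin_ext_eq
proof (rule tp_ext_diagram[OF real_linear_sym_tensor i_squared(2) _ _ X])
  show "sym_tensor n (inv \<alpha>) (word n h) = diagram {1..n} (inv \<alpha>) h"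
    if "\<alpha> permutes insert 0 {1..n}" for n \<alpha> and h :: "nat \<Rightarrow> 'a"
    by (rule diagram_word[OF permutes_inv[OF that], symmetric])
  show "diagram (\<sigma> ` X) (inv (\<sigma> \<circ> \<alpha> \<circ> inv \<sigma>)) (h \<circ> inv \<sigma>) = diagram X (inv \<alpha>) h"
    if "bij \<sigma>" "\<sigma> 0 = 0" "finite X" "0 \<notin> X" "\<alpha> permutes insert 0 X" for \<sigma> X \<alpha> and h :: "nat \<Rightarrow> 'a"
  proof -
    note b = permutes_bij[OF that(5)]
    have "inv (\<sigma> \<circ> \<alpha> \<circ> inv \<sigma>) = \<sigma> \<circ> inv \<alpha> \<circ> inv \<sigma>"
      unfolding o_inv_distrib[OF bij_comp[OF b that(1)] bij_imp_bij_inv[OF that(1)]]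
        o_inv_distrib[OF that(1) b] inv_inv_eq[OF that(1)] by (simp only: o_assoc)
    then show ?thesis
      using diagram_conj[OF that(3,4) permutes_inv[OF that(5)] that(1,2), of h] by (simp only:)
  qed
qed

lemma perm_cup_conj:
  assumes "\<beta> permutes insert 0 {1..k}" "bij s" "s 0 = 0" "\<And>j. j \<in> {1..k} \<Longrightarrow> s j = n + j"
  shows "perm_cup n k \<alpha> \<beta> = s \<circ> \<beta> \<circ> inv s \<circ> \<alpha>"
proof -
  have "insert 0 {1..k} = {0..k}" by auto
  then have "map_permutation {0..k} (\<lambda>j. if j = 0 then 0 else n + j) \<beta> = s \<circ> \<beta> \<circ> inv s"
    using assms by (intro map_permutation_conj) auto
  then show ?thesis by (simp only: perm_cup_def)
qed

lemma glue_shift: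
  assumes "\<And>j. j \<in> {1..k} \<Longrightarrow> s j = n + j" "i \<in> {1..n+k}"
  shows "glue n h (h \<circ> s) i = h i"
proof (cases "i \<le> n")
  case False
  then have "i - n \<in> {1..k}" using assms(2) by auto
  then have "s (i - n) = i" using assms(1)[of "i - n"] False by simp
  with False show ?thesis by (simp add: glue_def)
qed (simp add: glue_def)

abbreviation cup_elem where
  "cup_elem n k \<alpha> \<beta> F G \<equiv> sym_tensor (n + k) (perm_cup n k \<alpha> \<beta>) (tensor_mult n k F G)"

lemma cup_eq: "cup = tp_bilinear_ext cup_elem"
  by (simp only: fun_eq_iff cup_def tp_bilinear_ext_def lin_ext_eq) simp

interpretation cup: bilinear_op cup_elem
  using bounded_bilinear.bounded_linear_left[OF tensor_mult_word(1)] bounded_bilinear.bounded_linear_right[OF tensor_mult_word(1)]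
  by unfold_locales (intro real_linear_comp[OF real_linear_sym_tensor] bounded_linear.linear; assumption)+

lemma comp_conj:
  assumes "bij \<sigma>"
  shows "\<sigma> \<circ> \<beta> \<circ> inv \<sigma> \<circ> (\<sigma> \<circ> \<alpha> \<circ> inv \<sigma>) = \<sigma> \<circ> (\<beta> \<circ> \<alpha>) \<circ> inv \<sigma>"
  using inv_f_f[OF bij_is_inj[OF assms]] by (simp add: fun_eq_iff)

lemma comp_permutes_union:
  assumes "\<alpha> permutes insert 0 X" "\<beta> permutes insert 0 Y"
  shows "\<beta> \<circ> \<alpha> permutes insert 0 (X \<union> Y)"
  by (rule permutes_compose; rule permutes_subset[OF assms(1)] permutes_subset[OF assms(2)]) auto

lemma cup_diagram:
  assumes X: "finite X" "0 \<notin> X" and Y: "finite Y" "0 \<notin> Y" and XY: "X \<inter> Y = {}"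
    and \<alpha>: "\<alpha> permutes insert 0 X" and \<beta>: "\<beta> permutes insert 0 Y"
  shows "cup (diagram X \<alpha> h) (diagram Y \<beta> h) = diagram (X \<union> Y) (\<beta> \<circ> \<alpha>) h"
  unfolding cup_eq
proof (rule cup.tp_bilinear_ext_diagram[OF _ _ X Y XY \<alpha> \<beta>])
  show "cup_elem n k \<alpha> \<beta> (word n h) (word k (h \<circ> s)) = diagram ({1..n} \<union> {n+1..n+k}) (s \<circ> \<beta> \<circ> inv s \<circ> \<alpha>) h"
    if "\<alpha> permutes insert 0 {1..n}" "\<beta> permutes insert 0 {1..k}" "bij s" "s 0 = 0"
      "\<And>j. j \<in> {1..k} \<Longrightarrow> s j = n + j" for n k \<alpha> \<beta> s and h :: "nat \<Rightarrow> 'a"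
  proof -
    have u: "{1..n} \<union> {n+1..n+k} = {1..n+k}" by auto
    have sk: "s ` insert 0 {1..k} = insert 0 {n+1..n+k}"
    proof -
      have "s ` {1..k} = (+) n ` {1..k}" using that(5) by (rule image_cong[OF refl])
      then show ?thesis using that(4) by (simp add: add.commute)
    qed
    have p: "s \<circ> \<beta> \<circ> inv s \<circ> \<alpha> permutes insert 0 {1..n+k}"
      using comp_permutes_union[OF that(1) conj_permutes[OF that(3,2), unfolded sk]] unfolding u .
    have w: "word (n + k) (glue n h (h \<circ> s)) = word (n + k) h"
      by (rule word_cong, rule glue_shift[OF that(5)])
    have pc: "perm_cup n k \<alpha> \<beta> = s \<circ> \<beta> \<circ> inv s \<circ> \<alpha>"
      using that(2-5) by (rule perm_cup_conj)
    show ?thesis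
      unfolding tensor_mult_word(2) pc u w diagram_word[OF p] ..
  qed
  show "diagram (\<sigma> ` X \<union> \<sigma> ` Y) (\<sigma> \<circ> \<beta> \<circ> inv \<sigma> \<circ> (\<sigma> \<circ> \<alpha> \<circ> inv \<sigma>)) (h \<circ> inv \<sigma>) = diagram (X \<union> Y) (\<beta> \<circ> \<alpha>) h"
    if "bij \<sigma>" "\<sigma> 0 = 0" "finite X" "0 \<notin> X" "finite Y" "0 \<notin> Y" "\<alpha> permutes insert 0 X" "\<beta> permutes insert 0 Y"
    for \<sigma> X Y \<alpha> \<beta> and h :: "nat \<Rightarrow> 'a"
    unfolding comp_conj[OF that(1)] image_Un[symmetric]
    using that comp_permutes_union[OF that(7,8)] by (intro diagram_conj) auto
qed

text \<open>
  The product in terms of \<open>W\<close>: only contractions between the two factors occur. Every term is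
  bounded in the tensors, so that this formula makes sense on the Hilbert space tensor powers.
\<close>

definition mul_elem ::
  "real \<Rightarrow> nat \<Rightarrow> nat \<Rightarrow> (nat \<Rightarrow> nat) \<Rightarrow> (nat \<Rightarrow> nat) \<Rightarrow> 'a::real_inner tensor_space \<Rightarrow> 'a tensor_space \<Rightarrow> 'a tp" where
  "mul_elem q n k \<alpha> \<beta> F G = (\<Sum>\<pi>\<in>bipairings {1..n} {n+1..n+k}.
     sym_tensor (n + k - 2 * num_pairs \<pi>) (contract_perm (n + k) \<pi> (perm_cup n k \<alpha> \<beta>))
       (q powi contract_exp (n + k) \<pi> (perm_cup n k \<alpha> \<beta>) *\<^sub>R cross_contract n k \<pi> F G))"

definition mul :: "real \<Rightarrow> 'a::real_inner tp \<Rightarrow> 'a tp \<Rightarrow> 'a tp" where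
  "mul q = tp_bilinear_ext (mul_elem q)"

interpretation mul: bilinear_op "mul_elem q" for q
proof
  fix n k and \<alpha> \<beta> :: "nat \<Rightarrow> nat" and F G :: "'a::real_inner tensor_space"
  have "linear (\<lambda>F. c *\<^sub>R cross_contract n k \<pi> F G)" "linear (\<lambda>G. c *\<^sub>R cross_contract n k \<pi> F G)"
    if "\<pi> \<in> bipairings {1..n} {n+1..n+k}" for \<pi> c
    using bounded_bilinear.bounded_linear_left[OF cross_contract_word(1)[OF that], of G]
      bounded_bilinear.bounded_linear_right[OF cross_contract_word(1)[OF that], of F]
    by (simp_all add: linear_compose_scale_right bounded_linear.linear)
  then show "real_linear (\<lambda>F. mul_elem q n k \<alpha> \<beta> F G)" "real_linear (\<lambda>G. mul_elem q n k \<alpha> \<beta> F G)"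
    unfolding mul_elem_def by (intro real_linear_sum real_linear_comp[OF real_linear_sym_tensor]; blast)+
qed

lemma mul_elem_word:
  assumes \<beta>: "\<beta> permutes insert 0 {1..k}" and s: "bij s" "s 0 = 0" "\<And>j. j \<in> {1..k} \<Longrightarrow> s j = n + j"
  shows "mul_elem q n k \<alpha> \<beta> (word n h) (word k g) = (\<Sum>\<pi>\<in>bipairings {1..n} {n+1..n+k}.
    contraction q ({1..n} \<union> {n+1..n+k}) \<pi> (s \<circ> \<beta> \<circ> inv s \<circ> \<alpha>) (glue n h g))"
proof -
  have pc: "perm_cup n k \<alpha> \<beta> = s \<circ> \<beta> \<circ> inv s \<circ> \<alpha>" using \<beta> s by (rule perm_cup_conj)
  show ?thesis
    unfolding mul_elem_def pc
  proof (intro sum.cong refl)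
  fix \<pi> assume \<pi>: "\<pi> \<in> bipairings {1..n} {n+1..n+k}"
  have u: "{1..n} \<union> {n+1..n+k} = {1..n+k}" by auto
  have p: "\<pi> \<in> pairings_on {1..n+k}" using bipairings_subset[of "{1..n}" "{n+1..n+k}"] \<pi> unfolding u by blast
  show "sym_tensor (n + k - 2 * num_pairs \<pi>) (contract_perm (n + k) \<pi> (s \<circ> \<beta> \<circ> inv s \<circ> \<alpha>))
     (q powi contract_exp (n + k) \<pi> (s \<circ> \<beta> \<circ> inv s \<circ> \<alpha>) *\<^sub>R cross_contract n k \<pi> (word n h) (word k g)) =
    contraction q ({1..n} \<union> {n+1..n+k}) \<pi> (s \<circ> \<beta> \<circ> inv s \<circ> \<alpha>) (glue n h g)"
    by (simp only: u cross_contract_word(2)[OF \<pi>] sym_tensor_contraction[OF p])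
  qed
qed

lemma mul_diagram:
  assumes X: "finite X" "0 \<notin> X" and Y: "finite Y" "0 \<notin> Y" and XY: "X \<inter> Y = {}"
    and \<alpha>: "\<alpha> permutes insert 0 X" and \<beta>: "\<beta> permutes insert 0 Y"
  shows "mul q (diagram X \<alpha> h) (diagram Y \<beta> h) = (\<Sum>\<pi>\<in>bipairings X Y. contraction q (X \<union> Y) \<pi> (\<beta> \<circ> \<alpha>) h)"
  unfolding mul_def
proof (rule mul.tp_bilinear_ext_diagram[where
      \<Phi> = "\<lambda>X Y \<alpha> \<beta> h. \<Sum>\<pi>\<in>bipairings X Y. contraction q (X \<union> Y) \<pi> (\<beta> \<circ> \<alpha>) h", OF _ _ X Y XY \<alpha> \<beta>])
  show "mul_elem q n k \<alpha> \<beta> (word n h) (word k (h \<circ> s)) =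
      (\<Sum>\<pi>\<in>bipairings {1..n} {n+1..n+k}. contraction q ({1..n} \<union> {n+1..n+k}) \<pi> (s \<circ> \<beta> \<circ> inv s \<circ> \<alpha>) h)"
    if "\<alpha> permutes insert 0 {1..n}" "\<beta> permutes insert 0 {1..k}" "bij s" "s 0 = 0"
      "\<And>j. j \<in> {1..k} \<Longrightarrow> s j = n + j" for n k \<alpha> \<beta> s and h :: "nat \<Rightarrow> 'a"
  proof -
    have w: "mul_elem q n k \<alpha> \<beta> (word n h) (word k (h \<circ> s)) = (\<Sum>\<pi>\<in>bipairings {1..n} {n+1..n+k}.
        contraction q ({1..n} \<union> {n+1..n+k}) \<pi> (s \<circ> \<beta> \<circ> inv s \<circ> \<alpha>) (glue n h (h \<circ> s)))"
      using that(2-5) by (rule mul_elem_word)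
    have u: "{1..n} \<union> {n+1..n+k} = {1..n+k}" by auto
    show ?thesis
      unfolding w
    proof (intro sum.cong refl)
      fix \<pi> assume \<pi>: "\<pi> \<in> bipairings {1..n} {n+1..n+k}"
      have p: "\<pi> \<in> pairings_on {1..n+k}" using bipairings_subset[of "{1..n}" "{n+1..n+k}"] \<pi> unfolding u by blast
      show "contraction q ({1..n} \<union> {n+1..n+k}) \<pi> (s \<circ> \<beta> \<circ> inv s \<circ> \<alpha>) (glue n h (h \<circ> s)) =
          contraction q ({1..n} \<union> {n+1..n+k}) \<pi> (s \<circ> \<beta> \<circ> inv s \<circ> \<alpha>) h"
        unfolding u by (rule contraction_cong[OF finite_atLeastAtMost p glue_shift[OF that(5)]])
    qed
  qed
  show "(\<Sum>\<pi>\<in>bipairings (\<sigma> ` X) (\<sigma> ` Y). contraction q (\<sigma> ` X \<union> \<sigma> ` Y) \<pi>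
        (\<sigma> \<circ> \<beta> \<circ> inv \<sigma> \<circ> (\<sigma> \<circ> \<alpha> \<circ> inv \<sigma>)) (h \<circ> inv \<sigma>)) =
      (\<Sum>\<pi>\<in>bipairings X Y. contraction q (X \<union> Y) \<pi> (\<beta> \<circ> \<alpha>) h)"
    if "bij \<sigma>" "\<sigma> 0 = 0" "finite X" "0 \<notin> X" "finite Y" "0 \<notin> Y" "\<alpha> permutes insert 0 X" "\<beta> permutes insert 0 Y"
    for \<sigma> X Y \<alpha> \<beta> and h :: "nat \<Rightarrow> 'a"
    unfolding comp_conj[OF that(1)] image_Un[symmetric]
      sum.reindex_bij_betw[OF conj_pairings(2)[OF that(1), of X Y], symmetric]
  proof (rule sum.cong[OF refl])
    fix \<pi> assume "\<pi> \<in> bipairings X Y"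
    then have "\<pi> \<in> pairings_on (X \<union> Y)" using bipairings_subset by blast
    then show "contraction q (\<sigma> ` (X \<union> Y)) (\<sigma> \<circ> \<pi> \<circ> inv \<sigma>) (\<sigma> \<circ> (\<beta> \<circ> \<alpha>) \<circ> inv \<sigma>) (h \<circ> inv \<sigma>) =
        contraction q (X \<union> Y) \<pi> (\<beta> \<circ> \<alpha>) h"
      using that comp_permutes_union[OF that(7,8)] by (intro contraction_conj) auto
  qed
qed

section \<open>The algebra on the algebraic tensors\<close>

definition labelled :: "nat set \<Rightarrow> (nat \<Rightarrow> nat) \<Rightarrow> bool" where
  "labelled X \<gamma> \<longleftrightarrow> finite X \<and> 0 \<notin> X \<and> \<gamma> permutes insert 0 X"

lemma labelledD:
  assumes "labelled X \<gamma>"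
  shows "finite X" "0 \<notin> X" "\<gamma> permutes insert 0 X"
  using assms by (simp_all add: labelled_def)

definition diagrams :: "'a::real_inner tp set" where
  "diagrams = {diagram X \<gamma> h |X \<gamma> h. labelled X \<gamma>}"

lemma perms0_labelled: "\<alpha> \<in> perms0 n \<longleftrightarrow> labelled {1..n} \<alpha>"
proof -
  have "{0..n} = insert 0 {1..n}" by auto
  then show ?thesis by (simp add: perms0_def labelled_def)
qed

lemma diagram_sym_tensor:
  assumes "labelled X \<gamma>"
  obtains \<alpha> g where "\<alpha> \<in> perms0 (card X)" "diagram X \<gamma> h = sym_tensor (card X) \<alpha> (word (card X) g)"
proof -
  note D = labelledD[OF assms]
  obtain e where e: "bij e" "e 0 = 0" "e ` X = {1..card X}" using ex_numbering[OF D(1,2)] by blast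
  have "e ` insert 0 X = insert 0 {1..card X}" using e by simp
  then have "e \<circ> \<gamma> \<circ> inv e permutes insert 0 {1..card X}"
    using conj_permutes[OF e(1) D(3)] by simp
  then have "e \<circ> \<gamma> \<circ> inv e \<in> perms0 (card X)"
    by (simp add: perms0_labelled labelled_def)
  then show ?thesis using that diagram_numbering[OF D e] by blast
qed

lemma TP_eq: "TP = tp.span diagrams"
proof (rule antisym)
  have "sym_tensor n \<alpha> F \<in> tp.span diagrams" if "\<alpha> \<in> perms0 n" "F \<in> alg_power n"
    for n \<alpha> and F :: "'a tensor_space"
    using that(2)
  proof (induction rule: alg_power_induct)
    case (add F G)
    then show ?case by (simp only: real_linearD(1)[OF real_linear_sym_tensor] tp.span_add)
  next
    case (scale r F)
    then show ?case by (simp only: real_linearD(2)[OF real_linear_sym_tensor] tp.span_scale)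
  next
    case (word h)
    have l: "labelled {1..n} \<alpha>" using that(1) by (simp only: perms0_labelled)
    then have "sym_tensor n \<alpha> (word n h) = diagram {1..n} \<alpha> h"
      by (intro diagram_word[symmetric] labelledD(3))
    with l show ?case unfolding diagrams_def by (intro tp.span_base) blast
  qed
  then show "TP \<subseteq> tp.span (diagrams :: 'a tp set)"
    unfolding TP_def by (intro tp.span_minimal) (auto simp: tp.subspace_span)
  have "diagram X \<gamma> h \<in> TP" if l: "labelled X \<gamma>" for X \<gamma> and h :: "nat \<Rightarrow> 'a"
  proof -
    obtain \<alpha> g where a: "\<alpha> \<in> perms0 (card X)" "diagram X \<gamma> h = sym_tensor (card X) \<alpha> (word (card X) g)"
      using l by (rule diagram_sym_tensor)
    moreover have "word (card X) g \<in> alg_power (card X)"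
      unfolding alg_power_word by (intro span_base) simp
    ultimately show ?thesis unfolding TP_def by (intro tp.span_base) blast
  qed
  then show "tp.span diagrams \<subseteq> (TP :: 'a tp set)"
    unfolding diagrams_def by (intro tp.span_minimal) (auto simp: TP_def tp.subspace_span)
qed

lemma TP_induct [consumes 1, case_names add scale diagram]:
  assumes "\<xi> \<in> TP"
    and add: "\<And>\<xi> \<eta>. P \<xi> \<Longrightarrow> P \<eta> \<Longrightarrow> P (\<xi> + \<eta>)" and scale: "\<And>z \<xi>. P \<xi> \<Longrightarrow> P (tp_scale z \<xi>)"
    and diagram: "\<And>X \<gamma> h. labelled X \<gamma> \<Longrightarrow> P (diagram X \<gamma> h)"
  shows "P \<xi>"
  using assms(1) unfolding TP_eq
proof (induction rule: tp.span_induct_alt)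
  case base
  have "labelled {} id" by (simp add: labelled_def permutes_id)
  then show ?case using scale[OF diagram, of _ _ 0] by simp
next
  case (step c x y)
  then show ?case using add scale diagram unfolding diagrams_def by blast
qed

lemma TP_closed:
  "0 \<in> TP" "\<xi> \<in> TP \<Longrightarrow> \<eta> \<in> TP \<Longrightarrow> \<xi> + \<eta> \<in> TP" "\<xi> \<in> TP \<Longrightarrow> \<eta> \<in> TP \<Longrightarrow> \<xi> - \<eta> \<in> TP"
  "\<xi> \<in> TP \<Longrightarrow> tp_scale z \<xi> \<in> TP" "(\<And>i. i \<in> I \<Longrightarrow> \<zeta> i \<in> TP) \<Longrightarrow> sum \<zeta> I \<in> TP"
  "labelled X \<gamma> \<Longrightarrow> diagram X \<gamma> h \<in> TP"
  unfolding TP_eq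
  by (auto intro: tp.span_zero tp.span_add tp.span_diff tp.span_scale tp.span_sum tp.span_base simp: diagrams_def)

text \<open>
  Shifting the labels of one diagram away from those of the others makes them disjoint, and
  vectors attached to disjoint label sets fit into one labelling.
\<close>

lemma diagram_avoid:
  assumes l: "labelled X \<gamma>" and V: "finite V"
  obtains Y \<delta> g where "labelled Y \<delta>" "Y \<inter> V = {}" "diagram X \<gamma> h = diagram Y \<delta> g"
proof -
  note D = labelledD[OF l]
  obtain m where m: "\<And>v. v \<in> V \<Longrightarrow> v < m"
    using finite_nat_set_iff_bounded[of V] V by auto
  have inj: "inj_on (\<lambda>x. if x = 0 then 0 else m + x) (insert 0 X)" by (auto simp: inj_on_def)
  have fin: "finite (insert 0 X)" using D by simp
  obtain \<sigma> where s: "bij \<sigma>" "\<And>x. x \<in> insert 0 X \<Longrightarrow> \<sigma> x = (if x = 0 then 0 else m + x)"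
    using extend_to_bij[OF fin inj] by blast
  have s0: "\<sigma> 0 = 0" using s(2)[of 0] by simp
  have sX: "\<sigma> x = m + x" if "x \<in> X" for x using s(2)[of x] that D(2) by auto
  have Z: "\<sigma> ` insert 0 X = insert 0 (\<sigma> ` X)" using s0 by simp
  have "0 \<notin> \<sigma> ` X" using sX D(2) by (auto simp: image_iff)
  then have "labelled (\<sigma> ` X) (\<sigma> \<circ> \<gamma> \<circ> inv \<sigma>)"
    using D(1) conj_permutes[OF s(1) D(3)] unfolding Z labelled_def by blast
  moreover have "\<sigma> ` X \<inter> V = {}" using sX m by fastforce
  moreover have "diagram X \<gamma> h = diagram (\<sigma> ` X) (\<sigma> \<circ> \<gamma> \<circ> inv \<sigma>) (h \<circ> inv \<sigma>)"
    by (rule diagram_conj[OF D s(1) s0, symmetric])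
  ultimately show ?thesis by (rule that)
qed

lemma diagram_common2:
  assumes "labelled X \<alpha>" "labelled Y \<beta>" "finite V"
  obtains Y' \<beta>' h where "labelled Y' \<beta>'" "X \<inter> Y' = {}" "V \<inter> Y' = {}"
    "diagram X \<alpha> f = diagram X \<alpha> h" "diagram Y \<beta> g = diagram Y' \<beta>' h" "\<forall>x. x \<notin> Y' \<longrightarrow> h x = f x"
proof -
  have "finite (X \<union> V)" using labelledD(1)[OF assms(1)] assms(3) by simp
  then obtain Y' \<beta>' g' where Y: "labelled Y' \<beta>'" "Y' \<inter> (X \<union> V) = {}" "diagram Y \<beta> g = diagram Y' \<beta>' g'"
    by (rule diagram_avoid[OF assms(2)])
  define h where "h x = (if x \<in> Y' then g' x else f x)" for x
  have "diagram X \<alpha> f = diagram X \<alpha> h"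
    using Y(2) labelledD(1)[OF assms(1)] by (intro diagram_cong) (auto simp: h_def)
  moreover have "diagram Y \<beta> g = diagram Y' \<beta>' h"
    unfolding Y(3) using labelledD(1)[OF Y(1)] by (intro diagram_cong) (auto simp: h_def)
  moreover have "X \<inter> Y' = {}" "V \<inter> Y' = {}" using Y(2) by auto
  moreover have "\<forall>x. x \<notin> Y' \<longrightarrow> h x = f x" by (simp add: h_def)
  ultimately show ?thesis using that[OF Y(1)] by blast
qed

lemma diagram_common3:
  assumes "labelled X \<alpha>" "labelled Y \<beta>" "labelled Z \<gamma>"
  obtains Y' \<beta>' Z' \<gamma>' h where "labelled Y' \<beta>'" "labelled Z' \<gamma>'" "X \<inter> Y' = {}" "X \<inter> Z' = {}" "Y' \<inter> Z' = {}"
    "diagram X \<alpha> f = diagram X \<alpha> h" "diagram Y \<beta> g = diagram Y' \<beta>' h" "diagram Z \<gamma> k = diagram Z' \<gamma>' h"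
proof -
  obtain Y' \<beta>' h where 1: "labelled Y' \<beta>'" "X \<inter> Y' = {}" "diagram X \<alpha> f = diagram X \<alpha> h" "diagram Y \<beta> g = diagram Y' \<beta>' h"
    by (rule diagram_common2[OF assms(1,2) finite.emptyI, of f g]) (rule that; assumption)
  obtain Z' \<gamma>' h' where 2: "labelled Z' \<gamma>'" "X \<inter> Z' = {}" "Y' \<inter> Z' = {}"
    "diagram X \<alpha> h = diagram X \<alpha> h'" "diagram Z \<gamma> k = diagram Z' \<gamma>' h'" "\<forall>x. x \<notin> Z' \<longrightarrow> h' x = h x"
    by (rule diagram_common2[OF assms(1,3) labelledD(1)[OF 1(1)], of h k]) (rule that; assumption)
  have "diagram Y' \<beta>' h = diagram Y' \<beta>' h'"
    using 2(3,6) labelledD(1)[OF 1(1)] by (intro diagram_cong) auto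
  then show ?thesis using that[OF 1(1) 2(1) 1(2) 2(2,3)] 1(3,4) 2(4,5) by simp
qed

lemma pairings_on_iff: "\<pi> \<in> pairings_on X \<longleftrightarrow> (\<forall>x. \<pi> (\<pi> x) = x) \<and> (\<forall>x. x \<notin> X \<longrightarrow> \<pi> x = x)"
proof
  assume "\<pi> \<in> pairings_on X"
  then show "(\<forall>x. \<pi> (\<pi> x) = x) \<and> (\<forall>x. x \<notin> X \<longrightarrow> \<pi> x = x)"
    using pairings_onD(1,2) permutes_not_in by metis
next
  assume a: "(\<forall>x. \<pi> (\<pi> x) = x) \<and> (\<forall>x. x \<notin> X \<longrightarrow> \<pi> x = x)"
  have "\<exists>!x. \<pi> x = y" for y
  proof
    show "\<pi> (\<pi> y) = y" using a by blast
    show "x = \<pi> y" if "\<pi> x = y" for x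
    proof -
      have "\<pi> (\<pi> x) = x" using a by blast
      with that show ?thesis by simp
    qed
  qed
  then have "\<pi> permutes X" using a unfolding permutes_def by blast
  then show "\<pi> \<in> pairings_on X" using a by (simp add: pairings_on_def fun_eq_iff)
qed

text \<open>
  A pairing of \<open>X \<union> Y\<close> consists of a pairing inside \<open>X\<close>, one inside \<open>Y\<close>, and a pairing between
  the points that these leave over.
\<close>

lemma pairings_decompose:
  assumes XY: "X \<inter> Y = {}"
  shows "bij_betw (\<lambda>(\<pi>, \<rho>, \<tau>). \<tau> \<circ> (\<rho> \<circ> \<pi>))
    (SIGMA \<pi>:pairings_on X. SIGMA \<rho>:pairings_on Y. bipairings (X - supp \<pi>) (Y - supp \<rho>))
    (pairings_on (X \<union> Y))"
proof -
  define part where "part A \<omega> x = (if x \<in> A \<and> \<omega> x \<in> A then \<omega> x else x)" for A :: "nat set" and \<omega> x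
  define cross where "cross \<omega> x = (if x \<in> X \<and> \<omega> x \<in> Y \<or> x \<in> Y \<and> \<omega> x \<in> X then \<omega> x else x)" for \<omega> x
  let ?S = "SIGMA \<pi>:pairings_on X. SIGMA \<rho>:pairings_on Y. bipairings (X - supp \<pi>) (Y - supp \<rho>)"
  have bip: "\<tau> \<in> bipairings (X - supp \<pi>) (Y - supp \<rho>) \<longleftrightarrow> (\<forall>x. \<tau> (\<tau> x) = x) \<and>
      (\<forall>x. x \<notin> X - supp \<pi> \<union> (Y - supp \<rho>) \<longrightarrow> \<tau> x = x) \<and>
      (\<forall>x\<in>X - supp \<pi>. \<tau> x \<in> X - supp \<pi> \<longrightarrow> \<tau> x = x) \<and> (\<forall>y\<in>Y - supp \<rho>. \<tau> y \<in> Y - supp \<rho> \<longrightarrow> \<tau> y = y)"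
    for \<tau> \<pi> \<rho> by (auto simp: bipairings_def pairings_on_iff)
  have inS: "\<tau> (\<rho> (\<pi> z)) = (if z \<in> supp \<pi> then \<pi> z else if z \<in> supp \<rho> then \<rho> z else \<tau> z) \<and>
      (\<forall>z. z \<in> supp \<pi> \<longrightarrow> z \<in> X \<and> \<pi> z \<in> X) \<and> (\<forall>z. z \<in> supp \<rho> \<longrightarrow> z \<in> Y \<and> \<rho> z \<in> Y) \<and>
      (\<forall>z. \<tau> z \<noteq> z \<longrightarrow> z \<notin> supp \<pi> \<and> z \<notin> supp \<rho> \<and> (z \<in> X \<and> \<tau> z \<in> Y \<or> z \<in> Y \<and> \<tau> z \<in> X))"
    if "(\<pi>, \<rho>, \<tau>) \<in> ?S" for \<pi> \<rho> \<tau> z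
  proof -
    have p: "\<pi> \<in> pairings_on X" and r: "\<rho> \<in> pairings_on Y" and t: "\<tau> \<in> bipairings (X - supp \<pi>) (Y - supp \<rho>)"
      using that by auto
    have sp: "z \<in> X \<and> \<pi> z \<in> supp \<pi> \<and> \<pi> z \<in> X" if "z \<in> supp \<pi>" for z
      using pairings_on_supp[OF p] that by blast
    have sr: "z \<in> Y \<and> \<rho> z \<in> supp \<rho> \<and> \<rho> z \<in> Y" if "z \<in> supp \<rho>" for z
      using pairings_on_supp[OF r] that by blast
    have tp: "\<tau> \<in> pairings_on (X - supp \<pi> \<union> (Y - supp \<rho>))" using t bipairings_subset by blast
    have st: "z \<notin> supp \<pi> \<and> z \<notin> supp \<rho> \<and> (z \<in> X \<and> \<tau> z \<in> Y \<or> z \<in> Y \<and> \<tau> z \<in> X)" if "\<tau> z \<noteq> z" for z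
    proof -
      have z: "z \<in> supp \<tau>" using that by (simp add: supp_def)
      then have m: "z \<in> X - supp \<pi> \<union> (Y - supp \<rho>)" "\<tau> z \<in> X - supp \<pi> \<union> (Y - supp \<rho>)"
        using pairings_on_supp[OF tp] by blast+
      moreover have "\<not> (z \<in> X - supp \<pi> \<and> \<tau> z \<in> X - supp \<pi>)" "\<not> (z \<in> Y - supp \<rho> \<and> \<tau> z \<in> Y - supp \<rho>)"
        using t that unfolding bip by blast+
      moreover have "z \<notin> supp \<rho>" if "z \<in> X" using sr[of z] that XY by blast
      moreover have "z \<notin> supp \<pi>" if "z \<in> Y" using sp[of z] that XY by blast
      ultimately show ?thesis by blast
    qed
    have nf: "\<pi> z = z" if "z \<notin> supp \<pi>" for z using that by (simp add: supp_def)
    have nr: "\<rho> z = z" if "z \<notin> supp \<rho>" for z using that by (simp add: supp_def)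
    have "\<tau> (\<rho> (\<pi> z)) = (if z \<in> supp \<pi> then \<pi> z else if z \<in> supp \<rho> then \<rho> z else \<tau> z)"
    proof (cases "z \<in> supp \<pi>")
      case True
      then have "\<pi> z \<notin> supp \<rho>" using sp[of z] sr[of "\<pi> z"] XY by blast
      moreover have "\<tau> (\<pi> z) = \<pi> z" using st[of "\<pi> z"] sp[OF True] by blast
      ultimately show ?thesis using True nr by simp
    next
      case False
      have "\<tau> (\<rho> z) = \<rho> z" if "z \<in> supp \<rho>" using st[of "\<rho> z"] sr[OF that] by blast
      then show ?thesis using False nf nr by simp
    qed
    then show ?thesis using sp sr st by blast
  qed
  show ?thesis
  proof (rule bij_betw_byWitness[where f' = "\<lambda>\<omega>. (part X \<omega>, part Y \<omega>, cross \<omega>)"])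
    show "\<forall>a\<in>?S. (\<lambda>\<omega>. (part X \<omega>, part Y \<omega>, cross \<omega>)) ((\<lambda>(\<pi>, \<rho>, \<tau>). \<tau> \<circ> (\<rho> \<circ> \<pi>)) a) = a"
    proof
      fix a assume a: "a \<in> ?S"
      obtain \<pi> \<rho> \<tau> where a': "a = (\<pi>, \<rho>, \<tau>)" by (cases a)
      have m: "(\<pi>, \<rho>, \<tau>) \<in> ?S" using a unfolding a' .
      have e: "(\<tau> \<circ> (\<rho> \<circ> \<pi>)) z = (if z \<in> supp \<pi> then \<pi> z else if z \<in> supp \<rho> then \<rho> z else \<tau> z)" for z
        using inS[OF m, of z] by simp
      have s: "z \<in> supp \<pi> \<Longrightarrow> z \<in> X \<and> \<pi> z \<in> X" "z \<in> supp \<rho> \<Longrightarrow> z \<in> Y \<and> \<rho> z \<in> Y"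
        "\<tau> z \<noteq> z \<Longrightarrow> z \<notin> supp \<pi> \<and> z \<notin> supp \<rho> \<and> (z \<in> X \<and> \<tau> z \<in> Y \<or> z \<in> Y \<and> \<tau> z \<in> X)"
        "z \<notin> supp \<pi> \<Longrightarrow> \<pi> z = z" "z \<notin> supp \<rho> \<Longrightarrow> \<rho> z = z" for z
        using inS[OF m, of z] by (auto simp: supp_def)
      have "part X (\<tau> \<circ> (\<rho> \<circ> \<pi>)) z = \<pi> z" for z
        unfolding part_def e using s[of z] XY by (cases "\<tau> z = z") (auto split: if_splits)
      moreover have "part Y (\<tau> \<circ> (\<rho> \<circ> \<pi>)) z = \<rho> z" for z
        unfolding part_def e using s[of z] XY by (cases "\<tau> z = z") (auto split: if_splits)
      moreover have "cross (\<tau> \<circ> (\<rho> \<circ> \<pi>)) z = \<tau> z" for z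
        unfolding cross_def e using s[of z] XY by (cases "\<tau> z = z") (auto split: if_splits)
      ultimately have "part X (\<tau> \<circ> (\<rho> \<circ> \<pi>)) = \<pi> \<and> part Y (\<tau> \<circ> (\<rho> \<circ> \<pi>)) = \<rho> \<and> cross (\<tau> \<circ> (\<rho> \<circ> \<pi>)) = \<tau>"
        by (simp only: fun_eq_iff simp_thms)
      then show "(\<lambda>\<omega>. (part X \<omega>, part Y \<omega>, cross \<omega>)) ((\<lambda>(\<pi>, \<rho>, \<tau>). \<tau> \<circ> (\<rho> \<circ> \<pi>)) a) = a"
        unfolding a' by (simp only: split_conv simp_thms)
    qed
    have dec: "(part X \<omega>, part Y \<omega>, cross \<omega>) \<in> ?S \<and> cross \<omega> \<circ> (part Y \<omega> \<circ> part X \<omega>) = \<omega>"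
      if \<omega>: "\<omega> \<in> pairings_on (X \<union> Y)" for \<omega>
    proof -
      have inv: "\<omega> (\<omega> x) = x" and out: "x \<notin> X \<Longrightarrow> x \<notin> Y \<Longrightarrow> \<omega> x = x" for x
        using \<omega> by (auto simp: pairings_on_iff)
      have im: "\<omega> x \<in> X \<or> \<omega> x \<in> Y" if "x \<in> X \<or> x \<in> Y" for x
        using out[of "\<omega> x"] inv[of x] that by metis
      have pp: "part A \<omega> \<in> pairings_on A" for A
        unfolding pairings_on_iff by (auto simp: part_def inv)
      have cc: "cross \<omega> (cross \<omega> x) = x" for x
        unfolding cross_def using XY by (auto simp: inv)
      have "cross \<omega> \<in> bipairings (X - supp (part X \<omega>)) (Y - supp (part Y \<omega>))"
        unfolding bip
      proof (intro conjI allI ballI impI cc)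
        fix x assume "x \<notin> X - supp (part X \<omega>) \<union> (Y - supp (part Y \<omega>))"
        then show "cross \<omega> x = x" using XY by (auto simp: cross_def supp_def part_def split: if_splits)
      next
        fix x assume "x \<in> X - supp (part X \<omega>)" "cross \<omega> x \<in> X - supp (part X \<omega>)"
        then show "cross \<omega> x = x" using XY by (auto simp: cross_def split: if_splits)
      next
        fix x assume "x \<in> Y - supp (part Y \<omega>)" "cross \<omega> x \<in> Y - supp (part Y \<omega>)"
        then show "cross \<omega> x = x" using XY by (auto simp: cross_def split: if_splits)
      qed
      then have S: "(part X \<omega>, part Y \<omega>, cross \<omega>) \<in> ?S" using pp by blast
      moreover have "cross \<omega> (part Y \<omega> (part X \<omega> x)) = \<omega> x" for x
      proof -
        have e: "cross \<omega> (part Y \<omega> (part X \<omega> x)) =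
            (if part X \<omega> x \<noteq> x then part X \<omega> x else if part Y \<omega> x \<noteq> x then part Y \<omega> x else cross \<omega> x)"
          using inS[OF S, of x] unfolding supp_def mem_Collect_eq by blast
        consider "x \<in> X" "\<omega> x \<in> X" | "x \<in> Y" "\<omega> x \<in> Y" | "x \<in> X" "\<omega> x \<in> Y" | "x \<in> Y" "\<omega> x \<in> X"
          | "x \<notin> X" "x \<notin> Y" using im[of x] by blast
        then show ?thesis
        proof cases
          case 1
          then have "x \<notin> Y" "\<omega> x \<notin> Y" using XY by blast+
          with 1 show ?thesis unfolding e by (simp add: part_def cross_def)
        next
          case 2
          then have "x \<notin> X" "\<omega> x \<notin> X" using XY by blast+
          with 2 show ?thesis unfolding e by (simp add: part_def cross_def)
        next
          case 3
          then have "x \<notin> Y" "\<omega> x \<notin> X" using XY by blast+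
          with 3 show ?thesis unfolding e by (simp add: part_def cross_def)
        next
          case 4
          then have "x \<notin> X" "\<omega> x \<notin> Y" using XY by blast+
          with 4 show ?thesis unfolding e by (simp add: part_def cross_def)
        next
          case 5
          then show ?thesis using out[of x] unfolding e by (simp add: part_def cross_def)
        qed
      qed
      ultimately show ?thesis by (simp add: fun_eq_iff)
    qed
    then show "\<forall>\<omega>\<in>pairings_on (X \<union> Y). (\<lambda>(\<pi>, \<rho>, \<tau>). \<tau> \<circ> (\<rho> \<circ> \<pi>)) (part X \<omega>, part Y \<omega>, cross \<omega>) = \<omega>"
      "(\<lambda>\<omega>. (part X \<omega>, part Y \<omega>, cross \<omega>)) ` pairings_on (X \<union> Y) \<subseteq> ?S"
      by auto
    have "\<tau> \<circ> (\<rho> \<circ> \<pi>) \<in> pairings_on (X \<union> Y)" if "(\<pi>, \<rho>, \<tau>) \<in> ?S" for \<pi> \<rho> \<tau>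
    proof -
      have p: "\<pi> permutes X" "\<rho> permutes Y" using that pairings_onD(1) by auto
      have inv: "\<pi> (\<pi> z) = z" "\<rho> (\<rho> z) = z" "\<tau> (\<tau> z) = z" for z
        using that bip by (auto simp: pairings_on_iff)
      have e: "(\<tau> \<circ> (\<rho> \<circ> \<pi>)) z = (if z \<in> supp \<pi> then \<pi> z else if z \<in> supp \<rho> then \<rho> z else \<tau> z)" for z
        using inS[OF that, of z] by simp
      have s: "z \<in> supp \<pi> \<Longrightarrow> z \<in> X \<and> \<pi> z \<in> X" "z \<in> supp \<rho> \<Longrightarrow> z \<in> Y \<and> \<rho> z \<in> Y"
        "\<tau> z \<noteq> z \<Longrightarrow> z \<notin> supp \<pi> \<and> z \<notin> supp \<rho> \<and> (z \<in> X \<and> \<tau> z \<in> Y \<or> z \<in> Y \<and> \<tau> z \<in> X)" for z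
        using inS[OF that, of z] by blast+
      have im: "\<pi> z \<in> supp \<pi> \<longleftrightarrow> z \<in> supp \<pi>" "\<rho> z \<in> supp \<rho> \<longleftrightarrow> z \<in> supp \<rho>" "\<tau> (\<tau> z) = \<tau> z \<longleftrightarrow> \<tau> z = z" for z
        using inv unfolding supp_def mem_Collect_eq by metis+
      have "(\<tau> \<circ> (\<rho> \<circ> \<pi>)) ((\<tau> \<circ> (\<rho> \<circ> \<pi>)) z) = z" for z
      proof -
        consider "z \<in> supp \<pi>" | "z \<in> supp \<rho>" "z \<notin> supp \<pi>" | "z \<notin> supp \<pi>" "z \<notin> supp \<rho>" by blast
        then show ?thesis
        proof cases
          case 1
          then show ?thesis unfolding e by (simp add: im inv)
        next
          case 2
          then have "\<rho> z \<notin> supp \<pi>" using s(1)[of "\<rho> z"] s(2)[of z] XY by blast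
          with 2 show ?thesis unfolding e by (simp add: im inv)
        next
          case 3
          then have "\<tau> z \<notin> supp \<pi> \<and> \<tau> z \<notin> supp \<rho>"
            using s(3)[of "\<tau> z"] im(3)[of z] by (cases "\<tau> z = z") simp_all
          with 3 show ?thesis unfolding e by (simp add: inv)
        qed
      qed
      moreover have "(\<tau> \<circ> (\<rho> \<circ> \<pi>)) z = z" if "z \<notin> X \<union> Y" for z
        unfolding e using s[of z] that by auto
      ultimately show ?thesis unfolding pairings_on_iff by blast
    qed
    then show "(\<lambda>(\<pi>, \<rho>, \<tau>). \<tau> \<circ> (\<rho> \<circ> \<pi>)) ` ?S \<subseteq> pairings_on (X \<union> Y)" by auto
  qed
qed

text \<open>
  Exponents, weights and restricted permutations all compose, so contracting within the two
  factors and then between what is left of them is one contraction of the juxtaposed diagram.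
\<close>

lemma contraction_contraction:
  assumes q: "q \<noteq> 0" and X: "finite X" "0 \<notin> X" and Y: "finite Y" "0 \<notin> Y" and XY: "X \<inter> Y = {}"
    and \<alpha>: "\<alpha> permutes insert 0 X" and \<beta>: "\<beta> permutes insert 0 Y"
    and \<pi>: "\<pi> \<in> pairings_on X" and \<rho>: "\<rho> \<in> pairings_on Y"
    and \<tau>: "\<tau> \<in> bipairings (X - supp \<pi>) (Y - supp \<rho>)"
  shows "tp_scale (of_real (q powi expo X \<pi> \<alpha> * weight \<pi> h)) (tp_scale (of_real (q powi expo Y \<rho> \<beta> * weight \<rho> h))
      (contraction q ((X - supp \<pi>) \<union> (Y - supp \<rho>)) \<tau>
        (perm_avoid (\<rho> \<circ> \<beta>) (supp \<rho>) \<circ> perm_avoid (\<pi> \<circ> \<alpha>) (supp \<pi>)) h))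
    = contraction q (X \<union> Y) (\<tau> \<circ> (\<rho> \<circ> \<pi>)) (\<beta> \<circ> \<alpha>) h"
proof -
  have sX: "supp \<pi> \<subseteq> X" "supp \<rho> \<subseteq> Y" using pairings_on_supp[OF \<pi>] pairings_on_supp[OF \<rho>] by auto
  have fin: "finite (supp \<pi>)" "finite (supp \<rho>)" using sX X Y by (meson finite_subset)+
  have dis: "supp \<rho> \<inter> supp \<pi> = {}" using sX XY by blast
  note inv = pairings_onD(2)[OF \<rho>] pairings_onD(2)[OF \<pi>]
  have s: "supp (\<rho> \<circ> \<pi>) = supp \<rho> \<union> supp \<pi>" by (rule disjoint_supp(3)[OF inv dis])
  have \<omega>: "\<rho> \<circ> \<pi> \<in> pairings_on (X \<union> Y)"
    unfolding pairings_on_iff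
  proof (intro conjI allI impI)
    show "(\<rho> \<circ> \<pi>) ((\<rho> \<circ> \<pi>) x) = x" for x
      using disjoint_supp(2)[of \<rho> \<pi>, OF inv dis] by simp
    show "(\<rho> \<circ> \<pi>) x = x" if "x \<notin> X \<union> Y" for x
      using that permutes_not_in[OF pairings_onD(1)[OF \<pi>]] permutes_not_in[OF pairings_onD(1)[OF \<rho>]] by simp
  qed
  have rest: "(X - supp \<pi>) \<union> (Y - supp \<rho>) = X \<union> Y - supp (\<rho> \<circ> \<pi>)"
    unfolding s using sX XY by blast
  have \<tau>': "\<tau> \<in> pairings_on (X \<union> Y - supp (\<rho> \<circ> \<pi>))"
    using \<tau> bipairings_subset unfolding rest[symmetric] by blast
  have XY': "finite (X \<union> Y)" "0 \<notin> X \<union> Y" using X Y by auto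
  note C = expo_compose[OF XY' \<omega> comp_permutes_union[OF \<alpha> \<beta>] \<tau>']
  note P = expo_product[OF X Y XY \<pi> \<rho> \<alpha> \<beta>]
  have dis': "supp \<tau> \<inter> supp (\<rho> \<circ> \<pi>) = {}" using pairings_on_supp(1)[OF \<tau>'] by blast
  have fin': "finite (supp \<tau>)" "finite (supp (\<rho> \<circ> \<pi>))"
    using pairings_on_supp(1)[OF \<tau>'] XY' fin s by (auto intro: finite_subset)
  have inv': "\<tau> (\<tau> i) = i" "(\<rho> \<circ> \<pi>) ((\<rho> \<circ> \<pi>) i) = i" for i
    using pairings_onD(2)[OF \<tau>'] pairings_onD(2)[OF \<omega>] by blast+
  have w: "weight (\<tau> \<circ> (\<rho> \<circ> \<pi>)) h = weight \<tau> h * (weight \<rho> h * weight \<pi> h)"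
    unfolding disjoint_weight_num_pairs(1)[of \<tau> "\<rho> \<circ> \<pi>", OF inv' dis' fin']
      disjoint_weight_num_pairs(1)[of \<rho> \<pi>, OF inv dis fin(2,1)] ..
  have s': "supp (\<tau> \<circ> (\<rho> \<circ> \<pi>)) = supp \<tau> \<union> supp (\<rho> \<circ> \<pi>)"
    by (rule disjoint_supp(3)[of \<tau> "\<rho> \<circ> \<pi>", OF inv' dis'])
  have rest': "X \<union> Y - supp (\<rho> \<circ> \<pi>) - supp \<tau> = X \<union> Y - supp (\<tau> \<circ> (\<rho> \<circ> \<pi>))"
    unfolding s' by blast
  have coeff: "(q powi expo X \<pi> \<alpha> * weight \<pi> h) * (q powi expo Y \<rho> \<beta> * weight \<rho> h) *
      (q powi expo (X \<union> Y - supp (\<rho> \<circ> \<pi>)) \<tau> (perm_avoid (\<rho> \<circ> \<pi> \<circ> (\<beta> \<circ> \<alpha>)) (supp (\<rho> \<circ> \<pi>))) * weight \<tau> h)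
      = q powi expo (X \<union> Y) (\<tau> \<circ> (\<rho> \<circ> \<pi>)) (\<beta> \<circ> \<alpha>) * weight (\<tau> \<circ> (\<rho> \<circ> \<pi>)) h"
    unfolding C(2)[symmetric] P(2)[symmetric] w using q by (simp add: power_int_add)
  show ?thesis
    unfolding contraction_def rest P(1) tp.scale_scale of_real_mult[symmetric] rest' C(1) coeff[symmetric]
    by (simp only: mult.assoc)
qed

lemma sum_sigma3:
  assumes "finite A" "finite B" "\<And>a b. a \<in> A \<Longrightarrow> b \<in> B \<Longrightarrow> finite (C a b)"
  shows "(\<Sum>a\<in>A. \<Sum>b\<in>B. \<Sum>c\<in>C a b. f a b c) = (\<Sum>(a, b, c)\<in>(SIGMA a:A. SIGMA b:B. C a b). f a b c)"
proof -
  have "(\<Sum>a\<in>A. \<Sum>b\<in>B. \<Sum>c\<in>C a b. f a b c) = (\<Sum>a\<in>A. \<Sum>(b, c)\<in>(SIGMA b:B. C a b). f a b c)"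
    using assms by (intro sum.cong refl sum.Sigma) auto
  also have "\<dots> = (\<Sum>(a, bc)\<in>(SIGMA a:A. SIGMA b:B. C a b). case bc of (b, c) \<Rightarrow> f a b c)"
    using assms by (intro sum.Sigma) auto
  finally show ?thesis .
qed

lemma finite_bipairings: "finite X \<Longrightarrow> finite Y \<Longrightarrow> finite (bipairings X Y)"
  by (rule finite_subset[OF bipairings_subset]) (simp add: finite_pairings_on)

text \<open>
  Each pairing of \<open>X \<union> Y\<close> arises exactly once from pairings inside the factors followed by a pairing
  between them. The inner ones make up the two factors \<open>T\<close>, which leaves the pairings between
  the factors as those of the product.
\<close>

lemma mul_T_diagram:
  assumes q: "q \<noteq> 0" and X: "finite X" "0 \<notin> X" and Y: "finite Y" "0 \<notin> Y" and XY: "X \<inter> Y = {}"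
    and \<alpha>: "\<alpha> permutes insert 0 X" and \<beta>: "\<beta> permutes insert 0 Y"
  shows "mul q (T q (diagram X \<alpha> h)) (T q (diagram Y \<beta> h)) = T q (cup (diagram X \<alpha> h) (diagram Y \<beta> h))"
proof -
  let ?S = "SIGMA \<pi>:pairings_on X. SIGMA \<rho>:pairings_on Y. bipairings (X - supp \<pi>) (Y - supp \<rho>)"
  let ?c = "\<lambda>X \<pi> \<alpha>. of_real (q powi expo X \<pi> \<alpha> * weight \<pi> h)"
  have step: "mul q (contraction q X \<pi> \<alpha> h) (contraction q Y \<rho> \<beta> h) =
      (\<Sum>\<tau>\<in>bipairings (X - supp \<pi>) (Y - supp \<rho>). contraction q (X \<union> Y) (\<tau> \<circ> (\<rho> \<circ> \<pi>)) (\<beta> \<circ> \<alpha>) h)"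
    if \<pi>: "\<pi> \<in> pairings_on X" and \<rho>: "\<rho> \<in> pairings_on Y" for \<pi> \<rho>
  proof -
    have "mul q (diagram (X - supp \<pi>) (perm_avoid (\<pi> \<circ> \<alpha>) (supp \<pi>)) h) (diagram (Y - supp \<rho>) (perm_avoid (\<rho> \<circ> \<beta>) (supp \<rho>)) h)
      = (\<Sum>\<tau>\<in>bipairings (X - supp \<pi>) (Y - supp \<rho>). contraction q ((X - supp \<pi>) \<union> (Y - supp \<rho>)) \<tau>
          (perm_avoid (\<rho> \<circ> \<beta>) (supp \<rho>) \<circ> perm_avoid (\<pi> \<circ> \<alpha>) (supp \<pi>)) h)"
      using X Y XY by (intro mul_diagram pairing_avoid_permutes \<pi> \<rho> \<alpha> \<beta>) auto
    then have "mul q (contraction q X \<pi> \<alpha> h) (contraction q Y \<rho> \<beta> h) =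
      tp_scale (?c Y \<rho> \<beta>) (tp_scale (?c X \<pi> \<alpha>) (\<Sum>\<tau>\<in>bipairings (X - supp \<pi>) (Y - supp \<rho>). contraction q ((X - supp \<pi>) \<union> (Y - supp \<rho>)) \<tau>
          (perm_avoid (\<rho> \<circ> \<beta>) (supp \<rho>) \<circ> perm_avoid (\<pi> \<circ> \<alpha>) (supp \<pi>)) h))"
      unfolding contraction_def[of q X \<pi>] contraction_def[of q Y \<rho>] mul_def mul.ext_scale_left mul.ext_scale_right
      by (simp only:)
    also have "\<dots> = (\<Sum>\<tau>\<in>bipairings (X - supp \<pi>) (Y - supp \<rho>). tp_scale (?c X \<pi> \<alpha>) (tp_scale (?c Y \<rho> \<beta>) (contraction q ((X - supp \<pi>) \<union> (Y - supp \<rho>)) \<tau>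
          (perm_avoid (\<rho> \<circ> \<beta>) (supp \<rho>) \<circ> perm_avoid (\<pi> \<circ> \<alpha>) (supp \<pi>)) h)))"
      unfolding tp.scale_sum_right tp.scale_left_commute[of "?c Y \<rho> \<beta>"] ..
    also have "\<dots> = (\<Sum>\<tau>\<in>bipairings (X - supp \<pi>) (Y - supp \<rho>). contraction q (X \<union> Y) (\<tau> \<circ> (\<rho> \<circ> \<pi>)) (\<beta> \<circ> \<alpha>) h)"
      by (intro sum.cong refl contraction_contraction q X Y XY \<alpha> \<beta> \<pi> \<rho>)
    finally show ?thesis .
  qed
  have "mul q (T q (diagram X \<alpha> h)) (T q (diagram Y \<beta> h)) =
      (\<Sum>\<rho>\<in>pairings_on Y. \<Sum>\<pi>\<in>pairings_on X. mul q (contraction q X \<pi> \<alpha> h) (contraction q Y \<rho> \<beta> h))"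
    unfolding T_diagram[OF X \<alpha>] T_diagram[OF Y \<beta>] mul_def mul.ext_sum_right mul.ext_sum_left ..
  also have "\<dots> = (\<Sum>\<pi>\<in>pairings_on X. \<Sum>\<rho>\<in>pairings_on Y. mul q (contraction q X \<pi> \<alpha> h) (contraction q Y \<rho> \<beta> h))"
    by (rule sum.swap)
  also have "\<dots> = (\<Sum>\<pi>\<in>pairings_on X. \<Sum>\<rho>\<in>pairings_on Y. \<Sum>\<tau>\<in>bipairings (X - supp \<pi>) (Y - supp \<rho>).
      contraction q (X \<union> Y) (\<tau> \<circ> (\<rho> \<circ> \<pi>)) (\<beta> \<circ> \<alpha>) h)"
    by (intro sum.cong refl step)
  also have "\<dots> = (\<Sum>(\<pi>, \<rho>, \<tau>)\<in>?S. contraction q (X \<union> Y) (\<tau> \<circ> (\<rho> \<circ> \<pi>)) (\<beta> \<circ> \<alpha>) h)"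
    using X Y by (intro sum_sigma3 finite_pairings_on finite_bipairings) auto
  also have "\<dots> = (\<Sum>\<omega>\<in>?S. contraction q (X \<union> Y) ((\<lambda>(\<pi>, \<rho>, \<tau>). \<tau> \<circ> (\<rho> \<circ> \<pi>)) \<omega>) (\<beta> \<circ> \<alpha>) h)"
    by (intro sum.cong refl) (simp only: split_beta)
  also have "\<dots> = (\<Sum>\<omega>\<in>pairings_on (X \<union> Y). contraction q (X \<union> Y) \<omega> (\<beta> \<circ> \<alpha>) h)"
    by (rule sum.reindex_bij_betw[OF pairings_decompose[OF XY]])
  also have "\<dots> = T q (diagram (X \<union> Y) (\<beta> \<circ> \<alpha>) h)"
    using X Y by (intro T_diagram[symmetric] comp_permutes_union[OF \<alpha> \<beta>]) auto
  also have "\<dots> = T q (cup (diagram X \<alpha> h) (diagram Y \<beta> h))"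
    by (simp only: cup_diagram[OF X Y XY \<alpha> \<beta>])
  finally show ?thesis .
qed

lemma T_add: "T q (\<xi> + \<eta>) = T q \<xi> + T q \<eta>"
  unfolding T_def lin_ext_eq by (rule tp_ext_add[OF T_elem_real_linear])

lemma T_scale: "T q (tp_scale z \<xi>) = tp_scale z (T q \<xi>)"
  unfolding T_def lin_ext_eq
  by (subst tp_ext_scale[OF T_elem_real_linear i_squared(1)]) (simp only: complex_eq[symmetric])

lemma T_diff: "T q (\<xi> - \<eta>) = T q \<xi> - T q \<eta>"
  using T_add[of q \<xi> "tp_scale (-1) \<eta>"] T_scale[of q "-1" \<eta>] by simp

lemma flip_real_linear: "real_linear (\<lambda>F. sym_tensor n (inv \<alpha>) F)"
  by (rule real_linear_sym_tensor)

lemma flip_add: "flip (\<xi> + \<eta>) = flip \<xi> + flip \<eta>"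
  unfolding flip_def antilin_ext_eq by (rule tp_ext_add[OF flip_real_linear])

lemma flip_scale: "flip (tp_scale z \<xi>) = tp_scale (cnj z) (flip \<xi>)"
proof -
  have "of_real (Re z) + - \<i> * of_real (Im z) = cnj z" by (simp add: complex_eq_iff)
  then show ?thesis
    unfolding flip_def antilin_ext_eq
    by (subst tp_ext_scale[OF flip_real_linear i_squared(2)]) (simp only:)
qed

lemma flip_sum: "flip (\<Sum>i\<in>I. \<xi> i) = (\<Sum>i\<in>I. flip (\<xi> i))"
  unfolding flip_def antilin_ext_eq by (rule tp_ext_sum[OF flip_real_linear])

lemma W_add: "W (\<xi> + \<eta>) = W \<xi> + W \<eta>"
  unfolding W_def lin_ext_eq by (rule tp_ext_add[OF real_linear_sym_tensor])

lemma W_scale: "W (tp_scale z \<xi>) = tp_scale z (W \<xi>)"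
  unfolding W_def lin_ext_eq
  by (subst tp_ext_scale[OF real_linear_sym_tensor i_squared(1)]) (simp only: complex_eq[symmetric])

lemmas mul_linear =
  mul.ext_add_left[folded mul_def] mul.ext_add_right[folded mul_def]
  mul.ext_scale_left[folded mul_def] mul.ext_scale_right[folded mul_def]

lemmas cup_linear =
  cup.ext_add_left[folded cup_eq] cup.ext_add_right[folded cup_eq]
  cup.ext_scale_left[folded cup_eq] cup.ext_scale_right[folded cup_eq]


subsection \<open>Products, adjoints and the map T\<close>

lemma id_pairing: "id \<in> pairings_on X"
  by (simp add: pairings_on_iff)

lemma contraction_id: "contraction q X id \<gamma> h = diagram X \<gamma> h"
proof -
  have "supp id = {}" by (simp add: supp_def)
  then show ?thesis
    by (simp add: contraction_def expo_def weight_def num_pairs_def)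
qed

definition TP_below :: "nat \<Rightarrow> 'a::real_inner tp set" where
  "TP_below n = tp.span {diagram X \<gamma> h |X \<gamma> h. labelled X \<gamma> \<and> card X < n}"

lemma TP_below_mono: "m \<le> n \<Longrightarrow> TP_below m \<subseteq> TP_below n"
  unfolding TP_below_def
proof (rule tp.span_mono, rule subsetI)
  fix \<xi> :: "'a tp"
  assume "m \<le> n" "\<xi> \<in> {diagram X \<gamma> h |X \<gamma> h. labelled X \<gamma> \<and> card X < m}"
  then obtain X \<gamma> h where "\<xi> = diagram X \<gamma> h" "labelled X \<gamma>" "card X < n" by auto
  then show "\<xi> \<in> {diagram X \<gamma> h |X \<gamma> h. labelled X \<gamma> \<and> card X < n}" by blast
qed

lemma TP_below_induct [consumes 1, case_names add scale zero diagram]: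
  assumes "\<xi> \<in> TP_below n"
    and add: "\<And>\<xi> \<eta>. P \<xi> \<Longrightarrow> P \<eta> \<Longrightarrow> P (\<xi> + \<eta>)" and scale: "\<And>z \<xi>. P \<xi> \<Longrightarrow> P (tp_scale z \<xi>)"
    and zero: "P 0" and diagram: "\<And>X \<gamma> h. labelled X \<gamma> \<Longrightarrow> card X < n \<Longrightarrow> P (diagram X \<gamma> h)"
  shows "P \<xi>"
  using assms(1) unfolding TP_below_def
proof (induction rule: tp.span_induct_alt)
  case (step c x y)
  then show ?case using add scale diagram by blast
qed (rule zero)

lemma TP_below_TP: "TP_below n \<subseteq> TP"
proof
  fix \<xi> :: "'a tp" assume "\<xi> \<in> TP_below n"
  then show "\<xi> \<in> TP" by (induction rule: TP_below_induct) (simp_all add: TP_closed)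
qed

lemma TP_in_TP_below: "\<xi> \<in> TP \<Longrightarrow> \<exists>n. \<xi> \<in> TP_below n"
proof (induction rule: TP_induct)
  case (add \<xi> \<eta>)
  then obtain m n where "\<xi> \<in> TP_below m" "\<eta> \<in> TP_below n" by blast
  then have "\<xi> \<in> TP_below (max m n)" "\<eta> \<in> TP_below (max m n)"
    using TP_below_mono[of m "max m n"] TP_below_mono[of n "max m n"] by auto
  then have "\<xi> + \<eta> \<in> TP_below (max m n)" unfolding TP_below_def by (rule tp.span_add)
  then show ?case by blast
next
  case (scale z \<xi>)
  then show ?case unfolding TP_below_def using tp.span_scale by blast
next
  case (diagram X \<gamma> h)
  then have "diagram X \<gamma> h \<in> TP_below (Suc (card X))"
    unfolding TP_below_def by (intro tp.span_base) blast
  then show ?case by blast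
qed

text \<open>The empty pairing contributes the element itself, and every other contraction lowers the degree.\<close>

lemma T_minus_id:
  assumes "\<xi> \<in> TP_below (Suc n)"
  shows "T q \<xi> - \<xi> \<in> TP_below n"
  using assms
proof (induction rule: TP_below_induct)
  case (add \<xi> \<eta>)
  have "T q (\<xi> + \<eta>) - (\<xi> + \<eta>) = (T q \<xi> - \<xi>) + (T q \<eta> - \<eta>)" by (simp add: T_add)
  with add show ?case unfolding TP_below_def by (simp only: tp.span_add)
next
  case (scale z \<xi>)
  have "T q (tp_scale z \<xi>) - tp_scale z \<xi> = tp_scale z (T q \<xi> - \<xi>)"
    by (simp add: T_scale tp.scale_right_diff_distrib)
  with scale show ?case unfolding TP_below_def by (simp only: tp.span_scale)
next
  case zero
  have "T q 0 - 0 = (0 :: 'a tp)" using T_scale[of q 0 0] by simp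
  then show ?case unfolding TP_below_def by (simp only: tp.span_zero)
next
  case (diagram X \<gamma> h)
  note D = labelledD[OF diagram(1)]
  have "T q (diagram X \<gamma> h) = diagram X \<gamma> h + (\<Sum>\<pi>\<in>pairings_on X - {id}. contraction q X \<pi> \<gamma> h)"
    unfolding T_diagram[OF D] sum.remove[OF finite_pairings_on[OF D(1)] id_pairing] contraction_id ..
  moreover have "contraction q X \<pi> \<gamma> h \<in> TP_below n" if "\<pi> \<in> pairings_on X - {id}" for \<pi>
  proof -
    have \<pi>: "\<pi> \<in> pairings_on X" and "\<pi> \<noteq> id" using that by auto
    then have "supp \<pi> \<noteq> {}" by (auto simp: supp_def)
    then have "X - supp \<pi> \<subset> X" using pairings_on_supp(1)[OF \<pi>] by blast
    then have "card (X - supp \<pi>) < card X" using D(1) by (rule psubset_card_mono[rotated])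
    then have "card (X - supp \<pi>) < n" using diagram(2) by simp
    moreover have "labelled (X - supp \<pi>) (perm_avoid (\<pi> \<circ> \<gamma>) (supp \<pi>))"
      using pairing_avoid_permutes[OF D(1,2) \<pi> D(3)] D unfolding labelled_def by blast
    ultimately show ?thesis
      unfolding contraction_def TP_below_def by (intro tp.span_scale tp.span_base) blast
  qed
  then have "(\<Sum>\<pi>\<in>pairings_on X - {id}. contraction q X \<pi> \<gamma> h) \<in> TP_below n"
    unfolding TP_below_def by (intro tp.span_sum)
  ultimately show ?case by simp
qed

lemma TP_below_0: "TP_below 0 = {0}"
  by (simp add: TP_below_def)

text \<open>
  As \<open>T\<close> differs from the identity by a map that lowers the degree, a preimage is found by
  correcting \<open>\<xi>\<close> one degree at a time.
\<close>

lemma T_surj: "\<xi> \<in> TP \<Longrightarrow> \<exists>\<eta>\<in>TP. T q \<eta> = \<xi>"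
proof -
  have "\<forall>\<xi>\<in>TP_below n. \<exists>\<eta>\<in>TP. T q \<eta> = (\<xi> :: 'a tp)" for n
  proof (induction n)
    case 0
    have "T q 0 = (0 :: 'a tp)" using T_scale[of q 0 0] by simp
    then show ?case unfolding TP_below_0 using TP_closed(1) by (metis singletonD)
  next
    case (Suc n)
    show ?case
    proof
      fix \<xi> :: "'a tp" assume \<xi>: "\<xi> \<in> TP_below (Suc n)"
      from T_minus_id[OF \<xi>] Suc obtain \<eta> where \<eta>: "\<eta> \<in> TP" "T q \<eta> = T q \<xi> - \<xi>" by blast
      have "T q (\<xi> - \<eta>) = \<xi>" by (simp add: T_diff \<eta>(2))
      moreover have "\<xi> - \<eta> \<in> TP" using \<xi> \<eta>(1) TP_below_TP TP_closed(3) by blast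
      ultimately show "\<exists>\<eta>\<in>TP. T q \<eta> = \<xi>" by blast
    qed
  qed
  then show "\<xi> \<in> TP \<Longrightarrow> \<exists>\<eta>\<in>TP. T q \<eta> = \<xi>" using TP_in_TP_below by blast
qed

lemma labelled_avoid:
  assumes "labelled X \<gamma>" "\<pi> \<in> pairings_on X"
  shows "labelled (X - supp \<pi>) (perm_avoid (\<pi> \<circ> \<gamma>) (supp \<pi>))"
  using pairing_avoid_permutes[OF labelledD(1,2)[OF assms(1)] assms(2) labelledD(3)[OF assms(1)]] labelledD[OF assms(1)]
  unfolding labelled_def by blast

lemma contraction_TP:
  assumes "labelled X \<gamma>" "\<pi> \<in> pairings_on X"
  shows "contraction q X \<pi> \<gamma> h \<in> TP"
  unfolding contraction_def using labelled_avoid[OF assms] by (simp add: TP_closed)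

lemma labelled_union:
  assumes "labelled X \<alpha>" "labelled Y \<beta>"
  shows "labelled (X \<union> Y) (\<beta> \<circ> \<alpha>)"
  using labelledD[OF assms(1)] labelledD[OF assms(2)] comp_permutes_union[of \<alpha> X \<beta> Y]
  unfolding labelled_def by blast

lemma T_TP: "\<xi> \<in> TP \<Longrightarrow> T q \<xi> \<in> TP"
proof (induction rule: TP_induct)
  case (diagram X \<gamma> h)
  show ?case
    unfolding T_diagram[OF labelledD[OF diagram]] by (intro TP_closed(5) contraction_TP diagram)
qed (simp_all only: T_add T_scale TP_closed)

lemma labelled_inv: "labelled X \<gamma> \<Longrightarrow> labelled X (inv \<gamma>)"
  by (simp add: labelled_def permutes_inv)

lemma flip_TP: "\<xi> \<in> TP \<Longrightarrow> flip \<xi> \<in> TP"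
proof (induction rule: TP_induct)
  case (diagram X \<gamma> h)
  show ?case
    unfolding flip_diagram[OF labelledD[OF diagram]] by (intro TP_closed(6) labelled_inv diagram)
qed (simp_all only: flip_add flip_scale TP_closed)

text \<open>
  It suffices to consider diagrams, and these may be given disjoint label sets and one common
  labelling by vectors, which is what the formulas for products require.
\<close>

lemma TP_induct2 [consumes 2, case_names add1 scale1 add2 scale2 diagram]:
  assumes "\<xi> \<in> TP" "\<eta> \<in> TP"
    and "\<And>\<xi> \<xi>' \<eta>. P \<xi> \<eta> \<Longrightarrow> P \<xi>' \<eta> \<Longrightarrow> P (\<xi> + \<xi>') \<eta>" "\<And>z \<xi> \<eta>. P \<xi> \<eta> \<Longrightarrow> P (tp_scale z \<xi>) \<eta>"
    and "\<And>\<xi> \<eta> \<eta>'. P \<xi> \<eta> \<Longrightarrow> P \<xi> \<eta>' \<Longrightarrow> P \<xi> (\<eta> + \<eta>')" "\<And>z \<xi> \<eta>. P \<xi> \<eta> \<Longrightarrow> P \<xi> (tp_scale z \<eta>)"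
    and base: "\<And>X \<alpha> Y \<beta> h. labelled X \<alpha> \<Longrightarrow> labelled Y \<beta> \<Longrightarrow> X \<inter> Y = {} \<Longrightarrow> P (diagram X \<alpha> h) (diagram Y \<beta> h)"
  shows "P \<xi> \<eta>"
  using assms(1)
proof (induction rule: TP_induct)
  case (diagram X \<alpha> f)
  note 1 = diagram
  show ?case
    using assms(2)
  proof (induction rule: TP_induct)
    case (diagram Y \<beta> g)
    obtain Y' \<beta>' h where 2: "labelled Y' \<beta>'" "X \<inter> Y' = {}" "diagram X \<alpha> f = diagram X \<alpha> h" "diagram Y \<beta> g = diagram Y' \<beta>' h"
      by (rule diagram_common2[OF 1 diagram finite.emptyI, of f g]) (rule that; assumption)
    show ?case unfolding 2(3,4) by (rule base[OF 1 2(1,2)])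
  qed (use assms in blast)+
qed (use assms in blast)+

lemma cup_TP: "\<xi> \<in> TP \<Longrightarrow> \<eta> \<in> TP \<Longrightarrow> cup \<xi> \<eta> \<in> TP"
proof (induction \<xi> \<eta> rule: TP_induct2)
  case (diagram X \<alpha> Y \<beta> h)
  show ?case
    unfolding cup_diagram[OF labelledD(1,2)[OF diagram(1)] labelledD(1,2)[OF diagram(2)] diagram(3) labelledD(3)[OF diagram(1)] labelledD(3)[OF diagram(2)]]
    by (intro TP_closed(6) labelled_union diagram)
qed (simp_all only: cup_linear TP_closed)

text \<open>
  Juxtaposition in terms of \<open>T\<close> is therefore the product \<open>mul\<close> in terms of \<open>W\<close>; as \<open>T\<close> is onto, this
  determines the product of any two elements.
\<close>

lemma mul_T:
  assumes "q \<noteq> 0" "\<xi> \<in> TP" "\<eta> \<in> TP"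
  shows "mul q (T q \<xi>) (T q \<eta>) = T q (cup \<xi> \<eta>)"
  using assms(2,3)
proof (induction \<xi> \<eta> rule: TP_induct2)
  case (diagram X \<alpha> Y \<beta> h)
  show ?case
    by (rule mul_T_diagram[OF assms(1) labelledD(1,2)[OF diagram(1)] labelledD(1,2)[OF diagram(2)] diagram(3) labelledD(3)[OF diagram(1)] labelledD(3)[OF diagram(2)]])
qed (simp_all only: mul_linear cup_linear T_add T_scale)

lemma flip_T: "\<xi> \<in> TP \<Longrightarrow> flip (T q \<xi>) = T q (flip \<xi>)"
proof (induction rule: TP_induct)
  case (diagram X \<gamma> h)
  note D = labelledD[OF diagram]
  have "flip (contraction q X \<pi> \<gamma> h) = contraction q X \<pi> (inv \<gamma>) h" if \<pi>: "\<pi> \<in> pairings_on X" for \<pi>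
    unfolding contraction_def flip_scale flip_diagram[OF labelledD[OF labelled_avoid[OF diagram \<pi>]]]
      expo_inv[OF D(1,2) \<pi> D(3)] complex_cnj_complex_of_real ..
  then show ?case
    unfolding flip_diagram[OF D] T_diagram[OF D] T_diagram[OF D(1,2) permutes_inv[OF D(3)]] flip_sum
    by (rule sum.cong[OF refl])
qed (simp_all only: flip_add flip_scale T_add T_scale)

lemma T_inv_into:
  assumes "A \<in> TP"
  shows "inv_into TP (T q) A \<in> TP" "T q (inv_into TP (T q) A) = A"
proof -
  obtain \<eta> where "\<eta> \<in> TP" "A = T q \<eta>" using T_surj[OF assms, of q] by metis
  then have "A \<in> T q ` TP" by blast
  then show "inv_into TP (T q) A \<in> TP" "T q (inv_into TP (T q) A) = A"
    by (rule inv_into_into, rule f_inv_into_f)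
qed

lemma tp_mult_eq_mul:
  assumes "q \<noteq> 0" "A \<in> TP" "B \<in> TP"
  shows "tp_mult q A B = mul q A B"
  unfolding tp_mult_def
  using mul_T[OF assms(1) T_inv_into(1)[OF assms(2), where q = q] T_inv_into(1)[OF assms(3), where q = q]]
    T_inv_into(2)[OF assms(2), where q = q] T_inv_into(2)[OF assms(3), where q = q]
  by simp

lemma tp_adj_eq_flip:
  assumes "A \<in> TP"
  shows "tp_adj q A = flip A"
  unfolding tp_adj_def using flip_T[OF T_inv_into(1)[OF assms, where q = q], where q = q] T_inv_into(2)[OF assms, where q = q] by simp

lemma mul_TP:
  assumes "q \<noteq> 0" "A \<in> TP" "B \<in> TP"
  shows "mul q A B \<in> TP"
  unfolding tp_mult_eq_mul[OF assms, symmetric] tp_mult_def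
  by (intro T_TP cup_TP T_inv_into assms)

lemma cup_assoc:
  assumes "\<xi> \<in> TP" "\<eta> \<in> TP" "\<zeta> \<in> TP"
  shows "cup (cup \<xi> \<eta>) \<zeta> = cup \<xi> (cup \<eta> \<zeta>)"
  using assms(1)
proof (induction rule: TP_induct)
  case (diagram X \<alpha> f)
  note 1 = diagram
  show ?case
    using assms(2)
  proof (induction rule: TP_induct)
    case (diagram Y \<beta> g)
    note 2 = diagram
    show ?case
      using assms(3)
    proof (induction rule: TP_induct)
      case (diagram Z \<gamma> k)
      obtain Y' \<beta>' Z' \<gamma>' h where l: "labelled Y' \<beta>'" "labelled Z' \<gamma>'"
        and d: "X \<inter> Y' = {}" "X \<inter> Z' = {}" "Y' \<inter> Z' = {}"
        and e: "diagram X \<alpha> f = diagram X \<alpha> h" "diagram Y \<beta> g = diagram Y' \<beta>' h" "diagram Z \<gamma> k = diagram Z' \<gamma>' h"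
        by (rule diagram_common3[OF 1 2 diagram, of f g k]) (rule that; assumption)
      have cup: "cup (diagram A \<mu> h) (diagram B \<nu> h) = diagram (A \<union> B) (\<nu> \<circ> \<mu>) h"
        if "labelled A \<mu>" "labelled B \<nu>" "A \<inter> B = {}" for A \<mu> B \<nu>
        by (rule cup_diagram[OF labelledD(1,2)[OF that(1)] labelledD(1,2)[OF that(2)] that(3) labelledD(3)[OF that(1)] labelledD(3)[OF that(2)]])
      have "(X \<union> Y') \<inter> Z' = {}" "X \<inter> (Y' \<union> Z') = {}" using d by blast+
      then show ?case
        unfolding e cup[OF 1 l(1) d(1)] cup[OF l d(3)]
        using cup[OF labelled_union[OF 1 l(1)] l(2)] cup[OF 1 labelled_union[OF l]] by (simp only: o_assoc Un_assoc)
    qed (simp_all only: cup_linear)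
  qed (simp_all only: cup_linear)
qed (simp_all only: cup_linear)

lemma mul_assoc_TP:
  assumes q: "q \<noteq> 0" and "A \<in> TP" "B \<in> TP" "C \<in> TP"
  shows "mul q (mul q A B) C = mul q A (mul q B C)"
proof -
  obtain a b c where "a \<in> TP" "b \<in> TP" "c \<in> TP" and e: "A = T q a" "B = T q b" "C = T q c"
    using T_surj assms(2-4) by metis
  then show ?thesis unfolding e by (simp add: mul_T[OF q] cup_TP cup_assoc)
qed

lemma flip_cup:
  assumes "\<xi> \<in> TP" "\<eta> \<in> TP"
  shows "flip (cup \<xi> \<eta>) = cup (flip \<eta>) (flip \<xi>)"
  using assms
proof (induction \<xi> \<eta> rule: TP_induct2)
  case (diagram X \<alpha> Y \<beta> h)
  note X = labelledD[OF diagram(1)] and Y = labelledD[OF diagram(2)]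
  have dis: "Y \<inter> X = {}" using diagram(3) by blast
  show ?case
    unfolding cup_diagram[OF X(1,2) Y(1,2) diagram(3) X(3) Y(3)] flip_diagram[OF X] flip_diagram[OF Y]
      flip_diagram[OF labelledD[OF labelled_union[OF diagram(1,2)]]]
      cup_diagram[OF Y(1,2) X(1,2) dis permutes_inv[OF Y(3)] permutes_inv[OF X(3)]]
      o_inv_distrib[OF permutes_bij[OF Y(3)] permutes_bij[OF X(3)]]
    unfolding Un_commute[of X Y] ..
qed (simp_all only: cup_linear flip_add flip_scale)

lemma flip_mul_TP:
  assumes q: "q \<noteq> 0" and "A \<in> TP" "B \<in> TP"
  shows "flip (mul q A B) = mul q (flip B) (flip A)"
proof -
  obtain a b where "a \<in> TP" "b \<in> TP" and e: "A = T q a" "B = T q b"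
    using T_surj assms(2,3) by metis
  then show ?thesis unfolding e by (simp add: mul_T[OF q] cup_TP flip_T flip_TP flip_cup)
qed

lemma flip_flip_TP: "\<xi> \<in> TP \<Longrightarrow> flip (flip \<xi>) = \<xi>"
proof (induction rule: TP_induct)
  case (diagram X \<gamma> h)
  note D = labelledD[OF diagram]
  show ?case
    unfolding flip_diagram[OF D] flip_diagram[OF D(1,2) permutes_inv[OF D(3)]] permutes_inv_inv[OF D(3)] ..
qed (simp_all only: flip_add flip_scale complex_cnj_cnj)

lemma W_TP: "\<xi> \<in> TP \<Longrightarrow> W \<xi> = \<xi>"
proof (induction rule: TP_induct)
  case (diagram X \<gamma> h)
  show ?case by (rule W_diagram[OF labelledD[OF diagram]])
qed (simp_all only: W_add W_scale)

lemma tp_one_diagram: "tp_one = diagram {} id h"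
proof -
  have "labelled {} id" by (simp add: labelled_def permutes_id)
  moreover have "{1..0::nat} = {}" by simp
  ultimately have "diagram {} id h = sym_tensor 0 id (word 0 h)"
    using diagram_word[of id 0 h] labelledD(3)[of "{}" id] by simp
  then show ?thesis by (simp add: tp_one_def W_elem_tensor word_def)
qed

lemma labelled_empty: "labelled {} id"
  by (simp add: labelled_def permutes_id)

lemma tp_one_TP: "tp_one \<in> TP"
  unfolding tp_one_diagram[of "\<lambda>_. 0"] by (rule TP_closed(6)[OF labelled_empty])

lemma bipairings_empty: "bipairings {} X = {id}" "bipairings X {} = {id}"
proof -
  have "\<pi> = id" if "\<pi> \<in> pairings_on X" "\<And>x. x \<in> X \<Longrightarrow> \<pi> x \<in> X \<Longrightarrow> \<pi> x = x" for \<pi>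
  proof
    show "\<pi> x = id x" for x
      using that permutes_in_image[OF pairings_onD(1)[OF that(1)], of x] permutes_not_in[OF pairings_onD(1)[OF that(1)], of x]
      by (cases "x \<in> X") auto
  qed
  then show "bipairings {} X = {id}" "bipairings X {} = {id}"
    using id_pairing by (auto simp: bipairings_def)
qed

lemma mul_one_TP: "\<xi> \<in> TP \<Longrightarrow> mul q tp_one \<xi> = \<xi> \<and> mul q \<xi> tp_one = \<xi>"
proof (induction rule: TP_induct)
  case (diagram X \<gamma> h)
  note E = labelledD[OF labelled_empty] and D = labelledD[OF diagram]
  show ?case
    unfolding tp_one_diagram[of h] mul_diagram[OF E(1,2) D(1,2) Int_empty_left E(3) D(3)]
      mul_diagram[OF D(1,2) E(1,2) Int_empty_right D(3) E(3)] bipairings_empty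
    by (simp add: contraction_id)
qed (simp_all only: mul_linear simp_thms)

section \<open>Passage to the Hilbert space tensor powers\<close>

text \<open>
  Convergence of sequences in a fixed finite set of components. Every element of the completed
  space is such a limit of algebraic elements, and all operations are sequentially continuous, so
  that identities pass to the limit.
\<close>

definition tpconv :: "(nat \<Rightarrow> 'a::real_inner tp) \<Rightarrow> 'a tp \<Rightarrow> bool" where
  "tpconv \<xi>s \<xi> \<longleftrightarrow> (\<exists>K. finite K \<and> (\<forall>j. Poly_Mapping.keys (\<xi>s j) \<subseteq> K)) \<and>
     (\<forall>i. (\<lambda>j. Poly_Mapping.lookup (\<xi>s j) i) \<longlonglongrightarrow> Poly_Mapping.lookup \<xi> i)"

lemma tpconvE:
  assumes "tpconv \<xi>s \<xi>"
  obtains K where "finite K" "\<And>j. Poly_Mapping.keys (\<xi>s j) \<subseteq> K" "Poly_Mapping.keys \<xi> \<subseteq> K"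
    "\<And>i. (\<lambda>j. Poly_Mapping.lookup (\<xi>s j) i) \<longlonglongrightarrow> Poly_Mapping.lookup \<xi> i"
proof -
  obtain K where K: "finite K" "\<And>j. Poly_Mapping.keys (\<xi>s j) \<subseteq> K"
    and lim: "\<And>i. (\<lambda>j. Poly_Mapping.lookup (\<xi>s j) i) \<longlonglongrightarrow> Poly_Mapping.lookup \<xi> i"
    using assms unfolding tpconv_def by blast
  have "Poly_Mapping.keys \<xi> \<subseteq> K"
  proof
    fix i assume i: "i \<in> Poly_Mapping.keys \<xi>"
    show "i \<in> K"
    proof (rule ccontr)
      assume "i \<notin> K"
      then have "Poly_Mapping.lookup (\<xi>s j) i = 0" for j using K(2)[of j] by (meson in_keys_iff subsetD)
      then have "Poly_Mapping.lookup \<xi> i = 0" using lim[of i] by (simp add: LIMSEQ_const_iff)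
      with i show False by (simp add: in_keys_iff)
    qed
  qed
  with K lim show ?thesis by (intro that)
qed

lemma tpconvD: "tpconv \<xi>s \<xi> \<Longrightarrow> (\<lambda>j. Poly_Mapping.lookup (\<xi>s j) i) \<longlonglongrightarrow> Poly_Mapping.lookup \<xi> i"
  unfolding tpconv_def by blast

lemma tpconv_unique: "tpconv \<xi>s \<xi> \<Longrightarrow> tpconv \<xi>s \<eta> \<Longrightarrow> \<xi> = \<eta>"
  by (rule poly_mapping_eqI) (rule LIMSEQ_unique[OF tpconvD tpconvD])

lemma tpconv_const: "tpconv (\<lambda>_. \<xi>) \<xi>"
  unfolding tpconv_def by (auto intro: exI[of _ "Poly_Mapping.keys \<xi>"])

lemma tpconv_add:
  assumes "tpconv \<xi>s \<xi>" "tpconv \<eta>s \<eta>"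
  shows "tpconv (\<lambda>j. \<xi>s j + \<eta>s j) (\<xi> + \<eta>)"
proof -
  obtain K L where KL: "finite K" "\<And>j. Poly_Mapping.keys (\<xi>s j) \<subseteq> K" "finite L" "\<And>j. Poly_Mapping.keys (\<eta>s j) \<subseteq> L"
    using assms unfolding tpconv_def by blast
  have "Poly_Mapping.keys (\<xi>s j + \<eta>s j) \<subseteq> K \<union> L" for j
    using Poly_Mapping.keys_add[of "\<xi>s j" "\<eta>s j"] KL(2,4)[of j] by blast
  moreover have "finite (K \<union> L)" using KL by simp
  moreover have "(\<lambda>j. Poly_Mapping.lookup (\<xi>s j + \<eta>s j) i) \<longlonglongrightarrow> Poly_Mapping.lookup (\<xi> + \<eta>) i" for i
    unfolding lookup_add by (intro tendsto_add tpconvD assms)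
  ultimately show ?thesis unfolding tpconv_def by blast
qed

lemma cmul_eq: "cmul z p = (Re z *\<^sub>R fst p - Im z *\<^sub>R snd p, Re z *\<^sub>R snd p + Im z *\<^sub>R fst p)"
  by (simp add: cmul_def case_prod_unfold)

lemma keys_tp_scale: "Poly_Mapping.keys (tp_scale z \<xi>) \<subseteq> Poly_Mapping.keys \<xi>"
  by (auto simp: in_keys_iff lookup_tp_scale cmul_def zero_prod_def)

lemma tpconv_scale:
  assumes "tpconv \<xi>s \<xi>"
  shows "tpconv (\<lambda>j. tp_scale z (\<xi>s j)) (tp_scale z \<xi>)"
proof -
  obtain K where K: "finite K" "\<And>j. Poly_Mapping.keys (\<xi>s j) \<subseteq> K"
    using assms unfolding tpconv_def by blast
  have "Poly_Mapping.keys (tp_scale z (\<xi>s j)) \<subseteq> K" for j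
    using keys_tp_scale[of z "\<xi>s j"] K(2)[of j] by blast
  moreover have "(\<lambda>j. Poly_Mapping.lookup (tp_scale z (\<xi>s j)) i) \<longlonglongrightarrow> Poly_Mapping.lookup (tp_scale z \<xi>) i" for i
    unfolding lookup_tp_scale cmul_eq
    by (intro tendsto_Pair tendsto_diff tendsto_add tendsto_scaleR tendsto_const tendsto_fst tendsto_snd tpconvD assms)
  ultimately show ?thesis using K(1) unfolding tpconv_def by blast
qed

lemma tpconv_sum:
  assumes "\<And>i. i \<in> I \<Longrightarrow> tpconv (\<xi>s i) (\<xi> i)"
  shows "tpconv (\<lambda>j. \<Sum>i\<in>I. \<xi>s i j) (\<Sum>i\<in>I. \<xi> i)"
  using assms by (induction I rule: infinite_finite_induct) (auto intro: tpconv_const tpconv_add)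

lemma tpconv_diff:
  assumes "tpconv \<xi>s \<xi>" "tpconv \<eta>s \<eta>"
  shows "tpconv (\<lambda>j. \<xi>s j - \<eta>s j) (\<xi> - \<eta>)"
  using tpconv_add[OF assms(1) tpconv_scale[OF assms(2), of "-1"]] by simp

lemma tpconv_elem_tensor:
  assumes "Fs \<longlonglongrightarrow> F"
  shows "tpconv (\<lambda>j. elem_tensor n \<alpha> (Fs j)) (elem_tensor n \<alpha> F)"
proof -
  have "Poly_Mapping.keys (elem_tensor n \<alpha> (Fs j)) \<subseteq> {(n, \<alpha>)}" for j by (simp add: elem_tensor_def)
  moreover have "(\<lambda>j. Poly_Mapping.lookup (elem_tensor n \<alpha> (Fs j)) i) \<longlonglongrightarrow> Poly_Mapping.lookup (elem_tensor n \<alpha> F) i" for i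
    proof (cases "i = (n, \<alpha>)")
    case True
    then show ?thesis
      using tendsto_Pair[OF assms tendsto_const] by (simp add: elem_tensor_def lookup_single)
  next
    case False
    then show ?thesis by (simp add: elem_tensor_def lookup_single when_def)
  qed
  ultimately show ?thesis unfolding tpconv_def by blast
qed

lemma tpconv_sym_tensor:
  assumes "Fs \<longlonglongrightarrow> F"
  shows "tpconv (\<lambda>j. sym_tensor n \<alpha> (Fs j)) (sym_tensor n \<alpha> F)"
  unfolding sym_tensor_def
proof (intro tpconv_scale tpconv_sum tpconv_elem_tensor)
  fix \<sigma> assume "\<sigma> \<in> perms n"
  then have "bounded_linear (tensor_perm n \<sigma> :: 'a tensor_space \<Rightarrow> _)"
    unfolding perms_def by (intro tensor_perm_word(1)) blast
  then show "(\<lambda>j. tensor_perm n \<sigma> (Fs j)) \<longlonglongrightarrow> tensor_perm n \<sigma> F"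
    using assms by (rule bounded_linear.tendsto)
qed

lemma tpconv_tp_ext:
  assumes conv: "tpconv \<xi>s \<xi>"
    and g: "\<And>n \<alpha> Fs F. Fs \<longlonglongrightarrow> F \<Longrightarrow> tpconv (\<lambda>j. g j n \<alpha> (Fs j)) (g' n \<alpha> F)"
    and zero: "\<And>j n \<alpha>. g j n \<alpha> 0 = 0" "\<And>n \<alpha>. g' n \<alpha> 0 = 0"
  shows "tpconv (\<lambda>j. tp_ext c (g j) (\<xi>s j)) (tp_ext c g' \<xi>)"
proof -
  obtain K where K: "finite K" "\<And>j. Poly_Mapping.keys (\<xi>s j) \<subseteq> K" "Poly_Mapping.keys \<xi> \<subseteq> K"
    and lim: "\<And>i. (\<lambda>j. Poly_Mapping.lookup (\<xi>s j) i) \<longlonglongrightarrow> Poly_Mapping.lookup \<xi> i"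
    by (rule tpconvE[OF conv]) blast
  have e: "tp_ext c (g j) (\<xi>s j) = (\<Sum>i\<in>K. g j (fst i) (snd i) (fst (Poly_Mapping.lookup (\<xi>s j) i))
      + tp_scale c (g j (fst i) (snd i) (snd (Poly_Mapping.lookup (\<xi>s j) i))))" for j
    by (rule tp_ext_superset[where g = "g j", OF K(1,2) zero(1)])
  have e': "tp_ext c g' \<xi> = (\<Sum>i\<in>K. g' (fst i) (snd i) (fst (Poly_Mapping.lookup \<xi> i))
      + tp_scale c (g' (fst i) (snd i) (snd (Poly_Mapping.lookup \<xi> i))))"
    by (rule tp_ext_superset[where g = g', OF K(1,3) zero(2)])
  show ?thesis
    unfolding e e' by (intro tpconv_sum tpconv_add tpconv_scale g tendsto_fst tendsto_snd lim)
qed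

lemma tpconv_W: "tpconv \<xi>s \<xi> \<Longrightarrow> tpconv (\<lambda>j. W (\<xi>s j)) (W \<xi>)"
  unfolding W_def lin_ext_eq
  by (rule tpconv_tp_ext) (auto intro: tpconv_sym_tensor simp: real_linearD(3)[OF real_linear_sym_tensor])

lemma tpconv_flip: "tpconv \<xi>s \<xi> \<Longrightarrow> tpconv (\<lambda>j. flip (\<xi>s j)) (flip \<xi>)"
  unfolding flip_def antilin_ext_eq
  by (rule tpconv_tp_ext) (auto intro: tpconv_sym_tensor simp: real_linearD(3)[OF real_linear_sym_tensor])

lemma tpconv_mul_elem:
  assumes "Fs \<longlonglongrightarrow> F" "Gs \<longlonglongrightarrow> G"
  shows "tpconv (\<lambda>j. mul_elem q n k \<alpha> \<beta> (Fs j) (Gs j)) (mul_elem q n k \<alpha> \<beta> F G)"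
  unfolding mul_elem_def
  by (intro tpconv_sum tpconv_sym_tensor tendsto_scaleR tendsto_const
      bounded_bilinear.tendsto[OF cross_contract_word(1) assms])

lemma tpconv_mul:
  assumes "tpconv \<xi>s \<xi>" "tpconv \<eta>s \<eta>"
  shows "tpconv (\<lambda>j. mul q (\<xi>s j) (\<eta>s j)) (mul q \<xi> \<eta>)"
  unfolding mul_def tp_bilinear_ext_def
proof (rule tpconv_tp_ext[OF assms(1)])
  fix n \<alpha> and Fs :: "nat \<Rightarrow> 'a tensor_space" and F
  assume F: "Fs \<longlonglongrightarrow> F"
  show "tpconv (\<lambda>j. tp_ext \<i> (\<lambda>k \<beta> G. mul_elem q n k \<alpha> \<beta> (Fs j) G) (\<eta>s j)) (tp_ext \<i> (\<lambda>k \<beta> G. mul_elem q n k \<alpha> \<beta> F G) \<eta>)"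
    by (rule tpconv_tp_ext[OF assms(2) tpconv_mul_elem[OF F]])
      (rule real_linearD(3)[OF mul.right] | assumption)+
qed (rule real_linearD(3)[OF mul.inner_real_linear])+

lemma TP_coordinates:
  "\<xi> \<in> TP \<Longrightarrow> \<forall>n \<alpha>. fst (Poly_Mapping.lookup \<xi> (n, \<alpha>)) \<in> alg_power n \<and> snd (Poly_Mapping.lookup \<xi> (n, \<alpha>)) \<in> alg_power n \<and>
     (Poly_Mapping.lookup \<xi> (n, \<alpha>) \<noteq> 0 \<longrightarrow> \<alpha> \<in> perms0 n)"
proof -
  define P :: "'a tp \<Rightarrow> bool" where "P \<xi> \<longleftrightarrow> (\<forall>n \<alpha>. fst (Poly_Mapping.lookup \<xi> (n, \<alpha>)) \<in> alg_power n \<and>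
     snd (Poly_Mapping.lookup \<xi> (n, \<alpha>)) \<in> alg_power n \<and> (Poly_Mapping.lookup \<xi> (n, \<alpha>) \<noteq> 0 \<longrightarrow> \<alpha> \<in> perms0 n))" for \<xi>
  have z: "0 \<in> alg_power n" for n by (simp add: alg_power_def span_zero)
  have add: "P (\<xi> + \<eta>)" if "P \<xi>" "P \<eta>" for \<xi> \<eta>
    unfolding P_def
  proof (intro allI conjI impI)
    fix n \<alpha>
    show "fst (Poly_Mapping.lookup (\<xi> + \<eta>) (n, \<alpha>)) \<in> alg_power n" "snd (Poly_Mapping.lookup (\<xi> + \<eta>) (n, \<alpha>)) \<in> alg_power n"
      using that unfolding P_def lookup_add fst_add snd_add alg_power_def by (blast intro: span_add)+
    assume "Poly_Mapping.lookup (\<xi> + \<eta>) (n, \<alpha>) \<noteq> 0"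
    then have "Poly_Mapping.lookup \<xi> (n, \<alpha>) \<noteq> 0 \<or> Poly_Mapping.lookup \<eta> (n, \<alpha>) \<noteq> 0" by (auto simp: lookup_add)
    then show "\<alpha> \<in> perms0 n" using that unfolding P_def by blast
  qed
  have scale: "P (tp_scale c \<xi>)" if "P \<xi>" for c \<xi>
    unfolding P_def
  proof (intro allI conjI impI)
    fix n \<alpha>
    show "fst (Poly_Mapping.lookup (tp_scale c \<xi>) (n, \<alpha>)) \<in> alg_power n" "snd (Poly_Mapping.lookup (tp_scale c \<xi>) (n, \<alpha>)) \<in> alg_power n"
      using that unfolding P_def lookup_tp_scale cmul_eq fst_conv snd_conv alg_power_def
      by (blast intro: span_add span_diff span_scale)+
    assume "Poly_Mapping.lookup (tp_scale c \<xi>) (n, \<alpha>) \<noteq> 0"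
    then have "Poly_Mapping.lookup \<xi> (n, \<alpha>) \<noteq> 0" by (auto simp: lookup_tp_scale cmul_eq zero_prod_def)
    then show "\<alpha> \<in> perms0 n" using that unfolding P_def by blast
  qed
  have zero: "P 0" unfolding P_def lookup_zero fst_zero snd_zero using z by blast
  have sum: "P (\<Sum>i\<in>I. \<xi> i)" if "\<And>i. i \<in> I \<Longrightarrow> P (\<xi> i)" for I :: "(nat \<Rightarrow> nat) set" and \<xi>
    using that by (induction I rule: infinite_finite_induct) (auto intro: zero add)
  have elem: "P (elem_tensor m \<gamma> (word m h))" if "\<gamma> \<in> perms0 m" for m \<gamma> h
    unfolding P_def
  proof (intro allI)
    fix n \<alpha>
    have "word m h \<in> alg_power m" unfolding alg_power_word by (intro span_base) simp
    then show "fst (Poly_Mapping.lookup (elem_tensor m \<gamma> (word m h)) (n, \<alpha>)) \<in> alg_power n \<and>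
     snd (Poly_Mapping.lookup (elem_tensor m \<gamma> (word m h)) (n, \<alpha>)) \<in> alg_power n \<and>
     (Poly_Mapping.lookup (elem_tensor m \<gamma> (word m h)) (n, \<alpha>) \<noteq> 0 \<longrightarrow> \<alpha> \<in> perms0 n)"
      using that z by (cases "(n, \<alpha>) = (m, \<gamma>)") (auto simp: elem_tensor_def lookup_single when_def)
  qed
  have "P \<xi>" if "\<xi> \<in> TP" for \<xi>
    using that
  proof (induction rule: TP_induct)
    case (diagram X \<gamma> h)
    obtain \<beta> g where \<beta>: "\<beta> \<in> perms0 (card X)" and e: "diagram X \<gamma> h = sym_tensor (card X) \<beta> (word (card X) g)"
      using diagram by (rule diagram_sym_tensor)
    show ?case
      unfolding e sym_tensor_def
    proof (intro scale sum)
      fix \<sigma> assume "\<sigma> \<in> perms (card X)"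
      then have \<sigma>: "\<sigma> permutes {1..card X}" by (simp add: perms_def)
      have "\<sigma> ` {0..card X} = {0..card X}"
        using permutes_image[OF permutes_subset[OF \<sigma>, of "{0..card X}"]] by simp
      then have "\<sigma> \<circ> \<beta> \<circ> inv \<sigma> \<in> perms0 (card X)"
        using conj_permutes[OF permutes_bij[OF \<sigma>], of \<beta> "{0..card X}"] \<beta> by (simp add: perms0_def)
      then show "P (elem_tensor (card X) (\<sigma> \<circ> \<beta> \<circ> inv \<sigma>) (tensor_perm (card X) \<sigma> (word (card X) g)))"
        unfolding tensor_perm_word(2)[OF \<sigma>] by (rule elem)
    qed
  qed (intro add scale; assumption)+
  then show "\<xi> \<in> TP \<Longrightarrow> \<forall>n \<alpha>. fst (Poly_Mapping.lookup \<xi> (n, \<alpha>)) \<in> alg_power n \<and> snd (Poly_Mapping.lookup \<xi> (n, \<alpha>)) \<in> alg_power n \<and>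
     (Poly_Mapping.lookup \<xi> (n, \<alpha>) \<noteq> 0 \<longrightarrow> \<alpha> \<in> perms0 n)"
    unfolding P_def .
qed

lemma TPbar_approx:
  assumes "\<xi> \<in> TPbar"
  obtains \<xi>s where "\<And>j. \<xi>s j \<in> TP" "tpconv \<xi>s \<xi>"
proof -
  have "\<exists>\<xi>s. (\<forall>j. \<xi>s j \<in> TP) \<and> tpconv \<xi>s \<xi>"
    using assms unfolding TPbar_def
  proof (induction rule: tp.span_induct_alt)
    case base
    show ?case by (rule exI[of _ "\<lambda>_. 0"]) (simp add: TP_closed(1) tpconv_const)
  next
    case (step c x y)
    then obtain n \<alpha> F where x: "x = sym_tensor n \<alpha> F" "\<alpha> \<in> perms0 n" "F \<in> closure (alg_power n)"
      unfolding hilbert_power_def by blast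
    obtain Fs where Fs: "\<And>j. Fs j \<in> alg_power n" "Fs \<longlonglongrightarrow> F"
      using x(3) unfolding closure_sequential by blast
    obtain ys where ys: "\<And>j. ys j \<in> TP" "tpconv ys y" using step by blast
    have "sym_tensor n \<alpha> (Fs j) \<in> TP" for j
      unfolding TP_def using x(2) Fs(1) by (intro tp.span_base) blast
    then have "\<forall>j. tp_scale c (sym_tensor n \<alpha> (Fs j)) + ys j \<in> TP" using ys(1) by (simp add: TP_closed)
    moreover have "tpconv (\<lambda>j. tp_scale c (sym_tensor n \<alpha> (Fs j)) + ys j) (tp_scale c x + y)"
      unfolding x(1) by (intro tpconv_add tpconv_scale tpconv_sym_tensor Fs(2) ys(2))
    ultimately show ?case by (intro exI[of _ "\<lambda>j. tp_scale c (sym_tensor n \<alpha> (Fs j)) + ys j"] conjI)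
  qed
  then show ?thesis using that by blast
qed

text \<open>
  A limit of symmetric tensors is symmetric, that is, fixed by \<open>W\<close>. Its components lie in the
  closures of the algebraic powers, so that \<open>W\<close> maps it into the span of the symmetrised tensors.
\<close>

lemma TPbar_limit:
  assumes TP: "\<And>j. \<xi>s j \<in> TP" and conv: "tpconv \<xi>s \<xi>"
  shows "\<xi> \<in> TPbar" "W \<xi> = \<xi>"
proof -
  have "tpconv (\<lambda>j. W (\<xi>s j)) (W \<xi>)" by (rule tpconv_W[OF conv])
  then have "tpconv \<xi>s (W \<xi>)" by (simp only: W_TP[OF TP])
  then show W: "W \<xi> = \<xi>" using conv by (rule tpconv_unique)
  have lim: "(\<lambda>j. Poly_Mapping.lookup (\<xi>s j) i) \<longlonglongrightarrow> Poly_Mapping.lookup \<xi> i" for i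
    using conv by (rule tpconvD)
  have h: "fst (Poly_Mapping.lookup \<xi> (n, \<alpha>)) \<in> hilbert_power n" "snd (Poly_Mapping.lookup \<xi> (n, \<alpha>)) \<in> hilbert_power n" for n \<alpha>
  proof -
    have *: "\<forall>j. fst (Poly_Mapping.lookup (\<xi>s j) (n, \<alpha>)) \<in> alg_power n \<and> snd (Poly_Mapping.lookup (\<xi>s j) (n, \<alpha>)) \<in> alg_power n"
      using TP_coordinates[OF TP] by blast
    then show "fst (Poly_Mapping.lookup \<xi> (n, \<alpha>)) \<in> hilbert_power n"
      using tendsto_fst[OF lim[of "(n, \<alpha>)"]] unfolding hilbert_power_def closure_sequential
      by (intro exI[of _ "\<lambda>j. fst (Poly_Mapping.lookup (\<xi>s j) (n, \<alpha>))"] conjI) simp_all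
    show "snd (Poly_Mapping.lookup \<xi> (n, \<alpha>)) \<in> hilbert_power n"
      using * tendsto_snd[OF lim[of "(n, \<alpha>)"]] unfolding hilbert_power_def closure_sequential
      by (intro exI[of _ "\<lambda>j. snd (Poly_Mapping.lookup (\<xi>s j) (n, \<alpha>))"] conjI) simp_all
  qed
  have p: "\<alpha> \<in> perms0 n" if "(n, \<alpha>) \<in> Poly_Mapping.keys \<xi>" for n \<alpha>
  proof (rule ccontr)
    assume "\<alpha> \<notin> perms0 n"
    then have "Poly_Mapping.lookup (\<xi>s j) (n, \<alpha>) = 0" for j using TP_coordinates[OF TP] by blast
    then have "Poly_Mapping.lookup \<xi> (n, \<alpha>) = 0" using lim[of "(n, \<alpha>)"] by (simp add: LIMSEQ_const_iff)
    with that show False by (simp add: in_keys_iff)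
  qed
  have s: "sym_tensor n \<alpha> F \<in> TPbar" if "\<alpha> \<in> perms0 n" "F \<in> hilbert_power n" for n \<alpha> and F :: "'a tensor_space"
    unfolding TPbar_def using that by (intro tp.span_base) blast
  have "sym_tensor (fst i) (snd i) (fst (Poly_Mapping.lookup \<xi> i)) + tp_scale \<i> (sym_tensor (fst i) (snd i) (snd (Poly_Mapping.lookup \<xi> i))) \<in> TPbar"
    if "i \<in> Poly_Mapping.keys \<xi>" for i
  proof -
    obtain n \<alpha> where i: "i = (n, \<alpha>)" by force
    show ?thesis
      using s[OF p[of n \<alpha>] h(1)] s[OF p[of n \<alpha>] h(2)] that
      unfolding i fst_conv snd_conv TPbar_def by (intro tp.span_add tp.span_scale) blast+
  qed
  then have "W \<xi> \<in> TPbar"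
    unfolding W_def lin_ext_eq tp_ext_def TPbar_def by (intro tp.span_sum)
  then show "\<xi> \<in> TPbar" by (simp only: W)
qed

lemma TPbar_closed:
  "0 \<in> TPbar" "\<xi> \<in> TPbar \<Longrightarrow> \<eta> \<in> TPbar \<Longrightarrow> \<xi> + \<eta> \<in> TPbar" "\<xi> \<in> TPbar \<Longrightarrow> \<eta> \<in> TPbar \<Longrightarrow> \<xi> - \<eta> \<in> TPbar"
  "\<xi> \<in> TPbar \<Longrightarrow> tp_scale z \<xi> \<in> TPbar"
  unfolding TPbar_def by (auto intro: tp.span_zero tp.span_add tp.span_diff tp.span_scale)

lemma TP_subset_TPbar: "\<xi> \<in> TP \<Longrightarrow> \<xi> \<in> TPbar"
  by (rule TPbar_limit(1)[OF _ tpconv_const])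

lemma W_TPbar: "\<xi> \<in> TPbar \<Longrightarrow> W \<xi> = \<xi>"
  by (erule TPbar_approx) (rule TPbar_limit(2))

lemma flip_TPbar: "\<xi> \<in> TPbar \<Longrightarrow> flip \<xi> \<in> TPbar"
  by (erule TPbar_approx) (rule TPbar_limit(1)[OF flip_TP tpconv_flip])

lemma mul_TPbar:
  assumes "q \<noteq> 0" "\<xi> \<in> TPbar" "\<eta> \<in> TPbar"
  shows "mul q \<xi> \<eta> \<in> TPbar"
proof -
  obtain \<xi>s \<eta>s where "\<And>j. \<xi>s j \<in> TP" "tpconv \<xi>s \<xi>" "\<And>j. \<eta>s j \<in> TP" "tpconv \<eta>s \<eta>"
    using TPbar_approx[OF assms(2)] TPbar_approx[OF assms(3)] by metis
  then show ?thesis by (intro TPbar_limit(1)[of "\<lambda>j. mul q (\<xi>s j) (\<eta>s j)"] mul_TP assms(1) tpconv_mul)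
qed

lemma mul_assoc_TPbar:
  assumes q: "q \<noteq> 0" and "\<xi> \<in> TPbar" "\<eta> \<in> TPbar" "\<zeta> \<in> TPbar"
  shows "mul q (mul q \<xi> \<eta>) \<zeta> = mul q \<xi> (mul q \<eta> \<zeta>)"
proof -
  obtain \<xi>s where x: "\<And>j. \<xi>s j \<in> TP" "tpconv \<xi>s \<xi>" using TPbar_approx[OF assms(2)] by metis
  obtain \<eta>s where y: "\<And>j. \<eta>s j \<in> TP" "tpconv \<eta>s \<eta>" using TPbar_approx[OF assms(3)] by metis
  obtain \<zeta>s where z: "\<And>j. \<zeta>s j \<in> TP" "tpconv \<zeta>s \<zeta>" using TPbar_approx[OF assms(4)] by metis
  have "tpconv (\<lambda>j. mul q (mul q (\<xi>s j) (\<eta>s j)) (\<zeta>s j)) (mul q (mul q \<xi> \<eta>) \<zeta>)"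
    by (intro tpconv_mul x y z)
  moreover have "tpconv (\<lambda>j. mul q (\<xi>s j) (mul q (\<eta>s j) (\<zeta>s j))) (mul q \<xi> (mul q \<eta> \<zeta>))"
    by (intro tpconv_mul x y z)
  ultimately show ?thesis
    unfolding mul_assoc_TP[OF q x(1) y(1) z(1)] by (rule tpconv_unique)
qed

lemma flip_mul_TPbar:
  assumes q: "q \<noteq> 0" and "\<xi> \<in> TPbar" "\<eta> \<in> TPbar"
  shows "flip (mul q \<xi> \<eta>) = mul q (flip \<eta>) (flip \<xi>)"
proof -
  obtain \<xi>s where x: "\<And>j. \<xi>s j \<in> TP" "tpconv \<xi>s \<xi>" using TPbar_approx[OF assms(2)] by metis
  obtain \<eta>s where y: "\<And>j. \<eta>s j \<in> TP" "tpconv \<eta>s \<eta>" using TPbar_approx[OF assms(3)] by metis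
  have "tpconv (\<lambda>j. flip (mul q (\<xi>s j) (\<eta>s j))) (flip (mul q \<xi> \<eta>))"
    by (intro tpconv_flip tpconv_mul x y)
  moreover have "tpconv (\<lambda>j. mul q (flip (\<eta>s j)) (flip (\<xi>s j))) (mul q (flip \<eta>) (flip \<xi>))"
    by (intro tpconv_flip tpconv_mul x y)
  ultimately show ?thesis
    unfolding flip_mul_TP[OF q x(1) y(1)] by (rule tpconv_unique)
qed

lemma flip_flip_TPbar: "\<xi> \<in> TPbar \<Longrightarrow> flip (flip \<xi>) = \<xi>"
proof (erule TPbar_approx)
  fix \<xi>s assume x: "\<And>j. \<xi>s j \<in> TP" "tpconv \<xi>s \<xi>"
  have "tpconv (\<lambda>j. flip (flip (\<xi>s j))) (flip (flip \<xi>))" by (intro tpconv_flip x)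
  then have "tpconv \<xi>s (flip (flip \<xi>))" by (simp only: flip_flip_TP[OF x(1)])
  then show ?thesis using x(2) by (rule tpconv_unique)
qed

lemma mul_one_TPbar: "\<xi> \<in> TPbar \<Longrightarrow> mul q tp_one \<xi> = \<xi> \<and> mul q \<xi> tp_one = \<xi>"
proof (erule TPbar_approx)
  fix \<xi>s assume x: "\<And>j. \<xi>s j \<in> TP" "tpconv \<xi>s \<xi>"
  have "tpconv (\<lambda>j. mul q tp_one (\<xi>s j)) (mul q tp_one \<xi>)" "tpconv (\<lambda>j. mul q (\<xi>s j) tp_one) (mul q \<xi> tp_one)"
    by (intro tpconv_mul tpconv_const x)+
  then have "tpconv \<xi>s (mul q tp_one \<xi>)" "tpconv \<xi>s (mul q \<xi> tp_one)"
    using mul_one_TP[OF x(1)] by (simp_all only: simp_thms)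
  then show ?thesis using x(2) tpconv_unique by blast
qed

lemma star_algebra_TPbar:
  assumes "q \<noteq> 0"
  shows "star_algebra TPbar (+) 0 tp_scale (mul q) tp_one flip"
proof (rule star_algebra.intro)
  show "\<exists>y\<in>TPbar. x + y = 0" if "x \<in> TPbar" for x :: "'a tp"
    using TPbar_closed(3)[OF TPbar_closed(1) that] by (intro bexI[of _ "- x"]) simp_all
qed (use assms in \<open>simp_all add: TPbar_closed TP_subset_TPbar tp_one_TP mul_TPbar flip_TPbar mul_assoc_TPbar
    mul_one_TPbar mul_linear flip_flip_TPbar flip_add flip_scale flip_mul_TPbar tp.scale_right_distrib
    tp.scale_left_distrib add.assoc add.commute\<close>)

lemma tp_dist_tpconv:
  assumes "tpconv \<xi>s \<xi>"
  shows "(\<lambda>j. tp_dist (\<xi>s j) \<xi>) \<longlonglongrightarrow> 0"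
proof -
  have "tpconv (\<lambda>j. \<xi>s j - \<xi>) (\<xi> - \<xi>)" by (intro tpconv_diff assms tpconv_const)
  then have "tpconv (\<lambda>j. \<xi>s j - \<xi>) 0" by simp
  then obtain K where K: "finite K" "\<And>j. Poly_Mapping.keys (\<xi>s j - \<xi>) \<subseteq> K"
    and lim: "\<And>i. (\<lambda>j. Poly_Mapping.lookup (\<xi>s j - \<xi>) i) \<longlonglongrightarrow> Poly_Mapping.lookup 0 i"
    by (rule tpconvE) blast
  have e: "tp_dist (\<xi>s j) \<xi> = sqrt (\<Sum>i\<in>K. (norm (Poly_Mapping.lookup (\<xi>s j - \<xi>) i))\<^sup>2)" for j
  proof -
    have "(\<Sum>i\<in>Poly_Mapping.keys (\<xi>s j - \<xi>). (norm (Poly_Mapping.lookup (\<xi>s j - \<xi>) i))\<^sup>2)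
        = (\<Sum>i\<in>K. (norm (Poly_Mapping.lookup (\<xi>s j - \<xi>) i))\<^sup>2)"
      using K by (intro sum.mono_neutral_left) (auto simp: in_keys_iff)
    then show ?thesis by (simp only: tp_dist_def)
  qed
  have "(\<lambda>j. sqrt (\<Sum>i\<in>K. (norm (Poly_Mapping.lookup (\<xi>s j - \<xi>) i))\<^sup>2)) \<longlonglongrightarrow> sqrt (\<Sum>i\<in>K. (norm (Poly_Mapping.lookup (0::'a tp) i))\<^sup>2)"
    by (intro tendsto_real_sqrt tendsto_sum tendsto_power tendsto_norm lim)
  then show ?thesis unfolding e by simp
qed

text \<open>Sequential continuity of the operations yields the required continuity for any distance controlled by it.\<close>

lemma extends_by_continuityI:
  assumes TP: "\<And>A B. A \<in> TP \<Longrightarrow> B \<in> TP \<Longrightarrow> mul' (\<iota> A) (\<iota> B) = \<iota> (tp_mult q A B)"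
      "\<And>A. A \<in> TP \<Longrightarrow> adj' (\<iota> A) = \<iota> (tp_adj q A)"
    and bar: "\<And>A B. A \<in> TPbar \<Longrightarrow> B \<in> TPbar \<Longrightarrow> mul' (\<iota> A) (\<iota> B) = \<iota> (mul q A B)"
      "\<And>A. A \<in> TPbar \<Longrightarrow> adj' (\<iota> A) = \<iota> (flip A)"
    and d: "\<And>\<xi>s \<xi>. (\<And>j. \<xi>s j \<in> TPbar) \<Longrightarrow> \<xi> \<in> TPbar \<Longrightarrow> tpconv \<xi>s \<xi> \<Longrightarrow> (\<lambda>j. d (\<iota> (\<xi>s j)) (\<iota> \<xi>)) \<longlonglongrightarrow> 0"
    and q: "q \<noteq> 0"
  shows "extends_by_continuity q \<iota> d mul' adj'"
proof -
  define w where "w n \<alpha> F = W (sym_tensor n \<alpha> F)" for n \<alpha> and F :: "'a tensor_space"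
  have wb: "w n \<alpha> F \<in> TPbar" if "\<alpha> \<in> perms0 n" "F \<in> hilbert_power n" for n \<alpha> F
  proof -
    have "sym_tensor n \<alpha> F \<in> TPbar" unfolding TPbar_def using that by (intro tp.span_base) blast
    then show ?thesis unfolding w_def by (simp only: W_TPbar)
  qed
  have wc: "tpconv (\<lambda>j. w n \<alpha> (Fs j)) (w n \<alpha> F)" if "Fs \<longlonglongrightarrow> F" for n \<alpha> Fs F
    unfolding w_def by (intro tpconv_W tpconv_sym_tensor that)
  have m: "((\<lambda>(F', G'). d (mul' (\<iota> (w n \<alpha> F')) (\<iota> (w k \<beta> G'))) (mul' (\<iota> (w n \<alpha> F)) (\<iota> (w k \<beta> G)))) \<longlongrightarrow> 0)
      (at (F, G) within hilbert_power n \<times> hilbert_power k)"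
    if "\<alpha> \<in> perms0 n" "\<beta> \<in> perms0 k" "F \<in> hilbert_power n" "G \<in> hilbert_power k" for n k \<alpha> \<beta> F G
    unfolding tendsto_at_iff_sequentially
  proof (intro allI impI)
    fix X :: "nat \<Rightarrow> 'a tensor_space \<times> 'a tensor_space"
    assume X: "\<forall>i. X i \<in> hilbert_power n \<times> hilbert_power k - {(F, G)}" and lim: "X \<longlonglongrightarrow> (F, G)"
    have h: "fst (X j) \<in> hilbert_power n" "snd (X j) \<in> hilbert_power k" for j
      using spec[OF X, of j] by (simp_all add: mem_Times_iff)
    have l: "(\<lambda>j. fst (X j)) \<longlonglongrightarrow> F" "(\<lambda>j. snd (X j)) \<longlonglongrightarrow> G"
      using tendsto_fst[OF lim] tendsto_snd[OF lim] by simp_all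
    have "(\<lambda>j. d (\<iota> (mul q (w n \<alpha> (fst (X j))) (w k \<beta> (snd (X j))))) (\<iota> (mul q (w n \<alpha> F) (w k \<beta> G)))) \<longlonglongrightarrow> 0"
      using that h by (intro d mul_TPbar q wb tpconv_mul wc l)
    then show "((\<lambda>(F', G'). d (mul' (\<iota> (w n \<alpha> F')) (\<iota> (w k \<beta> G'))) (mul' (\<iota> (w n \<alpha> F)) (\<iota> (w k \<beta> G)))) \<circ> X) \<longlonglongrightarrow> 0"
      using that h by (simp add: o_def case_prod_unfold bar wb)
  qed
  have a: "((\<lambda>F'. d (adj' (\<iota> (w n \<alpha> F'))) (adj' (\<iota> (w n \<alpha> F)))) \<longlongrightarrow> 0) (at F within hilbert_power n)"
    if "\<alpha> \<in> perms0 n" "F \<in> hilbert_power n" for n \<alpha> F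
    unfolding tendsto_at_iff_sequentially
  proof (intro allI impI)
    fix X :: "nat \<Rightarrow> 'a tensor_space"
    assume X: "\<forall>i. X i \<in> hilbert_power n - {F}" and lim: "X \<longlonglongrightarrow> F"
    have h: "X j \<in> hilbert_power n" for j using spec[OF X, of j] by simp
    have "(\<lambda>j. d (\<iota> (flip (w n \<alpha> (X j)))) (\<iota> (flip (w n \<alpha> F)))) \<longlonglongrightarrow> 0"
      using that h by (intro d flip_TPbar wb tpconv_flip wc lim)
    then show "((\<lambda>F'. d (adj' (\<iota> (w n \<alpha> F'))) (adj' (\<iota> (w n \<alpha> F)))) \<circ> X) \<longlonglongrightarrow> 0"
      using that h by (simp add: o_def bar wb)
  qed
  show ?thesis
    unfolding extends_by_continuity_def using TP m a unfolding w_def by blast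
qed

section \<open>The state\<close>

text \<open>Complete contractions of one factor with another; only they contribute to the state.\<close>

definition matchings :: "nat set \<Rightarrow> nat set \<Rightarrow> (nat \<Rightarrow> nat) set" where
  "matchings X Y = {\<pi> \<in> bipairings X Y. supp \<pi> = X \<union> Y}"

lemma matchingsD:
  assumes "\<pi> \<in> matchings X Y" "X \<inter> Y = {}"
  shows "\<pi> \<in> bipairings X Y" "supp \<pi> = X \<union> Y" "\<pi> \<in> pairings_on (X \<union> Y)" "\<pi> (\<pi> x) = x" "bij \<pi>" "inv \<pi> = \<pi>"
    "\<pi> ` X = Y" "\<pi> ` Y = X" "z \<notin> X \<union> Y \<Longrightarrow> \<pi> z = z"
proof -
  show 1: "\<pi> \<in> bipairings X Y" "supp \<pi> = X \<union> Y" using assms(1) by (simp_all add: matchings_def)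
  show 2: "\<pi> \<in> pairings_on (X \<union> Y)" using 1(1) bipairings_subset by blast
  show 3: "\<pi> (\<pi> x) = x" "bij \<pi>" "inv \<pi> = \<pi>" for x by (rule pairings_onD[OF 2])+
  have "X \<inter> supp \<pi> = X" "Y \<inter> supp \<pi> = Y" using 1(2) by auto
  then show 4: "\<pi> ` X = Y" using bipairing_supp(1)[OF 1(1) assms(2)] by simp
  show "\<pi> ` Y = X" unfolding 4[symmetric] image_image 3(1) by simp
  show "z \<notin> X \<union> Y \<Longrightarrow> \<pi> z = z" using permutes_not_in[OF pairings_onD(1)[OF 2]] by blast
qed

lemma matchings_commute: "matchings X Y = matchings Y X"
  unfolding matchings_def bipairings_def by (auto simp: Un_commute)

lemma matching_card:
  assumes "\<pi> \<in> matchings X Y" "X \<inter> Y = {}"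
  shows "card X = card Y"
  using card_image[OF inj_on_subset[OF bij_is_inj[OF matchingsD(5)[OF assms]] subset_UNIV], of X] matchingsD(7)[OF assms] by simp

text \<open>Given one bijection between the two sides, the matchings are the permutations of one side.\<close>

definition matching_of :: "(nat \<Rightarrow> nat) \<Rightarrow> nat set \<Rightarrow> nat set \<Rightarrow> (nat \<Rightarrow> nat) \<Rightarrow> nat \<Rightarrow> nat" where
  "matching_of s X Y \<sigma> x = (if x \<in> Y then s (inv \<sigma> x) else if x \<in> X then \<sigma> (inv s x) else x)"

lemma bij_betw_matchings:
  assumes s: "bij s" "s ` Y = X" and XY: "X \<inter> Y = {}"
  shows "bij_betw (matching_of s X Y) {\<sigma>. \<sigma> permutes Y} (matchings X Y)"
proof (rule bij_betw_byWitness[where f' = "\<lambda>\<pi> y. if y \<in> Y then \<pi> (s y) else y"])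
  note si = inv_f_f[OF bij_is_inj[OF s(1)]] surj_f_inv_f[OF bij_is_surj[OF s(1)]]
  have sX: "s y \<in> X" if "y \<in> Y" for y using that s(2) by blast
  have iX: "inv s x \<in> Y" if "x \<in> X" for x
    using that si(1) unfolding s(2)[symmetric] by auto
  have XnY: "x \<notin> Y" if "x \<in> X" for x using that XY by blast
  have fY: "matching_of s X Y \<sigma> x = s (inv \<sigma> x)" if "x \<in> Y" for \<sigma> x using that by (simp add: matching_of_def)
  have fX: "matching_of s X Y \<sigma> x = \<sigma> (inv s x)" if "x \<in> X" for \<sigma> x using that XnY[OF that] by (simp add: matching_of_def)
  have out: "matching_of s X Y \<sigma> x = x" if "x \<notin> X \<union> Y" for \<sigma> x using that by (simp add: matching_of_def)
  show "\<forall>\<sigma>\<in>{\<sigma>. \<sigma> permutes Y}. (\<lambda>y. if y \<in> Y then matching_of s X Y \<sigma> (s y) else y) = \<sigma>"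
  proof (intro ballI ext)
    fix \<sigma> y assume "\<sigma> \<in> {\<sigma>. \<sigma> permutes Y}"
    then have \<sigma>: "\<sigma> permutes Y" by simp
    show "(if y \<in> Y then matching_of s X Y \<sigma> (s y) else y) = \<sigma> y"
    proof (cases "y \<in> Y")
      case True
      then show ?thesis using fX[OF sX[OF True]] by (simp only: si(1) if_True)
    next
      case False
      then show ?thesis using permutes_not_in[OF \<sigma> False] by simp
    qed
  qed
  have perm: "(\<lambda>y. if y \<in> Y then \<pi> (s y) else y) permutes Y" if \<pi>: "\<pi> \<in> matchings X Y" for \<pi>
  proof (rule bij_imp_permutes)
    have "bij_betw (\<pi> \<circ> s) Y Y"
      by (rule bij_betw_trans[OF bij_betw_subset[OF s(1) subset_UNIV s(2)]
          bij_betw_subset[OF matchingsD(5)[OF \<pi> XY] subset_UNIV matchingsD(7)[OF \<pi> XY]]])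
    then show "bij_betw (\<lambda>y. if y \<in> Y then \<pi> (s y) else y) Y Y"
      by (rule bij_betw_cong[THEN iffD1, rotated]) simp
  qed simp
  then show "(\<lambda>\<pi> y. if y \<in> Y then \<pi> (s y) else y) ` matchings X Y \<subseteq> {\<sigma>. \<sigma> permutes Y}" by blast
  show "\<forall>\<pi>\<in>matchings X Y. matching_of s X Y (\<lambda>y. if y \<in> Y then \<pi> (s y) else y) = \<pi>"
  proof (intro ballI ext)
    fix \<pi> x assume \<pi>: "\<pi> \<in> matchings X Y"
    note M = matchingsD[OF \<pi> XY]
    define \<sigma> where "\<sigma> = (\<lambda>y. if y \<in> Y then \<pi> (s y) else y)"
    have \<sigma>: "\<sigma> permutes Y" unfolding \<sigma>_def by (rule perm[OF \<pi>])
    have s1: "\<sigma> (inv s z) = \<pi> z" if "z \<in> X" for z using iX[OF that] by (simp add: \<sigma>_def si(2))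
    consider "x \<in> X" | "x \<in> Y" | "x \<notin> X \<union> Y" by blast
    then have "matching_of s X Y \<sigma> x = \<pi> x"
    proof cases
      case 1
      then show ?thesis unfolding fX[OF 1] by (rule s1)
    next
      case 2
      then have px: "\<pi> x \<in> X" using M(8) by blast
      then have "\<sigma> (inv s (\<pi> x)) = x" using s1[OF px] M(4) by simp
      then have "inv \<sigma> x = inv s (\<pi> x)" using permutes_inv_eq[OF \<sigma>] by simp
      then show ?thesis unfolding fY[OF 2] by (simp only: si(2))
    next
      case 3
      then show ?thesis unfolding out[OF 3] using M(9)[OF 3] by simp
    qed
    then show "matching_of s X Y (\<lambda>y. if y \<in> Y then \<pi> (s y) else y) x = \<pi> x" unfolding \<sigma>_def .
  qed
  show "matching_of s X Y ` {\<sigma>. \<sigma> permutes Y} \<subseteq> matchings X Y"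
  proof (intro image_subsetI)
    fix \<sigma> assume "\<sigma> \<in> {\<sigma>. \<sigma> permutes Y}"
    then have \<sigma>: "\<sigma> permutes Y" by simp
    define f where "f = matching_of s X Y \<sigma>"
    have sY: "\<sigma> y \<in> Y" "inv \<sigma> y \<in> Y" if "y \<in> Y" for y
      using that permutes_in_image[OF \<sigma>] permutes_in_image[OF permutes_inv[OF \<sigma>]] by simp_all
    have Y: "f x \<in> X" "f (f x) = x" if "x \<in> Y" for x
    proof -
      show 1: "f x \<in> X" unfolding f_def fY[OF that] by (rule sX[OF sY(2)[OF that]])
      show "f (f x) = x"
        using fX[OF 1] unfolding f_def fY[OF that] by (simp only: si(1) permutes_inverses(1)[OF \<sigma>])
    qed
    have X: "f x \<in> Y" "f (f x) = x" if "x \<in> X" for x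
    proof -
      show 1: "f x \<in> Y" unfolding f_def fX[OF that] by (rule sY(1)[OF iX[OF that]])
      show "f (f x) = x"
        using fY[OF 1] unfolding f_def fX[OF that] by (simp only: si(2) permutes_inverses(2)[OF \<sigma>])
    qed
    have o: "f x = x" if "x \<notin> X \<union> Y" for x unfolding f_def by (rule out[OF that])
    have "f (f x) = x" for x
    proof -
      consider "x \<in> X" | "x \<in> Y" | "x \<notin> X \<union> Y" by blast
      then show ?thesis
      proof cases
        case 3
        then show ?thesis using o[OF 3] by simp
      qed (rule X Y, assumption)+
    qed
    then have p: "f \<in> pairings_on (X \<union> Y)" unfolding pairings_on_iff using o by simp
    have ne: "f x \<notin> X" if "x \<in> X" for x using X(1)[OF that] XY by blast
    have ne': "f x \<notin> Y" if "x \<in> Y" for x using Y(1)[OF that] XY by blast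
    have "supp f = X \<union> Y"
    proof
      show "supp f \<subseteq> X \<union> Y" using o unfolding supp_def by blast
      show "X \<union> Y \<subseteq> supp f"
      proof
        fix x assume "x \<in> X \<union> Y"
        then have "f x \<noteq> x" using ne[of x] ne'[of x] by auto
        then show "x \<in> supp f" unfolding supp_def by simp
      qed
    qed
    moreover have "f \<in> bipairings X Y" using p ne ne' unfolding bipairings_def by simp
    ultimately show "matching_of s X Y \<sigma> \<in> matchings X Y"
      unfolding matchings_def f_def by simp
  qed
qed

lemma phi_eq: "phi A = of_real (inner (fst (Poly_Mapping.lookup A (0, id))) (tensor [])) + \<i> * of_real (inner (snd (Poly_Mapping.lookup A (0, id))) (tensor []))"
  by (simp add: phi_def case_prod_unfold complex_eq_iff)

lemma phi_add: "phi (A + B) = phi A + phi B"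
  by (simp add: phi_eq lookup_add inner_add_left algebra_simps)

lemma phi_scale: "phi (tp_scale z A) = z * phi A"
  by (simp add: phi_eq lookup_tp_scale cmul_eq inner_add_left inner_diff_left complex_eq_iff)

lemma phi_sum: "phi (\<Sum>i\<in>I. A i) = (\<Sum>i\<in>I. phi (A i))"
proof (induction I rule: infinite_finite_induct)
  case empty
  show ?case using phi_scale[of 0 0] by simp
qed (use phi_scale[of 0 0] in \<open>simp_all add: phi_add\<close>)

lemma phi_tpconv: "tpconv As A \<Longrightarrow> (\<lambda>j. phi (As j)) \<longlonglongrightarrow> phi A"
  unfolding phi_eq
  by (intro tendsto_add tendsto_mult tendsto_of_real tendsto_inner tendsto_fst tendsto_snd tendsto_const tpconvD)

lemma phi_sym_tensor:
  assumes "n \<noteq> 0"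
  shows "phi (sym_tensor n \<alpha> F) = 0"
proof -
  have "phi (elem_tensor n \<gamma> G) = 0" for \<gamma> and G :: "'a tensor_space"
    using assms by (simp add: phi_eq elem_tensor_def lookup_single when_def)
  then show ?thesis by (simp add: sym_tensor_def phi_scale phi_sum)
qed

lemma perms_0: "perms 0 = {id}"
  by (auto simp: perms_def)

lemma phi_diagram:
  assumes "labelled X \<gamma>"
  shows "phi (diagram X \<gamma> h) = (if X = {} then 1 else 0)"
proof (cases "X = {}")
  case True
  then have "\<gamma> permutes {0}" using labelledD(3)[OF assms] by simp
  then have "\<gamma> = id" by simp
  then have d: "diagram X \<gamma> h = sym_tensor 0 id (word 0 h)"
    using True tp_one_diagram[of h] by (simp add: tp_one_def W_elem_tensor word_def)
  have "(id::nat \<Rightarrow> nat) permutes {1..0}" by (rule permutes_id)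
  then have "tensor_perm 0 id (word 0 h) = word 0 h" using tensor_perm_word(2)[of id 0 h] by simp
  then have "diagram X \<gamma> h = elem_tensor 0 id (tensor [])"
    unfolding d sym_tensor_def perms_0 by (simp add: word_def)
  then show ?thesis using True by (simp add: phi_eq elem_tensor_def inner_tensor)
next
  case False
  then have "card X \<noteq> 0" using labelledD(1)[OF assms] by simp
  then show ?thesis using False unfolding diagram_def by (simp add: phi_sym_tensor)
qed

definition matching_sum ::
  "real \<Rightarrow> nat set \<Rightarrow> (nat \<Rightarrow> nat) \<Rightarrow> nat set \<Rightarrow> (nat \<Rightarrow> nat) \<Rightarrow> (nat \<Rightarrow> 'a::real_inner) \<Rightarrow> real" where
  "matching_sum q X \<alpha> Y \<beta> h = (\<Sum>\<pi>\<in>matchings X Y.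
     q powi (int (card X) - int (cyc0 (insert 0 Y) (\<beta> \<circ> (\<pi> \<circ> \<alpha> \<circ> \<pi>)))) * weight \<pi> h)"

text \<open>The state sees degree zero only, which is reached by the complete contractions.\<close>

lemma phi_mul_diagram:
  assumes "labelled X \<alpha>" "labelled Y \<beta>" "X \<inter> Y = {}"
  shows "phi (mul q (diagram X \<alpha> h) (diagram Y \<beta> h)) = of_real (matching_sum q X \<alpha> Y \<beta> h)"
proof -
  note X = labelledD[OF assms(1)] and Y = labelledD[OF assms(2)]
  have sub: "supp \<pi> \<subseteq> X \<union> Y" if "\<pi> \<in> bipairings X Y" for \<pi>
    using pairings_on_supp subsetD[OF bipairings_subset that] by blast
  have *: "phi (contraction q (X \<union> Y) \<pi> (\<beta> \<circ> \<alpha>) h) = (if \<pi> \<in> matchings X Y then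
      of_real (q powi (int (card X) - int (cyc0 (insert 0 Y) (\<beta> \<circ> (\<pi> \<circ> \<alpha> \<circ> \<pi>)))) * weight \<pi> h) else 0)"
    if \<pi>: "\<pi> \<in> bipairings X Y" for \<pi>
  proof -
    have l: "labelled (X \<union> Y - supp \<pi>) (perm_avoid (\<pi> \<circ> (\<beta> \<circ> \<alpha>)) (supp \<pi>))"
      using labelled_avoid[OF labelled_union[OF assms(1,2)]] subsetD[OF bipairings_subset \<pi>] by blast
    have e: "X \<union> Y - supp \<pi> = {} \<longleftrightarrow> \<pi> \<in> matchings X Y"
      using sub[OF \<pi>] \<pi> unfolding matchings_def by blast
    show ?thesis
    proof (cases "\<pi> \<in> matchings X Y")
      case True
      then have "supp \<pi> = X \<union> Y" by (simp add: matchings_def)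
      note x = expo_full_bipairing[OF X(1,2) Y(1,2) assms(3) \<pi> X(3) Y(3) this]
      show ?thesis unfolding contraction_def phi_scale phi_diagram[OF l] e x using True by simp
    next
      case False
      then show ?thesis unfolding contraction_def phi_scale phi_diagram[OF l] e by simp
    qed
  qed
  have "phi (mul q (diagram X \<alpha> h) (diagram Y \<beta> h)) = (\<Sum>\<pi>\<in>bipairings X Y. if \<pi> \<in> matchings X Y then
      complex_of_real (q powi (int (card X) - int (cyc0 (insert 0 Y) (\<beta> \<circ> (\<pi> \<circ> \<alpha> \<circ> \<pi>)))) * weight \<pi> h) else 0)"
    unfolding mul_diagram[OF X(1,2) Y(1,2) assms(3) X(3) Y(3)] phi_sum by (intro sum.cong refl *)
  also have "\<dots> = (\<Sum>\<pi>\<in>matchings X Y.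
      complex_of_real (q powi (int (card X) - int (cyc0 (insert 0 Y) (\<beta> \<circ> (\<pi> \<circ> \<alpha> \<circ> \<pi>)))) * weight \<pi> h))"
    using finite_bipairings[OF X(1) Y(1)] by (intro sum.mono_neutral_cong_right) (auto simp: matchings_def)
  finally show ?thesis unfolding matching_sum_def of_real_sum .
qed

text \<open>
  The state is a trace: the summand of a matching \<open>\<pi>\<close> does not change when the two diagrams are
  exchanged, because the permutations whose cycles are counted are conjugate under \<open>\<pi>\<close> and \<open>\<alpha>\<close>.
\<close>

lemma matching_sum_commute:
  assumes "labelled X \<alpha>" "labelled Y \<beta>" and XY: "X \<inter> Y = {}"
  shows "matching_sum q X \<alpha> Y \<beta> h = matching_sum q Y \<beta> X \<alpha> h"
  unfolding matching_sum_def matchings_commute[of Y X]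
proof (intro sum.cong refl)
  note X = labelledD[OF assms(1)] and Y = labelledD[OF assms(2)]
  fix \<pi> assume \<pi>: "\<pi> \<in> matchings X Y"
  note M = matchingsD[OF \<pi> XY]
  have p0: "\<pi> 0 = 0" using X(2) Y(2) by (intro M(9)) blast
  then have im: "\<pi> ` insert 0 Y = insert 0 X" using M(8) by simp
  define \<beta>' where "\<beta>' = \<pi> \<circ> \<beta> \<circ> inv \<pi>"
  have \<beta>': "\<beta>' permutes insert 0 X" using conj_permutes[OF M(5) Y(3)] unfolding im \<beta>'_def .
  have "cyc0 (insert 0 Y) (\<beta> \<circ> (\<pi> \<circ> \<alpha> \<circ> \<pi>)) = cyc0 (insert 0 X) (\<pi> \<circ> (\<beta> \<circ> (\<pi> \<circ> \<alpha> \<circ> \<pi>)) \<circ> inv \<pi>)"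
    using cyc0_conj[OF M(5) p0, of "insert 0 Y"] unfolding im by (rule sym)
  also have "\<pi> \<circ> (\<beta> \<circ> (\<pi> \<circ> \<alpha> \<circ> \<pi>)) \<circ> inv \<pi> = \<beta>' \<circ> \<alpha>"
    unfolding \<beta>'_def M(6) by (simp add: fun_eq_iff M(4))
  also have "cyc0 (insert 0 X) (\<beta>' \<circ> \<alpha>) = cyc0 (insert 0 X) (\<alpha> \<circ> (\<beta>' \<circ> \<alpha>) \<circ> inv \<alpha>)"
    using X by (intro cyc0_conj_permutes[symmetric] permutes_compose \<beta>') simp_all
  also have "\<alpha> \<circ> (\<beta>' \<circ> \<alpha>) \<circ> inv \<alpha> = \<alpha> \<circ> (\<pi> \<circ> \<beta> \<circ> \<pi>)"
    unfolding \<beta>'_def M(6) by (simp add: fun_eq_iff permutes_inverses[OF X(3)])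
  finally show "q powi (int (card X) - int (cyc0 (insert 0 Y) (\<beta> \<circ> (\<pi> \<circ> \<alpha> \<circ> \<pi>)))) * weight \<pi> h =
      q powi (int (card Y) - int (cyc0 (insert 0 X) (\<alpha> \<circ> (\<pi> \<circ> \<beta> \<circ> \<pi>)))) * weight \<pi> h"
    by (simp only: matching_card[OF \<pi> XY])
qed

lemma phi_mul_commute_TP: "\<xi> \<in> TP \<Longrightarrow> \<eta> \<in> TP \<Longrightarrow> phi (mul q \<xi> \<eta>) = phi (mul q \<eta> \<xi>)"
proof (induction \<xi> \<eta> rule: TP_induct2)
  case (diagram X \<alpha> Y \<beta> h)
  have "Y \<inter> X = {}" using diagram(3) by blast
  then show ?case
    by (simp only: phi_mul_diagram[OF diagram] phi_mul_diagram[OF diagram(2,1)] matching_sum_commute[OF diagram])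
qed (simp_all only: mul_linear phi_add phi_scale)

lemma phi_mul_commute:
  assumes "\<xi> \<in> TPbar" "\<eta> \<in> TPbar"
  shows "phi (mul q \<xi> \<eta>) = phi (mul q \<eta> \<xi>)"
proof -
  obtain \<xi>s where x: "\<And>j. \<xi>s j \<in> TP" "tpconv \<xi>s \<xi>" using TPbar_approx[OF assms(1)] by metis
  obtain \<eta>s where y: "\<And>j. \<eta>s j \<in> TP" "tpconv \<eta>s \<eta>" using TPbar_approx[OF assms(2)] by metis
  have "(\<lambda>j. phi (mul q (\<xi>s j) (\<eta>s j))) \<longlonglongrightarrow> phi (mul q \<xi> \<eta>)" "(\<lambda>j. phi (mul q (\<eta>s j) (\<xi>s j))) \<longlonglongrightarrow> phi (mul q \<eta> \<xi>)"
    by (intro phi_tpconv tpconv_mul x y)+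
  then show ?thesis unfolding phi_mul_commute_TP[OF x(1) y(1)] by (rule LIMSEQ_unique)
qed

lemma phi_flip:
  assumes "\<xi> \<in> TPbar"
  shows "phi (flip \<xi>) = cnj (phi \<xi>)"
proof -
  have TP: "phi (flip \<xi>) = cnj (phi \<xi>)" if "\<xi> \<in> TP" for \<xi> :: "'a tp"
    using that
  proof (induction rule: TP_induct)
    case (diagram X \<gamma> h)
    show ?case
      unfolding flip_diagram[OF labelledD[OF diagram]] phi_diagram[OF labelled_inv[OF diagram]] phi_diagram[OF diagram] by simp
  qed (simp_all add: flip_add flip_scale phi_add phi_scale)
  obtain \<xi>s where x: "\<And>j. \<xi>s j \<in> TP" "tpconv \<xi>s \<xi>" using TPbar_approx[OF assms(1)] by metis
  have "(\<lambda>j. phi (flip (\<xi>s j))) \<longlonglongrightarrow> phi (flip \<xi>)" by (intro phi_tpconv tpconv_flip x)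
  moreover have "(\<lambda>j. cnj (phi (\<xi>s j))) \<longlonglongrightarrow> cnj (phi \<xi>)" by (intro tendsto_cnj phi_tpconv x)
  ultimately show ?thesis unfolding TP[OF x(1)] by (rule LIMSEQ_unique)
qed

section \<open>The deformed inner product\<close>

definition qform_coeff :: "real \<Rightarrow> nat \<times> (nat \<Rightarrow> nat) \<Rightarrow> nat \<times> (nat \<Rightarrow> nat) \<Rightarrow>
    'a::real_inner tensor_space \<times> 'a tensor_space \<Rightarrow> 'a tensor_space \<times> 'a tensor_space \<Rightarrow> complex" where
  "qform_coeff q i j u v = (if fst i = fst j then \<Sum>\<sigma>\<in>perms (fst i).
     of_real (chi q (fst i) (snd i \<circ> \<sigma> \<circ> inv (snd j) \<circ> inv \<sigma>)) *
     cinner_pair u (map_prod (tensor_perm (fst i) \<sigma>) (tensor_perm (fst i) \<sigma>) v) else 0)"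

lemma qform_eq: "qform q \<xi> \<eta> = (\<Sum>i\<in>Poly_Mapping.keys \<xi>. \<Sum>j\<in>Poly_Mapping.keys \<eta>.
    qform_coeff q i j (Poly_Mapping.lookup \<xi> i) (Poly_Mapping.lookup \<eta> j))"
  by (simp only: qform_def qform_coeff_def case_prod_unfold prod.collapse)

lemma cinner_pair_eq: "cinner_pair u v = of_real (inner (fst u) (fst v) + inner (snd u) (snd v))
    + \<i> * of_real (inner (snd u) (fst v) - inner (fst u) (snd v))"
  by (simp add: cinner_pair_def case_prod_unfold complex_eq_iff)

lemma cinner_pair_sesquilinear:
  "cinner_pair (u + u') v = cinner_pair u v + cinner_pair u' v"
  "cinner_pair u (v + v') = cinner_pair u v + cinner_pair u v'"
  "cinner_pair (cmul z u) v = z * cinner_pair u v"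
  "cinner_pair u (cmul z v) = cnj z * cinner_pair u v"
  by (simp_all add: cinner_pair_eq cmul_eq inner_add_left inner_add_right inner_diff_left inner_diff_right
      complex_eq_iff algebra_simps)

lemma map_prod_linear:
  assumes "linear U"
  shows "map_prod U U (u + v) = map_prod U U u + map_prod U U v" "map_prod U U (cmul z u) = cmul z (map_prod U U u)"
  using assms by (simp_all add: cmul_eq map_prod_def case_prod_unfold linear_add linear_diff linear_cmul)

lemma linear_tensor_perm: "\<sigma> \<in> perms n \<Longrightarrow> linear (tensor_perm n \<sigma>)"
  unfolding perms_def by (intro bounded_linear.linear tensor_perm_word(1)) simp

lemma qform_coeff_sesquilinear:
  "qform_coeff q i j (u + u') v = qform_coeff q i j u v + qform_coeff q i j u' v"
  "qform_coeff q i j u (v + v') = qform_coeff q i j u v + qform_coeff q i j u v'"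
  "qform_coeff q i j (cmul z u) v = z * qform_coeff q i j u v"
  "qform_coeff q i j u (cmul z v) = cnj z * qform_coeff q i j u v"
  by (simp_all add: qform_coeff_def cinner_pair_sesquilinear map_prod_linear[OF linear_tensor_perm] sum.distrib[symmetric]
      sum_distrib_left algebra_simps cong: sum.cong)

lemma qform_coeff_zero: "qform_coeff q i j 0 v = 0" "qform_coeff q i j u 0 = 0"
  using qform_coeff_sesquilinear(3)[of q i j 0 0 v] qform_coeff_sesquilinear(4)[of q i j u 0 0] by (simp_all add: cmul_eq zero_prod_def)

lemma qform_superset:
  assumes "finite K" "Poly_Mapping.keys \<xi> \<subseteq> K" "finite L" "Poly_Mapping.keys \<eta> \<subseteq> L"
  shows "qform q \<xi> \<eta> = (\<Sum>i\<in>K. \<Sum>j\<in>L. qform_coeff q i j (Poly_Mapping.lookup \<xi> i) (Poly_Mapping.lookup \<eta> j))"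
proof -
  have "(\<Sum>j\<in>Poly_Mapping.keys \<eta>. qform_coeff q i j u (Poly_Mapping.lookup \<eta> j)) = (\<Sum>j\<in>L. qform_coeff q i j u (Poly_Mapping.lookup \<eta> j))" for i u
    using assms by (intro sum.mono_neutral_left) (auto simp: in_keys_iff qform_coeff_zero)
  then have "qform q \<xi> \<eta> = (\<Sum>i\<in>Poly_Mapping.keys \<xi>. \<Sum>j\<in>L. qform_coeff q i j (Poly_Mapping.lookup \<xi> i) (Poly_Mapping.lookup \<eta> j))"
    by (simp only: qform_eq)
  also have "\<dots> = (\<Sum>i\<in>K. \<Sum>j\<in>L. qform_coeff q i j (Poly_Mapping.lookup \<xi> i) (Poly_Mapping.lookup \<eta> j))"
    using assms by (intro sum.mono_neutral_left) (auto simp: in_keys_iff qform_coeff_zero)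
  finally show ?thesis .
qed

lemma qform_sesquilinear:
  "qform q (\<xi> + \<xi>') \<eta> = qform q \<xi> \<eta> + qform q \<xi>' \<eta>"
  "qform q \<xi> (\<eta> + \<eta>') = qform q \<xi> \<eta> + qform q \<xi> \<eta>'"
  "qform q (tp_scale z \<xi>) \<eta> = z * qform q \<xi> \<eta>"
  "qform q \<xi> (tp_scale z \<eta>) = cnj z * qform q \<xi> \<eta>"
proof -
  define K L where "K = Poly_Mapping.keys \<xi> \<union> Poly_Mapping.keys \<xi>'" and "L = Poly_Mapping.keys \<eta> \<union> Poly_Mapping.keys \<eta>'"
  have k: "Poly_Mapping.keys \<xi> \<subseteq> K" "Poly_Mapping.keys \<xi>' \<subseteq> K" "Poly_Mapping.keys (\<xi> + \<xi>') \<subseteq> K" "Poly_Mapping.keys (tp_scale z \<xi>) \<subseteq> K"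
      "Poly_Mapping.keys \<eta> \<subseteq> L" "Poly_Mapping.keys \<eta>' \<subseteq> L" "Poly_Mapping.keys (\<eta> + \<eta>') \<subseteq> L" "Poly_Mapping.keys (tp_scale z \<eta>) \<subseteq> L"
    using Poly_Mapping.keys_add[of \<xi> \<xi>'] Poly_Mapping.keys_add[of \<eta> \<eta>'] keys_tp_scale[of z \<xi>] keys_tp_scale[of z \<eta>]
    by (auto simp: K_def L_def)
  have "finite K" "finite L" by (simp_all add: K_def L_def)
  note S = qform_superset[OF this(1) _ this(2)]
  show "qform q (\<xi> + \<xi>') \<eta> = qform q \<xi> \<eta> + qform q \<xi>' \<eta>"
    unfolding S[OF k(3,5)] S[OF k(1,5)] S[OF k(2,5)] lookup_add qform_coeff_sesquilinear sum.distrib ..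
  show "qform q \<xi> (\<eta> + \<eta>') = qform q \<xi> \<eta> + qform q \<xi> \<eta>'"
    unfolding S[OF k(1,7)] S[OF k(1,5)] S[OF k(1,6)] lookup_add qform_coeff_sesquilinear sum.distrib ..
  show "qform q (tp_scale z \<xi>) \<eta> = z * qform q \<xi> \<eta>"
    unfolding S[OF k(4,5)] S[OF k(1,5)] lookup_tp_scale qform_coeff_sesquilinear sum_distrib_left ..
  show "qform q \<xi> (tp_scale z \<eta>) = cnj z * qform q \<xi> \<eta>"
    unfolding S[OF k(1,8)] S[OF k(1,5)] lookup_tp_scale qform_coeff_sesquilinear sum_distrib_left ..
qed

lemma qform_zero: "qform q 0 \<eta> = 0" "qform q \<xi> 0 = 0"
  by (simp_all add: qform_eq)

lemma qform_sum:
  "qform q (\<Sum>i\<in>I. \<zeta> i) \<eta> = (\<Sum>i\<in>I. qform q (\<zeta> i) \<eta>)" "qform q \<xi> (\<Sum>i\<in>I. \<zeta> i) = (\<Sum>i\<in>I. qform q \<xi> (\<zeta> i))"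
  by (induction I rule: infinite_finite_induct) (simp_all add: qform_zero qform_sesquilinear)

lemma qform_diff: "qform q (\<xi> - \<xi>') \<eta> = qform q \<xi> \<eta> - qform q \<xi>' \<eta>" "qform q \<xi> (\<eta> - \<eta>') = qform q \<xi> \<eta> - qform q \<xi> \<eta>'"
proof -
  show "qform q (\<xi> - \<xi>') \<eta> = qform q \<xi> \<eta> - qform q \<xi>' \<eta>"
    using qform_sesquilinear(1)[of q "\<xi> - \<xi>'" \<xi>' \<eta>] by simp
  show "qform q \<xi> (\<eta> - \<eta>') = qform q \<xi> \<eta> - qform q \<xi> \<eta>'"
    using qform_sesquilinear(2)[of q \<xi> "\<eta> - \<eta>'" \<eta>'] by simp
qed

lemma qform_tpconv:
  assumes "tpconv \<xi>s \<xi>" "tpconv \<eta>s \<eta>"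
  shows "(\<lambda>j. qform q (\<xi>s j) (\<eta>s j)) \<longlonglongrightarrow> qform q \<xi> \<eta>"
proof -
  obtain K where K: "finite K" "\<And>j. Poly_Mapping.keys (\<xi>s j) \<subseteq> K" "Poly_Mapping.keys \<xi> \<subseteq> K"
    by (rule tpconvE[OF assms(1)]) blast
  obtain L where L: "finite L" "\<And>j. Poly_Mapping.keys (\<eta>s j) \<subseteq> L" "Poly_Mapping.keys \<eta> \<subseteq> L"
    by (rule tpconvE[OF assms(2)]) blast
  have qc: "(\<lambda>j. qform_coeff q i k (us j) (vs j)) \<longlonglongrightarrow> qform_coeff q i k u v" if "us \<longlonglongrightarrow> u" "vs \<longlonglongrightarrow> v"
    for i k us vs and u v :: "'a tensor_space \<times> 'a tensor_space"
  proof -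
    have "(\<lambda>j. cinner_pair (us j) (map_prod (tensor_perm (fst i) \<sigma>) (tensor_perm (fst i) \<sigma>) (vs j)))
        \<longlonglongrightarrow> cinner_pair u (map_prod (tensor_perm (fst i) \<sigma>) (tensor_perm (fst i) \<sigma>) v)" if "\<sigma> \<in> perms (fst i)" for \<sigma>
    proof -
      have "\<sigma> permutes {1..fst i}" using that by (simp add: perms_def)
      note b = bounded_linear.tendsto[OF tensor_perm_word(1)[OF this]]
      show ?thesis unfolding cinner_pair_eq fst_map_prod snd_map_prod o_apply
        by (intro tendsto_add tendsto_diff tendsto_mult tendsto_const tendsto_of_real tendsto_inner b tendsto_fst tendsto_snd
            \<open>us \<longlonglongrightarrow> u\<close> \<open>vs \<longlonglongrightarrow> v\<close>)
    qed
    then show ?thesis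
      unfolding qform_coeff_def by (cases "fst i = fst k") (simp_all add: tendsto_sum tendsto_mult_left)
  qed
  show ?thesis
    unfolding qform_superset[OF K(1,2) L(1,2)] qform_superset[OF K(1,3) L(1,3)]
    by (intro tendsto_sum qc tpconvD assms)
qed

lemma inner_word: "inner (word n h) (word n g) = (\<Prod>i\<in>{1..n}. inner (h i) (g i))"
proof -
  have "inner (word n h) (word n g) = (\<Prod>i<n. inner (h (Suc i)) (g (Suc i)))"
    unfolding word_def inner_tensor by (auto intro!: prod.cong simp del: upt_Suc)
  also have "\<dots> = (\<Prod>i\<in>{1..n}. inner (h i) (g i))"
    by (rule prod.reindex_bij_witness[of _ "\<lambda>i. i - 1" Suc]) auto
  finally show ?thesis .
qed

lemma qform_elem: "qform q (elem_tensor n \<alpha> F) (elem_tensor k \<beta> G) = (if n = k then \<Sum>\<sigma>\<in>perms n.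
    of_real (chi q n (\<alpha> \<circ> (\<sigma> \<circ> inv \<beta> \<circ> inv \<sigma>)) * inner F (tensor_perm n \<sigma> G)) else 0)"
proof -
  have k: "Poly_Mapping.keys (elem_tensor n \<alpha> F) \<subseteq> {(n, \<alpha>)}" for n \<alpha> and F :: "'a tensor_space"
    by (simp add: elem_tensor_def)
  have z: "tensor_perm n \<sigma> 0 = (0::'a tensor_space)" if "\<sigma> \<in> perms n" for \<sigma>
    using linear_0[OF linear_tensor_perm[OF that]] .
  have "cinner_pair (F, 0) (map_prod (tensor_perm n \<sigma>) (tensor_perm n \<sigma>) (G, 0)) = of_real (inner F (tensor_perm n \<sigma> G))"
    if "\<sigma> \<in> perms n" for \<sigma>
    using z[OF that] by (simp add: cinner_pair_eq)
  then have "n = k \<Longrightarrow> qform_coeff q (n, \<alpha>) (k, \<beta>) (F, 0) (G, 0) = (\<Sum>\<sigma>\<in>perms n.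
      of_real (chi q n (\<alpha> \<circ> (\<sigma> \<circ> inv \<beta> \<circ> inv \<sigma>)) * inner F (tensor_perm n \<sigma> G)))"
    unfolding qform_coeff_def fst_conv snd_conv by (simp add: o_assoc cong: sum.cong)
  then show ?thesis
    unfolding qform_superset[OF finite.insertI[OF finite.emptyI] k finite.insertI[OF finite.emptyI] k]
    by (simp add: elem_tensor_def qform_coeff_def)
qed

lemma cyc0_le:
  assumes "\<gamma> permutes insert 0 X" "finite X" "0 \<notin> X"
  shows "cyc0 (insert 0 X) \<gamma> \<le> card X"
  using cyc0_eq_card_orbits[OF assms(1)] card_image_le[of "insert 0 X" "orbit \<gamma>"] assms by simp

text \<open>
  A matching between \<open>n\<close> points and \<open>n\<close> other points is a permutation \<open>\<sigma>\<close>, and its summand in the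
  state of a product is the summand of \<open>\<sigma>\<close> in the deformed inner product.
\<close>

lemma phi_mul_words:
  assumes \<alpha>: "\<alpha> \<in> perms0 n" and \<beta>: "\<beta> \<in> perms0 k"
  shows "phi (mul q (diagram {1..k} \<beta> g) (diagram {1..n} \<alpha> h)) = (if n = k then \<Sum>\<sigma>\<in>perms n.
    of_real (chi q n (\<alpha> \<circ> (\<sigma> \<circ> \<beta> \<circ> inv \<sigma>)) * (\<Prod>i\<in>{1..n}. inner (h i) (g (inv \<sigma> i)))) else 0)"
proof -
  note A = labelledD[OF \<alpha>[unfolded perms0_labelled]] and B = labelledD[OF \<beta>[unfolded perms0_labelled]]
  obtain s where s: "bij s" "s 0 = 0" "\<And>j. j \<in> {1..k} \<Longrightarrow> s j = n + j" using ex_shift by blast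
  note si = inv_f_f[OF bij_is_inj[OF s(1)]]
  define X \<beta>' where "X = s ` {1..k}" and "\<beta>' = s \<circ> \<beta> \<circ> inv s"
  define f where "f i = (if i \<in> {1..n} then h i else g (inv s i))" for i
  have X: "x > n" if "x \<in> X" for x using that s(3) by (auto simp: X_def)
  then have disj: "X \<inter> {1..n} = {}" and X0: "0 \<notin> X" by force+
  have finX: "finite X" by (simp add: X_def)
  have im: "s ` insert 0 {1..k} = insert 0 X" using s(2) by (simp add: X_def)
  have l: "labelled X \<beta>'"
    using conj_permutes[OF s(1) B(3)] X0 finX unfolding im \<beta>'_def labelled_def by blast
  have l': "labelled {1..n} \<alpha>" using \<alpha> by (simp only: perms0_labelled)
  have cX: "card X = k" using card_image[OF inj_on_subset[OF bij_is_inj[OF s(1)] subset_UNIV], of "{1..k}"] by (simp add: X_def)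
  have "diagram {1..k} \<beta> g = diagram X \<beta>' (g \<circ> inv s)"
    unfolding X_def \<beta>'_def by (rule diagram_conj[OF B s(1,2), symmetric])
  also have "\<dots> = diagram X \<beta>' f"
    using disj by (intro diagram_cong finX) (auto simp: f_def)
  finally have d1: "diagram {1..k} \<beta> g = diagram X \<beta>' f" .
  have d2: "diagram {1..n} \<alpha> h = diagram {1..n} \<alpha> f" by (intro diagram_cong) (auto simp: f_def)
  have phi: "phi (mul q (diagram {1..k} \<beta> g) (diagram {1..n} \<alpha> h)) = of_real (matching_sum q X \<beta>' {1..n} \<alpha> f)"
    unfolding d1 d2 by (rule phi_mul_diagram[OF l l' disj])
  show ?thesis
  proof (cases "n = k")
    case False
    then have "matchings X {1..n} = {}" using matching_card[OF _ disj] cX by auto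
    with False show ?thesis unfolding phi matching_sum_def by simp
  next
    case True
    then have Xn: "s ` {1..n} = X" by (simp add: X_def)
    have summand: "q powi (int (card X) - int (cyc0 (insert 0 {1..n}) (\<alpha> \<circ> (\<pi> \<circ> \<beta>' \<circ> \<pi>)))) * weight \<pi> f
        = chi q n (\<alpha> \<circ> (\<sigma> \<circ> \<beta> \<circ> inv \<sigma>)) * (\<Prod>i\<in>{1..n}. inner (h i) (g (inv \<sigma> i)))"
      if \<sigma>: "\<sigma> permutes {1..n}" and \<pi>: "\<pi> \<in> matchings X {1..n}" and \<pi>_def: "\<pi> = matching_of s X {1..n} \<sigma>" for \<sigma> \<pi>
    proof -
      note M = matchingsD[OF \<pi> disj]
      have \<pi>0: "\<pi> 0 = 0" using X0 by (intro M(9)) simp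
      have \<sigma>0: "\<sigma> 0 = 0" using permutes_not_in[OF \<sigma>, of 0] by simp
      have \<pi>s: "\<pi> (s z) = \<sigma> z" if "z \<in> insert 0 {1..n}" for z
      proof (cases "z = 0")
        case True
        then show ?thesis by (simp add: s(2) \<pi>0 \<sigma>0)
      next
        case False
        then have "s z \<in> X" using that Xn by blast
        moreover have "s z \<notin> {1..n}" using calculation disj by blast
        ultimately show ?thesis unfolding \<pi>_def matching_of_def by (simp only: if_True if_False si)
      qed
      have "\<pi> \<circ> \<beta>' \<circ> \<pi> = (\<pi> \<circ> s) \<circ> \<beta> \<circ> inv (\<pi> \<circ> s)"
        using bij_inv_comp(3)[OF M(5) s(1), of \<beta>] unfolding \<beta>'_def M(6) .
      also have "\<dots> = \<sigma> \<circ> \<beta> \<circ> inv \<sigma>"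
        using B(3) True \<pi>s by (intro conj_eqI[where Z = "insert 0 {1..n}"] bij_comp M(5) s(1) permutes_bij[OF \<sigma>]) simp_all
      finally have c: "\<pi> \<circ> \<beta>' \<circ> \<pi> = \<sigma> \<circ> \<beta> \<circ> inv \<sigma>" .
      have "\<sigma> ` insert 0 {1..n} = insert 0 {1..n}" using \<sigma>0 permutes_image[OF \<sigma>] by simp
      then have "\<sigma> \<circ> \<beta> \<circ> inv \<sigma> permutes insert 0 {1..n}"
        using conj_permutes[OF permutes_bij[OF \<sigma>] B(3)[folded True]] by simp
      then have le: "cyc0 (insert 0 {1..n}) (\<alpha> \<circ> (\<sigma> \<circ> \<beta> \<circ> inv \<sigma>)) \<le> n"
        using cyc0_le[OF permutes_compose[OF _ A(3)] A(1,2)] by simp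
      have e: "insert 0 {1..n} = {0..n}" by auto
      have "q powi (int (card X) - int (cyc0 (insert 0 {1..n}) (\<alpha> \<circ> (\<sigma> \<circ> \<beta> \<circ> inv \<sigma>)))) = chi q n (\<alpha> \<circ> (\<sigma> \<circ> \<beta> \<circ> inv \<sigma>))"
        using le unfolding cX True[symmetric] chi_def e of_nat_diff[symmetric, OF le[unfolded e]] by (simp only: power_int_of_nat)
      moreover have "weight \<pi> f = (\<Prod>i\<in>{1..n}. inner (f i) (f (\<pi> i)))"
        using M(2,8) disj by (intro weight_transversal M(4)) blast+
      moreover have "f i = h i" "f (\<pi> i) = g (inv \<sigma> i)" if "i \<in> {1..n}" for i
      proof -
        show "f i = h i" using that by (simp add: f_def)
        have "\<pi> i \<notin> {1..n}" using that M(8) disj by blast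
        moreover have "\<pi> i = s (inv \<sigma> i)" using that by (simp add: \<pi>_def matching_of_def)
        ultimately show "f (\<pi> i) = g (inv \<sigma> i)" unfolding f_def by (simp only: if_False si)
      qed
      ultimately show ?thesis unfolding c by simp
    qed
    note b = bij_betw_matchings[OF s(1) Xn disj]
    have "matching_sum q X \<beta>' {1..n} \<alpha> f = (\<Sum>\<sigma> | \<sigma> permutes {1..n}.
        chi q n (\<alpha> \<circ> (\<sigma> \<circ> \<beta> \<circ> inv \<sigma>)) * (\<Prod>i\<in>{1..n}. inner (h i) (g (inv \<sigma> i))))"
      unfolding matching_sum_def sum.reindex_bij_betw[OF b, symmetric]
      using bij_betw_apply[OF b] by (intro sum.cong refl summand) auto
    with True show ?thesis unfolding phi perms_def by (simp only: if_True of_real_sum simp_thms)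
  qed
qed

lemma qform_TP: "\<xi> \<in> TP \<Longrightarrow> \<eta> \<in> TP \<Longrightarrow> qform q \<xi> \<eta> = phi (mul q (flip \<eta>) \<xi>)"
proof (induction \<xi> \<eta> rule: TP_induct2)
  case (diagram X \<alpha>' Y \<beta>' f)
  obtain \<alpha> h where \<alpha>: "\<alpha> \<in> perms0 (card X)" and d1: "diagram X \<alpha>' f = sym_tensor (card X) \<alpha> (word (card X) h)"
    using diagram_sym_tensor[OF diagram(1)] by blast
  obtain \<beta> g where \<beta>: "\<beta> \<in> perms0 (card Y)" and d2: "diagram Y \<beta>' f = sym_tensor (card Y) \<beta> (word (card Y) g)"
    using diagram_sym_tensor[OF diagram(2)] by blast
  define n k where "n = card X" and "k = card Y"
  note A = labelledD[OF \<alpha>[unfolded perms0_labelled, folded n_def]] and B = labelledD[OF \<beta>[unfolded perms0_labelled, folded k_def]]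
  have B': "inv \<beta> permutes insert 0 {1..k}" by (rule permutes_inv[OF B(3)])
  have conj: "\<sigma> \<circ> \<gamma> \<circ> inv \<sigma> \<in> perms0 m" "diagram {1..m} (\<sigma> \<circ> \<gamma> \<circ> inv \<sigma>) (e \<circ> inv \<sigma>) = diagram {1..m} \<gamma> e"
    if \<sigma>: "\<sigma> \<in> perms m" and \<gamma>: "\<gamma> permutes insert 0 {1..m}" for m \<sigma> \<gamma> and e :: "nat \<Rightarrow> 'a"
  proof -
    have p: "\<sigma> permutes {1..m}" using \<sigma> by (simp add: perms_def)
    have s: "bij \<sigma>" "\<sigma> 0 = 0" "\<sigma> ` {1..m} = {1..m}"
      using permutes_bij[OF p] permutes_not_in[OF p, of 0] permutes_image[OF p] by simp_all
    have im: "\<sigma> ` insert 0 {1..m} = insert 0 {1..m}" using s(2,3) by (simp only: image_insert)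
    show "\<sigma> \<circ> \<gamma> \<circ> inv \<sigma> \<in> perms0 m"
      using conj_permutes[OF s(1) \<gamma>] unfolding im perms0_labelled labelled_def by simp
    show "diagram {1..m} (\<sigma> \<circ> \<gamma> \<circ> inv \<sigma>) (e \<circ> inv \<sigma>) = diagram {1..m} \<gamma> e"
      using diagram_conj[OF _ _ \<gamma> s(1,2), of e] unfolding s(3) by simp
  qed
  define V where "V = phi (mul q (diagram {1..k} (inv \<beta>) g) (diagram {1..n} \<alpha> h))"
  have summand: "qform q (elem_tensor n (\<sigma> \<circ> \<alpha> \<circ> inv \<sigma>) (tensor_perm n \<sigma> (word n h)))
      (elem_tensor k (\<tau> \<circ> \<beta> \<circ> inv \<tau>) (tensor_perm k \<tau> (word k g))) = V"
    if \<sigma>: "\<sigma> \<in> perms n" and \<tau>: "\<tau> \<in> perms k" for \<sigma> \<tau>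
  proof -
    have p: "\<sigma> permutes {1..n}" "\<tau> permutes {1..k}" using \<sigma> \<tau> by (simp_all add: perms_def)
    note b = permutes_bij[OF p(2)] permutes_bij[OF B(3)]
    have i: "inv (\<tau> \<circ> \<beta> \<circ> inv \<tau>) = \<tau> \<circ> inv \<beta> \<circ> inv \<tau>"
      unfolding o_inv_distrib[OF bij_comp[OF b(2,1)] bij_imp_bij_inv[OF b(1)]] o_inv_distrib[OF b(1,2)] inv_inv_eq[OF b(1)]
      by (simp only: o_assoc)
    have w: "tensor_perm k \<rho> (word k (g \<circ> inv \<tau>)) = word k (g \<circ> inv \<tau> \<circ> inv \<rho>)" if "\<rho> \<in> perms k" for \<rho>
      using that unfolding perms_def by (intro tensor_perm_word(2)) simp
    have "qform q (elem_tensor n (\<sigma> \<circ> \<alpha> \<circ> inv \<sigma>) (tensor_perm n \<sigma> (word n h)))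
        (elem_tensor k (\<tau> \<circ> \<beta> \<circ> inv \<tau>) (tensor_perm k \<tau> (word k g)))
      = phi (mul q (diagram {1..k} (\<tau> \<circ> inv \<beta> \<circ> inv \<tau>) (g \<circ> inv \<tau>)) (diagram {1..n} (\<sigma> \<circ> \<alpha> \<circ> inv \<sigma>) (h \<circ> inv \<sigma>)))"
      unfolding qform_elem phi_mul_words[OF conj(1)[OF \<sigma> A(3)] conj(1)[OF \<tau> B']] tensor_perm_word(2)[OF p(1)] tensor_perm_word(2)[OF p(2)] i
      by (intro if_cong refl sum.cong arg_cong[where f = of_real] arg_cong2[where f = "(*)"]) (simp add: w inner_word)
    also have "\<dots> = V" unfolding conj(2)[OF \<sigma> A(3)] conj(2)[OF \<tau> B'] V_def ..
    finally show ?thesis .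
  qed
  have "qform q (sym_tensor n \<alpha> (word n h)) (sym_tensor k \<beta> (word k g)) = (1 / fact n) * (cnj (1 / fact k) *
      (\<Sum>\<tau>\<in>perms k. \<Sum>\<sigma>\<in>perms n. V))"
    unfolding sym_tensor_def qform_sesquilinear qform_sum using summand by (simp cong: sum.cong)
  also have "\<dots> = V" by (simp add: card_perms)
  finally have "qform q (sym_tensor n \<alpha> (word n h)) (sym_tensor k \<beta> (word k g)) = V" .
  then show ?case
    unfolding d1 d2 V_def n_def[symmetric] k_def[symmetric] diagram_word[OF A(3), symmetric] diagram_word[OF B(3), symmetric] flip_diagram[OF B] .
qed (simp_all only: qform_sesquilinear flip_add flip_scale mul_linear phi_add phi_scale)

text \<open>Both sides are sequentially continuous, so the identity extends from the algebraic tensors.\<close>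

lemma qform_phi:
  assumes "\<xi> \<in> TPbar" "\<eta> \<in> TPbar"
  shows "qform q \<xi> \<eta> = phi (mul q (flip \<eta>) \<xi>)"
proof -
  obtain \<xi>s where x: "\<And>j. \<xi>s j \<in> TP" "tpconv \<xi>s \<xi>" using TPbar_approx[OF assms(1)] by metis
  obtain \<eta>s where y: "\<And>j. \<eta>s j \<in> TP" "tpconv \<eta>s \<eta>" using TPbar_approx[OF assms(2)] by metis
  have "(\<lambda>j. phi (mul q (flip (\<eta>s j)) (\<xi>s j))) \<longlonglongrightarrow> phi (mul q (flip \<eta>) \<xi>)"
    by (intro phi_tpconv tpconv_mul tpconv_flip x y)
  moreover have "(\<lambda>j. qform q (\<xi>s j) (\<eta>s j)) \<longlonglongrightarrow> qform q \<xi> \<eta>" by (intro qform_tpconv x y)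
  ultimately show ?thesis unfolding qform_TP[OF x(1) y(1)] using LIMSEQ_unique by blast
qed

section \<open>The quotient by the kernel\<close>

text \<open>
  Since the form comes from a tracial state, its kernel consists of the elements orthogonal to
  everything under the product alone, and is therefore a two-sided ideal invariant under the adjoint.
\<close>

lemma qkernel_iff: "\<xi> \<in> qkernel q \<longleftrightarrow> \<xi> \<in> TPbar \<and> (\<forall>\<zeta>\<in>TPbar. phi (mul q \<zeta> \<xi>) = 0)"
proof
  assume \<xi>: "\<xi> \<in> qkernel q"
  then have b: "\<xi> \<in> TPbar" by (simp add: qkernel_def)
  have "phi (mul q \<zeta> \<xi>) = 0" if "\<zeta> \<in> TPbar" for \<zeta>
  proof -
    have "qform q \<xi> (flip \<zeta>) = 0" using \<xi> flip_TPbar[OF that] by (simp add: qkernel_def)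
    then show ?thesis unfolding qform_phi[OF b flip_TPbar[OF that]] flip_flip_TPbar[OF that] .
  qed
  with b show "\<xi> \<in> TPbar \<and> (\<forall>\<zeta>\<in>TPbar. phi (mul q \<zeta> \<xi>) = 0)" by blast
next
  assume "\<xi> \<in> TPbar \<and> (\<forall>\<zeta>\<in>TPbar. phi (mul q \<zeta> \<xi>) = 0)"
  then show "\<xi> \<in> qkernel q" by (simp add: qkernel_def qform_phi flip_TPbar)
qed

lemma qkernelD:
  assumes "\<xi> \<in> qkernel q"
  shows "\<xi> \<in> TPbar" "\<zeta> \<in> TPbar \<Longrightarrow> phi (mul q \<zeta> \<xi>) = 0"
  using assms by (auto simp: qkernel_iff)

lemma qkernel_closed:
  "0 \<in> qkernel q" "\<xi> \<in> qkernel q \<Longrightarrow> \<eta> \<in> qkernel q \<Longrightarrow> \<xi> + \<eta> \<in> qkernel q"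
  "\<xi> \<in> qkernel q \<Longrightarrow> tp_scale z \<xi> \<in> qkernel q"
  unfolding qkernel_def by (simp_all add: TPbar_closed qform_zero qform_sesquilinear)

lemma qkernel_diff: "\<xi> \<in> qkernel q \<Longrightarrow> \<eta> \<in> qkernel q \<Longrightarrow> \<xi> - \<eta> \<in> qkernel q"
  using qkernel_closed(2)[of \<xi> q "tp_scale (-1) \<eta>"] qkernel_closed(3)[of \<eta> q "-1"] by simp

lemma qkernel_mul:
  assumes q: "q \<noteq> 0" and \<xi>: "\<xi> \<in> qkernel q" and \<zeta>: "\<zeta> \<in> TPbar"
  shows "mul q \<zeta> \<xi> \<in> qkernel q" "mul q \<xi> \<zeta> \<in> qkernel q"
proof -
  note b = qkernelD(1)[OF \<xi>] and m = mul_TPbar[OF q] and a = mul_assoc_TPbar[OF q]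
  have "phi (mul q \<omega> (mul q \<zeta> \<xi>)) = 0" if "\<omega> \<in> TPbar" for \<omega>
    unfolding a[OF that \<zeta> b, symmetric] by (intro qkernelD(2)[OF \<xi>] m that \<zeta>)
  then show "mul q \<zeta> \<xi> \<in> qkernel q" using m[OF \<zeta> b] by (simp add: qkernel_iff)
  have "phi (mul q \<omega> (mul q \<xi> \<zeta>)) = 0" if "\<omega> \<in> TPbar" for \<omega>
    unfolding a[OF that b \<zeta>, symmetric] phi_mul_commute[OF m[OF that b] \<zeta>] a[OF \<zeta> that b, symmetric]
    by (intro qkernelD(2)[OF \<xi>] m that \<zeta>)
  then show "mul q \<xi> \<zeta> \<in> qkernel q" using m[OF b \<zeta>] by (simp add: qkernel_iff)
qed

lemma qkernel_flip:
  assumes q: "q \<noteq> 0" and \<xi>: "\<xi> \<in> qkernel q"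
  shows "flip \<xi> \<in> qkernel q"
proof -
  note b = qkernelD(1)[OF \<xi>]
  have "phi (mul q \<zeta> (flip \<xi>)) = 0" if \<zeta>: "\<zeta> \<in> TPbar" for \<zeta>
  proof -
    note f = flip_TPbar[OF \<zeta>]
    have "phi (flip (mul q \<xi> (flip \<zeta>))) = cnj (phi (mul q (flip \<zeta>) \<xi>))"
      by (simp only: phi_flip[OF mul_TPbar[OF q b f]] phi_mul_commute[OF b f])
    then show ?thesis
      unfolding flip_mul_TPbar[OF q b f] flip_flip_TPbar[OF \<zeta>] by (simp add: qkernelD(2)[OF \<xi> f])
  qed
  then show ?thesis using flip_TPbar[OF b] by (simp add: qkernel_iff)
qed

lemma equiv_qrel: "equiv TPbar (qrel q)"
proof (rule equivI)
  show "qrel q \<subseteq> TPbar \<times> TPbar" by (auto simp: qrel_def)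
  show "refl_on TPbar (qrel q)" by (auto simp: refl_on_def qrel_def qkernel_closed)
  show "sym (qrel q)"
  proof (rule symI)
    fix \<xi> \<eta> assume "(\<xi>, \<eta>) \<in> qrel q"
    then show "(\<eta>, \<xi>) \<in> qrel q" using qkernel_diff[OF qkernel_closed(1), of "\<xi> - \<eta>"] by (simp add: qrel_def)
  qed
  show "trans (qrel q)"
  proof (rule transI)
    fix \<xi> \<eta> \<zeta> assume "(\<xi>, \<eta>) \<in> qrel q" "(\<eta>, \<zeta>) \<in> qrel q"
    then show "(\<xi>, \<zeta>) \<in> qrel q" using qkernel_closed(2)[of "\<xi> - \<eta>" q "\<eta> - \<zeta>"] by (simp add: qrel_def)
  qed
qed

lemma qclass_eqI: "\<xi> \<in> TPbar \<Longrightarrow> \<eta> \<in> TPbar \<Longrightarrow> \<xi> - \<eta> \<in> qkernel q \<Longrightarrow> qclass q \<xi> = qclass q \<eta>"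
  unfolding qclass_def by (rule equiv_class_eq[OF equiv_qrel]) (simp add: qrel_def)

lemma qrep_qclass:
  assumes "\<xi> \<in> TPbar"
  shows "qrep (qclass q \<xi>) \<in> TPbar" "\<xi> - qrep (qclass q \<xi>) \<in> qkernel q"
proof -
  have "\<xi> \<in> qclass q \<xi>" unfolding qclass_def by (rule equiv_class_self[OF equiv_qrel assms])
  then have "qrep (qclass q \<xi>) \<in> qclass q \<xi>" unfolding qrep_def by (rule someI)
  then have "(\<xi>, qrep (qclass q \<xi>)) \<in> qrel q"
    using Image_singleton_iff[of _ "qrel q" \<xi>] unfolding qclass_def by blast
  then show "qrep (qclass q \<xi>) \<in> TPbar" "\<xi> - qrep (qclass q \<xi>) \<in> qkernel q"
    unfolding qrel_def by blast+
qed

definition qmul :: "real \<Rightarrow> 'a::real_inner tp set \<Rightarrow> 'a tp set \<Rightarrow> 'a tp set" where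
  "qmul q X Y = qclass q (mul q (qrep X) (qrep Y))"

definition qadj :: "real \<Rightarrow> 'a::real_inner tp set \<Rightarrow> 'a tp set" where
  "qadj q X = qclass q (flip (qrep X))"

lemma qadd_qclass:
  assumes "\<xi> \<in> TPbar" "\<eta> \<in> TPbar"
  shows "qadd q (qclass q \<xi>) (qclass q \<eta>) = qclass q (\<xi> + \<eta>)"
proof -
  note x = qrep_qclass[OF assms(1), of q] and y = qrep_qclass[OF assms(2), of q]
  have "(\<xi> + \<eta>) - (qrep (qclass q \<xi>) + qrep (qclass q \<eta>)) \<in> qkernel q"
    using qkernel_closed(2)[OF x(2) y(2)] by (simp add: algebra_simps)
  then show ?thesis
    unfolding qadd_def by (intro qclass_eqI[symmetric] TPbar_closed assms x(1) y(1))
qed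

lemma qscale_qclass:
  assumes "\<xi> \<in> TPbar"
  shows "qscale q z (qclass q \<xi>) = qclass q (tp_scale z \<xi>)"
proof -
  note x = qrep_qclass[OF assms(1), of q]
  have "tp_scale z \<xi> - tp_scale z (qrep (qclass q \<xi>)) \<in> qkernel q"
    using qkernel_closed(3)[OF x(2), of z] by (simp add: tp.scale_right_diff_distrib)
  then show ?thesis
    unfolding qscale_def by (intro qclass_eqI[symmetric] TPbar_closed assms x(1))
qed

lemma mul_diff:
  "mul q (\<xi> - \<xi>') \<eta> = mul q \<xi> \<eta> - mul q \<xi>' \<eta>" "mul q \<xi> (\<eta> - \<eta>') = mul q \<xi> \<eta> - mul q \<xi> \<eta>'"
proof -
  show "mul q (\<xi> - \<xi>') \<eta> = mul q \<xi> \<eta> - mul q \<xi>' \<eta>"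
    using mul_linear(1)[of q "\<xi> - \<xi>'" \<xi>' \<eta>] by simp
  show "mul q \<xi> (\<eta> - \<eta>') = mul q \<xi> \<eta> - mul q \<xi> \<eta>'"
    using mul_linear(2)[of q \<xi> "\<eta> - \<eta>'" \<eta>'] by simp
qed

lemma flip_diff: "flip (\<xi> - \<eta>) = flip \<xi> - flip \<eta>"
  using flip_add[of "\<xi> - \<eta>" \<eta>] by simp

lemma qmul_qclass:
  assumes q: "q \<noteq> 0" and "\<xi> \<in> TPbar" "\<eta> \<in> TPbar"
  shows "qmul q (qclass q \<xi>) (qclass q \<eta>) = qclass q (mul q \<xi> \<eta>)"
proof -
  note x = qrep_qclass[OF assms(2), of q] and y = qrep_qclass[OF assms(3), of q]
  have "mul q (\<xi> - qrep (qclass q \<xi>)) \<eta> + mul q (qrep (qclass q \<xi>)) (\<eta> - qrep (qclass q \<eta>)) \<in> qkernel q"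
    by (intro qkernel_closed(2) qkernel_mul q assms x y)
  then have "mul q \<xi> \<eta> - mul q (qrep (qclass q \<xi>)) (qrep (qclass q \<eta>)) \<in> qkernel q"
    by (simp add: mul_diff)
  then show ?thesis
    unfolding qmul_def by (intro qclass_eqI[symmetric] mul_TPbar assms x(1) y(1))
qed

lemma qadj_qclass:
  assumes q: "q \<noteq> 0" and "\<xi> \<in> TPbar"
  shows "qadj q (qclass q \<xi>) = qclass q (flip \<xi>)"
proof -
  note x = qrep_qclass[OF assms(2), of q]
  have "flip \<xi> - flip (qrep (qclass q \<xi>)) \<in> qkernel q"
    using qkernel_flip[OF q x(2)] by (simp only: flip_diff)
  then show ?thesis
    unfolding qadj_def by (intro qclass_eqI[symmetric] flip_TPbar assms x(1))
qed

text \<open>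
  The kernel is orthogonal to everything in either argument of the form, in the second one because it is
  invariant under the adjoint; so the chosen representatives do not matter.
\<close>

lemma qdist_qclass:
  assumes q: "q \<noteq> 0" and "\<xi> \<in> TPbar" "\<eta> \<in> TPbar"
  shows "qdist q (qclass q \<xi>) (qclass q \<eta>) = sqrt (Re (qform q (\<xi> - \<eta>) (\<xi> - \<eta>)))"
proof -
  note x = qrep_qclass[OF assms(2), of q] and y = qrep_qclass[OF assms(3), of q]
  define D where "D = \<xi> - \<eta>"
  define N where "N = (\<xi> - qrep (qclass q \<xi>)) - (\<eta> - qrep (qclass q \<eta>))"
  have e: "qrep (qclass q \<xi>) - qrep (qclass q \<eta>) = D - N" by (simp add: D_def N_def)
  have D: "D \<in> TPbar" unfolding D_def by (intro TPbar_closed assms)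
  have N: "N \<in> qkernel q" unfolding N_def by (intro qkernel_diff x y)
  note Nb = qkernelD(1)[OF N]
  have "qform q N Z = 0" if "Z \<in> TPbar" for Z using N that by (simp add: qkernel_def)
  moreover have "qform q D N = 0"
    unfolding qform_phi[OF D Nb] phi_mul_commute[OF flip_TPbar[OF Nb] D] by (rule qkernelD(2)[OF qkernel_flip[OF q N] D])
  ultimately have "qform q (D - N) (D - N) = qform q D D" by (simp add: qform_diff D Nb)
  then show ?thesis unfolding qdist_def e by (simp only: D_def)
qed

lemma TPq_eq: "TPq q = qclass q ` TPbar"
  by (auto simp: TPq_def quotient_def qclass_def)

lemma star_algebra_image:
  fixes scale :: "complex \<Rightarrow> 'v \<Rightarrow> 'v" and zero one :: 'v and add mult :: "'v \<Rightarrow> 'v \<Rightarrow> 'v" and star :: "'v \<Rightarrow> 'v"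
    and f :: "'v \<Rightarrow> 'w"
  assumes "star_algebra V add zero scale mult one star"
    and hom: "\<And>x y. x \<in> V \<Longrightarrow> y \<in> V \<Longrightarrow> add' (f x) (f y) = f (add x y)"
      "\<And>a x. x \<in> V \<Longrightarrow> scale' a (f x) = f (scale a x)"
      "\<And>x y. x \<in> V \<Longrightarrow> y \<in> V \<Longrightarrow> mult' (f x) (f y) = f (mult x y)"
      "\<And>x. x \<in> V \<Longrightarrow> star' (f x) = f (star x)"
  shows "star_algebra (f ` V) add' (f zero) scale' mult' (f one) star'"
proof -
  interpret star_algebra V add zero scale mult one star by fact
  note c = add_closed zero_closed scale_closed mult_closed one_closed star_closed
  show ?thesis
  proof (rule star_algebra.intro)
    show "\<exists>y\<in>f ` V. add' x y = f zero" if x: "x \<in> f ` V" for x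
    proof -
      obtain v where v: "v \<in> V" "x = f v" using x by (rule imageE)
      obtain w where "w \<in> V" "add v w = zero" using add_inverse[OF v(1)] by blast
      then show ?thesis using v hom(1) by auto
    qed
    show "add' x y = add' y x" if "x \<in> f ` V" "y \<in> f ` V" for x y
      using that hom(1) add_commute by auto
  qed (auto simp: hom c add_assoc zero_add scale_add_right scale_add_left scale_scale scale_one mult_assoc
      one_mult mult_one mult_add add_mult mult_scale scale_mult star_star star_add star_scale star_mult)
qed

lemma star_algebra_TPq:
  assumes "q \<noteq> 0"
  shows "star_algebra (TPq q) (qadd q) (qclass q 0) (qscale q) (qmul q) (qclass q tp_one) (qadj q)"
  unfolding TPq_eq
  by (rule star_algebra_image[OF star_algebra_TPbar[OF assms] qadd_qclass qscale_qclass qmul_qclass[OF assms] qadj_qclass[OF assms]])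

lemma extends_TPbar:
  assumes "q \<noteq> 0"
  shows "extends_by_continuity q id tp_dist (mul q) flip"
proof (rule extends_by_continuityI[OF _ _ _ _ _ assms])
  show "(\<lambda>j. tp_dist (id (\<xi>s j)) (id \<xi>)) \<longlonglongrightarrow> 0" if "tpconv \<xi>s \<xi>" for \<xi>s and \<xi> :: "'a tp"
    using tp_dist_tpconv[OF that] by simp
qed (simp_all add: assms tp_mult_eq_mul tp_adj_eq_flip)

lemma extends_TPq:
  assumes q: "q \<noteq> 0"
  shows "extends_by_continuity q (qclass q) (qdist q) (qmul q) (qadj q)"
proof (rule extends_by_continuityI[OF _ _ _ _ _ q])
  show "qmul q (qclass q A) (qclass q B) = qclass q (tp_mult q A B)" if "A \<in> TP" "B \<in> TP" for A B :: "'a tp"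
    using that by (simp add: qmul_qclass q TP_subset_TPbar tp_mult_eq_mul)
  show "qadj q (qclass q A) = qclass q (tp_adj q A)" if "A \<in> TP" for A :: "'a tp"
    using that by (simp add: qadj_qclass q TP_subset_TPbar tp_adj_eq_flip)
  show "(\<lambda>j. qdist q (qclass q (\<xi>s j)) (qclass q \<xi>)) \<longlonglongrightarrow> 0"
    if b: "\<And>j. \<xi>s j \<in> TPbar" "\<xi> \<in> TPbar" and conv: "tpconv \<xi>s \<xi>" for \<xi>s and \<xi> :: "'a tp"
  proof -
    have "tpconv (\<lambda>j. \<xi>s j - \<xi>) (\<xi> - \<xi>)" by (intro tpconv_diff conv tpconv_const)
    then have "(\<lambda>j. sqrt (Re (qform q (\<xi>s j - \<xi>) (\<xi>s j - \<xi>)))) \<longlonglongrightarrow> sqrt (Re (qform q (\<xi> - \<xi>) (\<xi> - \<xi>)))"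
      by (intro tendsto_real_sqrt tendsto_Re qform_tpconv)
    then show ?thesis unfolding qdist_qclass[OF q b] by (simp add: qform_zero)
  qed
qed (simp_all add: qmul_qclass qadj_qclass q)

section \<open>The norm estimate\<close>

lemma shift_image:
  assumes "\<And>j::nat. j \<in> {1..k} \<Longrightarrow> s j = n + j"
  shows "s ` {1..k} = {n+1..n+k}"
proof -
  have "s ` {1..k} = (+) n ` {1..k}" using assms by (intro image_cong refl)
  then show ?thesis by (simp add: image_add_atLeastAtMost add.commute)
qed

lemma mul_sym_tensor:
  assumes \<alpha>: "\<alpha> \<in> perms0 n" and \<beta>: "\<beta> \<in> perms0 k" and F: "F \<in> alg_power n" and G: "G \<in> alg_power k"
  shows "mul q (sym_tensor n \<alpha> F) (sym_tensor k \<beta> G) = mul_elem q n k \<alpha> \<beta> F G"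
  using F
proof (induction rule: alg_power_induct)
  case (word h)
  show ?case
    using G
  proof (induction rule: alg_power_induct)
    case (word g)
    note A = labelledD[OF \<alpha>[unfolded perms0_labelled]] and B = labelledD[OF \<beta>[unfolded perms0_labelled]]
    obtain s where s: "bij s" "s 0 = 0" "\<And>j. j \<in> {1..k} \<Longrightarrow> s j = n + j" using ex_shift by blast
    have im: "s ` {1..k} = {n+1..n+k}" using s(3) by (rule shift_image)
    have im0: "s ` insert 0 {1..k} = insert 0 {n+1..n+k}" using s(2) im by (simp only: image_insert)
    have B': "s \<circ> \<beta> \<circ> inv s permutes insert 0 {n+1..n+k}" using conj_permutes[OF s(1) B(3)] unfolding im0 .
    have d1: "diagram {1..n} \<alpha> h = diagram {1..n} \<alpha> (glue n h g)"
      by (intro diagram_cong) (auto simp: glue_def)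
    have "diagram {1..k} \<beta> g = diagram {n+1..n+k} (s \<circ> \<beta> \<circ> inv s) (g \<circ> inv s)"
      using diagram_conj[OF B s(1,2), of g] unfolding im by (rule sym)
    also have "\<dots> = diagram {n+1..n+k} (s \<circ> \<beta> \<circ> inv s) (glue n h g)"
    proof (intro diagram_cong)
      fix x assume x: "x \<in> {n+1..n+k}"
      then have "x - n \<in> {1..k}" "n + (x - n) = x" by auto
      then have "s (x - n) = x" using s(3)[of "x - n"] by simp
      then have "inv s x = x - n" using inv_f_f[OF bij_is_inj[OF s(1)], of "x - n"] by simp
      then show "(g \<circ> inv s) x = glue n h g x" using x by (simp add: glue_def)
    qed simp
    finally have d2: "diagram {1..k} \<beta> g = diagram {n+1..n+k} (s \<circ> \<beta> \<circ> inv s) (glue n h g)" .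
    have "finite {n+1..n+k}" "0 \<notin> {n+1..n+k}" "{1..n} \<inter> {n+1..n+k} = {}" by auto
    note m = mul_diagram[OF A(1,2) this A(3) B']
    have w: "mul_elem q n k \<alpha> \<beta> (word n h) (word k g) = (\<Sum>\<pi>\<in>bipairings {1..n} {n+1..n+k}.
        contraction q ({1..n} \<union> {n+1..n+k}) \<pi> (s \<circ> \<beta> \<circ> inv s \<circ> \<alpha>) (glue n h g))"
      using B(3) s by (rule mul_elem_word)
    show ?case
      unfolding w diagram_word[OF A(3), symmetric] diagram_word[OF B(3), symmetric] d1 d2 m ..
  qed (simp_all only: real_linearD[OF real_linear_sym_tensor] real_linearD[OF mul.right] mul_linear)
qed (simp_all only: real_linearD[OF real_linear_sym_tensor] real_linearD[OF mul.left] mul_linear)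

lemma inner_tensor_perm:
  assumes \<sigma>: "\<sigma> \<in> perms n" and F: "F \<in> alg_power n" and G: "G \<in> alg_power n"
  shows "inner (tensor_perm n \<sigma> F) (tensor_perm n \<sigma> G) = inner F G"
  using F
proof (induction rule: alg_power_induct)
  note l = linear_add[OF linear_tensor_perm[OF \<sigma>]] linear_cmul[OF linear_tensor_perm[OF \<sigma>]]
  have p: "\<sigma> permutes {1..n}" using \<sigma> by (simp add: perms_def)
  case (word h)
  show ?case
    using G
  proof (induction rule: alg_power_induct)
    case (word g)
    have "(\<Prod>i\<in>{1..n}. inner (h (inv \<sigma> i)) (g (inv \<sigma> i))) = (\<Prod>i\<in>{1..n}. inner (h i) (g i))"
      by (rule prod.reindex_bij_betw[OF permutes_imp_bij[OF permutes_inv[OF p]]])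
    then show ?case by (simp add: tensor_perm_word(2)[OF p] inner_word)
  qed (simp_all add: l inner_add_right)
qed (simp_all add: linear_add[OF linear_tensor_perm[OF \<sigma>]] linear_cmul[OF linear_tensor_perm[OF \<sigma>]] inner_add_left)

lemma norm_tensor_perm:
  assumes \<sigma>: "\<sigma> \<in> perms n" and F: "F \<in> alg_power n"
  shows "norm (tensor_perm n \<sigma> F) = norm F"
  by (simp add: norm_eq_sqrt_inner inner_tensor_perm[OF assms F])

lemma norm_qform_elem_le:
  assumes q: "\<bar>q\<bar> \<le> 1" and G: "G \<in> alg_power k"
  shows "norm (qform q (elem_tensor n \<alpha> F) (elem_tensor k \<beta> G)) \<le> (if n = k then fact n * norm F * norm G else 0)"
proof (cases "n = k")
  case True
  have "norm (\<Sum>\<sigma>\<in>perms n. complex_of_real (chi q n (\<alpha> \<circ> (\<sigma> \<circ> inv \<beta> \<circ> inv \<sigma>)) * inner F (tensor_perm n \<sigma> G)))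
      \<le> real (card (perms n)) * (norm F * norm G)"
  proof (rule sum_norm_bound)
    fix \<sigma> assume \<sigma>: "\<sigma> \<in> perms n"
    have "\<bar>chi q n (\<alpha> \<circ> (\<sigma> \<circ> inv \<beta> \<circ> inv \<sigma>))\<bar> \<le> 1"
      unfolding chi_def power_abs using q by (intro power_le_one) simp_all
    moreover have "\<bar>inner F (tensor_perm n \<sigma> G)\<bar> \<le> norm F * norm G"
      using Cauchy_Schwarz_ineq2[of F "tensor_perm n \<sigma> G"] norm_tensor_perm[OF \<sigma>, of G] G True by simp
    ultimately show "norm (complex_of_real (chi q n (\<alpha> \<circ> (\<sigma> \<circ> inv \<beta> \<circ> inv \<sigma>)) * inner F (tensor_perm n \<sigma> G))) \<le> norm F * norm G"
      unfolding norm_of_real abs_mult using mult_mono[of "\<bar>chi q n (\<alpha> \<circ> (\<sigma> \<circ> inv \<beta> \<circ> inv \<sigma>))\<bar>" 1] by fastforce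
  qed
  then show ?thesis unfolding qform_elem using True by (simp add: card_perms)
next
  case False
  then show ?thesis by (simp add: qform_elem)
qed

lemma alg_power_tensor_perm:
  assumes \<sigma>: "\<sigma> \<in> perms n" and F: "F \<in> alg_power n"
  shows "tensor_perm n \<sigma> F \<in> alg_power n"
  using F
proof (induction rule: alg_power_induct)
  case (word h)
  have "tensor_perm n \<sigma> (word n h) = word n (h \<circ> inv \<sigma>)" using \<sigma> unfolding perms_def by (intro tensor_perm_word(2)) simp
  then show ?case unfolding alg_power_word by (simp add: span_base)
qed (simp_all add: linear_add[OF linear_tensor_perm[OF \<sigma>]] linear_cmul[OF linear_tensor_perm[OF \<sigma>]] alg_power_def span_add span_scale)

text \<open>The average over conjugates of elementary terms obeys the same bound as one of them.\<close>

lemma norm_qform_sym_tensor_le: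
  assumes q: "\<bar>q\<bar> \<le> 1" and F: "F \<in> alg_power n" and G: "G \<in> alg_power k"
  shows "norm (qform q (sym_tensor n \<alpha> F) (sym_tensor k \<beta> G)) \<le> fact n * norm F * norm G"
proof -
  define S where "S = (\<Sum>\<tau>\<in>perms k. \<Sum>\<sigma>\<in>perms n. qform q (elem_tensor n (\<sigma> \<circ> \<alpha> \<circ> inv \<sigma>) (tensor_perm n \<sigma> F))
      (elem_tensor k (\<tau> \<circ> \<beta> \<circ> inv \<tau>) (tensor_perm k \<tau> G)))"
  have "norm S \<le> real (card (perms k)) * (real (card (perms n)) * (fact n * norm F * norm G))"
    unfolding S_def
  proof (intro sum_norm_bound)
    fix \<sigma> \<tau> assume s: "\<tau> \<in> perms k" "\<sigma> \<in> perms n"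
    show "norm (qform q (elem_tensor n (\<sigma> \<circ> \<alpha> \<circ> inv \<sigma>) (tensor_perm n \<sigma> F))
      (elem_tensor k (\<tau> \<circ> \<beta> \<circ> inv \<tau>) (tensor_perm k \<tau> G))) \<le> fact n * norm F * norm G"
      using norm_qform_elem_le[OF q alg_power_tensor_perm[OF s(1) G], of n "\<sigma> \<circ> \<alpha> \<circ> inv \<sigma>" "tensor_perm n \<sigma> F" "\<tau> \<circ> \<beta> \<circ> inv \<tau>"]
        norm_tensor_perm[OF s(2) F] norm_tensor_perm[OF s(1) G] by (auto split: if_splits intro: order_trans)
  qed
  moreover have "qform q (sym_tensor n \<alpha> F) (sym_tensor k \<beta> G) = (1 / fact n) * (cnj (1 / fact k) * S)"
    unfolding sym_tensor_def S_def
    by (subst qform_sesquilinear(3), subst qform_sesquilinear(4)) (simp only: qform_sum)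
  then have "norm (qform q (sym_tensor n \<alpha> F) (sym_tensor k \<beta> G)) = norm S / (fact n * fact k)"
    by (simp add: norm_mult norm_divide)
  ultimately have "norm (qform q (sym_tensor n \<alpha> F) (sym_tensor k \<beta> G))
      \<le> real (card (perms k)) * (real (card (perms n)) * (fact n * norm F * norm G)) / (fact n * fact k)"
    by (simp only: divide_right_mono mult_nonneg_nonneg fact_ge_zero)
  then show ?thesis by (simp add: card_perms)
qed

text \<open>A pairing between two sets is determined by the partners of the points on one side.\<close>

lemma card_bipairings_le:
  assumes X: "finite X" and Y: "finite Y"
  shows "card (bipairings X Y) \<le> (card Y + 1) ^ card X"
proof -
  define f :: "(nat \<Rightarrow> nat) \<Rightarrow> nat \<Rightarrow> nat option" where
    "f \<pi> = restrict (\<lambda>x. if \<pi> x = x then None else Some (\<pi> x)) X" for \<pi>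
  have fX: "f \<pi> x = (if \<pi> x = x then None else Some (\<pi> x))" if "x \<in> X" for \<pi> x using that by (simp add: f_def)
  have B: "\<pi> (\<pi> x) = x" "x \<notin> X \<union> Y \<Longrightarrow> \<pi> x = x" "x \<in> X \<Longrightarrow> \<pi> x = x \<or> \<pi> x \<in> Y" "x \<in> Y \<Longrightarrow> \<pi> x = x \<or> \<pi> x \<in> X"
    if \<pi>: "\<pi> \<in> bipairings X Y" for \<pi> x
  proof -
    note p = pairings_onD[OF subsetD[OF bipairings_subset \<pi>]]
    show "\<pi> (\<pi> x) = x" by (rule p(2))
    show "x \<notin> X \<union> Y \<Longrightarrow> \<pi> x = x" using permutes_not_in[OF p(1)] by blast
    have "x \<in> X \<union> Y \<Longrightarrow> \<pi> x \<in> X \<union> Y" using permutes_in_image[OF p(1)] by blast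
    then show "x \<in> X \<Longrightarrow> \<pi> x = x \<or> \<pi> x \<in> Y" "x \<in> Y \<Longrightarrow> \<pi> x = x \<or> \<pi> x \<in> X"
      using \<pi> unfolding bipairings_def by blast+
  qed
  have "inj_on f (bipairings X Y)"
  proof (rule inj_onI)
    fix \<pi> \<rho> assume \<pi>: "\<pi> \<in> bipairings X Y" and \<rho>: "\<rho> \<in> bipairings X Y" and eq: "f \<pi> = f \<rho>"
    have X: "\<pi> x = \<rho> x" if "x \<in> X" for x
      using fun_cong[OF eq, of x] unfolding fX[OF that] by (auto split: if_splits)
    show "\<pi> = \<rho>"
    proof
      fix x
      consider "x \<in> X" | "x \<in> Y" "\<pi> x \<in> X" | "x \<in> Y" "\<rho> x \<in> X" | "x \<in> Y" "\<pi> x = x" "\<rho> x = x" | "x \<notin> X \<union> Y"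
        using B(4)[OF \<pi>] B(4)[OF \<rho>] by blast
      then show "\<pi> x = \<rho> x"
      proof cases
        case 1
        then show ?thesis by (rule X)
      next
        case 2
        then have "\<rho> (\<pi> x) = x" using X[OF 2(2)] B(1)[OF \<pi>, of x] by simp
        then show ?thesis using B(1)[OF \<rho>, of "\<pi> x"] by simp
      next
        case 3
        then have "\<pi> (\<rho> x) = x" using X[OF 3(2)] B(1)[OF \<rho>, of x] by simp
        then show ?thesis using B(1)[OF \<pi>, of "\<rho> x"] by simp
      next
        case 4
        then show ?thesis by simp
      next
        case 5
        then show ?thesis using B(2)[OF \<pi> 5] B(2)[OF \<rho> 5] by simp
      qed
    qed
  qed
  moreover have "f ` bipairings X Y \<subseteq> X \<rightarrow>\<^sub>E insert None (Some ` Y)"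
  proof (rule image_subsetI, rule PiE_I)
    show "f \<pi> x \<in> insert None (Some ` Y)" if "\<pi> \<in> bipairings X Y" "x \<in> X" for \<pi> x
      using B(3)[OF that] unfolding fX[OF that(2)] by auto
    show "f \<pi> x = undefined" if "x \<notin> X" for \<pi> x using that by (simp add: f_def)
  qed
  moreover have "finite (X \<rightarrow>\<^sub>E insert None (Some ` Y))" using X Y by (intro finite_PiE) simp_all
  ultimately have "card (bipairings X Y) \<le> card (X \<rightarrow>\<^sub>E insert None (Some ` Y))"
    by (rule card_inj_on_le)
  also have "\<dots> = (card Y + 1) ^ card X"
  proof -
    have "card (insert None (Some ` Y)) = card Y + 1" using Y by (simp add: card_image)
    then show ?thesis using X by (simp only: card_PiE prod_constant)
  qed
  finally show ?thesis .
qed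

lemma bipairings_commute: "bipairings X Y = bipairings Y X"
  unfolding bipairings_def by (simp only: Un_commute conj_commute)

lemma cross_contract_alg_power:
  assumes \<pi>: "\<pi> \<in> bipairings {1..n} {n+1..n+k}" and F: "F \<in> alg_power n" and G: "G \<in> alg_power k"
  shows "cross_contract n k \<pi> F G \<in> alg_power (n + k - 2 * num_pairs \<pi>)"
proof -
  interpret b: bounded_bilinear "cross_contract n k \<pi> :: 'a tensor_space \<Rightarrow> _" by (rule cross_contract_word(1)[OF \<pi>])
  have u: "{1..n} \<union> {n+1..n+k} = {1..n+k}" by auto
  have p: "\<pi> \<in> pairings_on {1..n+k}" using bipairings_subset[of "{1..n}" "{n+1..n+k}"] \<pi> unfolding u by blast
  note P = pairings_onD[OF p]
  have sub: "supp \<pi> \<subseteq> {1..n+k}" using pairings_on_supp[OF p] by blast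
  then have fin: "finite (supp \<pi>)" by (rule finite_subset) simp
  have "set (filter (\<lambda>i. \<pi> i = i) [1..<Suc (n + k)]) = {1..n+k} - supp \<pi>" by (auto simp: supp_def)
  then have "length (filter (\<lambda>i. \<pi> i = i) [1..<Suc (n + k)]) = card ({1..n+k} - supp \<pi>)"
    using distinct_card[of "filter (\<lambda>i. \<pi> i = i) [1..<Suc (n + k)]"] by (simp del: upt_Suc)
  then have len: "length (filter (\<lambda>i. \<pi> i = i) [1..<Suc (n + k)]) = n + k - 2 * num_pairs \<pi>"
    using card_Diff_subset[OF fin sub] card_supp[of \<pi>, OF P(2) fin] by simp
  show ?thesis
    using F
  proof (induction rule: alg_power_induct)
    case (word h)
    show ?case
      using G
    proof (induction rule: alg_power_induct)
      case (word g)
      have "tensor (map (glue n h g) (filter (\<lambda>i. \<pi> i = i) [1..<Suc (n + k)])) \<in> alg_power (n + k - 2 * num_pairs \<pi>)"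
        unfolding alg_power_def by (intro span_base) (use len in \<open>auto simp del: upt_Suc\<close>)
      then show ?case unfolding cross_contract_word(2)[OF \<pi>] alg_power_def by (rule span_scale)
    qed (simp_all add: b.add_right b.scaleR_right alg_power_def span_add span_scale)
  qed (simp_all add: b.add_left b.scaleR_left alg_power_def span_add span_scale)
qed

lemma Zset_abs_le: "q \<in> Zset \<Longrightarrow> \<bar>q\<bar> \<le> 1"
  unfolding Zset_def by auto

text \<open>
  The product is a sum over the pairings between the two groups of slots. Each summand is a
  contraction of \<open>F \<otimes> G\<close>, of norm at most \<open>\<parallel>F\<parallel> \<parallel>G\<parallel>\<close>, with a coefficient that is a nonnegative
  power of \<open>q\<close>.
\<close>

lemma mul_norm_le:
  assumes q: "q \<noteq> 0" "\<bar>q\<bar> \<le> 1" and \<alpha>: "\<alpha> \<in> perms0 n" and \<beta>: "\<beta> \<in> perms0 k" and F: "F \<in> alg_power n" and G: "G \<in> alg_power k"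
  defines "A \<equiv> mul q (sym_tensor n \<alpha> F) (sym_tensor k \<beta> G)"
  shows "norm (qform q A A) \<le> (real (card (bipairings {1..n} {n+1..n+k})))\<^sup>2 * (fact (n + k) * (norm F * norm G)\<^sup>2)"
proof -
  define B m \<gamma> X where "B = bipairings {1..n} {n+1..n+k}" and "m \<pi> = n + k - 2 * num_pairs \<pi>"
    and "\<gamma> \<pi> = contract_perm (n + k) \<pi> (perm_cup n k \<alpha> \<beta>)"
    and "X \<pi> = q powi contract_exp (n + k) \<pi> (perm_cup n k \<alpha> \<beta>) *\<^sub>R cross_contract n k \<pi> F G" for \<pi>
  note AL = labelledD[OF \<alpha>[unfolded perms0_labelled]] and BL = labelledD[OF \<beta>[unfolded perms0_labelled]]
  have A: "A = (\<Sum>\<pi>\<in>B. sym_tensor (m \<pi>) (\<gamma> \<pi>) (X \<pi>))"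
    unfolding A_def mul_sym_tensor[OF \<alpha> \<beta> F G] mul_elem_def B_def m_def \<gamma>_def X_def ..
  have Xalg: "X \<pi> \<in> alg_power (m \<pi>)" if "\<pi> \<in> B" for \<pi>
    using cross_contract_alg_power[OF that[unfolded B_def] F G] unfolding X_def m_def alg_power_def by (rule span_scale)
  obtain s where s: "bij s" "s 0 = 0" "\<And>j. j \<in> {1..k} \<Longrightarrow> s j = n + j" using ex_shift by blast
  have im: "s ` insert 0 {1..k} = insert 0 {n+1..n+k}"
  proof -
    have "s ` {1..k} = {n+1..n+k}" using s(3) by (rule shift_image)
    then show ?thesis using s(2) by (simp only: image_insert)
  qed
  have pc: "perm_cup n k \<alpha> \<beta> = s \<circ> \<beta> \<circ> inv s \<circ> \<alpha>" using BL(3) s by (rule perm_cup_conj)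
  have BL': "s \<circ> \<beta> \<circ> inv s permutes insert 0 {n+1..n+k}" using conj_permutes[OF s(1) BL(3)] unfolding im .
  have Xnorm: "norm (X \<pi>) \<le> norm F * norm G" if \<pi>: "\<pi> \<in> B" for \<pi>
  proof -
    have u: "{1..n+k} = {1..n} \<union> {n+1..n+k}" by auto
    have "0 \<le> contract_exp (n + k) \<pi> (perm_cup n k \<alpha> \<beta>)"
      unfolding contract_exp_eq pc u
      by (rule expo_bipairing_nonneg) (use \<pi> AL BL' in \<open>auto simp: B_def\<close>)
    then obtain e where e: "contract_exp (n + k) \<pi> (perm_cup n k \<alpha> \<beta>) = int e" by (rule nonneg_int_cases)
    have "\<bar>q ^ e\<bar> \<le> 1" unfolding power_abs using q by (intro power_le_one) simp_all
    then have "norm (X \<pi>) \<le> 1 * norm (cross_contract n k \<pi> F G)"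
      unfolding X_def e norm_scaleR power_int_of_nat by (intro mult_right_mono) simp_all
    also have "\<dots> \<le> norm F * norm G" using norm_cross_contract_le[OF \<pi>[unfolded B_def] F G] by simp
    finally show ?thesis .
  qed
  have "norm (qform q A A) \<le> real (card B) * (real (card B) * (fact (n + k) * (norm F * norm G)\<^sup>2))"
    unfolding A qform_sum
  proof (intro sum_norm_bound)
    fix \<pi> \<rho> assume r: "\<rho> \<in> B" "\<pi> \<in> B"
    have "norm (qform q (sym_tensor (m \<pi>) (\<gamma> \<pi>) (X \<pi>)) (sym_tensor (m \<rho>) (\<gamma> \<rho>) (X \<rho>))) \<le> fact (m \<pi>) * norm (X \<pi>) * norm (X \<rho>)"
      by (intro norm_qform_sym_tensor_le q Xalg r)
    also have "\<dots> = fact (m \<pi>) * (norm (X \<pi>) * norm (X \<rho>))" by simp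
    also have "\<dots> \<le> fact (n + k) * (norm F * norm G)\<^sup>2"
      unfolding power2_eq_square by (intro mult_mono fact_mono Xnorm r) (simp_all add: m_def)
    finally show "norm (qform q (sym_tensor (m \<pi>) (\<gamma> \<pi>) (X \<pi>)) (sym_tensor (m \<rho>) (\<gamma> \<rho>) (X \<rho>))) \<le> fact (n + k) * (norm F * norm G)\<^sup>2" .
  qed
  then show ?thesis by (simp add: B_def power2_eq_square mult.assoc)
qed

lemma phi_norm_mul_le:
  assumes q: "q \<in> Zset - {0}" and \<alpha>: "\<alpha> \<in> perms0 n" and \<beta>: "\<beta> \<in> perms0 k" and F: "F \<in> alg_power n" and G: "G \<in> alg_power k"
  shows "phi_norm q (tp_mult q (W (sym_tensor n \<alpha> F)) (W (sym_tensor k \<beta> G)))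
    \<le> fact (n + k) * min ((real k + 1) ^ n) ((real n + 1) ^ k) * norm F * norm G"
proof -
  have q': "q \<noteq> 0" "\<bar>q\<bar> \<le> 1" using q Zset_abs_le by auto
  have TP: "sym_tensor n \<alpha> F \<in> TP" "sym_tensor k \<beta> G \<in> TP"
    unfolding TP_def using assms by (blast intro: tp.span_base)+
  define A where "A = mul q (sym_tensor n \<alpha> F) (sym_tensor k \<beta> G)"
  define c where "c = real (card (bipairings {1..n} {n+1..n+k}))"
  have A: "A \<in> TP" unfolding A_def by (intro mul_TP q' TP)
  have e: "tp_mult q (W (sym_tensor n \<alpha> F)) (W (sym_tensor k \<beta> G)) = A"
    unfolding W_TP[OF TP(1)] W_TP[OF TP(2)] tp_mult_eq_mul[OF q'(1) TP] A_def ..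
  have "phi_norm q A = sqrt (Re (qform q A A))"
    unfolding phi_norm_def tp_adj_eq_flip[OF A] tp_mult_eq_mul[OF q'(1) flip_TP[OF A] A] qform_TP[OF A A] ..
  also have "\<dots> \<le> sqrt (c\<^sup>2 * (fact (n + k) * (norm F * norm G)\<^sup>2))"
    using order_trans[OF complex_Re_le_cmod mul_norm_le[OF q' \<alpha> \<beta> F G]] unfolding A_def c_def by simp
  also have "\<dots> = c * (sqrt (fact (n + k)) * (norm F * norm G))"
    by (simp add: real_sqrt_mult c_def)
  also have "\<dots> \<le> min ((real k + 1) ^ n) ((real n + 1) ^ k) * (fact (n + k) * (norm F * norm G))"
  proof (intro mult_mono)
    have "card (bipairings {1..n} {n+1..n+k}) \<le> (k + 1) ^ n"
      using card_bipairings_le[of "{1..n}" "{n+1..n+k}"] by simp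
    moreover have "card (bipairings {1..n} {n+1..n+k}) \<le> (n + 1) ^ k"
      using card_bipairings_le[of "{n+1..n+k}" "{1..n}"] unfolding bipairings_commute[of "{n+1..n+k}"] by simp
    ultimately have "c \<le> real ((k + 1) ^ n)" "c \<le> real ((n + 1) ^ k)"
      unfolding c_def of_nat_le_iff by blast+
    then show "c \<le> min ((real k + 1) ^ n) ((real n + 1) ^ k)" by (simp add: algebra_simps)
    show "sqrt (fact (n + k)) \<le> fact (n + k)"
      by (rule real_le_lsqrt) (simp_all add: self_le_power fact_ge_1)
  qed (simp_all add: c_def)
  finally show ?thesis unfolding e by (simp add: mult_ac)
qed

theorem propositionV16:
  fixes q :: real and n k :: nat and \<alpha> \<beta> :: "nat \<Rightarrow> nat"
    and F G :: "'a::{real_inner, complete_space} tensor_space"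
  assumes "q \<in> Zset - {0}"
    and "\<alpha> \<in> perms0 n" and "\<beta> \<in> perms0 k"
    and "F \<in> alg_power n" and "G \<in> alg_power k"
  shows "phi_norm q (tp_mult q (W (sym_tensor n \<alpha> F)) (W (sym_tensor k \<beta> G)))
           \<le> fact (n + k) * min ((real k + 1) ^ n) ((real n + 1) ^ k) * norm F * norm G
         \<and> (\<exists>(mul :: 'a tp \<Rightarrow> 'a tp \<Rightarrow> 'a tp) adj qmul qadj.
             star_algebra TPbar (+) 0 tp_scale mul tp_one adj \<and>
             extends_by_continuity q id tp_dist mul adj \<and>
             star_algebra (TPq q) (qadd q) (qclass q 0) (qscale q) qmul (qclass q tp_one) qadj \<and>
             extends_by_continuity q (qclass q) (qdist q) qmul qadj \<and>
             (\<forall>A\<in>TPbar. \<forall>B\<in>TPbar. qmul (qclass q A) (qclass q B) = qclass q (mul A B)) \<and>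
             (\<forall>A\<in>TPbar. qadj (qclass q A) = qclass q (adj A)))"
proof -
  have q: "q \<noteq> 0" using assms(1) by blast
  show ?thesis
    by (intro conjI phi_norm_mul_le assms exI[of _ "mul q"] exI[of _ flip] exI[of _ "qmul q"] exI[of _ "qadj q"]
        star_algebra_TPbar extends_TPbar star_algebra_TPq extends_TPq ballI qmul_qclass qadj_qclass q)
qed

end
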